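(* If $S$ is a zero-dimensional complex complete intersection, then $\operatorname{Der}_{\mathbb{C}} S$ is a solvable Lie algebra.
   Context: A zero-dimensional complex complete intersection is a local $\mathbb{C}$-algebra of the form $S\cong\mathbb{C}[\![x_1,\dots,x_n]\!]/I$, of Krull dimension zero, where $I$ is a proper ideal that can be generated by $n$ elements (equivalently, by a regular sequence of length $n$). $\operatorname{Der}_{\mathbb{C}}S$ is the complex Lie algebra of $\mathbb{C}$-linear derivations $S\to S$ with the commutator bracket. *)

theory Defs
  imports
    "HOL-Algebra.Algebra"
    "HOL-Algebra.Algebraic_Closure_Type"
    "HOL-Library.Poly_Mapping"
    "HOL-Library.Extended_Nat"
begin

section \<open>Lie algebras\<close>

text \<open>The \<open>mult\<close> and \<open>one\<close> fields inherited from rings carry no meaning here, just as for modules.\<close>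

record ('a, 'b) lie = "('a, 'b) module" +
  bracket :: "'b \<Rightarrow> 'b \<Rightarrow> 'b" (\<open>(\<open>notation=\<open>mixfix bracket\<close>\<close>\<lbrace>_,/ _\<rbrace>\<index>)\<close>)

locale lie_algebra = module R L + field R
  for R :: "('a, 'r) ring_scheme" (structure) and L :: "('a, 'b, 'm) lie_scheme" (structure) +
  assumes bracket_closed:
      "\<lbrakk>x \<in> carrier L; y \<in> carrier L\<rbrakk> \<Longrightarrow> \<lbrace>x, y\<rbrace>\<^bsub>L\<^esub> \<in> carrier L"
    and bracket_add_left:
      "\<lbrakk>x \<in> carrier L; y \<in> carrier L; z \<in> carrier L\<rbrakk> \<Longrightarrow>
       \<lbrace>x \<oplus>\<^bsub>L\<^esub> y, z\<rbrace>\<^bsub>L\<^esub> = \<lbrace>x, z\<rbrace>\<^bsub>L\<^esub> \<oplus>\<^bsub>L\<^esub> \<lbrace>y, z\<rbrace>\<^bsub>L\<^esub>"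
    and bracket_add_right:
      "\<lbrakk>x \<in> carrier L; y \<in> carrier L; z \<in> carrier L\<rbrakk> \<Longrightarrow>
       \<lbrace>x, y \<oplus>\<^bsub>L\<^esub> z\<rbrace>\<^bsub>L\<^esub> = \<lbrace>x, y\<rbrace>\<^bsub>L\<^esub> \<oplus>\<^bsub>L\<^esub> \<lbrace>x, z\<rbrace>\<^bsub>L\<^esub>"
    and bracket_smult_left:
      "\<lbrakk>c \<in> carrier R; x \<in> carrier L; y \<in> carrier L\<rbrakk> \<Longrightarrow>
       \<lbrace>c \<odot>\<^bsub>L\<^esub> x, y\<rbrace>\<^bsub>L\<^esub> = c \<odot>\<^bsub>L\<^esub> \<lbrace>x, y\<rbrace>\<^bsub>L\<^esub>"
    and bracket_smult_right:
      "\<lbrakk>c \<in> carrier R; x \<in> carrier L; y \<in> carrier L\<rbrakk> \<Longrightarrow>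
       \<lbrace>x, c \<odot>\<^bsub>L\<^esub> y\<rbrace>\<^bsub>L\<^esub> = c \<odot>\<^bsub>L\<^esub> \<lbrace>x, y\<rbrace>\<^bsub>L\<^esub>"
    and bracket_self:
      "x \<in> carrier L \<Longrightarrow> \<lbrace>x, x\<rbrace>\<^bsub>L\<^esub> = \<zero>\<^bsub>L\<^esub>"
    and jacobi:
      "\<lbrakk>x \<in> carrier L; y \<in> carrier L; z \<in> carrier L\<rbrakk> \<Longrightarrow>
       \<lbrace>x, \<lbrace>y, z\<rbrace>\<^bsub>L\<^esub>\<rbrace>\<^bsub>L\<^esub> \<oplus>\<^bsub>L\<^esub> \<lbrace>y, \<lbrace>z, x\<rbrace>\<^bsub>L\<^esub>\<rbrace>\<^bsub>L\<^esub> \<oplus>\<^bsub>L\<^esub> \<lbrace>z, \<lbrace>x, y\<rbrace>\<^bsub>L\<^esub>\<rbrace>\<^bsub>L\<^esub> = \<zero>\<^bsub>L\<^esub>"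

definition module_span :: "('a, 'r) ring_scheme \<Rightarrow> ('a, 'b, 'm) module_scheme \<Rightarrow> 'b set \<Rightarrow> 'b set"
  where "module_span R M A = \<Inter>{N. submodule N R M \<and> A \<subseteq> N}"

primrec derived_series :: "('a, 'r) ring_scheme \<Rightarrow> ('a, 'b, 'm) lie_scheme \<Rightarrow> nat \<Rightarrow> 'b set"
  where
    "derived_series R L 0 = carrier L"
  | "derived_series R L (Suc k) =
       module_span R L {\<lbrace>x, y\<rbrace>\<^bsub>L\<^esub> | x y. x \<in> derived_series R L k \<and> y \<in> derived_series R L k}"

locale solvable_lie_algebra = lie_algebra +
  assumes solvable: "\<exists>k. derived_series R L k = {\<zero>\<^bsub>L\<^esub>}"


section \<open>Derivations\<close>

text \<open>Maps are taken extensional, so that two derivations are equal as soon as they agree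
  on \<open>carrier S\<close>.\<close>

definition derivations :: "('a, 'r) ring_scheme \<Rightarrow> ('a, 'b, 'm) module_scheme \<Rightarrow> ('b \<Rightarrow> 'b) set"
  where "derivations R S = {D \<in> carrier S \<rightarrow>\<^sub>E carrier S.
     (\<forall>x \<in> carrier S. \<forall>y \<in> carrier S. D (x \<oplus>\<^bsub>S\<^esub> y) = D x \<oplus>\<^bsub>S\<^esub> D y) \<and>
     (\<forall>c \<in> carrier R. \<forall>x \<in> carrier S. D (c \<odot>\<^bsub>S\<^esub> x) = c \<odot>\<^bsub>S\<^esub> D x) \<and>
     (\<forall>x \<in> carrier S. \<forall>y \<in> carrier S. D (x \<otimes>\<^bsub>S\<^esub> y) = D x \<otimes>\<^bsub>S\<^esub> y \<oplus>\<^bsub>S\<^esub> x \<otimes>\<^bsub>S\<^esub> D y)}"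

definition Der :: "('a, 'r) ring_scheme \<Rightarrow> ('a, 'b, 'm) module_scheme \<Rightarrow> ('a, 'b \<Rightarrow> 'b) lie"
  where "Der R S = \<lparr>
     carrier = derivations R S,
     monoid.mult = undefined,
     one = undefined,
     ring.zero = (\<lambda>x \<in> carrier S. \<zero>\<^bsub>S\<^esub>),
     add = (\<lambda>D E. \<lambda>x \<in> carrier S. D x \<oplus>\<^bsub>S\<^esub> E x),
     module.smult = (\<lambda>c D. \<lambda>x \<in> carrier S. c \<odot>\<^bsub>S\<^esub> D x),
     bracket = (\<lambda>D E. \<lambda>x \<in> carrier S. D (E x) \<ominus>\<^bsub>S\<^esub> E (D x))\<rparr>"


section \<open>Formal power series in finitely many variables\<close>

abbreviation complex_field :: "complex ring"
  where "complex_field \<equiv> ring_of_type_algebra"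

type_synonym mpower_series = "(nat \<Rightarrow>\<^sub>0 nat) \<Rightarrow> complex"

text \<open>
  A power series is given by its coefficients; the monomial \<open>m\<close> is
  \<open>\<Prod>i. x\<^sub>i ^ (lookup m i)\<close>, and the variables are \<open>x\<^sub>0, \<dots>, x\<^sub>n\<^sub>-\<^sub>1\<close>.
  The index set of the sum in the product is finite for every \<open>m\<close>.
\<close>

definition power_series_algebra :: "nat \<Rightarrow> (complex, mpower_series) module"
  where "power_series_algebra n = \<lparr>
     carrier = {f. \<forall>m. f m \<noteq> 0 \<longrightarrow> Poly_Mapping.keys m \<subseteq> {..<n}},
     monoid.mult = (\<lambda>f g m. \<Sum>(a, b) \<in> {(a, b). a + b = m}. f a * g b),
     one = (\<lambda>m. if m = 0 then 1 else 0),
     ring.zero = (\<lambda>m. 0),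
     add = (\<lambda>f g m. f m + g m),
     module.smult = (\<lambda>c f m. c * f m)\<rparr>"


section \<open>Zero-dimensional complete intersections\<close>

definition quotient_algebra :: "('a, 'b, 'm) module_scheme \<Rightarrow> 'b set \<Rightarrow> ('a, 'b set) module"
  where "quotient_algebra A I = \<lparr>
     carrier = carrier (A Quot I),
     monoid.mult = monoid.mult (A Quot I),
     one = one (A Quot I),
     ring.zero = ring.zero (A Quot I),
     add = add (A Quot I),
     module.smult = (\<lambda>c C. \<Union>x \<in> C. I +>\<^bsub>A\<^esub> (c \<odot>\<^bsub>A\<^esub> x))\<rparr>"

definition algebra_iso ::
    "('a, 'r) ring_scheme \<Rightarrow> ('a, 'b, 'm) module_scheme \<Rightarrow> ('a, 'c, 'k) module_scheme \<Rightarrow> ('b \<Rightarrow> 'c) set"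
  where "algebra_iso R A B = {h \<in> ring_iso A B.
     \<forall>c \<in> carrier R. \<forall>x \<in> carrier A. h (c \<odot>\<^bsub>A\<^esub> x) = c \<odot>\<^bsub>B\<^esub> h x}"

locale local_ring = cring +
  assumes unique_maximalideal: "\<exists>!M. maximalideal M R"

text \<open>Supremum of the lengths of strict chains of prime ideals; as a supremum in \<^typ>\<open>enat\<close>,
  it is \<open>0\<close> rather than \<open>-\<infinity>\<close> for the zero ring.\<close>

definition krull_dim :: "('a, 'm) ring_scheme \<Rightarrow> enat"
  where "krull_dim R = Sup {enat k | k.
     \<exists>P. (\<forall>i \<le> k. primeideal (P i) R) \<and> (\<forall>i < k. P i \<subset> P (Suc i))}"

definition zero_dim_complete_intersection :: "(complex, 'a, 'm) module_scheme \<Rightarrow> bool"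
  where "zero_dim_complete_intersection S \<longleftrightarrow>
     algebra complex_field S \<and> local_ring S \<and> krull_dim S = 0 \<and>
     (\<exists>n I g. ideal I (power_series_algebra n) \<and> I \<noteq> carrier (power_series_algebra n) \<and>
        g ` {..<n} \<subseteq> carrier (power_series_algebra n) \<and>
        I = Idl\<^bsub>power_series_algebra n\<^esub> (g ` {..<n}) \<and>
        algebra_iso complex_field S (quotient_algebra (power_series_algebra n) I) \<noteq> {})"

end

theory Submission
  imports Defs "HOL-Computational_Algebra.Fundamental_Theorem_Algebra"
begin

text \<open>
  A finite-dimensional complex Lie algebra that is not solvable contains a copy of
  \<open>sl\<^sub>2\<close> (\<open>not_solv_contains_sl2\<close>). So, if \<open>Der S\<close> is not solvable, there are derivations
  \<open>e\<close>, \<open>f\<close>, \<open>h\<close> of \<open>S\<close> with \<open>e \<noteq> 0\<close>, \<open>[e, f] = h\<close>, \<open>[h, e] = 2 e\<close> and \<open>[h, f] = - 2 f\<close>. The heart of the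
  proof is that \<open>sl\<^sub>2\<close> can act on a zero-dimensional complete intersection only trivially
  (\<open>sl2_acts_trivially\<close>).

  Let \<open>m\<close> be the maximal ideal of \<open>S\<close> and \<open>n = dim m / m\<^sup>2\<close>. Derivations preserve \<open>m\<close>, hence
  \<open>m / m\<^sup>2\<close> is a representation of \<open>sl\<^sub>2\<close>. Choose generators \<open>\<theta>\<^sub>0, \<dots>, \<theta>\<^sub>n\<^sub>-\<^sub>1\<close> of \<open>m\<close> that are
  eigenvectors of \<open>h\<close>, with integral eigenvalues (weights) \<open>\<lambda>\<^sub>i\<close>, and write \<open>S = A / I\<close> where \<open>A\<close> is the
  polynomial ring in \<open>x\<^sub>0, \<dots>, x\<^sub>n\<^sub>-\<^sub>1\<close> and \<open>x\<^sub>i\<close> is sent to \<open>\<theta>\<^sub>i\<close>; then \<open>I\<close> contains only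
  polynomials of order at least 2. That \<open>S\<close> is a complete intersection enters as
  \<open>dim I / (x) I \<le> n\<close> (\<open>card_indep_relations\<close>). The operators \<open>e\<close>, \<open>f\<close>, \<open>h\<close> lift to derivations
  \<open>E\<close>, \<open>F\<close>, \<open>H\<close> of \<open>A\<close> that are homogeneous of degree 2, -2 and 0 for the grading by weights; they satisfy
  the relations of \<open>sl\<^sub>2\<close> on \<open>I / (x) I\<close>, which therefore is a representation as well
  (\<open>relations_sl2\<close>).

  On a representation, \<open>f\<close> is injective on the spaces of positive weight. Hence the \<open>\<theta>\<^sub>i\<close>, and a basis
  of \<open>I / (x) I\<close>, can be chosen such that \<open>f\<close> maps each element of weight at least 2 to another element. Let
  \<open>n\<^sub>c\<close> and \<open>q\<^sub>c\<close> be the numbers of variables and of basic relations of weight at least \<open>c\<close>. For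
  \<open>c \<ge> 0\<close> let \<open>J\<close> be the ideal generated by the variables that have weight less than \<open>c\<close> or are images
  under \<open>f\<close> of variables of weight at least 2, and by the basic relations of weight at least \<open>2 c\<close> that are
  not images under \<open>F\<close> of basic relations of weight at least 2. The ideal \<open>J\<close> contains \<open>F A\<close>, so it contains all basic relations of weight
  at least \<open>2 c\<close>. It contains the other ones too: each monomial of a relation has at least two factors, so in
  weight less than \<open>2 c\<close> one factor has weight less than \<open>c\<close>. Hence \<open>I \<subseteq> J + (x) I\<close>, high
  powers of \<open>(x)\<close> vanish modulo \<open>J\<close>, and \<open>J\<close> needs at least \<open>n\<close> generators
  (\<open>num_generators_ge_num_vars\<close>). Counting the generators gives
  \<open>n\<^sub>c - n\<^sub>c\<^sub>+\<^sub>2 \<le> q\<^sub>2\<^sub>c - q\<^sub>2\<^sub>c\<^sub>+\<^sub>2\<close>. The sum over all \<open>c \<ge> 0\<close> is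
  \<open>n\<^sub>0 + n\<^sub>1 \<le> q\<^sub>0 \<le> n\<close>: there are at least as many negative as positive weights
  (\<open>weight_inequality\<close>). Exchanging \<open>e\<close> and \<open>f\<close> gives the reverse inequality, and the case of equality forces
  all \<open>\<lambda>\<^sub>i\<close> to vanish. Then \<open>h\<close> is zero on \<open>S\<close>, and so is \<open>e = [h, e] / 2\<close>.

  Quotients are never formed: a statement about \<open>V / U\<close> is expressed on \<open>V\<close>, with membership in
  \<open>U\<close> instead of equality to zero. For all numbers of variables there is a single type of polynomials, in which
  \<open>Ord n k\<close> is the set of polynomials in \<open>x\<^sub>0, \<dots>, x\<^sub>n\<^sub>-\<^sub>1\<close> of order at least \<open>k\<close>.
  Krull dimension zero makes the variables nilpotent in \<open>S\<close> (\<open>variable_nilpotent\<close>), so that \<open>S\<close> is also a quotient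
  of a polynomial ring. A linear section of this quotient map turns derivations of \<open>S\<close> into linear
  operators on polynomials, compatibly with brackets (\<open>lift_bracket\<close>).
\<close>

section \<open>Linear algebra modulo a subspace\<close>

locale complex_vector_space = vector_space scale
  for scale :: "complex \<Rightarrow> 'b::ab_group_add \<Rightarrow> 'b"  (infixr \<open>*s\<close> 75)
begin

abbreviation endo :: "('b \<Rightarrow> 'b) \<Rightarrow> bool"
  where "endo T \<equiv> module_hom scale scale T"

definition indep_mod :: "'b set \<Rightarrow> 'i set \<Rightarrow> ('i \<Rightarrow> 'b) \<Rightarrow> bool"
  where "indep_mod U I b \<longleftrightarrow> (\<forall>c. (\<Sum>i\<in>I. c i *s b i) \<in> U \<longrightarrow> (\<forall>i\<in>I. c i = 0))"

definition fin_dim_mod :: "'b set \<Rightarrow> 'b set \<Rightarrow> bool"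
  where "fin_dim_mod V U \<longleftrightarrow> (\<exists>Y. finite Y \<and> V \<subseteq> span (Y \<union> U))"

lemma endoI:
  assumes "\<And>x y. T (x + y) = T x + T y" "\<And>c x. T (c *s x) = c *s T x"
  shows "endo T"
  using assms by unfold_locales auto

lemma subspace_scale_iff:
  assumes "subspace U" "c \<noteq> 0"
  shows "c *s v \<in> U \<longleftrightarrow> v \<in> U"
proof
  assume "c *s v \<in> U"
  then have "inverse c *s (c *s v) \<in> U" using assms(1) by (rule subspace_scale[rotated])
  then show "v \<in> U" using assms(2) by simp
qed (use assms in \<open>auto intro: subspace_scale\<close>)

lemma span_Un_subspaceE:
  assumes "v \<in> span (Y \<union> U)" "subspace U"
  obtains x u where "x \<in> span Y" "u \<in> U" "v = x + u"
proof -
  have U: "span U = U" using assms(2) by (simp add: span_eq_iff)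
  show ?thesis using assms(1) that unfolding span_Un U by blast
qed

lemma span_Un_finiteE:
  assumes "v \<in> span (Y \<union> U)" "subspace U" "finite Y"
  obtains c u where "u \<in> U" "v = (\<Sum>x\<in>Y. c x *s x) + u"
proof -
  obtain x u where xu: "x \<in> span Y" "u \<in> U" "v = x + u"
    using span_Un_subspaceE[OF assms(1,2)] .
  then obtain c where "x = (\<Sum>x\<in>Y. c x *s x)" using assms(3) by (auto simp: span_finite)
  then show ?thesis using that xu by blast
qed

text \<open>
  Subtracting the components in \<open>U\<close> turns an independent family modulo \<open>U\<close> into an independent family
  in \<open>span Y\<close>, where the exchange lemma applies.
\<close>

lemma indep_mod_card_le:
  assumes I: "finite I" and Y: "finite Y" and U: "subspace U"
    and b: "\<And>i. i \<in> I \<Longrightarrow> b i \<in> span (Y \<union> U)" and ind: "indep_mod U I b"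
  shows "card I \<le> card Y"
proof -
  have "\<forall>i\<in>I. \<exists>x u. x \<in> span Y \<and> u \<in> U \<and> b i = x + u"
    using b span_Un_subspaceE[OF _ U] by metis
  then obtain x u where xu: "\<And>i. i \<in> I \<Longrightarrow> x i \<in> span Y \<and> u i \<in> U \<and> b i = x i + u i"
    by metis
  have *: "\<forall>i\<in>I. c i = 0" if "(\<Sum>i\<in>I. c i *s x i) = 0" for c
  proof -
    have "(\<Sum>i\<in>I. c i *s b i) = (\<Sum>i\<in>I. c i *s x i) + (\<Sum>i\<in>I. c i *s u i)"
      using xu by (simp add: scale_right_distrib sum.distrib cong: sum.cong)
    also have "\<dots> \<in> U" using that xu U by (auto intro!: subspace_sum subspace_scale)
    finally show ?thesis using ind by (auto simp: indep_mod_def)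
  qed
  have inj: "inj_on x I"
  proof (rule inj_onI, rule ccontr)
    fix i j assume ij: "i \<in> I" "j \<in> I" "x i = x j" "i \<noteq> j"
    define c where "c k = (if k = i then 1 else if k = j then - 1 else (0::complex))" for k
    have "(\<Sum>k\<in>I. c k *s x k) = (\<Sum>k\<in>{i,j}. c k *s x k)"
      using ij I by (intro sum.mono_neutral_right) (auto simp: c_def)
    also have "\<dots> = 0" using ij by (simp add: c_def)
    finally have "c i = 0" using * ij by blast
    then show False by (simp add: c_def)
  qed
  have "independent (x ` I)"
  proof (rule independent_if_scalars_zero)
    fix f y assume s: "(\<Sum>y\<in>x ` I. f y *s y) = 0" and y: "y \<in> x ` I"
    have "(\<Sum>i\<in>I. f (x i) *s x i) = 0" using s by (simp add: sum.reindex[OF inj])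
    then show "f y = 0" using *[of "\<lambda>i. f (x i)"] y by auto
  qed (use I in auto)
  then have "card (x ` I) \<le> card Y"
    using independent_span_bound[OF Y] xu by auto
  then show ?thesis by (simp add: card_image[OF inj])
qed

text \<open>
  Applied to the iterates of an operator on one vector, this takes the place of the minimal polynomial.
\<close>

lemma fin_dim_mod_dependent:
  assumes "fin_dim_mod V U" "subspace U" "\<And>i::nat. u i \<in> V"
  obtains n c where "(\<Sum>i<n. c i *s u i) \<in> U" "\<exists>i<n. c i \<noteq> 0"
proof -
  obtain Y where Y: "finite Y" "V \<subseteq> span (Y \<union> U)" using assms(1) by (auto simp: fin_dim_mod_def)
  have "\<not> indep_mod U {..<Suc (card Y)} u"
    using indep_mod_card_le[OF _ Y(1) assms(2), of "{..<Suc (card Y)}" u] Y(2) assms(3) by auto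
  then show ?thesis using that unfolding indep_mod_def by (metis lessThan_iff)
qed

lemma fin_dim_mod_mono:
  assumes "fin_dim_mod V U" "V' \<subseteq> V" "U \<subseteq> U'"
  shows "fin_dim_mod V' U'"
proof -
  obtain Y where "finite Y" "V \<subseteq> span (Y \<union> U)" using assms(1) by (auto simp: fin_dim_mod_def)
  moreover have "span (Y \<union> U) \<subseteq> span (Y \<union> U')" using assms(3) by (intro span_mono) auto
  ultimately show ?thesis using assms(2) unfolding fin_dim_mod_def by blast
qed

lemma indep_mod_insert:
  assumes "finite B" "indep_mod U B id" "subspace U" "g \<notin> span (B \<union> U)"
  shows "indep_mod U (insert g B) id"
  unfolding indep_mod_def
proof (intro allI impI)
  fix c assume s: "(\<Sum>i\<in>insert g B. c i *s id i) \<in> U"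
  have gB: "g \<notin> B" using assms(4) span_base by blast
  have s': "c g *s g + (\<Sum>i\<in>B. c i *s i) \<in> U" using s gB assms(1) by simp
  have cg: "c g = 0"
  proof (rule ccontr)
    assume "c g \<noteq> 0"
    have 1: "c g *s g + (\<Sum>i\<in>B. c i *s i) \<in> span (B \<union> U)" using s' span_base by blast
    have 2: "(\<Sum>i\<in>B. c i *s i) \<in> span (B \<union> U)" by (intro span_sum span_scale span_base) auto
    have "c g *s g \<in> span (B \<union> U)" using span_diff[OF 1 2] by simp
    then have "inverse (c g) *s (c g *s g) \<in> span (B \<union> U)" by (rule span_scale)
    then show False using \<open>c g \<noteq> 0\<close> assms(4) by simp
  qed
  then have "(\<Sum>i\<in>B. c i *s id i) \<in> U" using s' by simp
  then show "\<forall>i\<in>insert g B. c i = 0" using assms(2) cg by (auto simp: indep_mod_def)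
qed

lemma indep_mod_extend:
  assumes G: "fin_dim_mod G U" and U: "subspace U"
    and B0: "B0 \<subseteq> G" "finite B0" "indep_mod U B0 id"
  obtains B where "B0 \<subseteq> B" "B \<subseteq> G" "finite B" "indep_mod U B id" "G \<subseteq> span (B \<union> U)"
proof -
  obtain Y where Y: "finite Y" "G \<subseteq> span (Y \<union> U)" using G by (auto simp: fin_dim_mod_def)
  let ?P = "\<lambda>B. B0 \<subseteq> B \<and> B \<subseteq> G \<and> finite B \<and> indep_mod U B id"
  have "\<forall>B. ?P B \<longrightarrow> card B \<le> card Y"
    using indep_mod_card_le[OF _ Y(1) U, where b=id] Y(2) by (metis id_apply subsetD)
  moreover have "?P B0" using B0 by auto
  ultimately obtain B where B: "?P B" "\<And>B'. ?P B' \<Longrightarrow> card B' \<le> card B"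
    using ex_has_greatest_nat[of ?P B0 card "Suc (card Y)"] by (metis less_Suc_eq_le)
  have "G \<subseteq> span (B \<union> U)"
  proof
    fix g assume g: "g \<in> G"
    show "g \<in> span (B \<union> U)"
    proof (rule ccontr)
      assume ng: "g \<notin> span (B \<union> U)"
      then have "indep_mod U (insert g B) id" using indep_mod_insert B(1) U by blast
      then have "card (insert g B) \<le> card B" using B(1) g by (intro B(2)) auto
      moreover have "g \<notin> B" using ng span_base by blast
      ultimately show False using B(1) by simp
    qed
  qed
  then show ?thesis using that B by blast
qed

lemma indep_mod_same_card:
  assumes "finite B" "finite B'" "subspace U" "indep_mod U B id" "indep_mod U B' id"
    "B \<subseteq> span (B' \<union> U)" "B' \<subseteq> span (B \<union> U)"
  shows "card B = card B'"
  using indep_mod_card_le[of B B' U id] indep_mod_card_le[of B' B U id] assms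
  by (metis dual_order.antisym id_apply subsetD)

lemma endo_image_span:
  assumes "endo T" "v \<in> span Y" "T ` Y \<subseteq> W" "subspace W"
  shows "T v \<in> W"
proof -
  have "T v \<in> T ` span Y" using assms by auto
  also have "\<dots> = span (T ` Y)" by (rule module_hom.span_image[OF assms(1), symmetric])
  also have "\<dots> \<subseteq> W" using assms by (simp add: span_minimal)
  finally show ?thesis .
qed

lemma endo_funpow: "endo T \<Longrightarrow> endo (T ^^ k)"
proof (induction k)
  case 0
  then show ?case by (auto intro!: endoI)
next
  case (Suc k)
  then show ?case by (auto intro!: endoI simp: module_hom.add module_hom.scale)
qed

section \<open>Eigenvectors modulo a subspace\<close>

definition polyapp :: "('b \<Rightarrow> 'b) \<Rightarrow> complex poly \<Rightarrow> 'b \<Rightarrow> 'b"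
  where "polyapp T p v = (\<Sum>i\<le>degree p. coeff p i *s (T ^^ i) v)"

lemma polyapp_bound:
  assumes "\<And>i. i \<ge> N \<Longrightarrow> coeff p i = 0"
  shows "(\<Sum>i<N. coeff p i *s (T ^^ i) v) = polyapp T p v"
proof -
  have "(\<Sum>i<N. coeff p i *s (T ^^ i) v) = (\<Sum>i<max N (Suc (degree p)). coeff p i *s (T ^^ i) v)"
    using assms by (intro sum.mono_neutral_left) auto
  also have "\<dots> = (\<Sum>i<Suc (degree p). coeff p i *s (T ^^ i) v)"
    by (intro sum.mono_neutral_right) (auto simp: coeff_eq_0)
  finally show ?thesis by (simp add: polyapp_def lessThan_Suc_atMost)
qed

lemma polyapp_linear_factor:
  assumes T: "endo T"
  shows "polyapp T ([:- z, 1:] * q) v = polyapp T q (T v - z *s v)"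
proof -
  define N where "N = Suc (degree q)"
  have q0: "coeff q i = 0" if "i \<ge> N" for i using that by (simp add: N_def coeff_eq_0)
  let ?p = "[:- z, 1:] * q"
  have cp: "coeff ?p i = (case i of 0 \<Rightarrow> 0 | Suc j \<Rightarrow> coeff q j) - z * coeff q i" for i
    by (simp add: coeff_pCons split: nat.split)
  have "polyapp T ?p v = (\<Sum>i<Suc N. coeff ?p i *s (T ^^ i) v)"
    by (rule polyapp_bound[symmetric]) (unfold cp, auto simp: q0 split: nat.split)
  also have "\<dots> = (\<Sum>i<Suc N. (case i of 0 \<Rightarrow> 0 | Suc j \<Rightarrow> coeff q j) *s (T ^^ i) v)
      - (\<Sum>i<Suc N. (z * coeff q i) *s (T ^^ i) v)"
    by (simp only: cp scale_left_diff_distrib sum_subtractf)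
  also have "(\<Sum>i<Suc N. (case i of 0 \<Rightarrow> 0 | Suc j \<Rightarrow> coeff q j) *s (T ^^ i) v)
      = (\<Sum>i<N. coeff q i *s (T ^^ Suc i) v)"
    by (subst sum.lessThan_Suc_shift) simp
  also have "(\<Sum>i<Suc N. (z * coeff q i) *s (T ^^ i) v) = (\<Sum>i<N. (z * coeff q i) *s (T ^^ i) v)"
    using q0[of N] by simp
  also have "(\<Sum>i<N. coeff q i *s (T ^^ Suc i) v) - (\<Sum>i<N. (z * coeff q i) *s (T ^^ i) v)
      = (\<Sum>i<N. coeff q i *s (T ^^ i) (T v - z *s v))"
  proof -
    have "coeff q i *s (T ^^ Suc i) v - (z * coeff q i) *s (T ^^ i) v
        = coeff q i *s (T ^^ i) (T v - z *s v)" for i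
      by (simp add: module_hom.diff[OF endo_funpow[OF T]] module_hom.scale[OF endo_funpow[OF T]]
          scale_right_diff_distrib funpow_swap1 mult.commute)
    then show ?thesis by (simp add: sum_subtractf[symmetric])
  qed
  also have "\<dots> = polyapp T q (T v - z *s v)"
    by (rule polyapp_bound) (rule q0)
  finally show ?thesis .
qed

text \<open>
  Split off linear factors of \<open>p\<close> one at a time; the last vector before the product reaches \<open>U\<close> is an
  eigenvector modulo \<open>U\<close>.
\<close>

lemma eigenvector_mod_if_annihilated:
  assumes T: "endo T" and V: "subspace V" "T ` V \<subseteq> V" and U: "subspace U"
  shows "p \<noteq> 0 \<Longrightarrow> v \<in> V \<Longrightarrow> v \<notin> U \<Longrightarrow> polyapp T p v \<in> U \<Longrightarrow>
     \<exists>w\<in>V - U. \<exists>z. T w - z *s w \<in> U"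
proof (induction "degree p" arbitrary: p v)
  case 0
  then obtain c where p: "p = [:c:]" "c \<noteq> 0" by (metis degree_eq_zeroE pCons_0_0)
  have "c *s v \<in> U" using 0 p by (simp add: polyapp_def)
  then show ?case using 0 subspace_scale_iff[OF U p(2)] by simp
next
  case (Suc n)
  then have "\<not> constant (poly p)" by (simp add: constant_degree)
  then obtain z where "poly p z = 0" using fundamental_theorem_of_algebra by blast
  then obtain q where q: "p = [:- z, 1:] * q" using poly_eq_0_iff_dvd by (metis dvdE)
  have q0: "q \<noteq> 0" using q Suc by auto
  have "degree p = degree [:- z, 1:] + degree q"
    unfolding q by (rule degree_mult_eq) (use q0 in auto)
  then have dq: "n = degree q" using Suc(2) by simp
  show ?case
  proof (cases "T v - z *s v \<in> U")
    case True
    then show ?thesis using Suc by blast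
  next
    case False
    moreover have "T v - z *s v \<in> V" using Suc V by (auto intro!: subspace_diff subspace_scale)
    moreover have "polyapp T q (T v - z *s v) \<in> U"
      using Suc.prems(4) unfolding q polyapp_linear_factor[OF T] .
    ultimately show ?thesis using Suc.hyps(1)[OF dq q0] by blast
  qed
qed

lemma eigenvector_mod_exists:
  assumes T: "endo T" and V: "subspace V" "T ` V \<subseteq> V" and U: "subspace U"
    and fd: "fin_dim_mod V U" and ne: "v \<in> V" "v \<notin> U"
  obtains w z where "w \<in> V" "w \<notin> U" "T w - z *s w \<in> U"
proof -
  have "(T ^^ i) v \<in> V" for i using ne V by (induction i) auto
  then obtain n c where nc: "(\<Sum>i<n. c i *s (T ^^ i) v) \<in> U" "\<exists>i<n. c i \<noteq> 0"
    by (rule fin_dim_mod_dependent[OF fd U])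
  define p where "p = (\<Sum>i<n. monom (c i) i)"
  have cp: "coeff p i = (if i < n then c i else 0)" for i
    by (simp add: p_def coeff_sum)
  have "p \<noteq> 0" using nc(2) cp by (metis coeff_0)
  moreover have "polyapp T p v \<in> U"
    using nc(1) polyapp_bound[of n p T v] by (auto simp: cp)
  ultimately show ?thesis using eigenvector_mod_if_annihilated[OF T V U _ ne] that by blast
qed

text \<open>
  Applying \<open>T - a\<close> to a vanishing sum removes the eigenvector for \<open>a\<close> and multiplies the others by nonzero
  factors.
\<close>

lemma eigenvectors_mod_independent:
  assumes T: "endo T" and U: "subspace U" "T ` U \<subseteq> U" and L: "finite L"
    and v: "\<And>l. l \<in> L \<Longrightarrow> T (v l) - l *s v l \<in> U" and s: "(\<Sum>l\<in>L. v l) \<in> U"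
  shows "\<forall>l\<in>L. v l \<in> U"
  using L v s
proof (induction L arbitrary: v rule: finite_induct)
  case (insert a L)
  have "(\<Sum>l\<in>L. (l - a) *s v l) \<in> U"
  proof -
    have 1: "T (\<Sum>l\<in>insert a L. v l) \<in> U" using U insert by auto
    have 2: "(\<Sum>l\<in>insert a L. T (v l) - l *s v l) \<in> U" using insert U by (intro subspace_sum) auto
    have 3: "a *s (\<Sum>l\<in>insert a L. v l) \<in> U" using insert U by (intro subspace_scale) auto
    have "T (\<Sum>l\<in>insert a L. v l) - (\<Sum>l\<in>insert a L. T (v l) - l *s v l) - a *s (\<Sum>l\<in>insert a L. v l)
      = (\<Sum>l\<in>insert a L. (l - a) *s v l)"
      by (simp add: module_hom.sum[OF T] sum_subtractf scale_sum_right scale_left_diff_distrib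
        del: sum.insert)
    then have "(\<Sum>l\<in>insert a L. (l - a) *s v l) \<in> U"
      using subspace_diff[OF U(1) subspace_diff[OF U(1) 1 2] 3] by (simp del: sum.insert)
    then show ?thesis using insert by simp
  qed
  moreover have "T ((l - a) *s v l) - l *s ((l - a) *s v l) \<in> U" if "l \<in> L" for l
  proof -
    have "T ((l - a) *s v l) - l *s ((l - a) *s v l) = (l - a) *s (T (v l) - l *s v l)"
      by (simp add: module_hom.scale[OF T] scale_right_diff_distrib mult.commute)
    then show ?thesis using insert that U by (auto intro!: subspace_scale)
  qed
  ultimately have *: "\<forall>l\<in>L. (l - a) *s v l \<in> U" using insert.IH[of "\<lambda>l. (l - a) *s v l"] by auto
  have L: "v l \<in> U" if "l \<in> L" for l
    using * that insert subspace_scale_iff[OF U(1), of "l - a"] by auto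
  then have "(\<Sum>l\<in>L. v l) \<in> U" using U by (intro subspace_sum) auto
  moreover have "v a + (\<Sum>l\<in>L. v l) \<in> U" using insert by simp
  ultimately have "v a \<in> U" using U subspace_diff by fastforce
  then show ?case using L by auto
qed auto

end

section \<open>Representations of sl2\<close>

lemma (in complex_vector_space) eigenvectors_mod_independent_family:
  assumes T: "endo T" and U: "subspace U" "T ` U \<subseteq> U" and I: "finite I" "inj_on l I"
    and v: "\<And>i. i \<in> I \<Longrightarrow> T (v i) - l i *s v i \<in> U" and s: "(\<Sum>i\<in>I. v i) \<in> U"
  shows "\<forall>i\<in>I. v i \<in> U"
proof -
  define g where "g = the_inv_into I l"
  have g: "g (l i) = i" if "i \<in> I" for i using that I by (simp add: g_def the_inv_into_f_f)
  have "(\<Sum>m\<in>l ` I. v (g m)) = (\<Sum>i\<in>I. v i)"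
    using I g by (simp add: sum.reindex)
  then have sum: "(\<Sum>m\<in>l ` I. v (g m)) \<in> U" using s by simp
  have eig: "T (v (g m)) - m *s v (g m) \<in> U" if "m \<in> l ` I" for m using that v g by auto
  have "\<forall>m\<in>l ` I. v (g m) \<in> U"
    by (rule eigenvectors_mod_independent[OF T U finite_imageI[OF I(1)] eig sum])
  then show ?thesis using g by auto
qed

text \<open>
  A finite-dimensional representation of \<open>sl\<^sub>2\<close> on \<open>V / U\<close>. The relations are required only on \<open>V\<close> and
  modulo \<open>U\<close>, because the derivations of polynomial rings that lift an action on a quotient satisfy them
  only there.
\<close>

locale sl2_module_mod = complex_vector_space scale
  for scale :: "complex \<Rightarrow> 'b::ab_group_add \<Rightarrow> 'b"  (infixr \<open>*s\<close> 75) +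
  fixes V U :: "'b set" and e f h :: "'b \<Rightarrow> 'b"
  assumes V: "subspace V" and U: "subspace U" and UV: "U \<subseteq> V"
    and e: "endo e" and f: "endo f" and h: "endo h"
    and eV: "\<And>v. v \<in> V \<Longrightarrow> e v \<in> V" and fV: "\<And>v. v \<in> V \<Longrightarrow> f v \<in> V" and hV: "\<And>v. v \<in> V \<Longrightarrow> h v \<in> V"
    and eU: "\<And>v. v \<in> U \<Longrightarrow> e v \<in> U" and fU: "\<And>v. v \<in> U \<Longrightarrow> f v \<in> U" and hU: "\<And>v. v \<in> U \<Longrightarrow> h v \<in> U"
    and ef: "\<And>v. v \<in> V \<Longrightarrow> e (f v) - f (e v) - h v \<in> U"
    and he: "\<And>v. v \<in> V \<Longrightarrow> h (e v) - e (h v) - 2 *s e v \<in> U"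
    and hf: "\<And>v. v \<in> V \<Longrightarrow> h (f v) - f (h v) + 2 *s f v \<in> U"
    and fin_dim: "fin_dim_mod V U"
begin

lemmas e_lin = module_hom.add[OF e] module_hom.diff[OF e] module_hom.scale[OF e] module_hom.sum[OF e] module_hom.neg[OF e]
lemmas f_lin = module_hom.add[OF f] module_hom.diff[OF f] module_hom.scale[OF f] module_hom.sum[OF f] module_hom.neg[OF f]
lemmas h_lin = module_hom.add[OF h] module_hom.diff[OF h] module_hom.scale[OF h] module_hom.sum[OF h] module_hom.neg[OF h]
lemmas scale_distrib = scale_right_distrib scale_left_distrib scale_right_diff_distrib
  scale_left_diff_distrib scale_minus_left scale_minus_right

lemma memU_plus: "a \<in> U \<Longrightarrow> b \<in> U \<Longrightarrow> c = a + b \<Longrightarrow> c \<in> U"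
  using U subspace_add by blast

lemma memU_minus: "a \<in> U \<Longrightarrow> b \<in> U \<Longrightarrow> c = a - b \<Longrightarrow> c \<in> U"
  using U subspace_diff by blast

lemma memU_trans: "a - b \<in> U \<Longrightarrow> b \<in> U \<Longrightarrow> a \<in> U"
  by (rule memU_plus[of "a - b" b]) simp_all

definition wt :: "complex \<Rightarrow> 'b set"
  where "wt l = {v \<in> V. h v - l *s v \<in> U}"

text \<open>
  This symmetry exchanges lowest and highest weights.
\<close>

lemma swapped: "sl2_module_mod (*s) V U f e (\<lambda>v. - h v)"
proof unfold_locales
  fix v assume v: "v \<in> V"
  have "f (e v) - e (f v) - - h v = - (e (f v) - f (e v) - h v)" by simp
  then show "f (e v) - e (f v) - - h v \<in> U" using ef[OF v] U by (metis subspace_neg)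
  have "- h (f v) - f (- h v) - 2 *s f v = - (h (f v) - f (h v) + 2 *s f v)" by (simp add: f_lin)
  then show "- h (f v) - f (- h v) - 2 *s f v \<in> U" using hf[OF v] U by (metis subspace_neg)
  have "- h (e v) - e (- h v) + 2 *s e v = - (h (e v) - e (h v) - 2 *s e v)" by (simp add: e_lin)
  then show "- h (e v) - e (- h v) + 2 *s e v \<in> U" using he[OF v] U by (metis subspace_neg)
qed (use V U UV e f h eV fV hV eU fU hU fin_dim in
    \<open>auto simp: h_lin scale_distrib subspace_neg module_hom.add module_hom.scale\<close>)

lemma wt_V: "v \<in> wt l \<Longrightarrow> v \<in> V"
  by (simp add: wt_def)

lemma subspace_wt: "subspace (wt l)"
proof (rule subspaceI)
  show "0 \<in> wt l" using V U by (simp add: wt_def subspace_0 module_hom.zero[OF h])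
next
  fix x y assume "x \<in> wt l" "y \<in> wt l"
  have "h (x + y) - l *s (x + y) \<in> U"
    by (rule memU_plus[of "h x - l *s x" "h y - l *s y"])
      (use \<open>x \<in> wt l\<close> \<open>y \<in> wt l\<close> in \<open>auto simp: wt_def h_lin scale_distrib\<close>)
  then show "x + y \<in> wt l" using \<open>x \<in> wt l\<close> \<open>y \<in> wt l\<close> V by (auto simp: wt_def subspace_add)
next
  fix c x assume x: "x \<in> wt l"
  have "h (c *s x) - l *s (c *s x) = c *s (h x - l *s x)"
    by (simp add: h_lin scale_distrib mult.commute)
  then show "c *s x \<in> wt l" using x U V by (auto simp: wt_def subspace_scale)
qed

lemma U_wt: "U \<subseteq> wt l"
  using U UV hU by (auto simp: wt_def subspace_diff subspace_scale)

lemma e_wt: assumes "v \<in> wt l" shows "e v \<in> wt (l + 2)"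
proof -
  have "h (e v) - (l + 2) *s e v \<in> U"
    by (rule memU_plus[OF he eU, of v "h v - l *s v"])
      (use assms in \<open>auto simp: wt_def e_lin scale_distrib\<close>)
  then show ?thesis using assms eV by (auto simp: wt_def)
qed

lemma f_wt: assumes "v \<in> wt l" shows "f v \<in> wt (l - 2)"
proof -
  have "h (f v) - (l - 2) *s f v \<in> U"
    by (rule memU_plus[OF hf fU, of v "h v - l *s v"])
      (use assms in \<open>auto simp: wt_def f_lin scale_distrib\<close>)
  then show ?thesis using assms fV by (auto simp: wt_def)
qed

lemma e_pow_wt: "v \<in> wt l \<Longrightarrow> (e ^^ k) v \<in> wt (l + 2 * of_nat k)"
  by (induction k) (auto dest: e_wt simp: algebra_simps)

lemma e_pow_V: "v \<in> V \<Longrightarrow> (e ^^ k) v \<in> V"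
  by (induction k) (auto intro: eV)

text \<open>
  The commutation rule for \<open>f\<close> and powers of \<open>e\<close> on a lowest weight vector. The hypothesis
  concerns \<open>e (f v)\<close> rather than \<open>f v\<close>, so that the rule describes the kernel of \<open>e \<circ> f\<close>.
\<close>

lemma f_e_pow:
  assumes v: "v \<in> wt l" and efv: "e (f v) \<in> U"
  shows "f ((e ^^ Suc k) v) + (of_nat (Suc k) * (l + of_nat k)) *s (e ^^ k) v \<in> U"
proof (induction k)
  case 0
  have "h v - l *s v \<in> U" using v by (simp add: wt_def)
  from subspace_diff[OF U subspace_diff[OF U efv ef[OF wt_V[OF v]]] this] show ?case by simp
next
  case (Suc k)
  define x where "x = (e ^^ Suc k) v"
  define y where "y = (e ^^ k) v"
  define c where "c = of_nat (Suc k) * (l + of_nat k)"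
  have xy: "x = e y" by (simp add: x_def y_def)
  have x: "x \<in> wt (l + 2 * of_nat (Suc k))" unfolding x_def by (rule e_pow_wt[OF v])
  have 1: "e (f x + c *s y) \<in> U" using Suc eU by (simp only: x_def y_def c_def)
  have 2: "e (f x) - f (e x) - h x \<in> U" using ef wt_V[OF x] .
  have 3: "h x - (l + 2 * of_nat (Suc k)) *s x \<in> U" using x by (simp add: wt_def)
  have *: "f (e x) + (c + (l + 2 * of_nat (Suc k))) *s x
      = e (f x + c *s y) - (e (f x) - f (e x) - h x) - (h x - (l + 2 * of_nat (Suc k)) *s x)"
    by (simp add: e_lin scale_distrib xy[symmetric])
  have "f (e x) + (c + (l + 2 * of_nat (Suc k))) *s x \<in> U"
    unfolding * by (intro subspace_diff U 1 2 3)
  moreover have "c + (l + 2 * of_nat (Suc k)) = of_nat (Suc (Suc k)) * (l + of_nat (Suc k))"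
    by (simp add: c_def algebra_simps)
  ultimately show ?case by (simp add: x_def)
qed

text \<open>
  The vectors \<open>(e ^^ k) v\<close> have distinct weights, so only finitely many are nonzero modulo \<open>U\<close>.
\<close>

lemma e_nilpotent:
  assumes v: "v \<in> wt l"
  shows "\<exists>k. (e ^^ k) v \<in> U"
proof -
  have "(e ^^ i) v \<in> V" for i using e_pow_V wt_V[OF v] .
  then obtain n c where nc: "(\<Sum>i<n. c i *s (e ^^ i) v) \<in> U" "\<exists>i<n. c i \<noteq> 0"
    by (rule fin_dim_mod_dependent[OF fin_dim U])
  have "c i *s (e ^^ i) v \<in> wt (l + 2 * of_nat i)" for i
    using e_pow_wt[OF v] subspace_wt by (auto intro: subspace_scale)
  then have "\<forall>i\<in>{..<n}. c i *s (e ^^ i) v \<in> U"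
    using nc(1) hU U h
    by (intro eigenvectors_mod_independent_family[where T = h and l = "\<lambda>i. l + 2 * of_nat i"])
      (auto simp: wt_def inj_on_def)
  then show ?thesis using nc(2) subspace_scale_iff[OF U] by (metis lessThan_iff)
qed

lemma e_pow_last:
  assumes v: "v \<in> wt l" "v \<notin> U"
  obtains j where "(e ^^ j) v \<notin> U" "(e ^^ Suc j) v \<in> U"
proof -
  define k where "k = (LEAST k. (e ^^ k) v \<in> U)"
  have k: "(e ^^ k) v \<in> U" unfolding k_def by (rule LeastI_ex[OF e_nilpotent[OF v(1)]])
  have "k \<noteq> 0" using k v by (cases k) auto
  then obtain j where j: "k = Suc j" by (cases k) auto
  have "(e ^^ j) v \<notin> U" using not_less_Least[of j "\<lambda>k. (e ^^ k) v \<in> U"] j k_def by auto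
  then show ?thesis using that k j by simp
qed

text \<open>
  For the last nonzero \<open>(e ^^ j) v\<close>, the coefficient \<open>(j + 1) * (l + j)\<close> in \<open>f_e_pow\<close> has to vanish.
\<close>

lemma lowest_weight:
  assumes v: "v \<in> wt l" "v \<notin> U" and efv: "e (f v) \<in> U"
  shows "\<exists>k::nat. l = - of_nat k"
proof -
  obtain j where j: "(e ^^ j) v \<notin> U" "(e ^^ Suc j) v \<in> U" using e_pow_last[OF v] .
  have "(of_nat (Suc j) * (l + of_nat j)) *s (e ^^ j) v \<in> U"
    by (rule memU_minus[OF f_e_pow[OF v(1) efv, of j] fU[OF j(2)]]) simp
  then have "of_nat (Suc j) * (l + of_nat j) = 0" using j(1) subspace_scale_iff[OF U] by blast
  then have "l + of_nat j = 0" by (metis mult_eq_0_iff of_nat_neq_0)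
  then show ?thesis by (auto simp: add_eq_0_iff2)
qed

lemma swapped_wt: "sl2_module_mod.wt (*s) V U (\<lambda>v. - h v) l = wt (- l)"
proof -
  have "- h v - l *s v \<in> U \<longleftrightarrow> h v - (- l) *s v \<in> U" for v
  proof -
    have "- h v - l *s v = - (h v - (- l) *s v)" by simp
    then show ?thesis using U subspace_neg by (metis minus_minus)
  qed
  then show ?thesis by (simp add: sl2_module_mod.wt_def[OF swapped] wt_def)
qed

lemma highest_weight:
  assumes "v \<in> wt l" "v \<notin> U" "f (e v) \<in> U"
  shows "\<exists>k::nat. l = of_nat k"
proof -
  interpret s: sl2_module_mod "(*s)" V U f e "\<lambda>v. - h v" by (rule swapped)
  have "v \<in> s.wt (- l)" using assms swapped_wt by simp
  from s.lowest_weight[OF this] assms show ?thesis by simp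
qed

lemma weight_int:
  assumes v: "v \<in> wt l" "v \<notin> U"
  shows "l \<in> \<int>"
proof -
  obtain j where j: "(e ^^ j) v \<notin> U" "(e ^^ Suc j) v \<in> U" using e_pow_last[OF v] .
  have "f (e ((e ^^ j) v)) \<in> U" using j(2) fU by simp
  then obtain k :: nat where "l + 2 * of_nat j = of_nat k"
    using highest_weight[OF e_pow_wt[OF v(1)] j(1)] by blast
  then have "l = of_nat k - 2 * of_nat j" by (simp add: eq_diff_eq)
  then show ?thesis by simp
qed

lemma ef_inj_mod:
  assumes "v \<in> wt l" "Re l > 0" "e (f v) \<in> U"
  shows "v \<in> U"
  using lowest_weight[OF assms(1) _ assms(3)] assms(2) by (cases "v \<in> U") auto

lemma f_inj_mod:
  assumes "v \<in> wt l" "Re l > 0" "f v \<in> U"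
  shows "v \<in> U"
  using ef_inj_mod[OF assms(1,2)] eU[OF assms(3)] by blast

lemma e_inj_mod:
  assumes "v \<in> wt l" "Re l < 0" "e v \<in> U"
  shows "v \<in> U"
  using highest_weight[OF assms(1) _ fU[OF assms(3)]] assms(2) by (cases "v \<in> U") auto

text \<open>
  Injectivity of \<open>e \<circ> f\<close> on a finite-dimensional space implies surjectivity: in a linear dependency among
  the iterates of \<open>u\<close>, cancel \<open>e \<circ> f\<close> until the coefficient of \<open>u\<close> is nonzero, and solve for \<open>u\<close>.
\<close>

lemma ef_surj_mod:
  assumes u: "u \<in> wt l" and l: "Re l > 0"
  shows "\<exists>w\<in>wt l. u - e (f w) \<in> U"
proof -
  let ?y = "\<lambda>v. e (f v)"
  have y: "?y v \<in> wt l" if "v \<in> wt l" for v using e_wt[OF f_wt[OF that]] by simp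
  have yi: "(?y ^^ i) u \<in> wt l" for i by (induction i) (auto intro: y u)
  obtain n c where "(\<Sum>i<n. c i *s (?y ^^ i) u) \<in> U" "\<exists>i<n. c i \<noteq> 0"
    by (rule fin_dim_mod_dependent[OF fin_dim U wt_V[OF yi]])
  then show ?thesis
  proof (induction n arbitrary: c)
    case (Suc n)
    define s where "s = (\<Sum>i<n. c (Suc i) *s (?y ^^ i) u)"
    have s: "s \<in> wt l" unfolding s_def using yi subspace_wt by (auto intro!: subspace_sum subspace_scale)
    have "(\<Sum>i<Suc n. c i *s (?y ^^ i) u) = c 0 *s u + ?y s"
      by (subst sum.lessThan_Suc_shift) (simp add: s_def e_lin f_lin)
    then have *: "c 0 *s u + ?y s \<in> U" using Suc.prems by simp
    show ?case
    proof (cases "c 0 = 0")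
      case True
      then have "s \<in> U" using ef_inj_mod[OF s l] * by simp
      moreover have "\<exists>i<n. c (Suc i) \<noteq> 0" using Suc.prems(2) True less_Suc_eq_0_disj by auto
      ultimately show ?thesis using Suc.IH[of "\<lambda>i. c (Suc i)"] by (simp add: s_def)
    next
      case False
      have "c 0 *s (u - ?y (- inverse (c 0) *s s)) = c 0 *s u + ?y s"
        using False by (simp add: e_lin f_lin scale_distrib)
      then have "u - ?y (- inverse (c 0) *s s) \<in> U" using * False subspace_scale_iff[OF U] by metis
      moreover have "- inverse (c 0) *s s \<in> wt l" using s subspace_wt by (intro subspace_scale)
      ultimately show ?thesis by blast
    qed
  qed simp
qed

definition wts_sum :: "'b set"
  where "wts_sum = span (\<Union>l. wt l)"

lemma wts_sum_V: "wts_sum \<subseteq> V"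
  unfolding wts_sum_def using wt_V by (intro span_minimal V) auto

lemma wt_wts_sum: "wt l \<subseteq> wts_sum"
  unfolding wts_sum_def by (auto intro: span_base)

lemma subspace_wts_sum: "subspace wts_sum"
  unfolding wts_sum_def by (rule subspace_span)

lemma wts_sum_decompose:
  assumes "v \<in> wts_sum"
  shows "\<exists>L x. finite L \<and> (\<forall>l. x l \<in> wt l) \<and> (\<forall>l. l \<notin> L \<longrightarrow> x l = 0) \<and> v = (\<Sum>l\<in>L. x l)"
proof -
  let ?S = "{v. \<exists>L x. finite L \<and> (\<forall>l. x l \<in> wt l) \<and> (\<forall>l. l \<notin> L \<longrightarrow> x l = 0) \<and> v = (\<Sum>l\<in>L. x l)}"
  have wt0: "0 \<in> wt l" for l using subspace_wt by (rule subspace_0)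
  have "subspace ?S"
  proof (rule subspaceI)
    show "0 \<in> ?S" using wt0 by (auto intro!: exI[of _ "{}"] exI[of _ "\<lambda>_. 0"])
  next
    fix a b assume "a \<in> ?S" "b \<in> ?S"
    then obtain L x M y where *: "finite L" "\<forall>l. x l \<in> wt l" "\<forall>l. l \<notin> L \<longrightarrow> x l = 0" "a = (\<Sum>l\<in>L. x l)"
      "finite M" "\<forall>l. y l \<in> wt l" "\<forall>l. l \<notin> M \<longrightarrow> y l = 0" "b = (\<Sum>l\<in>M. y l)" by auto
    have "a = (\<Sum>l\<in>L \<union> M. x l)" "b = (\<Sum>l\<in>L \<union> M. y l)"
      using * by (auto intro!: sum.mono_neutral_left)
    then have "a + b = (\<Sum>l\<in>L \<union> M. x l + y l)" by (simp add: sum.distrib)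
    then show "a + b \<in> ?S" using * subspace_wt
      by (intro CollectI exI[of _ "L \<union> M"] exI[of _ "\<lambda>l. x l + y l"]) (auto intro: subspace_add)
  next
    fix c a assume "a \<in> ?S"
    then obtain L x where *: "finite L" "\<forall>l. x l \<in> wt l" "\<forall>l. l \<notin> L \<longrightarrow> x l = 0" "a = (\<Sum>l\<in>L. x l)" by auto
    then show "c *s a \<in> ?S" using subspace_wt
      by (intro CollectI exI[of _ "L"] exI[of _ "\<lambda>l. c *s x l"]) (auto intro: subspace_scale simp: scale_sum_right)
  qed
  moreover have "(\<Union>l. wt l) \<subseteq> ?S"
  proof
    fix v assume "v \<in> (\<Union>l. wt l)"
    then obtain l where "v \<in> wt l" by auto
    then show "v \<in> ?S" using wt0
      by (intro CollectI exI[of _ "{l}"] exI[of _ "\<lambda>m. if m = l then v else 0"]) auto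
  qed
  ultimately have "wts_sum \<subseteq> ?S" unfolding wts_sum_def by (rule span_minimal[rotated])
  then show ?thesis using assms by auto
qed

lemma wt_components:
  assumes "finite L" "\<And>l. l \<in> L \<Longrightarrow> x l \<in> wt l" "(\<Sum>l\<in>L. x l) \<in> U"
  shows "\<forall>l\<in>L. x l \<in> U"
  using assms eigenvectors_mod_independent[OF h U, of L x] hU by (auto simp: wt_def)

lemma stable_wts_sum: "v \<in> wts_sum \<Longrightarrow> e v \<in> wts_sum \<and> f v \<in> wts_sum \<and> h v \<in> wts_sum"
proof -
  have h_wt: "h v \<in> wts_sum" if "v \<in> wt l" for v l
  proof -
    have "h v - l *s v \<in> wts_sum" using that U_wt wt_wts_sum by (auto simp: wt_def)
    moreover have "l *s v \<in> wts_sum" using that wt_wts_sum subspace_wts_sum subspace_scale by blast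
    ultimately have "(h v - l *s v) + l *s v \<in> wts_sum" using subspace_wts_sum by (rule subspace_add[rotated])
    then show ?thesis by simp
  qed
  assume v: "v \<in> wts_sum"
  show ?thesis
    using endo_image_span[OF e v[unfolded wts_sum_def] _ subspace_wts_sum]
      endo_image_span[OF f v[unfolded wts_sum_def] _ subspace_wts_sum]
      endo_image_span[OF h v[unfolded wts_sum_def] _ subspace_wts_sum]
      e_wt f_wt h_wt wt_wts_sum by blast
qed

text \<open>
  Here \<open>x\<close> spans, together with the weight vector \<open>y\<close>, a Jordan block of \<open>h\<close>. The formulas are those for a
  highest weight vector, with an additional term in \<open>y\<close>.
\<close>

lemma e_f_pow_jordan:
  assumes x: "x \<in> V" "e x \<in> U" and hx: "h x - l *s x - y \<in> U" and y: "y \<in> wt l" 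
  shows "h ((f ^^ k) x) - (l - 2 * of_nat k) *s (f ^^ k) x - (f ^^ k) y \<in> U"
    and "e ((f ^^ Suc k) x) - (of_nat (Suc k) * (l - of_nat k)) *s (f ^^ k) x - of_nat (Suc k) *s (f ^^ k) y \<in> U"
proof -
  have fV': "(f ^^ k) x \<in> V" for k by (induction k) (auto intro: fV x)
  show H: "h ((f ^^ k) x) - (l - 2 * of_nat k) *s (f ^^ k) x - (f ^^ k) y \<in> U" for k
  proof (induction k)
    case (Suc k)
    let ?x = "(f ^^ k) x" and ?y = "(f ^^ k) y"
    have "h (f ?x) - (l - 2 * of_nat (Suc k)) *s f ?x - f ?y
      = (h (f ?x) - f (h ?x) + 2 *s f ?x) + f (h ?x - (l - 2 * of_nat k) *s ?x - ?y)"
      by (simp add: f_lin scale_distrib)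
    moreover have "h (f ?x) - f (h ?x) + 2 *s f ?x \<in> U" using hf fV' by blast
    moreover have "f (h ?x - (l - 2 * of_nat k) *s ?x - ?y) \<in> U" using Suc fU by blast
    ultimately show ?case using U by (simp only: funpow.simps o_apply subspace_add)
  qed (use hx in auto)
  show "e ((f ^^ Suc k) x) - (of_nat (Suc k) * (l - of_nat k)) *s (f ^^ k) x - of_nat (Suc k) *s (f ^^ k) y \<in> U"
  proof (induction k)
    case 0
    have *: "e (f x) - l *s x - y = (e (f x) - f (e x) - h x) + f (e x) + (h x - l *s x - y)" by simp
    have "e (f x) - l *s x - y \<in> U"
      unfolding * by (intro subspace_add U ef[OF x(1)] fU[OF x(2)] hx)
    then show ?case by simp
  next
    case (Suc k)
    let ?x = "(f ^^ k) x" and ?y = "(f ^^ k) y"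
    define c where "c = of_nat (Suc k) * (l - of_nat k)"
    have c: "of_nat (Suc (Suc k)) * (l - of_nat (Suc k)) = c + (l - 2 * of_nat (Suc k))"
      by (simp add: c_def algebra_simps)
    have c': "of_nat (Suc (Suc k)) = of_nat (Suc k) + (1::complex)" by simp
    have "e (f (f ?x)) - (c + (l - 2 * of_nat (Suc k))) *s f ?x - (of_nat (Suc k) + 1) *s f ?y
       = (e (f (f ?x)) - f (e (f ?x)) - h (f ?x)) + f (e (f ?x) - c *s ?x - of_nat (Suc k) *s ?y)
        + (h (f ?x) - (l - 2 * of_nat (Suc k)) *s f ?x - f ?y)"
      by (simp only: f_lin scale_distrib scale_one) (simp add: algebra_simps)
    moreover have "e (f (f ?x)) - f (e (f ?x)) - h (f ?x) \<in> U" using ef fV' fV by blast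
    moreover have "f (e (f ?x) - c *s ?x - of_nat (Suc k) *s ?y) \<in> U" using Suc fU by (simp add: c_def)
    moreover have "h (f ?x) - (l - 2 * of_nat (Suc k)) *s f ?x - f ?y \<in> U" using H[of "Suc k"] by simp
    ultimately show ?case unfolding c unfolding c' using U by (simp only: funpow.simps o_apply subspace_add)
  qed
qed

lemma ker_e_h:
  assumes "x \<in> V" "e x \<in> U"
  shows "e (h x) \<in> U"
proof -
  have "e (h x) = h (e x) - 2 *s e x - (h (e x) - e (h x) - 2 *s e x)" by simp
  then show ?thesis using assms he hU U by (metis subspace_diff subspace_scale)
qed

text \<open>
  If \<open>y\<close> were nonzero, it would be a highest weight vector, so \<open>l\<close> is the number \<open>j\<close> for which
  \<open>(f ^^ j) y\<close> is the last nonzero power. Then \<open>t = (f ^^ (j + 1)) x\<close> is a weight vector of weight \<open>- j - 2\<close>,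
  and \<open>e t\<close> is a nonzero multiple of \<open>(f ^^ j) y\<close>, which is killed by \<open>f\<close>. By \<open>highest_weight\<close> the weight of
  \<open>t\<close> is not negative, a contradiction.
\<close>

lemma no_jordan_block:
  assumes x: "x \<in> V" "e x \<in> U" and hx: "h x - l *s x - y \<in> U" and y: "y \<in> wt l"
  shows "y \<in> U"
proof (rule ccontr)
  assume yU: "y \<notin> U"
  have "e y = e (h x) - l *s e x - e (h x - l *s x - y)" by (simp add: e_lin)
  then have ey: "e y \<in> U" using ker_e_h[OF x] x eU[OF hx] U by (simp add: subspace_diff subspace_scale)
  interpret s: sl2_module_mod "(*s)" V U f e "\<lambda>v. - h v" by (rule swapped)
  have ys: "y \<in> s.wt (- l)" using y swapped_wt by simp
  obtain j where fy: "(f ^^ j) y \<notin> U" "(f ^^ Suc j) y \<in> U" using s.e_pow_last[OF ys yU] .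
  have "(of_nat (Suc j) * (- l + of_nat j)) *s (f ^^ j) y \<in> U"
    by (rule memU_minus[OF s.f_e_pow[OF ys fU[OF ey], of j] eU[OF fy(2)]]) simp
  then have "of_nat (Suc j) * (- l + of_nat j) = 0" using fy(1) subspace_scale_iff[OF U] by blast
  then have "- l + of_nat j = 0" by (metis mult_eq_0_iff of_nat_neq_0)
  then have j: "l = of_nat j" by simp
  define t where "t = (f ^^ Suc j) x"
  have et: "e t - of_nat (Suc j) *s (f ^^ j) y \<in> U"
    using e_f_pow_jordan(2)[OF x hx y, of j] by (simp add: t_def j)
  have "h t - (l - 2 * of_nat (Suc j)) *s t - (f ^^ Suc j) y \<in> U"
    using e_f_pow_jordan(1)[OF x hx y, of "Suc j"] by (simp add: t_def)
  then have "h t - (l - 2 * of_nat (Suc j)) *s t \<in> U" using fy(2) memU_trans by blast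
  moreover have "t \<in> V" unfolding t_def by (rule s.e_pow_V[OF x(1)])
  ultimately have tw: "t \<in> wt (l - 2 * of_nat (Suc j))" by (simp add: wt_def)
  have etU: "e t \<notin> U"
  proof
    assume "e t \<in> U"
    then have "of_nat (Suc j) *s (f ^^ j) y \<in> U" by (rule memU_minus[OF _ et]) auto
    then show False using fy(1) subspace_scale_iff[OF U] by (metis of_nat_neq_0)
  qed
  have "f (e t) - of_nat (Suc j) *s (f ^^ Suc j) y \<in> U" using fU[OF et] by (simp add: f_lin)
  then have "f (e t) \<in> U" using fy(2) U memU_trans subspace_scale by blast
  moreover have "t \<notin> U" using etU eU by blast
  ultimately obtain k :: nat where "l - 2 * of_nat (Suc j) = of_nat k" using highest_weight[OF tw] by blast
  then have "of_nat (Suc (Suc j) + k) = (0::complex)"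
    by (simp add: j algebra_simps neg_eq_iff_add_eq_0)
  then show False by (metis add_Suc of_nat_neq_0)
qed

text \<open>
  If the sum \<open>D\<close> of the weight spaces were different from \<open>V\<close>, there would be a highest weight vector \<open>v\<close> of
  \<open>V / D\<close>, of some weight \<open>l\<close>. A
  correction of \<open>v\<close> by an element of \<open>D\<close> achieves \<open>e v = 0\<close>; a second one makes \<open>h v - l v\<close> a weight vector
  of weight \<open>l\<close>. The last vector is zero by \<open>no_jordan_block\<close>, so that \<open>v\<close> belongs to \<open>D\<close>.
\<close>

theorem wts_sum_eq: "wts_sum = V"
proof (rule ccontr)
  assume "wts_sum \<noteq> V"
  then obtain v0 where v0: "v0 \<in> V" "v0 \<notin> wts_sum" using wts_sum_V by blast
  let ?D = wts_sum
  have UD: "U \<subseteq> ?D" using U_wt[of 0] wt_wts_sum by blast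
  interpret Q: sl2_module_mod "(*s)" V ?D e f h
    by unfold_locales (use V subspace_wts_sum wts_sum_V e f h eV fV hV stable_wts_sum ef he hf UD
        fin_dim fin_dim_mod_mono[OF fin_dim order_refl UD] in \<open>auto simp: module_hom.add module_hom.scale\<close>)
  obtain w z where w: "w \<in> V" "w \<notin> ?D" "h w - z *s w \<in> ?D"
    using eigenvector_mod_exists[OF h V _ subspace_wts_sum Q.fin_dim v0] hV by blast
  then have "w \<in> Q.wt z" by (simp add: Q.wt_def)
  then obtain j where j: "(e ^^ j) w \<notin> ?D" "(e ^^ Suc j) w \<in> ?D" using Q.e_pow_last w(2) by blast
  define v where "v = (e ^^ j) w"
  define l where "l = z + 2 * of_nat j"
  have v: "v \<in> Q.wt l" "v \<notin> ?D" "e v \<in> ?D"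
    using j Q.e_pow_wt[OF \<open>w \<in> Q.wt z\<close>, of j] by (auto simp: v_def l_def)
  have vV: "v \<in> V" using Q.wt_V v(1) .
  obtain k :: nat where k: "l = of_nat k" using Q.highest_weight[OF v(1,2) Q.fU[OF v(3)]] by blast
  obtain L x where x: "finite L" "\<forall>m. x m \<in> wt m" "\<forall>m. m \<notin> L \<longrightarrow> x m = 0" "e v = (\<Sum>m\<in>L. x m)"
    using wts_sum_decompose[OF v(3)] by blast
  have qD: "h v - l *s v \<in> ?D" using v(1) by (simp add: Q.wt_def)
  obtain M y where y: "finite M" "\<forall>m. y m \<in> wt m" "\<forall>m. m \<notin> M \<longrightarrow> y m = 0" "h v - l *s v = (\<Sum>m\<in>M. y m)"
    using wts_sum_decompose[OF qD] by blast
  define K where "K = L \<union> (\<lambda>m. m + 2) ` M"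
  have K: "finite K" using x y by (simp add: K_def)
  have sx: "e v = (\<Sum>m\<in>K. x m)" unfolding x(4) using x K by (intro sum.mono_neutral_left) (auto simp: K_def)
  have sy: "e (h v - l *s v) = (\<Sum>m\<in>K. e (y (m - 2)))"
  proof -
    have "e (h v - l *s v) = (\<Sum>m\<in>M. e (y m))" unfolding y(4) by (simp add: e_lin)
    also have "\<dots> = (\<Sum>m\<in>(\<lambda>m. m + 2) ` M. e (y (m - 2)))"
      by (subst sum.reindex) (auto simp: inj_on_def)
    also have "\<dots> = (\<Sum>m\<in>K. e (y (m - 2)))"
    proof (intro sum.mono_neutral_left ballI)
      fix m assume m: "m \<in> K - (\<lambda>m. m + 2) ` M"
      then have "m - 2 \<notin> M" by (metis DiffD2 diff_add_cancel image_eqI)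
      then show "e (y (m - 2)) = 0" using y(3) by (simp add: module_hom.zero[OF e])
    qed (use K in \<open>auto simp: K_def\<close>)
    finally show ?thesis .
  qed
  have comp: "(m - (l + 2)) *s x m - e (y (m - 2)) \<in> U" if "m \<in> K" for m
  proof -
    have "(\<Sum>m\<in>K. (m - (l + 2)) *s x m - e (y (m - 2))) \<in> U"
    proof -
      have "h (x m) - m *s x m \<in> U" for m using x(2) by (auto simp: wt_def)
      then have 1: "(\<Sum>m\<in>K. h (x m) - m *s x m) \<in> U" using U by (intro subspace_sum) auto
      have 2: "h (e v) - e (h v) - 2 *s e v \<in> U" using he vV .
      have "(\<Sum>m\<in>K. (m - (l + 2)) *s x m - e (y (m - 2)))
        = (h (e v) - (\<Sum>m\<in>K. h (x m) - m *s x m)) - (l + 2) *s e v - e (h v - l *s v)"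
        unfolding sy unfolding sx
        by (simp add: h_lin sum_subtractf scale_distrib scale_sum_right)
      also have "\<dots> = (h (e v) - e (h v) - 2 *s e v) - (\<Sum>m\<in>K. h (x m) - m *s x m)"
        by (simp add: e_lin scale_distrib)
      finally show ?thesis using 1 2 U by (simp add: subspace_diff)
    qed
    moreover have "(m - (l + 2)) *s x m - e (y (m - 2)) \<in> wt m" for m
      using x(2) y(2) e_wt[of "y (m - 2)" "m - 2"] subspace_wt[of m] by (auto intro!: subspace_diff subspace_scale)
    ultimately show ?thesis using wt_components[OF K, of "\<lambda>m. (m - (l + 2)) *s x m - e (y (m - 2))"] that by blast
  qed
  \<comment> \<open>All components of \<open>e v\<close> lie in \<open>e D\<close>: in weight \<open>l + 2\<close>, which is positive, by \<open>ef_surj_mod\<close>; in the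
    other weights by comparison with \<open>e (h v - l v)\<close>.\<close>
  have "\<exists>d\<in>?D. x m - e d \<in> U" if m: "m \<in> K" for m
  proof (cases "m = l + 2")
    case True
    have "Re m > 0" using True k by simp
    then obtain w where "w \<in> wt m" "x m - e (f w) \<in> U" using ef_surj_mod[of "x m" m] x(2) by blast
    then show ?thesis using f_wt wt_wts_sum by blast
  next
    case False
    define c where "c = inverse (m - (l + 2))"
    have c: "c \<noteq> 0" "c * (m - (l + 2)) = 1" using False by (auto simp: c_def)
    have "c *s ((m - (l + 2)) *s x m - e (y (m - 2))) = x m - e (c *s y (m - 2))"
      by (simp only: scale_right_diff_distrib scale_scale c e_lin scale_one)
    then have "x m - e (c *s y (m - 2)) \<in> U" using comp[OF m] U by (metis subspace_scale)
    moreover have "c *s y (m - 2) \<in> ?D" using y(2) wt_wts_sum subspace_wts_sum subspace_scale by blast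
    ultimately show ?thesis by blast
  qed
  then obtain d where d: "\<And>m. m \<in> K \<Longrightarrow> d m \<in> ?D \<and> x m - e (d m) \<in> U" by metis
  define x1 where "x1 = v - (\<Sum>m\<in>K. d m)"
  have dD: "(\<Sum>m\<in>K. d m) \<in> ?D" using d subspace_wts_sum by (auto intro: subspace_sum)
  have x1D: "x1 \<notin> ?D" using v(2) dD subspace_wts_sum unfolding x1_def
    by (metis add.commute diff_add_cancel subspace_add)
  have x1V: "x1 \<in> V" using vV dD wts_sum_V V by (auto simp: x1_def subspace_diff)
  have ex1: "e x1 \<in> U"
  proof -
    have "e x1 = (\<Sum>m\<in>K. x m - e (d m))" by (simp add: x1_def e_lin sx sum_subtractf)
    then show ?thesis using d U by (auto intro: subspace_sum)
  qed
  have "h x1 - l *s x1 = (h v - l *s v) - (h (\<Sum>m\<in>K. d m) - l *s (\<Sum>m\<in>K. d m))"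
    by (simp add: x1_def h_lin scale_distrib)
  then have "h x1 - l *s x1 \<in> ?D" using qD dD stable_wts_sum subspace_wts_sum
    by (auto intro!: subspace_diff subspace_scale)
  then obtain N u where u: "finite N" "\<forall>m. u m \<in> wt m" "\<forall>m. m \<notin> N \<longrightarrow> u m = 0" "h x1 - l *s x1 = (\<Sum>m\<in>N. u m)"
    using wts_sum_decompose by blast
  \<comment> \<open>On the components of weight different from \<open>l\<close> the operator \<open>h - l\<close> is invertible.\<close>
  define z1 where "z1 = (\<Sum>m\<in>N - {l}. inverse (m - l) *s u m)"
  have z1D: "z1 \<in> ?D" unfolding z1_def
    using u(2) wt_wts_sum subspace_wts_sum by (auto intro!: subspace_sum subspace_scale)
  define x2 where "x2 = x1 - z1"
  have hx2: "h x2 - l *s x2 - u l \<in> U"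
  proof -
    have "(\<Sum>m\<in>N - {l}. h (inverse (m - l) *s u m) - l *s (inverse (m - l) *s u m) - u m) \<in> U"
    proof (rule subspace_sum[OF U])
      fix m assume m: "m \<in> N - {l}"
      have "u m = inverse (m - l) *s (m - l) *s u m" using m by simp
      then have "h (inverse (m - l) *s u m) - l *s (inverse (m - l) *s u m) - u m
        = h (inverse (m - l) *s u m) - l *s (inverse (m - l) *s u m) - inverse (m - l) *s (m - l) *s u m"
        by simp
      also have "\<dots> = inverse (m - l) *s (h (u m) - l *s u m - (m - l) *s u m)"
        by (simp only: h_lin scale_right_diff_distrib scale_scale mult.commute)
      also have "h (u m) - l *s u m - (m - l) *s u m = h (u m) - m *s u m" by (simp add: scale_distrib)
      finally show "h (inverse (m - l) *s u m) - l *s (inverse (m - l) *s u m) - u m \<in> U"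
        using u(2) U by (auto simp: wt_def subspace_scale)
    qed
    moreover have "(\<Sum>m\<in>N. u m) = u l + (\<Sum>m\<in>N - {l}. u m)"
      using u by (cases "l \<in> N") (auto simp: sum.remove)
    ultimately have "h z1 - l *s z1 - ((h x1 - l *s x1) - u l) \<in> U"
      unfolding u(4) z1_def by (simp add: h_lin sum_subtractf scale_sum_right)
    moreover have "h x2 - l *s x2 - u l = - (h z1 - l *s z1 - ((h x1 - l *s x1) - u l))"
      by (simp add: x2_def h_lin scale_distrib)
    ultimately show ?thesis using U by (metis subspace_neg)
  qed
  have "(\<Sum>m\<in>N. e (u m)) \<in> U"
  proof -
    have "(\<Sum>m\<in>N. e (u m)) = e (h x1) - l *s e x1"
      by (simp add: e_lin(4)[symmetric] u(4)[symmetric] e_lin(2,3))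
    then show ?thesis using ker_e_h[OF x1V ex1] ex1 U by (simp add: subspace_diff subspace_scale)
  qed
  then have eu: "\<forall>m\<in>N. e (u m) \<in> U"
    using e_wt[OF u(2)[rule_format]] u(1) hU
    by (intro eigenvectors_mod_independent_family[OF h U, of N "\<lambda>m. m + 2"]) (auto simp: wt_def inj_on_def)
  have "e z1 \<in> U" unfolding z1_def using eu U by (auto simp: e_lin intro!: subspace_sum subspace_scale)
  then have ex2: "e x2 \<in> U" using ex1 U by (simp add: x2_def e_lin subspace_diff)
  have x2V: "x2 \<in> V" using x1V z1D wts_sum_V V by (auto simp: x2_def subspace_diff)
  have "u l \<in> U" using no_jordan_block[OF x2V ex2 hx2] u(2) by blast
  then have "h x2 - l *s x2 \<in> U" using hx2 memU_trans by blast
  then have "x2 \<in> ?D" using x2V wt_wts_sum by (auto simp: wt_def)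
  then have "x2 + z1 \<in> ?D" using z1D subspace_wts_sum by (simp add: subspace_add)
  then show False using x1D by (simp add: x2_def)
qed

end

context sl2_module_mod
begin

text \<open>
  The operator \<open>h - 2\<close> is invertible on all weight spaces other than that of weight 2, and on this one \<open>e \<circ> f\<close>
  is surjective. This and the following lemmas solve the linear equations that arise when the relations of
  \<open>sl\<^sub>2\<close> are lifted through an extension by \<open>V / U\<close>.
\<close>

lemma hE_decompose:
  assumes "v \<in> V"
  shows "\<exists>w\<in>V. \<exists>u\<in>V. v - (h w - 2 *s w) - e u \<in> U"
proof -
  let ?S = "{v. \<exists>w\<in>V. \<exists>u\<in>V. v - (h w - 2 *s w) - e u \<in> U}"
  have sS: "subspace ?S"
  proof (rule subspaceI)
    show "0 \<in> ?S" using V U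
      by (intro CollectI bexI[of _ 0]) (auto simp: subspace_0 module_hom.zero[OF h] module_hom.zero[OF e])
  next
    fix a b assume "a \<in> ?S" "b \<in> ?S"
    then obtain w u w' u' where *: "w \<in> V" "u \<in> V" "a - (h w - 2 *s w) - e u \<in> U"
      "w' \<in> V" "u' \<in> V" "b - (h w' - 2 *s w') - e u' \<in> U" by auto
    have "(a + b) - (h (w + w') - 2 *s (w + w')) - e (u + u') \<in> U"
      by (rule memU_plus[OF *(3,6)]) (simp add: h_lin e_lin scale_distrib)
    then show "a + b \<in> ?S" using * V by (blast intro: subspace_add)
  next
    fix c a assume "a \<in> ?S"
    then obtain w u where *: "w \<in> V" "u \<in> V" "a - (h w - 2 *s w) - e u \<in> U" by auto
    have "c *s (a - (h w - 2 *s w) - e u) = c *s a - (h (c *s w) - 2 *s (c *s w)) - e (c *s u)"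
      by (simp add: h_lin e_lin scale_right_diff_distrib mult.commute)
    then have "c *s a - (h (c *s w) - 2 *s (c *s w)) - e (c *s u) \<in> U"
      using *(3) U by (metis subspace_scale)
    then show "c *s a \<in> ?S" using * V by (blast intro: subspace_scale)
  qed
  have V0: "0 \<in> V" using V by (rule subspace_0)
  have "wt l \<subseteq> ?S" for l
  proof
    fix v assume v: "v \<in> wt l"
    show "v \<in> ?S"
    proof (cases "l = 2")
      case True
      obtain w where w: "w \<in> wt l" "v - e (f w) \<in> U" using ef_surj_mod[OF v] True by auto
      have "v - (h 0 - 2 *s 0) - e (f w) \<in> U" using w by (simp add: module_hom.zero[OF h])
      then show ?thesis using V0 fV wt_V w by blast
    next
      case False
      define c where "c = inverse (l - 2)"
      have "v = c *s ((l - 2) *s v)" using False by (simp add: c_def)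
      then have "v - (h (c *s v) - 2 *s (c *s v)) - e 0 = c *s ((l - 2) *s v) - (h (c *s v) - 2 *s (c *s v))"
        by (simp add: module_hom.zero[OF e])
      also have "\<dots> = (- c) *s (h v - l *s v)"
        by (simp add: h_lin scale_right_diff_distrib scale_left_diff_distrib left_diff_distrib right_diff_distrib mult.commute)
      finally have "v - (h (c *s v) - 2 *s (c *s v)) - e 0 \<in> U"
        using v U by (simp only: wt_def mem_Collect_eq subspace_scale)
      then show ?thesis using V0 subspace_scale[OF V wt_V[OF v]] by blast
    qed
  qed
  then have "wts_sum \<subseteq> ?S" unfolding wts_sum_def using sS by (intro span_minimal) auto
  then show ?thesis using assms wts_sum_eq by auto
qed

lemma h_plus_2_decompose:
  assumes "v \<in> V"
  shows "\<exists>w\<in>V. \<exists>n\<in>wt (- 2). v - (h w + 2 *s w) - n \<in> U"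
proof -
  let ?S = "{v. \<exists>w\<in>V. \<exists>n\<in>wt (- 2). v - (h w + 2 *s w) - n \<in> U}"
  have sS: "subspace ?S"
  proof (rule subspaceI)
    show "0 \<in> ?S" using V U subspace_wt
      by (intro CollectI bexI[of _ 0]) (auto simp: subspace_0 module_hom.zero[OF h])
  next
    fix a b assume "a \<in> ?S" "b \<in> ?S"
    then obtain w u w' u' where *: "w \<in> V" "u \<in> wt (- 2)" "a - (h w + 2 *s w) - u \<in> U"
      "w' \<in> V" "u' \<in> wt (- 2)" "b - (h w' + 2 *s w') - u' \<in> U" by auto
    have "(a + b) - (h (w + w') + 2 *s (w + w')) - (u + u') \<in> U"
      by (rule memU_plus[OF *(3,6)]) (simp add: h_lin scale_distrib)
    then show "a + b \<in> ?S" using * V subspace_wt by (blast intro: subspace_add)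
  next
    fix c a assume "a \<in> ?S"
    then obtain w u where *: "w \<in> V" "u \<in> wt (- 2)" "a - (h w + 2 *s w) - u \<in> U" by auto
    have "c *s (a - (h w + 2 *s w) - u) = c *s a - (h (c *s w) + 2 *s (c *s w)) - c *s u"
      by (simp add: h_lin scale_right_diff_distrib scale_right_distrib mult.commute)
    then have "c *s a - (h (c *s w) + 2 *s (c *s w)) - c *s u \<in> U"
      using *(3) U by (metis subspace_scale)
    then show "c *s a \<in> ?S" using * V subspace_wt by (blast intro: subspace_scale)
  qed
  have V0: "0 \<in> V" using V by (rule subspace_0)
  have "wt l \<subseteq> ?S" for l
  proof
    fix v assume v: "v \<in> wt l"
    show "v \<in> ?S"
    proof (cases "l = - 2")
      case True
      have "v - (h 0 + 2 *s 0) - v \<in> U" using U by (simp add: module_hom.zero[OF h] subspace_0)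
      then show ?thesis using V0 v True by blast
    next
      case False
      define c where "c = inverse (l + 2)"
      have "l + 2 \<noteq> 0" using False by (simp add: add_eq_0_iff2)
      then have "v = c *s ((l + 2) *s v)" by (simp add: c_def)
      then have "v - (h (c *s v) + 2 *s (c *s v)) - 0 = c *s ((l + 2) *s v) - (h (c *s v) + 2 *s (c *s v))"
        by simp
      also have "\<dots> = (- c) *s (h v - l *s v)"
        by (simp add: h_lin scale_right_diff_distrib scale_right_distrib scale_left_distrib distrib_left mult.commute)
      finally have "v - (h (c *s v) + 2 *s (c *s v)) - 0 \<in> U"
        using v U by (simp only: wt_def mem_Collect_eq subspace_scale)
      moreover have "0 \<in> wt (- 2)" using subspace_wt subspace_0 by blast
      ultimately show ?thesis using subspace_scale[OF V wt_V[OF v]] by blast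
    qed
  qed
  then have "wts_sum \<subseteq> ?S" unfolding wts_sum_def using sS by (intro span_minimal) auto
  then show ?thesis using assms wts_sum_eq by auto
qed

lemma h_image_meets_weight_zero:
  assumes v: "v \<in> V" and n: "n \<in> wt (- 2)" and hv: "h v - e n \<in> U"
  shows "n \<in> U" "v \<in> wt 0"
proof -
  obtain L x where x: "finite L" "\<forall>m. x m \<in> wt m" "\<forall>m. m \<notin> L \<longrightarrow> x m = 0" "v = (\<Sum>m\<in>L. x m)"
    using wts_sum_decompose[of v] v wts_sum_eq by blast
  define K where "K = insert 0 L"
  have K: "finite K" "v = (\<Sum>m\<in>K. x m)" using x by (auto simp: K_def sum.insert_if)
  define y where "y m = m *s x m - (if m = 0 then e n else 0)" for m
  have en: "e n \<in> wt 0" using e_wt[OF n] by simp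
  have y: "y m \<in> wt m" for m using x(2) subspace_wt[of m] en
    by (auto simp: y_def intro!: subspace_diff subspace_scale subspace_0 subspace_neg)
  have "(\<Sum>m\<in>K. y m) = (h v - e n) - (\<Sum>m\<in>K. h (x m) - m *s x m)"
    unfolding K(2) using K(1) by (simp add: y_def h_lin sum_subtractf K_def sum.insert_if)
  moreover have "(\<Sum>m\<in>K. h (x m) - m *s x m) \<in> U" using x(2) U by (auto intro: subspace_sum simp: wt_def)
  ultimately have "(\<Sum>m\<in>K. y m) \<in> U" using hv U by (simp add: subspace_diff)
  then have "y 0 \<in> U" using wt_components[OF K(1), of y] y by (auto simp: K_def)
  then have enU: "e n \<in> U" using subspace_neg[OF U, of "y 0"] by (simp add: y_def)
  then show "n \<in> U" using e_inj_mod[OF n] by simp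
  show "v \<in> wt 0" using memU_trans[OF hv enU] v by (simp add: wt_def)
qed

lemma weight_zero_split:
  assumes z: "z \<in> wt 0"
  shows "\<exists>w\<in>wt 2. e (z - f w) \<in> U \<and> f (z - f w) \<in> U"
proof -
  have "e z \<in> wt 2" using e_wt[OF z] by simp
  then obtain w where w: "w \<in> wt 2" "e z - e (f w) \<in> U" using ef_surj_mod[of "e z" 2] by auto
  define u where "u = z - f w"
  have u: "u \<in> wt 0" using z f_wt[OF w(1)] subspace_wt[of 0] by (auto simp: u_def intro: subspace_diff)
  have eu: "e u \<in> U" using w(2) by (simp add: u_def e_lin)
  have "h u \<in> U" using u by (simp add: wt_def)
  have "e (f u) = (e (f u) - f (e u) - h u) + f (e u) + h u" by simp
  also have "\<dots> \<in> U" by (intro subspace_add U ef wt_V[OF u] fU eu \<open>h u \<in> U\<close>)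
  finally have "f u \<in> U" using e_inj_mod[OF f_wt[OF u]] by simp
  then show ?thesis using w(1) eu by (auto simp: u_def)
qed

end

section \<open>Lie algebras and common eigenvectors\<close>

text \<open>
  Lie algebras are subspaces of a type with a total bracket, so that bilinearity holds without side conditions.
\<close>

locale lie_bracket = complex_vector_space scale
  for scale :: "complex \<Rightarrow> 'b::ab_group_add \<Rightarrow> 'b"  (infixr \<open>*s\<close> 75) +
  fixes br :: "'b \<Rightarrow> 'b \<Rightarrow> 'b"
  assumes br_left: "endo (\<lambda>x. br x y)" and br_right: "endo (br x)"
    and br_self: "br x x = 0"
    and jacobi: "br x (br y z) = br (br x y) z + br y (br x z)"
begin

lemmas brl = module_hom.add[OF br_left] module_hom.diff[OF br_left] module_hom.scale[OF br_left]
  module_hom.neg[OF br_left] module_hom.zero[OF br_left]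
lemmas brr = module_hom.add[OF br_right] module_hom.diff[OF br_right] module_hom.scale[OF br_right]
  module_hom.neg[OF br_right] module_hom.zero[OF br_right]
lemmas sc_distrib = scale_right_distrib scale_left_distrib scale_right_diff_distrib
  scale_left_diff_distrib scale_minus_left scale_minus_right

lemma br_skew: "br x y = - br y x"
proof -
  have "br (x + y) (x + y) = (br x x + br y y) + (br x y + br y x)" by (simp add: brl brr)
  then have "br x y + br y x = 0" by (simp only: br_self) simp
  then show ?thesis by (simp add: eq_neg_iff_add_eq_0)
qed

definition subalg :: "'b set \<Rightarrow> bool"
  where "subalg g \<longleftrightarrow> subspace g \<and> (\<forall>x\<in>g. \<forall>y\<in>g. br x y \<in> g)"

definition der :: "'b set \<Rightarrow> 'b set"
  where "der g = span {br x y | x y. x \<in> g \<and> y \<in> g}"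

definition solv :: "'b set \<Rightarrow> bool"
  where "solv g \<longleftrightarrow> (\<exists>k. (der ^^ k) g \<subseteq> {0})"

lemma br_der: "x \<in> g \<Longrightarrow> y \<in> g \<Longrightarrow> br x y \<in> der g"
  unfolding der_def by (blast intro: span_base)

lemma subspace_der: "subspace (der g)"
  unfolding der_def by (rule subspace_span)

lemma der_minimal: "(\<And>x y. x \<in> g \<Longrightarrow> y \<in> g \<Longrightarrow> br x y \<in> W) \<Longrightarrow> subspace W \<Longrightarrow> der g \<subseteq> W"
  unfolding der_def by (intro span_minimal) auto

lemma der_mono: "g \<subseteq> g' \<Longrightarrow> der g \<subseteq> der g'"
  unfolding der_def by (intro span_mono) auto

lemma der_pow_mono: "g \<subseteq> g' \<Longrightarrow> (der ^^ k) g \<subseteq> (der ^^ k) g'"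
  by (induction k) (auto dest: der_mono)

lemma solv_subset: "solv g \<Longrightarrow> g' \<subseteq> g \<Longrightarrow> solv g'"
  unfolding solv_def using der_pow_mono by blast

lemma solv_extend:
  assumes "(der ^^ k) g \<subseteq> r" "solv r"
  shows "solv g"
proof -
  obtain j where "(der ^^ j) r \<subseteq> {0}" using assms(2) by (auto simp: solv_def)
  moreover have "(der ^^ (j + k)) g \<subseteq> (der ^^ j) r"
    using der_pow_mono[OF assms(1)] by (simp add: funpow_add)
  ultimately show ?thesis unfolding solv_def by blast
qed

lemma solv_der_neq:
  assumes "solv g" "\<not> g \<subseteq> {0}"
  shows "der g \<noteq> g"
proof
  assume "der g = g"
  then have "(der ^^ k) g = g" for k by (induction k) auto
  then show False using assms by (auto simp: solv_def)
qed

lemma der_subset: "subalg g \<Longrightarrow> der g \<subseteq> g"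
  by (rule der_minimal) (auto simp: subalg_def)

lemma dim_strict_mono:
  assumes "V \<subseteq> W" "V \<noteq> W" "subspace V" "finite Y" "W \<subseteq> span Y"
  shows "dim V < dim W"
proof -
  obtain B where B: "B \<subseteq> V" "independent B" "V \<subseteq> span B" "card B = dim V" by (rule basis_exists)
  obtain B' where B': "B \<subseteq> B'" "B' \<subseteq> W" "independent B'" "W \<subseteq> span B'"
    using maximal_independent_subset_extend[of B W] B assms(1) by blast
  have fin: "finite B'" using independent_span_bound[OF assms(4) B'(3)] B'(2) assms(5) by blast
  have "B \<noteq> B'"
  proof
    assume "B = B'"
    moreover have "span B \<subseteq> V" using B(1) assms(3) by (rule span_minimal)
    ultimately show False using B'(4) assms(1,2) by blast
  qed
  then have "card B < card B'" using B'(1) fin by (simp add: psubset_card_mono psubsetI)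
  then show ?thesis using B(4) basis_card_eq_dim[OF B'(2,4,3)] by simp
qed

text \<open>
  The inductive step for common eigenvectors of a solvable algebra, here for the action of \<open>b\<close> on \<open>g / b\<close>. The
  joint eigenspace \<open>K\<close> of \<open>c\<close> for the weight \<open>l\<close> is stable under \<open>z\<close> as soon as \<open>l\<close> vanishes on brackets
  \<open>[y, z]\<close>, and then it contains an eigenvector of \<open>z\<close>.
\<close>

lemma lie_weight_extend:
  assumes g: "subspace g" "finite Y" "g \<subseteq> span Y" and b: "subspace b" "b \<subseteq> g"
    and gb: "\<And>y v. y \<in> b \<Longrightarrow> v \<in> g \<Longrightarrow> br y v \<in> g" and bb: "\<And>y v. y \<in> b \<Longrightarrow> v \<in> b \<Longrightarrow> br y v \<in> b"
    and c: "c \<subseteq> b" and z: "z \<in> b" and cz: "\<And>y. y \<in> c \<Longrightarrow> br y z \<in> c"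
    and x0: "x0 \<in> g - b" and l: "\<And>y. y \<in> c \<Longrightarrow> br y x0 - l y *s x0 \<in> b"
  shows "\<exists>x\<in>g - b. (\<forall>y\<in>c. br y x - l y *s x \<in> b) \<and> (\<exists>m. br z x - m *s x \<in> b)"
proof -
  define K where "K = {v \<in> g. \<forall>y\<in>c. br y v - l y *s v \<in> b}"
  have fd: "fin_dim_mod V U" if "V \<subseteq> g" for V U
    unfolding fin_dim_mod_def using g that span_mono[of Y "Y \<union> U"] by blast
  have sK: "subspace K"
  proof (rule subspaceI)
    show "0 \<in> K" using g b by (auto simp: K_def subspace_0 brr)
  next
    fix u v assume uv: "u \<in> K" "v \<in> K"
    have "br y (u + v) - l y *s (u + v) \<in> b" if "y \<in> c" for y
    proof -
      have "br y (u + v) - l y *s (u + v) = (br y u - l y *s u) + (br y v - l y *s v)"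
        by (simp add: brr sc_distrib)
      then show ?thesis using uv that subspace_add[OF b(1)] by (auto simp: K_def)
    qed
    then show "u + v \<in> K" using uv g by (auto simp: K_def subspace_add)
  next
    fix t u assume u: "u \<in> K"
    have "br y (t *s u) - l y *s (t *s u) \<in> b" if "y \<in> c" for y
    proof -
      have "br y (t *s u) - l y *s (t *s u) = t *s (br y u - l y *s u)"
        by (simp add: brr sc_distrib mult.commute)
      then show ?thesis using u that subspace_scale[OF b(1)] by (auto simp: K_def)
    qed
    then show "t *s u \<in> K" using u g by (auto simp: K_def subspace_scale)
  qed
  have bK: "b \<subseteq> K" using b c bb by (auto simp: K_def subspace_diff subspace_scale)
  \<comment> \<open>Let \<open>u k\<close> be the result of applying \<open>z\<close> to \<open>v\<close> \<open>k\<close> times. By induction,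
    \<open>[y, u k] = l y * u k + k * l [y, z] * u (k - 1)\<close> modulo the span \<open>W (k - 1)\<close> of \<open>b\<close> and the \<open>u i\<close> with
    \<open>i < k - 1\<close>. At the first
    \<open>k\<close> for which \<open>u k\<close> depends on \<open>b\<close> and the earlier vectors, the second coefficient has to be zero.\<close>
  have trace: "l (br y z) = 0" if v: "v \<in> K" "v \<notin> b" and y: "y \<in> c" for v y
  proof -
    define u where "u k = (br z ^^ k) v" for k
    define W where "W k = span (u ` {..<k} \<union> b)" for k
    have sW: "subspace (W k)" for k unfolding W_def by (rule subspace_span)
    have bW: "b \<subseteq> W k" for k unfolding W_def by (auto intro: span_base)
    have uW: "u i \<in> W k" if "i < k" for i k unfolding W_def using that by (auto intro: span_base)
    have Wmono: "W i \<subseteq> W k" if "i \<le> k" for i k unfolding W_def using that by (intro span_mono) auto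
    have W0: "W 0 = b" using b by (simp add: W_def span_eq_iff)
    have zu: "br z (u i) = u (Suc i)" for i by (simp add: u_def)
    have zW: "br z w \<in> W k" if "w \<in> W (k - 1)" for w k
      by (rule endo_image_span[OF br_right that[unfolded W_def] _ sW])
        (use bb[OF z] bW zu uW in fastforce)
    have A: "br y (u k) - l y *s u k \<in> W k"
      if "br y (u k) - l y *s u k - (of_nat k * l (br y z)) *s u (k - 1) \<in> W (k - 1)" for y k
    proof (cases k)
      case 0
      then show ?thesis using that by simp
    next
      case (Suc j)
      have "(of_nat k * l (br y z)) *s u (k - 1) \<in> W k" using uW[of j k] sW Suc by (auto intro: subspace_scale)
      moreover have "W (k - 1) \<subseteq> W k" by (rule Wmono) simp
      ultimately have "(br y (u k) - l y *s u k - (of_nat k * l (br y z)) *s u (k - 1))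
          + (of_nat k * l (br y z)) *s u (k - 1) \<in> W k"
        using that sW by (blast intro: subspace_add)
      then show ?thesis by simp
    qed
    have C: "\<forall>y\<in>c. br y (u k) - l y *s u k - (of_nat k * l (br y z)) *s u (k - 1) \<in> W (k - 1)" for k
    proof (induction k)
      case 0
      then show ?case using v by (auto simp: u_def K_def W0)
    next
      case (Suc k)
      show ?case
      proof
        fix y assume y: "y \<in> c"
        let ?m = "l (br y z)"
        have 1: "br (br y z) (u k) - ?m *s u k \<in> W k"
          using A Suc cz[OF y] by blast
        have 2: "br z (br y (u k) - l y *s u k - (of_nat k * ?m) *s u (k - 1)) \<in> W k"
          using zW Suc y by blast
        have 3: "(of_nat k * ?m) *s br z (u (k - 1)) = (of_nat k * ?m) *s u k"
          by (cases k) (auto simp: zu)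
        have "br y (u (Suc k)) - l y *s u (Suc k) - (of_nat (Suc k) * ?m) *s u k
          = (br (br y z) (u k) - ?m *s u k) + br z (br y (u k) - l y *s u k - (of_nat k * ?m) *s u (k - 1))"
          unfolding brr 3 zu[symmetric] jacobi[of y z] by (simp add: sc_distrib distrib_right)
        also have "\<dots> \<in> W k" using 1 2 sW by (rule subspace_add[rotated])
        finally show "br y (u (Suc k)) - l y *s u (Suc k) - (of_nat (Suc k) * ?m) *s u (Suc k - 1) \<in> W (Suc k - 1)"
          by simp
      qed
    qed
    have "u i \<in> g" for i using v gb[OF z] by (induction i) (auto simp: u_def K_def)
    then obtain N t where "(\<Sum>i<N. t i *s u i) \<in> b" "\<exists>i<N. t i \<noteq> 0"
      by (rule fin_dim_mod_dependent[OF fd[OF order_refl] b(1)])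
    then have ex: "\<exists>n. u n \<in> W n"
    proof (induction N)
      case (Suc N)
      show ?case
      proof (cases "t N = 0")
        case True
        then show ?thesis using Suc by (auto simp: less_Suc_eq)
      next
        case False
        have "(\<Sum>i<N. t i *s u i) \<in> W N" using sW uW by (auto intro!: subspace_sum subspace_scale)
        moreover have "(\<Sum>i<Suc N. t i *s u i) \<in> W N" using Suc.prems(1) bW by blast
        ultimately have "(\<Sum>i<Suc N. t i *s u i) - (\<Sum>i<N. t i *s u i) \<in> W N"
          using sW by (blast intro: subspace_diff)
        then have "t N *s u N \<in> W N" by simp
        then show ?thesis using False subspace_scale_iff[OF sW] by blast
      qed
    qed simp
    define n where "n = (LEAST n. u n \<in> W n)"
    have n: "u n \<in> W n" unfolding n_def by (rule LeastI_ex[OF ex])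
    have "n \<noteq> 0" using n v W0 by (cases n) (auto simp: u_def)
    then obtain j where j: "n = Suc j" by (cases n) auto
    have uj: "u j \<notin> W j" using not_less_Least[of j "\<lambda>n. u n \<in> W n"] j n_def by auto
    have endoT: "endo (\<lambda>w. br y w - l y *s w)"
      by (rule endoI) (simp_all add: brr sc_distrib mult.commute)
    have "br y (u n) - l y *s u n \<in> W j"
    proof (rule endo_image_span[OF endoT n[unfolded W_def] _ sW])
      show "(\<lambda>w. br y w - l y *s w) ` (u ` {..<n} \<union> b) \<subseteq> W j"
      proof safe
        fix i assume "i < n"
        then have "br y (u i) - l y *s u i \<in> W i" using A C y by blast
        then show "br y (u i) - l y *s u i \<in> W j" using Wmono[of i j] j \<open>i < n\<close> by auto
      next
        fix w assume "w \<in> b"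
        then have "br y w - l y *s w \<in> b" using bb c y b by (blast intro: subspace_diff subspace_scale)
        then show "br y w - l y *s w \<in> W j" using bW by blast
      qed
    qed
    moreover have "br y (u n) - l y *s u n - (of_nat n * l (br y z)) *s u j \<in> W j"
      using C[of n] y j by simp
    ultimately have "(br y (u n) - l y *s u n) - (br y (u n) - l y *s u n - (of_nat n * l (br y z)) *s u j) \<in> W j"
      using sW by (blast intro: subspace_diff)
    then have "(of_nat n * l (br y z)) *s u j \<in> W j" by simp
    then have "of_nat n * l (br y z) = 0" using uj subspace_scale_iff[OF sW] by blast
    then show ?thesis using j by (metis mult_eq_0_iff of_nat_neq_0)
  qed
  have zK: "br z v \<in> K" if v: "v \<in> K" for v
  proof (cases "v \<in> b")
    case True
    then show ?thesis using bb z bK by blast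
  next
    case False
    have "br y (br z v) - l y *s br z v \<in> b" if y: "y \<in> c" for y
    proof -
      have "br (br y z) v - l (br y z) *s v \<in> b" using v cz y by (auto simp: K_def)
      then have 1: "br (br y z) v \<in> b" using trace[OF v False y] by simp
      have 2: "br z (br y v - l y *s v) \<in> b" using bb z v y by (auto simp: K_def)
      have "br y (br z v) - l y *s br z v = br (br y z) v + br z (br y v - l y *s v)"
        by (simp add: jacobi[of y z] brr)
      then show ?thesis using 1 2 b by (simp add: subspace_add)
    qed
    then show ?thesis using v gb z by (auto simp: K_def)
  qed
  have "x0 \<in> K" using x0 l by (auto simp: K_def)
  moreover have "fin_dim_mod K b" by (rule fd) (auto simp: K_def)
  moreover have "br z ` K \<subseteq> K" using zK by blast
  moreover have "x0 \<notin> b" using x0 by simp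
  ultimately obtain x m where x: "x \<in> K" "x \<notin> b" "br z x - m *s x \<in> b"
    using eigenvector_mod_exists[OF br_right[of z] sK _ b(1)] by metis
  then show ?thesis by (auto simp: K_def)
qed

text \<open>
  Common eigenvectors are constructed along a chain of subalgebras of \<open>b\<close>, each of codimension one in the next and
  containing its derived algebra.
\<close>

theorem lie_theorem:
  assumes g: "subalg g" "finite Y" "g \<subseteq> span Y" and b: "subalg b" "b \<subseteq> g" "b \<noteq> g" "solv b"
    and C: "finite C" "subalg (span C)" "span C \<subseteq> b"
  shows "\<exists>x\<in>g - b. \<forall>y\<in>span C. \<exists>l. br y x - l *s x \<in> b"
  using C
proof (induction "card C" arbitrary: C rule: less_induct)
  case less
  obtain x1 where x1: "x1 \<in> g - b" using b by blast
  have sb: "subspace b" using b by (simp add: subalg_def)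
  show ?case
  proof (cases "span C \<subseteq> {0}")
    case True
    have "br y x1 - 0 *s x1 \<in> b" if "y \<in> span C" for y
      using that True sb by (auto simp: brl subspace_0)
    then show ?thesis using x1 by blast
  next
    case False
    have "der (span C) \<noteq> span C"
      using solv_der_neq[OF _ False] solv_subset[OF b(4) less.prems(3)] by blast
    moreover have dC: "der (span C) \<subseteq> span C" using der_subset less.prems by blast
    ultimately have ps: "\<not> span C \<subseteq> der (span C)" by blast
    obtain B where B: "B \<subseteq> der (span C)" "independent B" "der (span C) \<subseteq> span B"
      by (rule maximal_independent_subset)
    obtain B' where B': "B \<subseteq> B'" "B' \<subseteq> span C" "independent B'" "span C \<subseteq> span B'"
      using maximal_independent_subset_extend[of B "span C"] B dC by blast
    have fB': "finite B'" "card B' \<le> card C"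
      using independent_span_bound[OF less.prems(1) B'(3,2)] by auto
    have "B \<noteq> B'" using ps B' B(1) subspace_der span_minimal by blast
    then obtain z where z: "z \<in> B'" "z \<notin> B" using B' by blast
    define D where "D = B' - {z}"
    have D: "finite D" "card D < card C"
      using fB' z card_Diff1_less[OF fB'(1) z(1)] by (auto simp: D_def)
    have derD: "der (span C) \<subseteq> span D"
      using B(3) B'(1) z span_mono[of B D] by (auto simp: D_def)
    have DC: "span D \<subseteq> span C" using B'(2) by (intro span_minimal) (auto simp: D_def)
    have "br x y \<in> span D" if "x \<in> span C" "y \<in> span C" for x y using br_der[OF that] derD by blast
    then have "subalg (span D)" using DC by (auto simp: subalg_def)
    then obtain x0 where x0: "x0 \<in> g - b" "\<forall>y\<in>span D. \<exists>l. br y x0 - l *s x0 \<in> b"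
      using less.hyps[OF D(2,1)] DC less.prems(3) by blast
    then obtain l where l: "\<And>y. y \<in> span D \<Longrightarrow> br y x0 - l y *s x0 \<in> b" by metis
    have zC: "z \<in> span C" using z B' by blast
    obtain x m where x: "x \<in> g - b" "\<forall>y\<in>span D. br y x - l y *s x \<in> b" "br z x - m *s x \<in> b"
    proof -
      have "\<exists>x\<in>g - b. (\<forall>y\<in>span D. br y x - l y *s x \<in> b) \<and> (\<exists>m. br z x - m *s x \<in> b)"
      proof (rule lie_weight_extend[OF _ g(2,3) sb b(2)])
        show "span D \<subseteq> b" "z \<in> b" using zC DC less.prems(3) by auto
        show "br y z \<in> span D" if "y \<in> span D" for y
          using br_der[OF _ zC, of y] that DC derD by blast
      qed (use g(1) b x0(1) l in \<open>auto simp: subalg_def\<close>)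
      then show ?thesis using that by blast
    qed
    have "\<exists>l. br y x - l *s x \<in> b" if "y \<in> span C" for y
    proof -
      have "insert z D = B'" using z by (auto simp: D_def)
      then have "y \<in> span (insert z D)" using that B'(4) by auto
      then obtain k where k: "y - k *s z \<in> span D" by (auto simp: span_breakdown_eq)
      have "(br (y - k *s z) x - l (y - k *s z) *s x) + k *s (br z x - m *s x) \<in> b"
        using x k sb by (blast intro: subspace_add subspace_scale)
      then have "br y x - (l (y - k *s z) + k * m) *s x \<in> b"
        by (simp add: brl sc_distrib algebra_simps)
      then show ?thesis by blast
    qed
    then show ?thesis using x(1) by blast
  qed
qed

end

section \<open>A solvable subalgebra of codimension one\<close>

context lie_bracket
begin

lemma subalg_span:
  assumes "\<And>x y. x \<in> A \<Longrightarrow> y \<in> A \<Longrightarrow> br x y \<in> span A"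
  shows "subalg (span A)"
proof -
  have 1: "br x y \<in> span A" if x: "x \<in> span A" and y: "y \<in> A" for x y
    by (rule endo_image_span[OF br_left x _ subspace_span]) (use assms y in auto)
  have "br x y \<in> span A" if x: "x \<in> span A" and y: "y \<in> span A" for x y
    by (rule endo_image_span[OF br_right y _ subspace_span]) (use 1 x in auto)
  then show ?thesis by (auto simp: subalg_def)
qed

lemma der_span_insert:
  assumes r: "subspace r" and "\<And>v. v \<in> r \<Longrightarrow> br w v \<in> r" "\<And>u v. u \<in> r \<Longrightarrow> v \<in> r \<Longrightarrow> br u v \<in> r"
  shows "der (span (insert w r)) \<subseteq> r"
proof (rule der_minimal[OF _ r])
  fix x y assume "x \<in> span (insert w r)" "y \<in> span (insert w r)"
  moreover have "span r = r" using r by (simp add: span_eq_iff)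
  ultimately obtain a b where ab: "x - a *s w \<in> r" "y - b *s w \<in> r"
    by (auto simp: span_breakdown_eq)
  define u v where "u = x - a *s w" and "v = y - b *s w"
  have x: "x = a *s w + u" and y: "y = b *s w + v" by (simp_all add: u_def v_def)
  have uv: "u \<in> r" "v \<in> r" using ab by (simp_all add: u_def v_def)
  have "br x y = a *s br w v - b *s br w u + br u v"
    unfolding x y brl brr br_self br_skew[of u w] by (simp add: sc_distrib)
  then show "br x y \<in> r" using assms uv by (auto intro!: subspace_add subspace_diff subspace_scale)
qed

text \<open>
  If \<open>g\<close> is regarded as a Lie algebra of vector fields on a line, with \<open>b\<close> the fields that vanish at a point and
  \<open>x\<close> a field that does not, then this is the filtration of \<open>g\<close> by the order of vanishing at the point.
\<close>

fun isotropy_filtration :: "'b set \<Rightarrow> 'b set \<Rightarrow> 'b \<Rightarrow> nat \<Rightarrow> 'b set" where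
  "isotropy_filtration g b x 0 = g"
| "isotropy_filtration g b x (Suc 0) = b"
| "isotropy_filtration g b x (Suc (Suc i)) = {y \<in> isotropy_filtration g b x (Suc i). br y x \<in> isotropy_filtration g b x (Suc i)}"

definition sl2_mod :: "'b set \<Rightarrow> 'b \<Rightarrow> 'b \<Rightarrow> 'b \<Rightarrow> bool"
  where "sl2_mod r e f h \<longleftrightarrow>
    br e f - h \<in> r \<and> br h e - 2 *s e \<in> r \<and> br h f + 2 *s f \<in> r"

definition is_ideal :: "'b set \<Rightarrow> 'b set \<Rightarrow> bool"
  where "is_ideal r g \<longleftrightarrow> subspace r \<and> r \<subseteq> g \<and> (\<forall>u\<in>g. \<forall>v\<in>r. br u v \<in> r)"

text \<open>
  This is the classification of the transitive Lie algebras of vector fields on a line. In the filtration \<open>c\<close>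
  below, the successive quotients before it becomes stationary are spanned by single elements \<open>L 0\<close>, \<open>L 1\<close>,
  \<dots>, corresponding to multiples of \<open>d/dt\<close>, \<open>t d/dt\<close>, \<dots>, where \<open>L 0 - x\<close> belongs to \<open>b\<close>. The
  stationary term \<open>r = c k\<close> is an ideal. For \<open>k \<le> 2\<close> the algebra \<open>g / r\<close> would be solvable, and the commutation rules
  of the \<open>L i\<close> exclude \<open>k \<ge> 4\<close>. For \<open>k = 3\<close> the quotient \<open>g / r\<close> is \<open>sl\<^sub>2\<close>.
\<close>

theorem codim_one_gives_sl2:
  assumes g: "subalg g" "finite Y" "g \<subseteq> span Y" "\<not> solv g"
    and b: "subalg b" "b \<subseteq> g" "solv b" and x: "x \<in> g" "x \<notin> b"
    and gx: "\<And>u. u \<in> g \<Longrightarrow> \<exists>t. u - t *s x \<in> b"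
  shows "\<exists>r e f h. is_ideal r g \<and> solv r \<and> e \<in> g \<and> f \<in> g \<and> h \<in> g \<and> sl2_mod r e f h \<and>
    g \<subseteq> span ({e, f, h} \<union> r) \<and> (\<forall>s t u. s *s e + t *s f + u *s h \<in> r \<longrightarrow> s = 0 \<and> t = 0 \<and> u = 0)"
proof -
  define c where "c = isotropy_filtration g b x"
  have c0: "c 0 = g" and c1: "c (Suc 0) = b"
    and cS: "y \<in> c (Suc (Suc i)) \<longleftrightarrow> y \<in> c (Suc i) \<and> br y x \<in> c (Suc i)" for y i
    by (simp_all add: c_def)
  have sg: "subspace g" and sb: "subspace b" using g b by (auto simp: subalg_def)
  have sc: "subspace (c i)" for i
  proof (induction i rule: induct_nat_012)
    case (ge2 n)
    note s = ge2(2)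
    show ?case
    proof (rule subspaceI)
      show "0 \<in> c (Suc (Suc n))" using s by (simp add: cS brl subspace_0)
    qed (use s in \<open>auto simp: cS brl intro: subspace_add subspace_scale\<close>)
  qed (use sg sb in \<open>auto simp: c0 c1\<close>)
  have dec: "c (Suc i) \<subseteq> c i" for i using b by (cases i) (auto simp: c0 c1 cS)
  have cg: "c i \<subseteq> g" for i using dec by (induction i) (auto simp: c0)
  have brx: "br y x \<in> c i" if "y \<in> c (Suc i)" for y i
    using that g x b by (cases i) (auto simp: c0 c1 cS subalg_def)
  have brc: "y \<in> c (Suc i) \<Longrightarrow> z \<in> c (Suc j) \<Longrightarrow> br y z \<in> c (Suc (i + j))" for y z i j
  proof (induction "i + j" arbitrary: i j y z)
    case 0
    then show ?case using b by (auto simp: c1 subalg_def)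
  next
    case (Suc m)
    have *: "br y (br z x) \<in> c (Suc m)" if ij: "i + j = Suc m" "y \<in> c (Suc i)" "z \<in> c (Suc j)" for i j y z
    proof (cases j)
      case 0
      then have i: "i = Suc m" using ij by simp
      have "br z x \<in> g" using brx[OF ij(3)] cg by blast
      then obtain t where t: "br z x - t *s x \<in> b" using gx by blast
      have "y \<in> c (Suc m)" using ij(2) dec[of "Suc m"] i by blast
      then have "br y (br z x - t *s x) \<in> c (Suc m)"
        using Suc.hyps(1)[of m 0 y] t by (auto simp: c1)
      moreover have "t *s br y x \<in> c (Suc m)" using brx ij(2) i sc by (blast intro: subspace_scale)
      ultimately have "br y (br z x - t *s x) + t *s br y x \<in> c (Suc m)" using sc by (blast intro: subspace_add)
      then show ?thesis by (simp add: brr)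
    next
      case (Suc j')
      then show ?thesis using Suc.hyps(1)[of i j' y "br z x"] ij brx by auto
    qed
    have 1: "br y z \<in> c (Suc m)"
    proof (cases i)
      case 0
      then have j: "j = Suc m" using Suc by simp
      show ?thesis using Suc.hyps(1)[of 0 m y z] Suc.prems 0 j dec[of "Suc m"] by auto
    next
      case (Suc i')
      then show ?thesis using Suc.hyps(1)[of i' j y z] Suc.hyps(2) Suc.prems dec[of i] by auto
    qed
    have "br (br y z) x = br y (br z x) - br z (br y x)" by (simp add: jacobi[of y z x])
    moreover have "br z (br y x) \<in> c (Suc m)" using *[of j i z y] Suc by (simp add: add.commute)
    ultimately have "br (br y z) x \<in> c (Suc m)"
      using *[of i j y z] Suc sc by (simp add: subspace_diff)
    then have "br y z \<in> c (Suc (Suc m))" using 1 cS by blast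
    then show ?case by (simp only: Suc.hyps(2)[symmetric])
  qed
  have "\<exists>k. c (Suc k) = c (Suc (Suc k))"
  proof (rule ccontr)
    assume "\<nexists>k. c (Suc k) = c (Suc (Suc k))"
    then have lt: "dim (c (Suc (Suc k))) < dim (c (Suc k))" for k
      using dim_strict_mono[OF dec _ sc g(2)] cg g(3) by (metis order_trans)
    have "dim (c (Suc k)) + k \<le> dim (c (Suc 0))" for k
    proof (induction k)
      case (Suc k)
      then show ?case using lt[of k] by simp
    qed simp
    from this[of "Suc (dim (c (Suc 0)))"] show False by simp
  qed
  then obtain k' where k': "c (Suc k') = c (Suc (Suc k'))" "\<And>j. j < k' \<Longrightarrow> c (Suc j) \<noteq> c (Suc (Suc j))"
    using exists_least_iff[of "\<lambda>k. c (Suc k) = c (Suc (Suc k))"] by blast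
  define k where "k = Suc k'"
  define r where "r = c k"
  have strict: "c i \<noteq> c (Suc i)" if "i < k" for i
    using that k'(2) x by (cases i) (auto simp: k_def c0 c1)
  have rx: "br v x \<in> r" if "v \<in> r" for v using brx[of v k] that k' by (simp add: r_def k_def)
  have ideal: "is_ideal r g"
    unfolding is_ideal_def
  proof (intro conjI ballI)
    show "subspace r" "r \<subseteq> g" using sc cg by (auto simp: r_def)
    fix u v assume u: "u \<in> g" and v: "v \<in> r"
    obtain t where t: "u - t *s x \<in> b" using gx u by blast
    have 1: "br (u - t *s x) v \<in> r" using brc[of "u - t *s x" 0 v k'] t v by (simp add: r_def k_def c1)
    have 2: "br x v \<in> r" using rx[OF v] sc br_skew[of x v] by (simp add: r_def subspace_neg)
    have "br u v = br (u - t *s x) v + t *s br x v" by (simp add: brl)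
    then show "br u v \<in> r" using 1 2 sc by (simp add: r_def subspace_add subspace_scale)
  qed
  then have sr: "subspace r" and rg: "r \<subseteq> g" and rI: "\<And>u v. u \<in> g \<Longrightarrow> v \<in> r \<Longrightarrow> br u v \<in> r"
    by (auto simp: is_ideal_def)
  have rb: "r \<subseteq> b" using dec by (simp add: r_def k_def c1[symmetric]) (induction k', auto)
  have solvr: "solv r" using solv_subset[OF b(3) rb] .
  have rI': "br v u \<in> r" if "u \<in> g" "v \<in> r" for u v
    using rI[OF that] br_skew[of v u] sr by (simp add: subspace_neg)
  let ?ad = "\<lambda>w. br w x"
  have ad: "endo (?ad ^^ n)" for n by (rule endo_funpow[OF br_left])
  have L_mem: "(?ad ^^ j) y \<in> c (k' - j) \<and> (?ad ^^ j) y \<notin> c (Suc (k' - j))"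
    if y: "y \<in> c k'" "y \<notin> c (Suc k')" and j: "j \<le> k'" for y j
    using j
  proof (induction j)
    case (Suc j)
    then obtain i where i: "k' - j = Suc i" "k' - Suc j = i" by (metis Suc_diff_Suc Suc_le_lessD)
    have IH: "(?ad ^^ j) y \<in> c (Suc i)" "(?ad ^^ j) y \<notin> c (Suc (Suc i))" using Suc i by auto
    then show ?case using brx[OF IH(1)] cS i by simp
  qed (use y in auto)
  obtain y0 where y0: "y0 \<in> c k'" "y0 \<notin> c (Suc k')"
    using strict[of k'] dec[of k'] by (auto simp: k_def)
  obtain t where t: "(?ad ^^ k') y0 - t *s x \<in> b"
    using gx L_mem[OF y0, of k'] by (auto simp: c0)
  have t0: "t \<noteq> 0" using t L_mem[OF y0, of k'] by (auto simp: c1)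
  define y where "y = inverse t *s y0"
  have y: "y \<in> c k'" "y \<notin> c (Suc k')"
    using y0 t0 subspace_scale_iff[OF sc] by (auto simp: y_def)
  define L where "L i = (?ad ^^ (k' - i)) y" for i
  have L: "L i \<in> c i" "L i \<notin> c (Suc i)" if "i < k" for i
    using L_mem[OF y, of "k' - i"] that by (auto simp: L_def k_def)
  have Lx: "br (L (Suc i)) x = L i" if "Suc i < k" for i
  proof -
    have "k' - i = Suc (k' - Suc i)" using that by (simp add: k_def)
    then show ?thesis by (simp add: L_def)
  qed
  have L0: "L 0 - x \<in> b"
  proof -
    have "L 0 - x = inverse t *s ((?ad ^^ k') y0 - t *s x)"
      using t0 by (simp add: L_def y_def module_hom.scale[OF ad] scale_right_diff_distrib)
    then show ?thesis using t sb by (simp add: subspace_scale)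
  qed
  have Lg: "L i \<in> g" if "i < k" for i using L(1)[OF that] cg by blast
  have codim: "\<exists>t. w - t *s L i \<in> c (Suc i)" if "i < k" "w \<in> c i" for i w
    using that
  proof (induction i arbitrary: w)
    case 0
    then obtain t where t: "w - t *s x \<in> b" using gx by (auto simp: c0)
    have "(w - t *s x) - t *s (L 0 - x) \<in> b" using t L0 sb by (simp add: subspace_diff subspace_scale)
    then show ?case by (auto simp: c1 scale_right_diff_distrib)
  next
    case (Suc i)
    obtain t where t: "br w x - t *s L i \<in> c (Suc i)" using Suc.IH[of "br w x"] brx[OF Suc.prems(2)] Suc.prems by auto
    have "w - t *s L (Suc i) \<in> c (Suc i)" using Suc.prems L[of "Suc i"] sc by (auto intro: subspace_diff subspace_scale)
    moreover have "br (w - t *s L (Suc i)) x \<in> c (Suc i)" using t Lx[of i] Suc.prems by (simp add: brl)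
    ultimately show ?case using cS by blast
  qed
  have brLx: "br (br a b') x = br a (br b' x) - br b' (br a x)" for a b' by (simp add: jacobi[of a b' x])
  have LL0: "br (L (Suc i)) (L 0) - L i \<in> c (Suc i)" if "Suc i < k" for i
  proof -
    have "br (L (Suc i)) (L 0) - L i = br (L (Suc i)) (L 0 - x)" by (simp add: brr Lx[OF that])
    then show ?thesis using brc[of "L (Suc i)" i "L 0 - x" 0] L that L0 by (auto simp: c1)
  qed
  \<comment> \<open>The brackets of the vector fields \<open>t ^ i d/dt\<close> with \<open>t d/dt\<close>, up to normalization and higher order.\<close>
  have LL1: "Suc i < k \<Longrightarrow> br (L (Suc i)) (L 1) - of_nat i *s L (Suc i) \<in> c (Suc (Suc i))" for i
  proof (induction i)
    case 0
    then show ?case using sc[of "Suc (Suc 0)"] by (simp add: br_self subspace_0)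
  next
    case (Suc i)
    let ?z = "br (L (Suc (Suc i))) (L 1) - of_nat (Suc i) *s L (Suc (Suc i))"
    have 1: "?z \<in> c (Suc (Suc i))"
      using brc[of "L (Suc (Suc i))" "Suc i" "L 1" 0] L Suc.prems sc by (auto intro!: subspace_diff subspace_scale)
    have "br ?z x = br (L (Suc (Suc i))) (L 0) - br (L 1) (L (Suc i)) - of_nat (Suc i) *s L (Suc i)"
      using Lx[of "Suc i"] Lx[of 0] Suc.prems by (simp only: brl brLx One_nat_def)
    also have "\<dots> = (br (L (Suc (Suc i))) (L 0) - L (Suc i)) + (br (L (Suc i)) (L 1) - of_nat i *s L (Suc i))"
      by (simp add: br_skew[of "L 1" "L (Suc i)"] br_skew[of "L (Suc 0)" "L (Suc i)"] sc_distrib)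
    also have "\<dots> \<in> c (Suc (Suc i))" using LL0[of "Suc i"] Suc sc by (auto intro: subspace_add)
    finally show ?case using 1 cS by blast
  qed
  \<comment> \<open>The exact structure constants are irrelevant; it matters only that they are not negative.\<close>
  have LL2: "i + 3 < k \<Longrightarrow> \<exists>a::nat. br (L (i + 2)) (L 2) - of_nat a *s L (i + 3) \<in> c (i + 4)" for i
  proof (induction i)
    case 0
    have "br (L (0 + 2)) (L 2) = 0" by (simp only: add_0 br_self)
    then show ?case using subspace_0[OF sc] by (intro exI[of _ 0]) simp
  next
    case (Suc i)
    then obtain a :: nat where a: "br (L (i + 2)) (L 2) - of_nat a *s L (i + 3) \<in> c (i + 4)" by auto
    let ?z = "br (L (i + 3)) (L 2) - of_nat (a + i + 2) *s L (i + 4)"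
    have 1: "?z \<in> c (i + 4)"
      using brc[of "L (i + 3)" "i + 2" "L 2" 1] L[of "i + 3"] L[of "i + 4"] L[of 2] Suc.prems sc
      by (intro subspace_diff subspace_scale) (auto simp: eval_nat_numeral)
    have 2: "br (L (i + 3)) (L 1) - of_nat (i + 2) *s L (i + 3) \<in> c (i + 4)"
      using LL1[of "i + 2"] Suc.prems by (simp add: eval_nat_numeral)
    have x3: "br (L (i + 3)) x = L (i + 2)" "br (L 2) x = L 1" "br (L (i + 4)) x = L (i + 3)"
      using Lx[of "i + 2"] Lx[of 1] Lx[of "i + 3"] Suc.prems by (simp_all add: eval_nat_numeral)
    have "br ?z x = br (L (i + 3)) (L 1) + br (L (i + 2)) (L 2) - of_nat (a + i + 2) *s L (i + 3)"
      by (simp only: brl brLx x3) (use br_skew[of "L 2" "L (i + 2)"] in simp)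
    also have "\<dots> = (br (L (i + 3)) (L 1) - of_nat (i + 2) *s L (i + 3)) + (br (L (i + 2)) (L 2) - of_nat a *s L (i + 3))"
      by (simp add: sc_distrib algebra_simps)
    also have "\<dots> \<in> c (i + 4)" using 2 a sc by (auto intro: subspace_add)
    finally have "?z \<in> c (i + 5)" using 1 cS[of ?z "i + 3"] by (simp add: eval_nat_numeral)
    then show ?case by (intro exI[of _ "a + i + 2"]) (simp add: eval_nat_numeral)
  qed
  have "k \<noteq> 1"
  proof
    assume "k = 1"
    then have "r = b" by (simp add: r_def c1)
    then have "g \<subseteq> span (insert x r)"
      unfolding span_breakdown_eq subset_iff using gx span_base[of _ b] by blast
    moreover have "der (span (insert x r)) \<subseteq> r" using der_span_insert[OF sr] rI x rg by blast
    ultimately have "der g \<subseteq> r" using der_mono[of g "span (insert x r)"] by blast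
    then have "(der ^^ 1) g \<subseteq> r" by simp
    then show False using solv_extend[OF _ solvr] g(4) by metis
  qed
  have "k \<noteq> 2"
  proof
    assume k: "k = 2"
    define w where "w = br (L 0) (L 1)"
    have w: "w \<in> g" using Lg k g(1) by (simp add: w_def subalg_def)
    have *: "\<exists>s t. u - s *s L 0 - t *s L 1 \<in> r" if u: "u \<in> g" for u
    proof -
      obtain s where s: "u - s *s L 0 \<in> c (Suc 0)" using codim[of 0 u] u k by (auto simp: c0)
      then obtain t where "u - s *s L 0 - t *s L 1 \<in> c (Suc (Suc 0))" using codim[of "Suc 0" "u - s *s L 0"] k by auto
      then show ?thesis by (auto simp: r_def k numeral_2_eq_2)
    qed
    have "der g \<subseteq> span (insert w r)"
    proof (rule der_minimal[OF _ subspace_span])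
      fix u v assume uv: "u \<in> g" "v \<in> g"
      obtain s t where st: "u - s *s L 0 - t *s L 1 \<in> r" using *[OF uv(1)] by blast
      obtain s' t' where st': "v - s' *s L 0 - t' *s L 1 \<in> r" using *[OF uv(2)] by blast
      define p q where "p = u - s *s L 0 - t *s L 1" and "q = v - s' *s L 0 - t' *s L 1"
      have u: "u = s *s L 0 + t *s L 1 + p" and v: "v = s' *s L 0 + t' *s L 1 + q" by (simp_all add: p_def q_def)
      have pq: "p \<in> r" "q \<in> r" using st st' by (simp_all add: p_def q_def)
      define a where "a = s *s L 0 + t *s L 1"
      have "br u v - (s * t' - t * s') *s w = br u q + br p a'"
        if a': "a' = s' *s L 0 + t' *s L 1" for a'
        unfolding u v a' brl brr br_self w_def br_skew[of "L 1" "L 0"] by (simp add: sc_distrib mult.commute)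
      moreover have "br u q \<in> r" using rI uv(1) pq by blast
      moreover have "s' *s L 0 + t' *s L 1 \<in> g" using Lg k sg by (auto intro!: subspace_add subspace_scale)
      ultimately have "br u v - (s * t' - t * s') *s w \<in> r" using rI' pq sr by (auto intro!: subspace_add)
      then show "br u v \<in> span (insert w r)" using span_base by (auto simp: span_breakdown_eq)
    qed
    then have "der (der g) \<subseteq> r" using der_mono der_span_insert[OF sr, of w] rI w rg by blast
    then have "(der ^^ 2) g \<subseteq> r" by (simp add: numeral_2_eq_2)
    then show False using solv_extend[OF _ solvr] g(4) by metis
  qed
  \<comment> \<open>The bracket of \<open>L (k - 1)\<close> and \<open>L 2\<close> has too high an order, so it belongs to \<open>r\<close>. Bracketing it with
    \<open>x\<close> shows that a positive multiple of \<open>L (k - 1)\<close> belongs to \<open>r\<close>.\<close>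
  have "\<not> k \<ge> 4"
  proof
    assume "k \<ge> 4"
    then obtain i where i: "k = i + 4" by (metis le_Suc_ex add.commute)
    obtain a :: nat where a: "br (L (i + 2)) (L 2) - of_nat a *s L (i + 3) \<in> r"
      using LL2[of i] i by (auto simp: r_def)
    have 2: "br (L (i + 3)) (L 1) - of_nat (i + 2) *s L (i + 3) \<in> r"
      using LL1[of "i + 2"] i by (simp add: eval_nat_numeral r_def)
    have "br (L (i + 3)) (L 2) \<in> r"
      using brc[of "L (i + 3)" "i + 2" "L 2" 1] L[of "i + 3"] L[of 2] i by (simp add: eval_nat_numeral r_def)
    then have "br (br (L (i + 3)) (L 2)) x \<in> r" by (rule rx)
    moreover have "br (br (L (i + 3)) (L 2)) x = br (L (i + 3)) (L 1) + br (L (i + 2)) (L 2)"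
    proof -
      have x3: "br (L (i + 3)) x = L (i + 2)" "br (L 2) x = L 1"
        using Lx[of "i + 2"] Lx[of 1] i by (simp_all add: eval_nat_numeral)
      show ?thesis by (simp only: brLx x3) (use br_skew[of "L 2" "L (i + 2)"] in simp)
    qed
    ultimately have 3: "br (L (i + 3)) (L 1) + br (L (i + 2)) (L 2) \<in> r" by (simp only:)
    have "br (L (i + 3)) (L 1) + br (L (i + 2)) (L 2) - (br (L (i + 3)) (L 1) - of_nat (i + 2) *s L (i + 3))
        - (br (L (i + 2)) (L 2) - of_nat a *s L (i + 3)) \<in> r" by (intro subspace_diff sr 2 3 a)
    then have "of_nat (i + 2 + a) *s L (i + 3) \<in> r" by (simp add: sc_distrib algebra_simps)
    then have "L (i + 3) \<in> r" using subspace_scale_iff[OF sr]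
      by (metis add_2_eq_Suc' add_Suc of_nat_neq_0)
    then show False using L(2)[of "i + 3"] i by (simp add: r_def eval_nat_numeral)
  qed
  then have k: "k = 3" using \<open>k \<noteq> 1\<close> \<open>k \<noteq> 2\<close> by (cases k) (auto simp: k_def)
  have Lk: "L 0 \<in> g" "L 1 \<in> b" "L 2 \<in> c 2" "L 2 \<in> g" "L 1 \<in> g" "L 1 \<notin> c 2" "L 2 \<notin> r" "br (L 2) x = L 1" "br (L 1) x = L 0"
    using L[of 0] L[of 1] L[of 2] Lg[of 1] Lg[of 2] k c0 c1 Lx[of 0] Lx[of 1] by (auto simp: r_def eval_nat_numeral)
  have r12: "br (L 2) (L 1) - L 2 \<in> r" using LL1[of 1] k by (simp add: r_def eval_nat_numeral)
  obtain \<alpha> where \<alpha>: "L 0 - x - \<alpha> *s L 1 \<in> c 2"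
    using codim[of "Suc 0" "L 0 - x"] L0 k c1 by (auto simp: eval_nat_numeral)
  then obtain \<beta> where \<beta>: "L 0 - x - \<alpha> *s L 1 - \<beta> *s L 2 \<in> r"
    using codim[of 2 "L 0 - x - \<alpha> *s L 1"] k by (auto simp: r_def eval_nat_numeral)
  define \<rho> where "\<rho> = L 0 - x - \<alpha> *s L 1 - \<beta> *s L 2"
  have L0e: "L 0 = x + \<alpha> *s L 1 + \<beta> *s L 2 + \<rho>" by (simp add: \<rho>_def)
  have \<rho>: "\<rho> \<in> r" using \<beta> by (simp add: \<rho>_def)
  define \<sigma> where "\<sigma> = br (L 2) (L 1) - L 2"
  have s: "br (L 2) (L 1) = L 2 + \<sigma>" by (simp add: \<sigma>_def)
  have s': "br (L 1) (L 2) = - L 2 - \<sigma>" by (subst br_skew, subst s) simp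
  have \<sigma>: "\<sigma> \<in> r" using r12 by (simp add: \<sigma>_def)
  \<comment> \<open>Expand the Jacobi identity for \<open>L 1\<close>, \<open>L 2\<close> and \<open>x\<close>, where the bracket of \<open>L 2\<close> with \<open>x\<close> is \<open>L 1\<close>.\<close>
  have "\<alpha> *s L 2 \<in> r"
  proof -
    have "0 = br (L 1) (br (L 2) x)" by (simp only: Lk br_self)
    also have "\<dots> = br (br (L 1) (L 2)) x + br (L 2) (L 0)" using jacobi[of "L 1" "L 2" x] by (simp only: Lk)
    also have "\<dots> = - br \<sigma> x + \<alpha> *s (L 2 + \<sigma>) + br (L 2) \<rho>"
      unfolding s' L0e brr brl br_self s Lk(8) by simp
    finally have *: "\<alpha> *s L 2 = br \<sigma> x - \<alpha> *s \<sigma> - br (L 2) \<rho>"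
      by (simp add: sc_distrib algebra_simps eq_neg_iff_add_eq_0)
    show ?thesis unfolding * using rI'[OF x(1) \<sigma>] rI[OF Lk(4) \<rho>] \<sigma> sr
      by (intro subspace_diff subspace_scale)
  qed
  then have "\<alpha> = 0" using Lk subspace_scale_iff[OF sr] by blast
  then have L0e: "L 0 = x + \<beta> *s L 2 + \<rho>" using L0e by simp
  define e f h where "e = x + (\<beta> / 2) *s L 2" and "f = - (2 *s L 2)" and "h = 2 *s L 1"
  have efh: "e \<in> g" "f \<in> g" "h \<in> g" using x Lk sg
    by (auto simp: e_def f_def h_def intro!: subspace_add subspace_scale subspace_neg)
  have bx: "br x (L 2) = - L 1" by (subst br_skew) (simp only: Lk)
  have "br e f = h" unfolding e_def f_def h_def brl brr br_self bx by (simp add: sc_distrib)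
  moreover have "br h e - 2 *s e = 2 *s \<rho> - \<beta> *s \<sigma>"
  proof -
    have "br h e - 2 *s e = 2 *s L 0 + 2 *s ((\<beta> / 2) *s (- L 2 - \<sigma>)) - 2 *s (x + (\<beta> / 2) *s L 2)"
      unfolding h_def e_def brl brr s' Lk(9) by (simp add: sc_distrib)
    also have "\<dots> = 2 *s \<rho> - \<beta> *s \<sigma>" unfolding L0e
    proof -
      have "2 *s \<beta> *s L 2 - \<beta> *s L 2 - \<beta> *s L 2 = (2 * \<beta> - \<beta> - \<beta>) *s L 2"
        by (simp only: sc_distrib scale_scale)
      then show "2 *s (x + \<beta> *s L 2 + \<rho>) + 2 *s ((\<beta> / 2) *s (- L 2 - \<sigma>)) - 2 *s (x + (\<beta> / 2) *s L 2) = 2 *s \<rho> - \<beta> *s \<sigma>"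
        by (simp add: sc_distrib algebra_simps)
    qed
    finally show ?thesis .
  qed
  moreover have "br h f + 2 *s f = 4 *s \<sigma>"
  proof -
    have "4 *s L 2 = 2 *s 2 *s L 2" by simp
    then show ?thesis unfolding h_def f_def brl brr s' by (simp add: sc_distrib)
  qed
  ultimately have "sl2_mod r e f h" using sr \<rho> \<sigma>
    by (auto simp: sl2_mod_def intro!: subspace_0 subspace_diff subspace_scale)
  moreover have "g \<subseteq> span ({e, f, h} \<union> r)"
  proof
    fix u assume u: "u \<in> g"
    let ?S = "span ({e, f, h} \<union> r)"
    have eS: "e \<in> ?S" "f \<in> ?S" "h \<in> ?S" "r \<subseteq> ?S" by (auto intro: span_base)
    have "- (1 / 2) *s f \<in> ?S" "(1 / 2) *s h \<in> ?S" using eS by (auto intro: span_scale span_neg)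
    then have L12: "L 2 \<in> ?S" "L 1 \<in> ?S" by (simp_all add: f_def h_def)
    have "e + (\<beta> / 2) *s L 2 + \<rho> \<in> ?S" using eS L12 \<rho> by (auto intro!: span_add span_scale)
    moreover have "e + (\<beta> / 2) *s L 2 + \<rho> = L 0"
      unfolding L0e e_def by (simp add: scale_left_distrib[symmetric])
    ultimately have L0S: "L 0 \<in> ?S" by simp
    obtain s where s: "u - s *s L 0 \<in> c (Suc 0)" using codim[of 0 u] u k by (auto simp: c0)
    then obtain t where t: "u - s *s L 0 - t *s L 1 \<in> c 2" using codim[of "Suc 0" "u - s *s L 0"] k
      by (auto simp: numeral_2_eq_2)
    then obtain q where "u - s *s L 0 - t *s L 1 - q *s L 2 \<in> r" using codim[of 2 "u - s *s L 0 - t *s L 1"] k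
      by (auto simp: r_def eval_nat_numeral)
    then have "(u - s *s L 0 - t *s L 1 - q *s L 2) + s *s L 0 + t *s L 1 + q *s L 2 \<in> ?S"
      using eS L0S L12 by (intro span_add span_scale) auto
    then show "u \<in> ?S" by simp
  qed
  moreover have "s = 0 \<and> t = 0 \<and> u = 0" if stu: "s *s e + t *s f + u *s h \<in> r" for s t u
  proof -
    have c2b: "c 2 \<subseteq> b" using dec[of "Suc 0"] by (simp add: c1 numeral_2_eq_2)
    have rc2: "r \<subseteq> c 2" using dec[of 2] k by (simp add: r_def eval_nat_numeral)
    have f2: "f \<in> c 2" using Lk(3) sc by (auto simp: f_def intro: subspace_neg subspace_scale)
    have hb: "h \<in> b" using Lk sb by (auto simp: h_def intro: subspace_scale)
    have ex: "e - x \<in> b" using Lk(3) c2b sb by (auto simp: e_def intro: subspace_scale)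
    have "(s *s e + t *s f + u *s h) - s *s (e - x) - t *s f - u *s h \<in> b"
      using stu rb f2 c2b hb by (intro subspace_diff sb subspace_scale[OF sb ex] subspace_scale[OF sb, of f]
          subspace_scale[OF sb, of h]) auto
    then have "s *s x \<in> b" by (simp add: sc_distrib)
    then have s: "s = 0" using x subspace_scale_iff[OF sb] by blast
    have "(s *s e + t *s f + u *s h) - t *s f \<in> c 2"
      using stu rc2 f2 sc by (intro subspace_diff subspace_scale) auto
    then have "(u * 2) *s L 1 \<in> c 2" using s by (simp add: h_def)
    then have "u * 2 = 0" using Lk(6) subspace_scale_iff[OF sc] by blast
    then have u: "u = 0" by simp
    then have "- (t *s f) \<in> r" using stu s subspace_neg[OF sr] by simp
    then have "(t * 2) *s L 2 \<in> r" by (simp add: f_def)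
    then have "t * 2 = 0" using Lk(7) subspace_scale_iff[OF sr] by blast
    then show ?thesis using s u by simp
  qed
  ultimately show ?thesis using ideal solvr efh by blast
qed

end

section \<open>Subalgebras of type sl2\<close>

context lie_bracket
begin

lemma ideal_der:
  assumes "is_ideal r g"
  shows "is_ideal (der r) g"
  unfolding is_ideal_def
proof (intro conjI ballI)
  have r: "subspace r" "r \<subseteq> g" "\<And>u v. u \<in> g \<Longrightarrow> v \<in> r \<Longrightarrow> br u v \<in> r" using assms by (auto simp: is_ideal_def)
  show "subspace (der r)" by (rule subspace_der)
  have "der r \<subseteq> r" using r by (intro der_minimal) auto
  then show "der r \<subseteq> g" using r by blast
  fix u v assume u: "u \<in> g" and v: "v \<in> der r"
  show "br u v \<in> der r"
  proof (rule endo_image_span[OF br_right v[unfolded der_def] _ subspace_der])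
    show "br u ` {br x y |x y. x \<in> r \<and> y \<in> r} \<subseteq> der r"
    proof safe
      fix x y assume xy: "x \<in> r" "y \<in> r"
      have "br (br u x) y + br x (br u y) \<in> der r"
        using xy r u by (intro subspace_add subspace_der br_der) auto
      then show "br u (br x y) \<in> der r" by (simp add: jacobi[of u x y])
    qed
  qed
qed

text \<open>
  The relations hold only modulo \<open>r\<close>, but \<open>r\<close> acts trivially on \<open>r / [r, r]\<close>.
\<close>

lemma radical_sl2_module:
  assumes g: "subalg g" "finite Y" "g \<subseteq> span Y" and r: "is_ideal r g"
    and efh: "e \<in> g" "f \<in> g" "h \<in> g" "sl2_mod r e f h"
  shows "sl2_module_mod (*s) r (der r) (br e) (br f) (br h)"
proof -
  have rs: "subspace r" "r \<subseteq> g" "\<And>u v. u \<in> g \<Longrightarrow> v \<in> r \<Longrightarrow> br u v \<in> r" using r by (auto simp: is_ideal_def)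
  have ds: "\<And>u v. u \<in> g \<Longrightarrow> v \<in> der r \<Longrightarrow> br u v \<in> der r" using ideal_der[OF r] by (auto simp: is_ideal_def)
  have dr: "der r \<subseteq> r" using rs by (intro der_minimal) auto
  have rel: "br e f - h \<in> r" "br h e - 2 *s e \<in> r" "br h f + 2 *s f \<in> r" using efh(4) by (auto simp: sl2_mod_def)
  have 1: "br e (br f v) - br f (br e v) - br h v \<in> der r" if "v \<in> r" for v
  proof -
    have "br e (br f v) - br f (br e v) - br h v = br (br e f - h) v" by (simp add: jacobi[of e f v] brl)
    then show ?thesis using br_der[OF rel(1) that] by simp
  qed
  have 2: "br h (br e v) - br e (br h v) - 2 *s br e v \<in> der r" if "v \<in> r" for v
  proof -
    have "br h (br e v) - br e (br h v) - 2 *s br e v = br (br h e - 2 *s e) v" by (simp add: jacobi[of h e v] brl)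
    then show ?thesis using br_der[OF rel(2) that] by simp
  qed
  have 3: "br h (br f v) - br f (br h v) + 2 *s br f v \<in> der r" if "v \<in> r" for v
  proof -
    have "br h (br f v) - br f (br h v) + 2 *s br f v = br (br h f + 2 *s f) v" by (simp add: jacobi[of h f v] brl)
    then show ?thesis using br_der[OF rel(3) that] by simp
  qed
  have fd: "fin_dim_mod r (der r)"
    unfolding fin_dim_mod_def using g(2,3) rs(2) span_mono[of Y "Y \<union> der r"] by blast
  show ?thesis
    by (intro sl2_module_mod.intro complex_vector_space.intro sl2_module_mod_axioms.intro vector_space_axioms
      rs(1) subspace_der dr br_right 1 2 3 fd complex_vector_space_axioms)
      (use rs(3) ds efh in auto)
qed

text \<open>
  A copy of \<open>sl\<^sub>2\<close> in \<open>g / r\<close> lifts to \<open>g / [r, r]\<close>. The errors in the three relations lie in the representation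
  \<open>r / [r, r]\<close>. First \<open>e\<close> and \<open>h\<close> are changed to repair \<open>[h, e] = 2 e\<close>, then \<open>f\<close> to repair \<open>[h, f] = - 2 f\<close> up to a
  vector \<open>n\<close> of weight -2. The Jacobi identity shows that \<open>n\<close> vanishes and that the error of \<open>[e, f] = h\<close>
  has weight 0; this error is absorbed by \<open>e\<close> and \<open>h\<close>.
\<close>

lemma sl2_lift_mod_der:
  assumes g: "subalg g" "finite Y" "g \<subseteq> span Y" and r: "is_ideal r g"
    and efh: "e \<in> g" "f \<in> g" "h \<in> g" "sl2_mod r e f h"
  shows "\<exists>e' f' h'. e' - e \<in> r \<and> f' - f \<in> r \<and> h' - h \<in> r \<and> sl2_mod (der r) e' f' h'"
proof -
  have rs: "subspace r" "r \<subseteq> g" and rI: "\<And>u v. u \<in> g \<Longrightarrow> v \<in> r \<Longrightarrow> br u v \<in> r" using r by (auto simp: is_ideal_def)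
  have ds: "\<And>u v. u \<in> g \<Longrightarrow> v \<in> der r \<Longrightarrow> br u v \<in> der r" using ideal_der[OF r] by (auto simp: is_ideal_def)
  have ds': "br v u \<in> der r" if "u \<in> g" "v \<in> der r" for u v
    using ds[OF that] br_skew[of v u] by (simp add: subspace_neg subspace_der)
  have rI': "br v u \<in> r" if "u \<in> g" "v \<in> r" for u v
    using rI[OF that] br_skew[of v u] rs by (simp add: subspace_neg)
  have sg: "subspace g" using g by (simp add: subalg_def)
  have rel: "br e f - h \<in> r" "br h e - 2 *s e \<in> r" "br h f + 2 *s f \<in> r" using efh(4) by (auto simp: sl2_mod_def)
  interpret M0: sl2_module_mod "(*s)" r "der r" "br e" "br f" "br h"
    by (rule radical_sl2_module[OF g r efh])
  obtain w1 u1 where w1: "w1 \<in> r" "u1 \<in> r" "(br h e - 2 *s e) - (br h w1 - 2 *s w1) - br e u1 \<in> der r"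
    using M0.hE_decompose[OF rel(2)] by blast
  define e1 where "e1 = e - w1"
  define h1 where "h1 = h + u1"
  have eh1: "e1 \<in> g" "h1 \<in> g" using efh w1 rs sg by (auto simp: e1_def h1_def intro: subspace_add subspace_diff)
  have he1: "br h1 e1 - 2 *s e1 \<in> der r"
  proof -
    have "br h1 e1 - 2 *s e1 = ((br h e - 2 *s e) - (br h w1 - 2 *s w1) - br e u1) - br u1 w1"
      by (simp add: e1_def h1_def brl brr br_skew[of u1 e] sc_distrib)
    then show ?thesis using w1 br_der[of u1 r w1] by (simp add: subspace_diff subspace_der)
  qed
  have rel1: "sl2_mod r e1 f h1"
    unfolding sl2_mod_def
  proof (intro conjI)
    have "br e1 f - h1 = (br e f - h) - br w1 f - u1" by (simp add: e1_def h1_def brl)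
    then show "br e1 f - h1 \<in> r" using rel rI'[OF efh(2) w1(1)] w1 rs by (simp add: subspace_diff)
    show "br h1 e1 - 2 *s e1 \<in> r" using he1 M0.UV by blast
    have "br h1 f + 2 *s f = (br h f + 2 *s f) + br u1 f" by (simp add: h1_def brl)
    then show "br h1 f + 2 *s f \<in> r" using rel rI'[OF efh(2) w1(2)] rs by (simp only: subspace_add)
  qed
  interpret M1: sl2_module_mod "(*s)" r "der r" "br e1" "br f" "br h1"
    by (rule radical_sl2_module[OF g r eh1(1) efh(2) eh1(2) rel1])
  have "br h1 f + 2 *s f \<in> r" using rel1 by (simp add: sl2_mod_def)
  then obtain w2 n where w2: "w2 \<in> r" "n \<in> M1.wt (- 2)" "(br h1 f + 2 *s f) - (br h1 w2 + 2 *s w2) - n \<in> der r"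
    using M1.h_plus_2_decompose by blast
  define f1 where "f1 = f - w2"
  have f1: "f1 \<in> g" using efh w2 rs sg by (auto simp: f1_def intro: subspace_diff)
  have hf1: "br h1 f1 + 2 *s f1 - n \<in> der r"
  proof -
    have "br h1 f1 + 2 *s f1 - n = (br h1 f + 2 *s f) - (br h1 w2 + 2 *s w2) - n"
      by (simp add: f1_def brr sc_distrib)
    then show ?thesis using w2 by simp
  qed
  have nr: "n \<in> r" using M1.wt_V w2 by blast
  have rel2: "sl2_mod r e1 f1 h1"
    unfolding sl2_mod_def
  proof (intro conjI)
    have "br e1 f1 - h1 = (br e1 f - h1) - br e1 w2" by (simp add: f1_def brr)
    then show "br e1 f1 - h1 \<in> r" using rel1 rI[OF eh1(1) w2(1)] rs
      by (simp only: sl2_mod_def subspace_diff)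
    show "br h1 e1 - 2 *s e1 \<in> r" using he1 M0.UV by blast
    have "(br h1 f1 + 2 *s f1 - n) + n \<in> r" using hf1 nr M0.UV rs by (blast intro: subspace_add)
    then show "br h1 f1 + 2 *s f1 \<in> r" by simp
  qed
  interpret M2: sl2_module_mod "(*s)" r "der r" "br e1" "br f1" "br h1"
    by (rule radical_sl2_module[OF g r eh1(1) f1 eh1(2) rel2])
  define z where "z = br e1 f1 - h1"
  have zr: "z \<in> r" using rel2 by (simp add: z_def sl2_mod_def)
  have n2: "n \<in> M2.wt (- 2)" using w2(2) unfolding M1.wt_def M2.wt_def .
  have "br h1 z - br e1 n \<in> der r"
  proof -
    have "br h1 z - br e1 n = br (br h1 e1 - 2 *s e1) f1 + br e1 (br h1 f1 + 2 *s f1 - n)"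
      by (simp add: z_def brl brr br_self jacobi[of h1 e1 f1])
    then show ?thesis using ds'[OF f1 he1] ds[OF eh1(1) hf1] by (simp add: subspace_add subspace_der)
  qed
  then have n0: "n \<in> der r" and z0: "z \<in> M2.wt 0"
    using M2.h_image_meets_weight_zero[OF zr n2] by auto
  obtain w where w: "w \<in> M2.wt 2" "br e1 (z - br f1 w) \<in> der r" "br f1 (z - br f1 w) \<in> der r"
    using M2.weight_zero_split[OF z0] by blast
  define u where "u = z - br f1 w"
  have wr: "w \<in> r" using M2.wt_V w by blast
  have ur: "u \<in> r" using zr rI[OF f1 wr] rs by (simp add: u_def subspace_diff)
  define e2 h2 where "e2 = e1 + w" and "h2 = h1 + u"
  have "sl2_mod (der r) e2 f1 h2"
    unfolding sl2_mod_def
  proof (intro conjI)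
    have "br e2 f1 - h2 = 0"
      by (simp add: e2_def h2_def u_def z_def brl br_skew[of w f1])
    then show "br e2 f1 - h2 \<in> der r" using subspace_der subspace_0 by simp
    have "br h2 e2 - 2 *s e2 = (br h1 e1 - 2 *s e1) + (br h1 w - 2 *s w) - br e1 u + br u w"
      by (simp add: e2_def h2_def brl brr br_skew[of u e1] sc_distrib)
    moreover have "br h1 w - 2 *s w \<in> der r" using w(1) by (simp add: M2.wt_def)
    moreover have "br e1 u \<in> der r" using w by (simp add: u_def)
    ultimately show "br h2 e2 - 2 *s e2 \<in> der r" using he1 br_der[OF ur wr]
      by (simp add: subspace_add subspace_diff subspace_der)
    have "br h2 f1 + 2 *s f1 = (br h1 f1 + 2 *s f1 - n) + n - br f1 u"
      by (simp add: h2_def brl br_skew[of u f1])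
    then show "br h2 f1 + 2 *s f1 \<in> der r" using hf1 n0 w(3) unfolding u_def
      by (simp only: subspace_add subspace_diff subspace_der)
  qed
  moreover have "e2 - e \<in> r" "f1 - f \<in> r" "h2 - h \<in> r"
    using wr w1 w2 ur rs by (auto simp: e2_def e1_def f1_def h2_def h1_def subspace_neg subspace_diff subspace_add)
  ultimately show ?thesis by blast
qed

text \<open>
  Since \<open>sl\<^sub>2\<close> is perfect, every term of the derived series contains elements congruent to \<open>e\<close>, \<open>f\<close> and \<open>h\<close>.
\<close>

lemma sl2_mod_not_solv:
  assumes r: "is_ideal r G" and g: "g \<subseteq> G" and efh: "sl2_mod r e f h" "e \<notin> r" and mem: "e \<in> g" "f \<in> g" "h \<in> g"
    and G: "subalg G"
  shows "\<not> solv g"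
proof
  assume "solv g"
  then obtain k where k: "(der ^^ k) g \<subseteq> {0}" by (auto simp: solv_def)
  have rs: "subspace r" "r \<subseteq> G" and rI: "\<And>u v. u \<in> G \<Longrightarrow> v \<in> r \<Longrightarrow> br u v \<in> r" using r by (auto simp: is_ideal_def)
  have rI': "br v u \<in> r" if "u \<in> G" "v \<in> r" for u v
    using rI[OF that] br_skew[of v u] rs by (simp add: subspace_neg)
  have sG: "subspace G" using G by (simp add: subalg_def)
  have efhG: "e \<in> G" "f \<in> G" "h \<in> G" using mem g by auto
  have cong: "br x y - br x' y' \<in> r" if "x - x' \<in> r" "y - y' \<in> r" "x \<in> G" "y' \<in> G" for x y x' y'
  proof -
    have "br x y - br x' y' = br x (y - y') + br (x - x') y'" by (simp add: brl brr)
    then show ?thesis using rI rI' that rs by (simp add: subspace_add)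
  qed
  have lift: "x \<in> G" if "x - y \<in> r" "y \<in> G" for x y
  proof -
    have "(x - y) + y \<in> G" using that rs sG by (blast intro: subspace_add)
    then show ?thesis by simp
  qed
  have *: "\<exists>a b c. a \<in> (der ^^ k) g \<and> b \<in> (der ^^ k) g \<and> c \<in> (der ^^ k) g \<and> a - e \<in> r \<and> b - f \<in> r \<and> c - h \<in> r" for k
  proof (induction k)
    case 0
    then show ?case using mem rs by (intro exI[of _ e] exI[of _ f] exI[of _ h]) (auto simp: subspace_0)
  next
    case (Suc k)
    then obtain a b c where abc: "a \<in> (der ^^ k) g" "b \<in> (der ^^ k) g" "c \<in> (der ^^ k) g" "a - e \<in> r" "b - f \<in> r" "c - h \<in> r" by blast
    let ?D = "(der ^^ Suc k) g"
    have D: "br x y \<in> ?D" if "x \<in> (der ^^ k) g" "y \<in> (der ^^ k) g" for x y using br_der that by simp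
    have sD: "subspace ?D" using subspace_der by simp
    have aG: "a \<in> G" "c \<in> G" using lift abc efhG by blast+
    have rel: "br e f - h \<in> r" "br h e - 2 *s e \<in> r" "br h f + 2 *s f \<in> r" using efh by (auto simp: sl2_mod_def)
    have 1: "(1/2) *s br c a - e \<in> r"
    proof -
      have "(1/2) *s br c a - e = (1/2) *s ((br c a - br h e) + (br h e - 2 *s e))"
        by (simp add: sc_distrib)
      then show ?thesis using cong[OF abc(6,4) aG(2) efhG(1)] rel rs by (simp only: subspace_add subspace_scale)
    qed
    have 2: "(- 1/2) *s br c b - f \<in> r"
    proof -
      have "(- 1/2) *s br c b - f = (- 1/2) *s ((br c b - br h f) + (br h f + 2 *s f))"
        by (simp add: sc_distrib)
      then show ?thesis using cong[OF abc(6,5) aG(2) efhG(2)] rel rs by (simp only: subspace_add subspace_scale)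
    qed
    have 3: "br a b - h \<in> r"
    proof -
      have "br a b - h = (br a b - br e f) + (br e f - h)" by simp
      then show ?thesis using cong[OF abc(4,5) aG(1) efhG(2)] rel rs by (simp only: subspace_add)
    qed
    show ?case using 1 2 3 D abc sD subspace_scale[OF sD] by blast
  qed
  obtain a where "a \<in> (der ^^ k) g" "a - e \<in> r" using *[of k] by blast
  then have "- e \<in> r" using k by auto
  then show False using efh(2) subspace_neg[OF rs(1), of "- e"] by simp
qed

text \<open>
  By induction on the dimension, all proper subalgebras may be assumed to be solvable. Let \<open>b\<close> be a maximal one. It
  has an eigenvector \<open>x\<close> in \<open>g / b\<close>, so that \<open>b\<close> and \<open>x\<close> span a subalgebra, which is \<open>g\<close>. Hence
  \<open>g / r\<close> is \<open>sl\<^sub>2\<close> for a solvable ideal \<open>r\<close>. A lift of this \<open>sl\<^sub>2\<close> modulo \<open>[r, r]\<close> generates, together with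
  \<open>[r, r]\<close>, a subalgebra that is not solvable, hence is equal to \<open>g\<close>. Comparison with \<open>r\<close> gives
  \<open>r = [r, r]\<close>, so \<open>r\<close> is zero.
\<close>

theorem not_solv_contains_sl2:
  assumes "subalg g" "finite Y" "g \<subseteq> span Y" "\<not> solv g"
  shows "\<exists>e\<in>g. \<exists>f\<in>g. \<exists>h\<in>g. e \<noteq> 0 \<and> br e f = h \<and> br h e = 2 *s e \<and> br h f = - (2 *s f)"
  using assms
proof (induction "dim g" arbitrary: g rule: less_induct)
  case (less g)
  have sg: "subspace g" using less.prems by (simp add: subalg_def)
  show ?case
  proof (cases "\<exists>g'. subalg g' \<and> g' \<subseteq> g \<and> g' \<noteq> g \<and> \<not> solv g'")
    case True
    then obtain g' where g': "subalg g'" "g' \<subseteq> g" "g' \<noteq> g" "\<not> solv g'" by blast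
    have "dim g' < dim g" using dim_strict_mono[OF g'(2,3) _ less.prems(2,3)] g'(1) by (simp add: subalg_def)
    then show ?thesis using less.hyps[of g'] g' less.prems by blast
  next
    case False
    then have proper_solv: "\<And>g'. subalg g' \<Longrightarrow> g' \<subseteq> g \<Longrightarrow> g' \<noteq> g \<Longrightarrow> solv g'" by blast
    let ?P = "\<lambda>b. subalg b \<and> b \<subseteq> g \<and> b \<noteq> g"
    have "solv {0}" by (auto simp: solv_def intro: exI[of _ 0])
    then have "?P {0}" using less.prems(4) sg by (auto simp: subalg_def brl subspace_0 subspace_def)
    moreover have "\<forall>b. ?P b \<longrightarrow> dim b < Suc (dim g)"
      using dim_strict_mono[OF _ _ _ less.prems(2,3)] by (auto simp: subalg_def less_Suc_eq)
    ultimately obtain b where b: "?P b" "\<And>b'. ?P b' \<Longrightarrow> dim b' \<le> dim b"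
      using ex_has_greatest_nat[of ?P "{0}" dim "Suc (dim g)"] by metis
    have sb: "subspace b" using b by (simp add: subalg_def)
    obtain C where C: "C \<subseteq> b" "independent C" "b \<subseteq> span C" by (rule maximal_independent_subset)
    have Cb: "span C = b" using C sb span_minimal by blast
    have "finite C" using independent_span_bound[OF less.prems(2) C(2)] C(1) b(1) less.prems(3) by blast
    then obtain x where x: "x \<in> g" "x \<notin> b" "\<forall>y\<in>b. \<exists>l. br y x - l *s x \<in> b"
      using lie_theorem[OF less.prems(1-3), of b C] b(1) proper_solv[of b] Cb by auto
    have spb: "span b = b" using sb by (simp add: span_eq_iff)
    have "subalg (span (insert x b))"
    proof (rule subalg_span)
      have xb: "br y x \<in> span (insert x b)" if "y \<in> b" for y
        unfolding span_breakdown_eq spb using x(3) that by blast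
      fix u v assume "u \<in> insert x b" "v \<in> insert x b"
      then consider "u = x" "v = x" | "u = x" "v \<in> b" | "u \<in> b" "v = x" | "u \<in> b" "v \<in> b" by blast
      then show "br u v \<in> span (insert x b)"
      proof cases
        case 1
        then show ?thesis by (simp add: br_self span_zero)
      next
        case 2
        then show ?thesis using span_neg[OF xb[of v]] br_skew[of x v] by simp
      next
        case 3
        then show ?thesis using xb by simp
      next
        case 4
        then show ?thesis using b(1) by (auto simp: subalg_def intro: span_base)
      qed
    qed
    moreover have sub: "span (insert x b) \<subseteq> g" using x b(1) sg by (intro span_minimal) auto
    moreover have bx: "b \<subseteq> span (insert x b)" by (auto intro: span_base)
    moreover have "x \<in> span (insert x b)" by (auto intro: span_base)
    ultimately have gx: "span (insert x b) = g"
      using b(2)[of "span (insert x b)"] dim_strict_mono[OF bx _ sb less.prems(2)] less.prems(3) x(2)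
      by (metis leD order_trans)
    have gx': "\<exists>t. u - t *s x \<in> b" if "u \<in> g" for u
      using that unfolding gx[symmetric] span_breakdown_eq spb .
    obtain r e f h where r: "is_ideal r g" "solv r" and efh: "e \<in> g" "f \<in> g" "h \<in> g" "sl2_mod r e f h"
      and gen: "g \<subseteq> span ({e, f, h} \<union> r)"
      and ind: "\<And>s t u. s *s e + t *s f + u *s h \<in> r \<Longrightarrow> s = 0 \<and> t = 0 \<and> u = 0"
      using codim_one_gives_sl2[OF less.prems _ _ _ x(1,2) gx'] b(1) proper_solv[of b] by blast
    have rs: "subspace r" "r \<subseteq> g" and rI: "\<And>u v. u \<in> g \<Longrightarrow> v \<in> r \<Longrightarrow> br u v \<in> r" using r by (auto simp: is_ideal_def)
    obtain e' f' h' where efh': "e' - e \<in> r" "f' - f \<in> r" "h' - h \<in> r" "sl2_mod (der r) e' f' h'"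
      using sl2_lift_mod_der[OF less.prems(1-3) r(1) efh] by blast
    have lift: "u' \<in> g" if "u' - u \<in> r" "u \<in> g" for u u'
    proof -
      have "(u' - u) + u \<in> g" using that rs sg by (blast intro: subspace_add)
      then show ?thesis by simp
    qed
    have efhg: "e' \<in> g" "f' \<in> g" "h' \<in> g" using lift efh efh' by blast+
    have ind': "s = 0 \<and> t = 0 \<and> u = 0" if "s *s e' + t *s f' + u *s h' \<in> r" for s t u
    proof -
      have "(s *s e' + t *s f' + u *s h') - (s *s (e' - e) + t *s (f' - f) + u *s (h' - h)) \<in> r"
        by (intro subspace_diff[OF rs(1) that] subspace_add rs(1) subspace_scale[OF rs(1) efh'(1)]
            subspace_scale[OF rs(1) efh'(2)] subspace_scale[OF rs(1) efh'(3)])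
      then have "s *s e + t *s f + u *s h \<in> r" by (simp add: sc_distrib algebra_simps)
      then show ?thesis using ind by blast
    qed
    have e'r: "e' \<notin> r" using ind'[of 1 0 0] by auto
    define r' where "r' = der r"
    have r': "is_ideal r' g" unfolding r'_def using ideal_der r(1) .
    have r's: "subspace r'" "r' \<subseteq> g" and r'I: "\<And>u v. u \<in> g \<Longrightarrow> v \<in> r' \<Longrightarrow> br u v \<in> r'" using r' by (auto simp: is_ideal_def)
    have r'r: "r' \<subseteq> r" using rs rI unfolding r'_def by (intro der_minimal) auto
    define A where "A = {e', f', h'} \<union> r'"
    have Ag: "A \<subseteq> g" using efhg r's by (auto simp: A_def)
    have sA: "span A \<subseteq> g" using Ag sg by (rule span_minimal)
    have "subalg (span A)"
    proof (rule subalg_span)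
      have A1: "e' \<in> span A" "f' \<in> span A" "h' \<in> span A" "\<And>v. v \<in> r' \<Longrightarrow> v \<in> span A"
        by (auto simp: A_def intro: span_base)
      have rel: "br e' f' - h' \<in> r'" "br h' e' - 2 *s e' \<in> r'" "br h' f' + 2 *s f' \<in> r'"
        using efh'(4) by (auto simp: sl2_mod_def r'_def)
      have "(br e' f' - h') + h' \<in> span A" "(br h' e' - 2 *s e') + 2 *s e' \<in> span A" "(br h' f' + 2 *s f') - 2 *s f' \<in> span A"
        using span_add[OF A1(4)[OF rel(1)] A1(3)] span_add[OF A1(4)[OF rel(2)] span_scale[OF A1(1)]]
          span_diff[OF A1(4)[OF rel(3)] span_scale[OF A1(2)]] by blast+
      then have br3: "br e' f' \<in> span A" "br h' e' \<in> span A" "br h' f' \<in> span A" by simp_all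
      have br3': "br f' e' \<in> span A" "br e' h' \<in> span A" "br f' h' \<in> span A"
        using br3[THEN span_neg] br_skew[of f' e'] br_skew[of e' h'] br_skew[of f' h'] by simp_all
      have brr': "br u v \<in> span A" "br v u \<in> span A" if "u \<in> g" "v \<in> r'" for u v
        using r'I[OF that] A1(4) br_skew[of v u] by (auto intro: span_neg)
      fix u v assume uv: "u \<in> A" "v \<in> A"
      show "br u v \<in> span A"
      proof (cases "u \<in> r' \<or> v \<in> r'")
        case True
        then show ?thesis using brr' uv Ag by blast
      next
        case False
        then show ?thesis using uv br3 br3' by (auto simp: A_def br_self span_zero)
      qed
    qed
    moreover have "\<not> solv (span A)"
    proof (rule sl2_mod_not_solv[OF r' sA _ _ _ _ _ less.prems(1)])
      show "sl2_mod r' e' f' h'" using efh'(4) by (simp add: r'_def)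
    qed (use e'r r'r in \<open>auto simp: A_def intro: span_base\<close>)
    ultimately have "span A = g" using proper_solv sA by blast
    have "r \<subseteq> r'"
    proof
      fix v assume v: "v \<in> r"
      then have "v \<in> span ({e', f', h'} \<union> r')" using \<open>span A = g\<close> rs by (auto simp: A_def)
      then obtain s t u where stu: "v - s *s e' - t *s f' - u *s h' \<in> r'"
        using r's(1) by (auto simp: span_breakdown_eq span_eq_iff[THEN iffD2])
      have "v - (v - s *s e' - t *s f' - u *s h') \<in> r" using v stu r'r rs by (blast intro: subspace_diff)
      then have "s *s e' + t *s f' + u *s h' \<in> r" by (simp add: algebra_simps)
      then show "v \<in> r'" using ind' stu by force
    qed
    then have "r \<subseteq> {0}" using solv_der_neq[OF r(2)] r'r by (auto simp: r'_def)
    then have "der r \<subseteq> {0}" using r'r by (auto simp: r'_def)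
    then have "br e' f' - h' = 0" "br h' e' - 2 *s e' = 0" "br h' f' + 2 *s f' = 0"
      using efh'(4) by (auto simp: sl2_mod_def)
    moreover have "e' \<noteq> 0" using e'r rs by (auto simp: subspace_0)
    ultimately show ?thesis using efhg by (metis add_eq_0_iff2 right_minus_eq)
  qed
qed

end

section \<open>Polynomials and ideals of finite colength\<close>

text \<open>
  Polynomials in countably many variables, because the number of variables changes in the course of the proof.
\<close>

type_synonym mpoly = "(nat \<Rightarrow>\<^sub>0 nat) \<Rightarrow>\<^sub>0 complex"

definition psc :: "complex \<Rightarrow> mpoly \<Rightarrow> mpoly"
  where "psc c p = Poly_Mapping.single 0 c * p"

definition pmono :: "(nat \<Rightarrow>\<^sub>0 nat) \<Rightarrow> mpoly"
  where "pmono m = Poly_Mapping.single m 1"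

definition mdeg :: "(nat \<Rightarrow>\<^sub>0 nat) \<Rightarrow> nat"
  where "mdeg m = (\<Sum>i\<in>Poly_Mapping.keys m. Poly_Mapping.lookup m i)"

abbreviation pvar :: "nat \<Rightarrow> mpoly"
  where "pvar i \<equiv> pmono (Poly_Mapping.single i 1)"

global_interpretation mp: complex_vector_space psc
  by unfold_locales
    (simp_all add: psc_def algebra_simps single_add mult_single flip: mult.assoc)

lemma lookup_psc: "Poly_Mapping.lookup (psc c p) m = c * Poly_Mapping.lookup p m"
proof -
  have "psc c p = Poly_Mapping.map ((*) c) p" by (simp add: psc_def mult_map_scale_conv_mult)
  then show ?thesis by (simp add: Poly_Mapping.map.rep_eq when_def)
qed

lemma psc_mult_left: "psc c p * q = psc c (p * q)"
  by (simp add: psc_def mult.assoc)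

lemma psc_mult_right: "p * psc c q = psc c (p * q)"
  by (simp add: psc_def mult.left_commute)

lemma psc_1: "psc c 1 = Poly_Mapping.single 0 c"
  by (simp add: psc_def)

lemma mono_0: "pmono 0 = 1"
  by (simp add: pmono_def)

lemma mono_add: "pmono (m + m') = pmono m * pmono m'"
  by (simp add: pmono_def mult_single)

lemma keys_mono: "Poly_Mapping.keys (pmono m) = {m}"
  by (simp add: pmono_def)

lemma lookup_mono: "Poly_Mapping.lookup (pmono m) m' = (if m = m' then 1 else 0)"
  by (simp add: pmono_def lookup_single when_def)

lemma endo_mult: "mp.endo (\<lambda>p. q * p)"
  by (rule mp.endoI) (simp_all add: distrib_left psc_mult_right)

lemma mpoly_sum_mono: "p = (\<Sum>m\<in>Poly_Mapping.keys p. psc (Poly_Mapping.lookup p m) (pmono m))"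
proof (rule poly_mapping_eqI)
  fix m
  have "Poly_Mapping.lookup (\<Sum>m\<in>Poly_Mapping.keys p. psc (Poly_Mapping.lookup p m) (pmono m)) m
    = (\<Sum>k\<in>Poly_Mapping.keys p. if k = m then Poly_Mapping.lookup p m else 0)"
    unfolding lookup_sum lookup_psc lookup_mono by (rule sum.cong) auto
  then show "Poly_Mapping.lookup p m = Poly_Mapping.lookup (\<Sum>m\<in>Poly_Mapping.keys p. psc (Poly_Mapping.lookup p m) (pmono m)) m"
    by (simp add: in_keys_iff)
qed

lemma mpoly_in_subspace:
  assumes "mp.subspace W" "\<And>m. m \<in> Poly_Mapping.keys p \<Longrightarrow> pmono m \<in> W"
  shows "p \<in> W"
  by (subst mpoly_sum_mono) (intro mp.subspace_sum mp.subspace_scale assms)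

lemma endo_eqI:
  assumes "mp.endo S" "mp.endo T" "\<And>m. S (pmono m) = T (pmono m)"
  shows "S p = T p"
proof -
  have "p \<in> {p. S p = T p}"
    by (rule mpoly_in_subspace)
      (use assms in \<open>auto intro!: mp.subspaceI simp: module_hom.add module_hom.scale module_hom.zero\<close>)
  then show ?thesis by simp
qed

definition lin_ext :: "((nat \<Rightarrow>\<^sub>0 nat) \<Rightarrow> mpoly) \<Rightarrow> mpoly \<Rightarrow> mpoly"
  where "lin_ext \<phi> p = (\<Sum>m\<in>Poly_Mapping.keys p. psc (Poly_Mapping.lookup p m) (\<phi> m))"

lemma lin_ext_superset:
  assumes "finite K" "Poly_Mapping.keys p \<subseteq> K"
  shows "lin_ext \<phi> p = (\<Sum>m\<in>K. psc (Poly_Mapping.lookup p m) (\<phi> m))"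
  unfolding lin_ext_def using assms by (intro sum.mono_neutral_left) (auto simp: in_keys_iff)

lemma endo_lin_ext: "mp.endo (lin_ext \<phi>)"
proof (rule mp.endoI)
  fix p q :: mpoly
  let ?K = "Poly_Mapping.keys p \<union> Poly_Mapping.keys q"
  have "Poly_Mapping.keys (p + q) \<subseteq> ?K" by (rule Poly_Mapping.keys_add)
  then show "lin_ext \<phi> (p + q) = lin_ext \<phi> p + lin_ext \<phi> q"
    by (simp add: lin_ext_superset[where K = ?K] lookup_add mp.scale_left_distrib sum.distrib)
next
  fix c p
  have "Poly_Mapping.keys (psc c p) \<subseteq> Poly_Mapping.keys p" by (auto simp: in_keys_iff lookup_psc)
  then show "lin_ext \<phi> (psc c p) = psc c (lin_ext \<phi> p)"
    by (simp add: lin_ext_superset[where K = "Poly_Mapping.keys p"] lookup_psc mp.scale_sum_right)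
qed

lemma lin_ext_mono: "lin_ext \<phi> (pmono m) = \<phi> m"
  by (simp add: lin_ext_def keys_mono lookup_mono)

lemma deg_superset:
  assumes "finite K" "Poly_Mapping.keys m \<subseteq> K"
  shows "mdeg m = (\<Sum>i\<in>K. Poly_Mapping.lookup m i)"
  unfolding mdeg_def using assms by (intro sum.mono_neutral_left) (auto simp: in_keys_iff)

lemma keys_plus_nat: "Poly_Mapping.keys (m + m') = Poly_Mapping.keys m \<union> Poly_Mapping.keys (m' :: nat \<Rightarrow>\<^sub>0 nat)"
  by (auto simp: in_keys_iff lookup_add)

lemma deg_add: "mdeg (m + m') = mdeg m + mdeg m'"
  by (simp add: deg_superset[where K = "Poly_Mapping.keys m \<union> Poly_Mapping.keys m'"]
      keys_plus_nat lookup_add sum.distrib)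

lemma deg_0 [simp]: "mdeg 0 = 0"
  by (simp add: mdeg_def)

lemma deg_single [simp]: "mdeg (Poly_Mapping.single i k) = k"
  by (simp add: mdeg_def)

lemma deg_eq_0: "mdeg m = 0 \<longleftrightarrow> m = 0"
proof
  assume "mdeg m = 0"
  then have "Poly_Mapping.keys m = {}" by (auto simp: mdeg_def in_keys_iff intro: poly_mapping_eqI)
  then show "m = 0" by (simp only: keys_eq_empty)
qed simp

lemma monomial_remove_var:
  assumes "i \<in> Poly_Mapping.keys (m :: nat \<Rightarrow>\<^sub>0 nat)"
  shows "m = Poly_Mapping.single i 1 + (m - Poly_Mapping.single i 1)"
    "mdeg m = Suc (mdeg (m - Poly_Mapping.single i 1))"
    "Poly_Mapping.keys (m - Poly_Mapping.single i 1) \<subseteq> Poly_Mapping.keys m"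
proof -
  show 1: "m = Poly_Mapping.single i 1 + (m - Poly_Mapping.single i 1)"
    using assms by (intro poly_mapping_eqI) (auto simp: lookup_add lookup_minus lookup_single when_def in_keys_iff)
  show "mdeg m = Suc (mdeg (m - Poly_Mapping.single i 1))"
    by (subst 1) (simp add: deg_add)
  show "Poly_Mapping.keys (m - Poly_Mapping.single i 1) \<subseteq> Poly_Mapping.keys m"
    by (auto simp: in_keys_iff lookup_minus)
qed

text \<open>
  For \<open>k = 0\<close> this is the polynomial ring in \<open>n\<close> variables, and in general it is the power \<open>k\<close> of its ideal
  generated by the variables.
\<close>

definition Ord :: "nat \<Rightarrow> nat \<Rightarrow> mpoly set"
  where "Ord n k = {p. \<forall>m\<in>Poly_Mapping.keys p. Poly_Mapping.keys m \<subseteq> {..<n} \<and> k \<le> mdeg m}"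

lemma subspace_Ord: "mp.subspace (Ord n k)"
proof (rule mp.subspaceI)
  fix p q assume "p \<in> Ord n k" "q \<in> Ord n k"
  then show "p + q \<in> Ord n k" using Poly_Mapping.keys_add[of p q] by (auto simp: Ord_def)
next
  fix c p assume "p \<in> Ord n k"
  moreover have "Poly_Mapping.keys (psc c p) \<subseteq> Poly_Mapping.keys p" by (auto simp: in_keys_iff lookup_psc)
  ultimately show "psc c p \<in> Ord n k" by (auto simp: Ord_def)
qed (simp add: Ord_def)

lemma Ord_mult:
  assumes "p \<in> Ord n i" "q \<in> Ord n j"
  shows "p * q \<in> Ord n (i + j)"
  unfolding Ord_def
proof (intro CollectI ballI)
  fix m assume "m \<in> Poly_Mapping.keys (p * q)"
  then obtain a b where "m = a + b" "a \<in> Poly_Mapping.keys p" "b \<in> Poly_Mapping.keys q"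
    using Poly_Mapping.keys_mult[of p q] by blast
  then show "Poly_Mapping.keys m \<subseteq> {..<n} \<and> i + j \<le> mdeg m"
    using assms by (auto simp: Ord_def keys_plus_nat deg_add intro: add_mono)
qed

lemma Ord_antimono: "i \<le> j \<Longrightarrow> Ord n j \<subseteq> Ord n i"
  by (auto simp: Ord_def)

lemma Ord_mult': "p \<in> Ord n i \<Longrightarrow> q \<in> Ord n j \<Longrightarrow> k \<le> i + j \<Longrightarrow> p * q \<in> Ord n k"
  using Ord_mult Ord_antimono by blast

lemma mono_Ord: "pmono m \<in> Ord n k \<longleftrightarrow> Poly_Mapping.keys m \<subseteq> {..<n} \<and> k \<le> mdeg m"
  by (simp add: Ord_def keys_mono)

lemma one_Ord: "1 \<in> Ord n 0"
  using mono_Ord[of 0 n 0] by (simp add: mono_0)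

lemma pvar_Ord: "i < n \<Longrightarrow> pvar i \<in> Ord n 1"
  by (simp add: mono_Ord)

lemma Ord_power: "p \<in> Ord n i \<Longrightarrow> p ^ k \<in> Ord n (i * k)"
  by (induction k) (auto intro: one_Ord Ord_mult simp: algebra_simps)

lemma Ord_in_subspace:
  assumes "p \<in> Ord n k" "mp.subspace W"
    "\<And>m. Poly_Mapping.keys m \<subseteq> {..<n} \<Longrightarrow> k \<le> mdeg m \<Longrightarrow> pmono m \<in> W"
  shows "p \<in> W"
  by (rule mpoly_in_subspace) (use assms in \<open>auto simp: Ord_def\<close>)

lemma Ord_induct_var [consumes 1, case_names const add mult]:
  assumes p: "p \<in> Ord n 0" and c: "\<And>c. P (psc c 1)"
    and a: "\<And>p q. p \<in> Ord n 0 \<Longrightarrow> q \<in> Ord n 0 \<Longrightarrow> P p \<Longrightarrow> P q \<Longrightarrow> P (p + q)"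
    and x: "\<And>i p. i < n \<Longrightarrow> p \<in> Ord n 0 \<Longrightarrow> P p \<Longrightarrow> P (pvar i * p)"
  shows "P p"
proof -
  have m: "P (psc c (pmono m))" if "Poly_Mapping.keys m \<subseteq> {..<n}" for m c
    using that
  proof (induction "mdeg m" arbitrary: m)
    case 0
    then have "m = 0" by (simp add: deg_eq_0)
    then show ?case using c by (simp add: mono_0)
  next
    case (Suc d)
    then obtain i where i: "i \<in> Poly_Mapping.keys m" by (metis mdeg_def equals0I nat.distinct(1) sum.empty)
    let ?m = "m - Poly_Mapping.single i 1"
    note * = monomial_remove_var[OF i]
    have k: "Poly_Mapping.keys ?m \<subseteq> {..<n}" using * Suc.prems by blast
    have "P (psc c (pmono ?m))" using Suc.hyps(1)[of ?m] * Suc.hyps(2) k by simp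
    moreover have "psc c (pmono ?m) \<in> Ord n 0" using mp.subspace_scale[OF subspace_Ord] mono_Ord k by blast
    ultimately have "P (pvar i * psc c (pmono ?m))" using x[of i] i Suc.prems by blast
    moreover have "pvar i * psc c (pmono ?m) = psc c (pmono m)"
      by (subst (2) *(1)) (simp only: mono_add psc_mult_right)
    ultimately show ?case by simp
  qed
  have "P (\<Sum>m\<in>K. psc (Poly_Mapping.lookup p m) (pmono m))" if "finite K" "K \<subseteq> Poly_Mapping.keys p" for K
    using that
  proof (induction K rule: finite_induct)
    case empty
    then show ?case using c[of 0] by simp
  next
    case (insert k K)
    have mem: "psc (Poly_Mapping.lookup p m) (pmono m) \<in> Ord n 0" if "m \<in> Poly_Mapping.keys p" for m
      using that p by (intro mp.subspace_scale[OF subspace_Ord]) (unfold mono_Ord, auto simp: Ord_def)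
    have "(\<Sum>m\<in>K. psc (Poly_Mapping.lookup p m) (pmono m)) \<in> Ord n 0"
      using insert mem by (intro mp.subspace_sum[OF subspace_Ord]) auto
    then show ?case using insert p by (auto intro!: a m mem simp: Ord_def)
  qed
  from this[of "Poly_Mapping.keys p"] show ?thesis by (simp flip: mpoly_sum_mono)
qed

definition subst_poly :: "(nat \<Rightarrow> mpoly) \<Rightarrow> mpoly \<Rightarrow> mpoly"
  where "subst_poly \<theta> = lin_ext (\<lambda>m. \<Prod>i\<in>Poly_Mapping.keys m. \<theta> i ^ Poly_Mapping.lookup m i)"

lemma endo_mult_homI:
  assumes T: "mp.endo T" and m: "\<And>m m'. T (pmono (m + m')) = T (pmono m) * T (pmono m')"
  shows "T (p * q) = T p * T q"
proof -
  have 1: "T (pmono m * q) = T (pmono m) * T q" for m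
    by (rule endo_eqI[of "\<lambda>q. T (pmono m * q)" "\<lambda>q. T (pmono m) * T q" q])
      (use m T in \<open>auto intro!: mp.endoI simp: module_hom.add module_hom.scale distrib_left psc_mult_right mono_add\<close>)
  show ?thesis
    by (rule endo_eqI[of "\<lambda>p. T (p * q)" "\<lambda>p. T p * T q" p])
      (use 1 T in \<open>auto intro!: mp.endoI simp: module_hom.add module_hom.scale distrib_right psc_mult_left\<close>)
qed

lemma endo_subst: "mp.endo (subst_poly \<theta>)"
  unfolding subst_poly_def by (rule endo_lin_ext)

lemma subst_mono: "finite K \<Longrightarrow> Poly_Mapping.keys m \<subseteq> K \<Longrightarrow>
    subst_poly \<theta> (pmono m) = (\<Prod>i\<in>K. \<theta> i ^ Poly_Mapping.lookup m i)"
  unfolding subst_poly_def lin_ext_mono by (intro prod.mono_neutral_left) (auto simp: in_keys_iff)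

lemma subst_mult: "subst_poly \<theta> (p * q) = subst_poly \<theta> p * subst_poly \<theta> q"
proof (rule endo_mult_homI[OF endo_subst])
  fix m m' :: "nat \<Rightarrow>\<^sub>0 nat"
  let ?K = "Poly_Mapping.keys m \<union> Poly_Mapping.keys m'"
  show "subst_poly \<theta> (pmono (m + m')) = subst_poly \<theta> (pmono m) * subst_poly \<theta> (pmono m')"
    by (simp add: subst_mono[where K = ?K] keys_plus_nat lookup_add power_add prod.distrib)
qed

lemma subst_1: "subst_poly \<theta> 1 = 1"
  using subst_mono[of "{}" 0 \<theta>] by (simp add: mono_0)

lemma subst_pvar: "subst_poly \<theta> (pvar i) = \<theta> i"
  using subst_mono[of "{i}" "Poly_Mapping.single i 1" \<theta>] by simp

lemma subst_Ord:
  assumes "\<And>i. i < n \<Longrightarrow> \<theta> i \<in> Ord N 1" "p \<in> Ord n k"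
  shows "subst_poly \<theta> p \<in> Ord N k"
proof -
  have mn: "subst_poly \<theta> (pmono m) \<in> Ord N (mdeg m)" if "Poly_Mapping.keys m \<subseteq> {..<n}" for m
  proof -
    have "(\<Prod>i\<in>K. \<theta> i ^ Poly_Mapping.lookup m i) \<in> Ord N (\<Sum>i\<in>K. Poly_Mapping.lookup m i)"
      if "finite K" "K \<subseteq> {..<n}" for K
      using that
    proof (induction K rule: finite_induct)
      case (insert i K)
      have "\<theta> i ^ Poly_Mapping.lookup m i \<in> Ord N (1 * Poly_Mapping.lookup m i)"
        using insert assms(1) by (intro Ord_power) auto
      then show ?case using insert by (auto intro: Ord_mult)
    qed (simp add: one_Ord)
    from this[of "Poly_Mapping.keys m"] that show ?thesis
      by (simp add: subst_mono[of "Poly_Mapping.keys m"] mdeg_def)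
  qed
  have "p \<in> {p. subst_poly \<theta> p \<in> Ord N k}"
  proof (rule Ord_in_subspace[OF assms(2)])
    show "mp.subspace {p. subst_poly \<theta> p \<in> Ord N k}"
      using subspace_Ord by (intro mp.subspaceI)
        (auto simp: module_hom.add[OF endo_subst] module_hom.scale[OF endo_subst] module_hom.zero[OF endo_subst]
          mp.subspace_add mp.subspace_scale mp.subspace_0)
    show "pmono m \<in> {p. subst_poly \<theta> p \<in> Ord N k}" if "Poly_Mapping.keys m \<subseteq> {..<n}" "k \<le> mdeg m" for m
      using mn[OF that(1)] Ord_antimono[OF that(2)] by blast
  qed
  then show ?thesis by simp
qed

definition derivation :: "(mpoly \<Rightarrow> mpoly) \<Rightarrow> bool"
  where "derivation D \<longleftrightarrow> mp.endo D \<and> (\<forall>p q. D (p * q) = D p * q + p * D q)"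

lemma
  assumes "derivation D"
  shows derivation_endo: "mp.endo D"
    and derivation_add: "D (p + q) = D p + D q"
    and derivation_scale: "D (psc c p) = psc c (D p)"
    and derivation_mult: "D (p * q) = D p * q + p * D q"
  using assms module_hom.add[of psc psc D] module_hom.scale[of psc psc D]
  by (auto simp: derivation_def)

lemma derivation_1: "derivation D \<Longrightarrow> D (psc c 1) = 0"
proof -
  assume D: "derivation D"
  then have "D (1 * 1) = D 1 * 1 + 1 * D 1" by (simp only: derivation_def)
  then have "D 1 = 0" by simp
  then show ?thesis using derivation_scale[OF D] by simp
qed

text \<open>
  The derivation \<open>\<Sum>i<n. a i * d/dx\<^sub>i\<close>.
\<close>

definition pderivation :: "nat \<Rightarrow> (nat \<Rightarrow> mpoly) \<Rightarrow> mpoly \<Rightarrow> mpoly"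
  where "pderivation n a = lin_ext (\<lambda>m. \<Sum>i<n. psc (of_nat (Poly_Mapping.lookup m i)) (pmono (m - Poly_Mapping.single i 1) * a i))"

lemma mono_minus_add:
  "psc (of_nat (Poly_Mapping.lookup m i)) (pmono (m + m' - Poly_Mapping.single i 1))
    = psc (of_nat (Poly_Mapping.lookup m i)) (pmono (m - Poly_Mapping.single i 1) * pmono m')"
proof (cases "Poly_Mapping.lookup m i = 0")
  case False
  then have "m + m' - Poly_Mapping.single i 1 = (m - Poly_Mapping.single i 1) + m'"
    by (intro poly_mapping_eqI) (auto simp: lookup_add lookup_minus lookup_single when_def)
  then show ?thesis by (simp add: mono_add)
qed simp

lemma derivation_pderivation: "derivation (pderivation n a)"
proof -
  let ?D = "pderivation n a"
  have E: "mp.endo ?D" unfolding pderivation_def by (rule endo_lin_ext)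
  note lin = module_hom.add[OF E] module_hom.scale[OF E]
  have Dm: "?D (pmono m) = (\<Sum>i<n. psc (of_nat (Poly_Mapping.lookup m i)) (pmono (m - Poly_Mapping.single i 1) * a i))" for m
    by (simp add: pderivation_def lin_ext_mono)
  have mm: "?D (pmono m * pmono m') = ?D (pmono m) * pmono m' + pmono m * ?D (pmono m')" for m m'
  proof -
    have "psc (of_nat (Poly_Mapping.lookup (m + m') i)) (pmono (m + m' - Poly_Mapping.single i 1) * a i)
      = psc (of_nat (Poly_Mapping.lookup m i)) (pmono (m - Poly_Mapping.single i 1) * a i) * pmono m'
        + pmono m * psc (of_nat (Poly_Mapping.lookup m' i)) (pmono (m' - Poly_Mapping.single i 1) * a i)" for i
    proof -
      have "psc (of_nat (Poly_Mapping.lookup (m + m') i)) (pmono (m + m' - Poly_Mapping.single i 1) * a i)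
        = psc (of_nat (Poly_Mapping.lookup m i)) (pmono (m + m' - Poly_Mapping.single i 1)) * a i
         + psc (of_nat (Poly_Mapping.lookup m' i)) (pmono (m' + m - Poly_Mapping.single i 1)) * a i"
        by (simp add: lookup_add mp.scale_left_distrib psc_mult_left add.commute[of m' m])
      then show ?thesis unfolding mono_minus_add
        by (simp add: psc_mult_left psc_mult_right mult_ac)
    qed
    then show ?thesis by (simp add: mono_add[symmetric] Dm sum.distrib sum_distrib_left sum_distrib_right)
  qed
  have 1: "?D (pmono m * q) = ?D (pmono m) * q + pmono m * ?D q" for m q
    by (rule endo_eqI[of "\<lambda>q. ?D (pmono m * q)" "\<lambda>q. ?D (pmono m) * q + pmono m * ?D q" q])
      (use mm in \<open>auto intro!: mp.endoI simp: lin distrib_left psc_mult_right mp.scale_right_distrib\<close>)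
  have "?D (p * q) = ?D p * q + p * ?D q" for p q
    by (rule endo_eqI[of "\<lambda>p. ?D (p * q)" "\<lambda>p. ?D p * q + p * ?D q" p])
      (use 1 in \<open>auto intro!: mp.endoI simp: lin distrib_right psc_mult_left mp.scale_right_distrib\<close>)
  then show ?thesis using E by (simp add: derivation_def)
qed

lemma pderivation_pvar:
  assumes "i < n"
  shows "pderivation n a (pvar i) = a i"
proof -
  have "pderivation n a (pvar i) = (\<Sum>j<n. if j = i then a i else 0)"
    unfolding pderivation_def lin_ext_mono
    by (intro sum.cong) (auto simp: lookup_single when_def mono_0)
  then show ?thesis using assms by simp
qed

definition is_pideal :: "nat \<Rightarrow> mpoly set \<Rightarrow> bool"
  where "is_pideal n J \<longleftrightarrow> mp.subspace J \<and> J \<subseteq> Ord n 0 \<and> (\<forall>a\<in>Ord n 0. \<forall>j\<in>J. a * j \<in> J)"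

lemma is_pideal_span:
  assumes "B \<subseteq> Ord n 0" "\<And>a b. a \<in> Ord n 0 \<Longrightarrow> b \<in> B \<Longrightarrow> a * b \<in> mp.span B"
  shows "is_pideal n (mp.span B)"
  unfolding is_pideal_def
proof (intro conjI ballI)
  show "mp.span B \<subseteq> Ord n 0" using assms(1) subspace_Ord by (rule mp.span_minimal)
  fix a j assume a: "a \<in> Ord n 0" and j: "j \<in> mp.span B"
  show "a * j \<in> mp.span B"
    by (rule mp.endo_image_span[OF endo_mult j]) (use assms a in auto)
qed (rule mp.subspace_span)

text \<open>
  The product of \<open>I\<close> and the ideal generated by the variables. In the situations below, its codimension in \<open>I\<close> is
  the minimal number of generators of \<open>I\<close> at the origin.
\<close>

definition max_times :: "nat \<Rightarrow> mpoly set \<Rightarrow> mpoly set"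
  where "max_times n I = mp.span {a * b | a b. a \<in> Ord n 1 \<and> b \<in> I}"

definition gen_ideal :: "nat \<Rightarrow> mpoly set \<Rightarrow> mpoly set"
  where "gen_ideal n Z = mp.span {a * z | a z. a \<in> Ord n 0 \<and> z \<in> Z}"

lemma is_pideal_max_times:
  assumes "is_pideal n I"
  shows "is_pideal n (max_times n I)"
  unfolding max_times_def
proof (rule is_pideal_span)
  show "{a * b |a b. a \<in> Ord n 1 \<and> b \<in> I} \<subseteq> Ord n 0"
    using assms by (auto simp: is_pideal_def intro: Ord_mult'[of _ n 1 _ 0])
  fix a b assume "a \<in> Ord n 0" "b \<in> {a * b |a b. a \<in> Ord n 1 \<and> b \<in> I}"
  then obtain u v where uv: "a \<in> Ord n 0" "b = u * v" "u \<in> Ord n 1" "v \<in> I" by blast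
  then have "a * b = (a * u) * v" "a * u \<in> Ord n 1" by (auto simp: mult.assoc intro: Ord_mult'[of _ n 0 _ 1])
  then show "a * b \<in> mp.span {a * b |a b. a \<in> Ord n 1 \<and> b \<in> I}" using uv by (intro mp.span_base) blast
qed

lemma max_times_subset: "is_pideal n I \<Longrightarrow> max_times n I \<subseteq> I"
  unfolding max_times_def using Ord_antimono[of 0 1 n]
  by (intro mp.span_minimal) (auto simp: is_pideal_def)

lemma is_pideal_gen:
  assumes "Z \<subseteq> Ord n 0"
  shows "is_pideal n (gen_ideal n Z)"
  unfolding gen_ideal_def
proof (rule is_pideal_span)
  show "{a * z |a z. a \<in> Ord n 0 \<and> z \<in> Z} \<subseteq> Ord n 0"
    using assms by (auto intro: Ord_mult'[of _ n 0 _ 0])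
  fix a b assume "a \<in> Ord n 0" "b \<in> {a * z |a z. a \<in> Ord n 0 \<and> z \<in> Z}"
  then obtain u v where uv: "a \<in> Ord n 0" "b = u * v" "u \<in> Ord n 0" "v \<in> Z" by blast
  then have "a * b = (a * u) * v" "a * u \<in> Ord n 0" by (auto simp: mult.assoc intro: Ord_mult'[of _ n 0 _ 0])
  then show "a * b \<in> mp.span {a * z |a z. a \<in> Ord n 0 \<and> z \<in> Z}" using uv by (intro mp.span_base) blast
qed

lemma gen_ideal_base: "z \<in> Z \<Longrightarrow> z \<in> gen_ideal n Z"
  unfolding gen_ideal_def by (rule mp.span_base) (use one_Ord in force)

lemma derivation_into_ideal:
  assumes D: "derivation D" and J: "is_pideal n J" and x: "\<And>i. i < n \<Longrightarrow> D (pvar i) \<in> J"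
    and p: "p \<in> Ord n 0"
  shows "D p \<in> J"
  using p
proof (induction p rule: Ord_induct_var)
  case (const c)
  then show ?case using derivation_1[OF D] J by (simp add: is_pideal_def mp.subspace_0)
next
  case (add p q)
  then show ?case using derivation_add[OF D] J by (simp add: is_pideal_def mp.subspace_add)
next
  case (mult i p)
  have "D (pvar i * p) = p * D (pvar i) + pvar i * D p" using D by (simp add: derivation_def mult.commute)
  moreover have "p * D (pvar i) \<in> J" "pvar i * D p \<in> J"
    using mult x J pvar_Ord[of i n] Ord_antimono[of 0 1 n] by (auto simp: is_pideal_def)
  ultimately show ?case using J by (simp add: is_pideal_def mp.subspace_add)
qed

definition low_monomials :: "nat \<Rightarrow> nat \<Rightarrow> (nat \<Rightarrow>\<^sub>0 nat) set"
  where "low_monomials n M = {m. Poly_Mapping.keys m \<subseteq> {..<n} \<and> mdeg m < M}"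

definition monomial_of :: "nat \<Rightarrow> (nat \<Rightarrow> nat) \<Rightarrow> (nat \<Rightarrow>\<^sub>0 nat)"
  where "monomial_of n g = (\<Sum>i<n. Poly_Mapping.single i (g i))"

lemma lookup_monomial_of: "Poly_Mapping.lookup (monomial_of n g) i = (if i < n then g i else 0)"
  by (simp add: monomial_of_def lookup_sum lookup_single when_def)

lemma keys_monomial_of: "Poly_Mapping.keys (monomial_of n g) \<subseteq> {..<n}"
  by (auto simp: in_keys_iff lookup_monomial_of split: if_splits)

lemma deg_monomial_of: "mdeg (monomial_of n g) = (\<Sum>i<n. g i)"
  using deg_superset[OF _ keys_monomial_of, of n g] by (simp add: lookup_monomial_of)

lemma finite_low_monomials: "finite (low_monomials n M)"
proof (rule finite_surj)
  show "finite ({..<n} \<rightarrow>\<^sub>E {..<M})" by (intro finite_PiE) auto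
  show "low_monomials n M \<subseteq> monomial_of n ` ({..<n} \<rightarrow>\<^sub>E {..<M})"
  proof
    fix m assume m: "m \<in> low_monomials n M"
    have "Poly_Mapping.lookup m i < M" for i
    proof (cases "i \<in> Poly_Mapping.keys m")
      case True
      then have "Poly_Mapping.lookup m i \<le> mdeg m" unfolding mdeg_def by (intro member_le_sum) auto
      then show ?thesis using m by (simp add: low_monomials_def)
    qed (use m in \<open>auto simp: low_monomials_def in_keys_iff\<close>)
    moreover have "m = monomial_of n (restrict (Poly_Mapping.lookup m) {..<n})"
      using m by (intro poly_mapping_eqI) (auto simp: lookup_monomial_of low_monomials_def in_keys_iff)
    moreover have "restrict (Poly_Mapping.lookup m) {..<n} \<in> {..<n} \<rightarrow>\<^sub>E {..<M}"
      using \<open>\<And>i. Poly_Mapping.lookup m i < M\<close> by simp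
    ultimately show "m \<in> monomial_of n ` ({..<n} \<rightarrow>\<^sub>E {..<M})" by (metis image_eqI)
  qed
qed

lemma Ord_low_decompose: "Ord n 0 \<subseteq> mp.span (pmono ` low_monomials n M \<union> Ord n M)"
proof
  fix p assume "p \<in> Ord n 0"
  then show "p \<in> mp.span (pmono ` low_monomials n M \<union> Ord n M)"
  proof (rule Ord_in_subspace[OF _ mp.subspace_span])
    fix m :: "nat \<Rightarrow>\<^sub>0 nat" assume "Poly_Mapping.keys m \<subseteq> {..<n}"
    then show "pmono m \<in> mp.span (pmono ` low_monomials n M \<union> Ord n M)"
      by (intro mp.span_base) (auto simp: low_monomials_def mono_Ord not_less)
  qed
qed

text \<open>
  If all polynomials of order at least \<open>M\<close> belong to the ideal generated by \<open>Z\<close>, up to order \<open>k\<close>, then every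
  polynomial is a combination of monomials of degree less than \<open>M\<close> whose coefficients are polynomials in the
  elements of \<open>Z\<close>. Products of at least \<open>k\<close> elements of \<open>Z\<close> may be discarded.
\<close>

lemma low_monomials_span:
  assumes Z: "finite Z" "Z \<subseteq> Ord n 1"
    and M: "Ord n M \<subseteq> mp.span (gen_ideal n Z \<union> Ord n k)"
  shows "\<exists>G. finite G \<and> card G \<le> k ^ card Z * card (low_monomials n M) \<and> Ord n 0 \<subseteq> mp.span (G \<union> Ord n k)"
proof -
  define h where "h \<alpha> = (\<Prod>z\<in>Z. z ^ \<alpha> z)" for \<alpha> :: "mpoly \<Rightarrow> nat"
  define G where "G = (\<lambda>(\<alpha>, m). h \<alpha> * pmono m) ` ((Z \<rightarrow>\<^sub>E {..<k}) \<times> low_monomials n M)"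
  have fin: "finite ((Z \<rightarrow>\<^sub>E {..<k}) \<times> low_monomials n M)"
    using Z finite_low_monomials by (intro finite_cartesian_product finite_PiE) auto
  have "card G \<le> card ((Z \<rightarrow>\<^sub>E {..<k}) \<times> low_monomials n M)"
    unfolding G_def by (rule card_image_le[OF fin])
  also have "\<dots> = k ^ card Z * card (low_monomials n M)"
    using Z by (simp add: card_cartesian_product card_PiE)
  finally have cardG: "card G \<le> k ^ card Z * card (low_monomials n M)" .
  have h_Ord: "h \<alpha> \<in> Ord n (\<Sum>z\<in>Z. \<alpha> z)" for \<alpha>
  proof -
    have "(\<Prod>z\<in>K. z ^ \<alpha> z) \<in> Ord n (\<Sum>z\<in>K. \<alpha> z)" if "finite K" "K \<subseteq> Z" for K
      using that
    proof (induction K rule: finite_induct)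
      case (insert z K)
      have "z ^ \<alpha> z \<in> Ord n (1 * \<alpha> z)" using insert Z(2) by (intro Ord_power) auto
      then show ?case using insert by (auto intro: Ord_mult)
    qed (simp add: one_Ord)
    then show ?thesis using Z(1) by (simp add: h_def)
  qed
  let ?S = "mp.span (G \<union> Ord n k)"
  have gens: "Ord n 0 \<subseteq> mp.span (pmono ` low_monomials n M \<union> {a * z | a z. a \<in> Ord n 0 \<and> z \<in> Z} \<union> Ord n k)" (is "_ \<subseteq> mp.span ?A")
  proof -
    have "gen_ideal n Z \<subseteq> mp.span ?A" unfolding gen_ideal_def by (intro mp.span_mono) auto
    moreover have "Ord n k \<subseteq> mp.span ?A" by (auto intro: mp.span_base)
    ultimately have "mp.span (gen_ideal n Z \<union> Ord n k) \<subseteq> mp.span ?A" by (intro mp.span_minimal) auto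
    then have "Ord n M \<subseteq> mp.span ?A" using M by blast
    moreover have "pmono ` low_monomials n M \<subseteq> mp.span ?A" by (auto intro: mp.span_base)
    ultimately have "mp.span (pmono ` low_monomials n M \<union> Ord n M) \<subseteq> mp.span ?A" by (intro mp.span_minimal) auto
    then show ?thesis using Ord_low_decompose by blast
  qed
  have main: "h \<alpha> * a \<in> ?S" if "a \<in> Ord n 0" for \<alpha> a
    using that
  proof (induction "k - (\<Sum>z\<in>Z. \<alpha> z)" arbitrary: \<alpha> a)
    case 0
    then have "h \<alpha> * a \<in> Ord n k" by (intro Ord_mult'[OF h_Ord]) auto
    then show ?case by (auto intro: mp.span_base)
  next
    case (Suc d)
    show ?case
    proof (rule mp.endo_image_span[OF endo_mult subsetD[OF gens Suc.prems] _ mp.subspace_span], safe)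
      fix m assume m: "m \<in> low_monomials n M"
      have "\<alpha> z < k" if "z \<in> Z" for z
      proof -
        have "\<alpha> z \<le> (\<Sum>z\<in>Z. \<alpha> z)" using that Z(1) by (intro member_le_sum) auto
        then show ?thesis using Suc.hyps(2) by simp
      qed
      then have "restrict \<alpha> Z \<in> Z \<rightarrow>\<^sub>E {..<k}" by auto
      moreover have "h \<alpha> = h (restrict \<alpha> Z)" by (simp add: h_def)
      ultimately have "h \<alpha> * pmono m \<in> G" unfolding G_def using m by (intro image_eqI[of _ _ "(restrict \<alpha> Z, m)"]) auto
      then show "h \<alpha> * pmono m \<in> ?S" by (auto intro: mp.span_base)
    next
      fix b z assume bz: "b \<in> Ord n 0" "z \<in> Z"
      define \<beta> where "\<beta> = \<alpha>(z := Suc (\<alpha> z))"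
      have "h \<beta> = z ^ Suc (\<alpha> z) * (\<Prod>y\<in>Z - {z}. y ^ \<alpha> y)"
        using bz Z(1) by (simp add: h_def \<beta>_def prod.remove[of Z z])
      moreover have "h \<alpha> = z ^ \<alpha> z * (\<Prod>y\<in>Z - {z}. y ^ \<alpha> y)"
        using bz Z(1) by (simp add: h_def prod.remove[of Z z])
      ultimately have eq: "h \<alpha> * (b * z) = h \<beta> * b" by (simp add: mult_ac)
      have "(\<Sum>y\<in>Z. \<beta> y) = Suc (\<Sum>y\<in>Z. \<alpha> y)"
        using bz Z(1) by (simp add: \<beta>_def sum.remove[of Z z])
      then show "h \<alpha> * (b * z) \<in> ?S" unfolding eq using Suc.hyps(1)[of \<beta> b] Suc.hyps(2) bz(1) by simp
    next
      fix q assume "q \<in> Ord n k"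
      then have "h \<alpha> * q \<in> Ord n k" by (intro Ord_mult'[OF h_Ord]) auto
      then show "h \<alpha> * q \<in> ?S" by (auto intro: mp.span_base)
    qed
  qed
  have "Ord n 0 \<subseteq> ?S" using main[of _ "\<lambda>_. 0"] by (auto simp: h_def)
  then show ?thesis using cardG fin by (intro exI[of _ G]) (auto simp: G_def)
qed

text \<open>
  An ideal of finite colength at the origin needs at least as many generators as there are variables. The spanning set of
  \<open>low_monomials_span\<close> has a cardinality of order \<open>k ^ card Z\<close>, whereas the polynomials modulo order
  \<open>k\<close> have a dimension of order \<open>k ^ n\<close>. For the latter, \<open>k = n * t\<close> and the \<open>t ^ n\<close> monomials with all
  exponents less than \<open>t\<close> are enough.
\<close>

theorem num_generators_ge_num_vars:
  assumes Z: "finite Z" "Z \<subseteq> Ord n 1"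
    and M: "\<And>k. Ord n M \<subseteq> mp.span (gen_ideal n Z \<union> Ord n k)"
  shows "n \<le> card Z"
proof (rule ccontr)
  assume "\<not> n \<le> card Z"
  then have lt: "card Z < n" by simp
  define b where "b = card (low_monomials n M)"
  have bound: "t ^ n \<le> (n * t) ^ card Z * b" if t: "t > 0" for t
  proof -
    define k where "k = n * t"
    obtain G where G: "finite G" "card G \<le> k ^ card Z * b" "Ord n 0 \<subseteq> mp.span (G \<union> Ord n k)"
      using low_monomials_span[OF Z M] unfolding b_def by blast
    let ?I = "{..<n} \<rightarrow>\<^sub>E {..<t}"
    have fI: "finite ?I" by (intro finite_PiE) auto
    have "mp.indep_mod (Ord n k) ?I (\<lambda>g. pmono (monomial_of n g))"
      unfolding mp.indep_mod_def
    proof (intro allI impI ballI)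
      fix c g assume s: "(\<Sum>i\<in>?I. psc (c i) (pmono (monomial_of n i))) \<in> Ord n k" and g: "g \<in> ?I"
      have inj: "monomial_of n i = monomial_of n g \<longleftrightarrow> i = g" if "i \<in> ?I" for i
      proof
        assume e: "monomial_of n i = monomial_of n g"
        show "i = g"
        proof (rule PiE_ext[OF that g])
          fix j assume "j \<in> {..<n}"
          then show "i j = g j" using arg_cong[OF e, of "\<lambda>m. Poly_Mapping.lookup m j"] by (simp add: lookup_monomial_of)
        qed
      qed simp
      have "Poly_Mapping.lookup (\<Sum>i\<in>?I. psc (c i) (pmono (monomial_of n i))) (monomial_of n g)
        = (\<Sum>i\<in>?I. if i = g then c g else 0)"
        unfolding lookup_sum
      proof (rule sum.cong[OF refl])
        fix i assume i: "i \<in> ?I"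
        show "Poly_Mapping.lookup (psc (c i) (pmono (monomial_of n i))) (monomial_of n g) = (if i = g then c g else 0)"
          unfolding lookup_psc lookup_mono inj[OF i] by simp
      qed
      also have "\<dots> = c g" using g by (subst sum.delta[OF fI]) (rule if_P)
      finally have l: "Poly_Mapping.lookup (\<Sum>i\<in>?I. psc (c i) (pmono (monomial_of n i))) (monomial_of n g) = c g" .
      show "c g = 0"
      proof (rule ccontr)
        assume "c g \<noteq> 0"
        then have "monomial_of n g \<in> Poly_Mapping.keys (\<Sum>i\<in>?I. psc (c i) (pmono (monomial_of n i)))"
          using l by (simp add: in_keys_iff)
        then have "k \<le> mdeg (monomial_of n g)" using s by (auto simp: Ord_def)
        also have "\<dots> = (\<Sum>i<n. g i)" by (rule deg_monomial_of)
        also have "\<dots> < (\<Sum>i<n. t)" using g lt by (intro sum_strict_mono) (auto simp: PiE_def Pi_def)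
        finally show False by (simp add: k_def)
      qed
    qed
    moreover have "pmono (monomial_of n g) \<in> mp.span (G \<union> Ord n k)" for g
      using G(3) keys_monomial_of mono_Ord by (metis le0 subsetD)
    ultimately have "card ?I \<le> card G"
      by (intro mp.indep_mod_card_le[OF fI G(1) subspace_Ord])
    moreover have "card ?I = t ^ n" by (simp add: card_PiE)
    ultimately show ?thesis using G(2) by (simp add: k_def)
  qed
  define t where "t = Suc (n ^ card Z * b)"
  have "t > 0" by (simp add: t_def)
  then have "t ^ n \<le> t ^ card Z * (n ^ card Z * b)" using bound[of t] by (simp add: power_mult_distrib mult_ac)
  also have "\<dots> < t ^ card Z * t" by (simp add: t_def)
  also have "\<dots> = t ^ Suc (card Z)" by simp
  also have "\<dots> \<le> t ^ n" using lt by (intro power_increasing) (auto simp: t_def)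
  finally show False by simp
qed

section \<open>Bases that are stable under a lowering operator\<close>

context complex_vector_space
begin

lemma indep_mod_image:
  assumes U: "subspace U" and f: "endo f" and G: "subspace G" "B \<subseteq> G" "finite B"
    and inj: "\<And>v. v \<in> G \<Longrightarrow> f v \<in> U \<Longrightarrow> v \<in> U" and ind: "indep_mod U B id"
  shows "inj_on f B" "indep_mod U (f ` B) id"
proof -
  show i: "inj_on f B"
  proof (rule inj_onI, rule ccontr)
    fix b b' assume b: "b \<in> B" "b' \<in> B" "f b = f b'" "b \<noteq> b'"
    have "f (b - b') = 0" using b by (simp add: module_hom.diff[OF f])
    then have "b - b' \<in> U" using inj[of "b - b'"] b subspace_diff[OF G(1), of b b'] G(2) subspace_0[OF U] by auto
    moreover define c where "c k = (if k = b then 1 else if k = b' then - 1 else (0::complex))" for k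
    have "(\<Sum>k\<in>B. c k *s id k) = (\<Sum>k\<in>{b, b'}. c k *s id k)"
      using b G(3) by (intro sum.mono_neutral_right) (auto simp: c_def)
    ultimately have "(\<Sum>k\<in>B. c k *s id k) \<in> U" using b(4) by (simp add: c_def)
    then have "c b = 0" using ind b unfolding indep_mod_def by blast
    then show False by (simp add: c_def)
  qed
  show "indep_mod U (f ` B) id"
    unfolding indep_mod_def
  proof (intro allI impI)
    fix c assume "(\<Sum>y\<in>f ` B. c y *s id y) \<in> U"
    then have "f (\<Sum>b\<in>B. c (f b) *s b) \<in> U"
      by (simp add: sum.reindex[OF i] module_hom.sum[OF f] module_hom.scale[OF f])
    moreover have "(\<Sum>b\<in>B. c (f b) *s b) \<in> G" using G by (intro subspace_sum subspace_scale) auto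
    ultimately have "(\<Sum>b\<in>B. c (f b) *s id b) \<in> U" using inj by simp
    then have "\<forall>b\<in>B. c (f b) = 0" using ind[unfolded indep_mod_def, rule_format, of "\<lambda>b. c (f b)"] by blast
    then show "\<forall>y\<in>f ` B. c y = 0" by blast
  qed
qed

text \<open>
  A basis \<open>B\<close> of \<open>V / U\<close>, homogeneous for the subspaces \<open>G d\<close>, on whose elements of weight at least 2
  the operator \<open>f\<close> acts as an injective map into \<open>B\<close>. The condition stops at weight 2, since \<open>f\<close> lowers weights
  by 2 and the counting concerns nonnegative weights only.
\<close>

definition string_basis :: "('b \<Rightarrow> 'b) \<Rightarrow> (int \<Rightarrow> 'b set) \<Rightarrow> 'b set \<Rightarrow> 'b set \<Rightarrow> 'b set \<Rightarrow> ('b \<Rightarrow> int) \<Rightarrow> bool"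
  where "string_basis f G V U B w \<longleftrightarrow>
    finite B \<and> B \<subseteq> V \<and> indep_mod U B id \<and> V \<subseteq> span (B \<union> U) \<and>
    (\<forall>b\<in>B. b \<in> G (w b)) \<and> (\<forall>b\<in>B. 2 \<le> w b \<longrightarrow> f b \<in> B \<and> w (f b) = w b - 2) \<and>
    inj_on f {b \<in> B. 2 \<le> w b}"

text \<open>
  Construct the parts of weight \<open>d\<close> from the highest weight downwards: the images under \<open>f\<close> of the basis in weight
  \<open>d + 2\<close> are independent by injectivity, and they are extended to a basis of \<open>G d\<close> modulo \<open>U\<close>.
\<close>

theorem string_basis_exists:
  assumes U: "subspace U" and G: "\<And>d. subspace (G d)" "\<And>d. G d \<subseteq> V" and fd: "fin_dim_mod V U"
    and f: "endo f" and fG: "\<And>d v. 2 \<le> d \<Longrightarrow> v \<in> G d \<Longrightarrow> f v \<in> G (d - 2)"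
    and inj: "\<And>d v. 2 \<le> d \<Longrightarrow> v \<in> G d \<Longrightarrow> f v \<in> U \<Longrightarrow> v \<in> U"
    and gen: "V \<subseteq> span (U \<union> (\<Union>d. G d))"
    and ind: "\<And>D x. finite D \<Longrightarrow> (\<And>d. d \<in> D \<Longrightarrow> x d \<in> G d) \<Longrightarrow> (\<Sum>d\<in>D. x d) \<in> U \<Longrightarrow> \<forall>d\<in>D. x d \<in> U"
  shows "\<exists>B w. string_basis f G V U B w"
proof -
  define D0 where "D0 = {d. \<not> G d \<subseteq> U}"
  have finD0: "finite D0"
  proof (rule ccontr)
    assume inf: "infinite D0"
    obtain Y where Y: "finite Y" "V \<subseteq> span (Y \<union> U)" using fd by (auto simp: fin_dim_mod_def)
    obtain D where D: "D \<subseteq> D0" "finite D" "card D = Suc (card Y)"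
      using infinite_arbitrarily_large[OF inf] by blast
    have "\<forall>d\<in>D. \<exists>v. v \<in> G d \<and> v \<notin> U" using D(1) by (auto simp: D0_def)
    then obtain v where v: "\<And>d. d \<in> D \<Longrightarrow> v d \<in> G d \<and> v d \<notin> U" by metis
    have "indep_mod U D v"
      unfolding indep_mod_def
    proof (intro allI impI)
      fix c assume "(\<Sum>d\<in>D. c d *s v d) \<in> U"
      then have "\<forall>d\<in>D. c d *s v d \<in> U"
        by (intro ind[OF D(2)]) (use v G(1) in \<open>auto intro: subspace_scale\<close>)
      then show "\<forall>d\<in>D. c d = 0" using v subspace_scale_iff[OF U] by blast
    qed
    then have "card D \<le> card Y"
      by (rule indep_mod_card_le[OF D(2) Y(1) U, rotated]) (use v G(2) Y(2) in blast)
    then show False using D by simp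
  qed
  obtain T where T: "\<And>d. d \<in> D0 \<Longrightarrow> d \<le> T" using finD0 by (meson Max_ge)
  define valid where "valid d A \<longleftrightarrow> A \<subseteq> G d \<and> finite A \<and> indep_mod U A id" for d A
  define ext where "ext d A = (SOME B. A \<subseteq> B \<and> valid d B \<and> G d \<subseteq> span (B \<union> U))" for d A
  have ext: "A \<subseteq> ext d A \<and> valid d (ext d A) \<and> G d \<subseteq> span (ext d A \<union> U)" if "valid d A" for d A
    unfolding ext_def
  proof (rule someI_ex)
    have "fin_dim_mod (G d) U" using fin_dim_mod_mono[OF fd G(2) order_refl] .
    then show "\<exists>B. A \<subseteq> B \<and> valid d B \<and> G d \<subseteq> span (B \<union> U)"
      using that indep_mod_extend[of "G d" U A] U unfolding valid_def by metis
  qed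
  \<comment> \<open>Descending recursion over integral weights: \<open>BB j d\<close> is the part of weight \<open>d\<close> of a construction that starts with the empty
    set in weight \<open>d + 2 * j\<close>. The value \<open>fuel d\<close> is the number of steps from \<open>d\<close> until
    the bound \<open>T\<close> of all weights is exceeded.\<close>
  define BB where "BB = rec_nat (\<lambda>d. {}) (\<lambda>j R d. ext d (if 0 \<le> d then f ` R (d + 2) else {}))"
  have BB0: "BB 0 d = {}" and BBS: "BB (Suc j) d = ext d (if 0 \<le> d then f ` BB j (d + 2) else {})" for j d
    by (simp_all add: BB_def)
  have valid_empty: "valid d {}" for d by (simp add: valid_def indep_mod_def)
  have valid_f: "valid d (f ` A)" if "valid (d + 2) A" "0 \<le> d" for d A
  proof -
    have A: "A \<subseteq> G (d + 2)" "finite A" "indep_mod U A id" using that by (auto simp: valid_def)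
    have "\<And>v. v \<in> G (d + 2) \<Longrightarrow> f v \<in> U \<Longrightarrow> v \<in> U" using inj[of "d + 2"] that by auto
    then have "indep_mod U (f ` A) id" using indep_mod_image(2)[OF U f G(1) A(1,2) _ A(3)] by blast
    then show ?thesis using A fG[of "d + 2"] that by (auto simp: valid_def)
  qed
  have valid_BB: "valid d (BB j d)" for j d
    by (induction j arbitrary: d) (auto simp: BB0 BBS valid_empty ext valid_f)
  define fuel where "fuel d = nat ((T - d) div 2 + 1)" for d
  define Bd where "Bd d = BB (fuel d) d" for d
  have Bd: "Bd d \<subseteq> G d" "finite (Bd d)" "indep_mod U (Bd d) id" for d
    using valid_BB[of d "fuel d"] by (auto simp: Bd_def valid_def)
  have Bd_rec: "Bd d = ext d (if 0 \<le> d then f ` Bd (d + 2) else {})" if "d \<le> T" for d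
  proof -
    have "fuel d = Suc (fuel (d + 2))" using that by (simp add: fuel_def nat_eq_iff Suc_nat_eq_nat_zadd1 pos_imp_zdiv_nonneg_iff) linarith
    then show ?thesis by (simp add: Bd_def BBS)
  qed
  have Bd_empty: "Bd d = {}" if "d > T" for d
  proof -
    have "fuel d = 0" using that by (simp add: fuel_def)
    then show ?thesis by (simp add: Bd_def BB0)
  qed
  have v': "valid d (if 0 \<le> d then f ` Bd (d + 2) else {})" for d
    using valid_empty valid_f[of d "Bd (d + 2)"] Bd[of "d + 2"] by (auto simp: valid_def)
  have span_Bd: "G d \<subseteq> span (Bd d \<union> U)" for d
  proof (cases "d \<le> T")
    case True
    then show ?thesis using ext[OF v', of d] Bd_rec[OF True] by simp
  next
    case False
    then have "d \<notin> D0" using T by force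
    then show ?thesis using span_superset[of "Bd d \<union> U"] by (auto simp: D0_def)
  qed
  have f_Bd: "f ` Bd (d + 2) \<subseteq> Bd d" if "0 \<le> d" for d
  proof (cases "d \<le> T")
    case True
    then show ?thesis using ext[OF v', of d] Bd_rec[OF True] that by simp
  qed (use Bd_empty in simp)
  have nU: "b \<notin> U" if "b \<in> Bd d" for b d
  proof
    assume b: "b \<in> U"
    have "(\<Sum>k\<in>Bd d. (if k = b then 1 else 0) *s id k) = (\<Sum>k\<in>{b}. (if k = b then 1 else 0) *s id k)"
      using that Bd(2) by (intro sum.mono_neutral_right) auto
    then have "(\<Sum>k\<in>Bd d. (if k = b then 1 else 0) *s id k) \<in> U" using b by simp
    then show False using Bd(3)[unfolded indep_mod_def, rule_format, of "\<lambda>k. if k = b then 1 else 0" d b] that by auto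
  qed
  have disj: "d = d'" if "b \<in> Bd d" "b \<in> Bd d'" for b d d'
  proof (rule ccontr)
    assume ne: "d \<noteq> d'"
    have "\<forall>k\<in>{d, d'}. (if k = d then b else - b) \<in> U"
      by (rule ind) (use that Bd(1) ne U in \<open>auto simp: subspace_0 intro: subspace_neg[OF G(1)]\<close>)
    then show False using nU that by auto
  qed
  define B where "B = (\<Union>d\<in>D0. Bd d)"
  have BdB: "Bd d \<subseteq> B" for d
  proof
    fix b assume b: "b \<in> Bd d"
    then have "b \<in> G d" "b \<notin> U" using Bd(1) nU by blast+
    then show "b \<in> B" using b by (auto simp: B_def D0_def)
  qed
  define w where "w b = (THE d. b \<in> Bd d)" for b
  have w: "w b = d" if "b \<in> Bd d" for b d
    unfolding w_def using that disj by (intro the_equality) auto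
  have wB: "b \<in> Bd (w b)" if "b \<in> B" for b using that w by (auto simp: B_def)
  have "string_basis f G V U B w"
    unfolding string_basis_def
  proof (intro conjI ballI impI)
    show "finite B" using finD0 Bd by (auto simp: B_def)
    show "B \<subseteq> V" using Bd(1) G(2) by (auto simp: B_def)
    show "indep_mod U B id"
      unfolding indep_mod_def
    proof (intro allI impI ballI)
      fix c b assume s: "(\<Sum>b\<in>B. c b *s id b) \<in> U" and b: "b \<in> B"
      have "(\<Sum>b\<in>B. c b *s id b) = (\<Sum>d\<in>D0. \<Sum>b\<in>Bd d. c b *s id b)"
        unfolding B_def by (rule sum.UNION_disjoint) (use finD0 Bd disj in auto)
      then have "\<forall>d\<in>D0. (\<Sum>b\<in>Bd d. c b *s id b) \<in> U"
        using s by (intro ind[OF finD0]) (use Bd(1) G(1) in \<open>auto intro!: subspace_sum subspace_scale\<close>)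
      moreover obtain d where "d \<in> D0" "b \<in> Bd d" using b by (auto simp: B_def)
      ultimately show "c b = 0" using Bd(3)[unfolded indep_mod_def] by blast
    qed
    show "V \<subseteq> span (B \<union> U)"
    proof -
      have "G d \<subseteq> span (B \<union> U)" for d
        using span_Bd[of d] span_mono[of "Bd d \<union> U" "B \<union> U"] BdB by blast
      then have "span (U \<union> (\<Union>d. G d)) \<subseteq> span (B \<union> U)"
        by (intro span_minimal subspace_span) (auto intro: span_base)
      then show ?thesis using gen by blast
    qed
    show "b \<in> G (w b)" if "b \<in> B" for b using wB[OF that] Bd(1) by blast
    show fb: "f b \<in> B" "w (f b) = w b - 2" if "b \<in> B" "2 \<le> w b" for b
    proof -
      have "f b \<in> Bd (w b - 2)" using f_Bd[of "w b - 2"] wB[OF that(1)] that(2) by auto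
      then show "f b \<in> B" "w (f b) = w b - 2" using BdB w by blast+
    qed
    show "inj_on f {b \<in> B. 2 \<le> w b}"
    proof (rule inj_onI)
      fix b b' assume bb: "b \<in> {b \<in> B. 2 \<le> w b}" "b' \<in> {b \<in> B. 2 \<le> w b}" "f b = f b'"
      then have eq: "w b = w b'" using fb(2)[of b] fb(2)[of b'] by auto
      have "inj_on f (Bd (w b))"
        by (rule indep_mod_image(1)[OF U f G(1) Bd(1,2) _ Bd(3)]) (use inj bb in blast)
      then show "b = b'" using bb eq wB[of b] wB[of b'] by (auto dest: inj_onD)
    qed
  qed
  then show ?thesis by blast
qed

text \<open>
  Of the elements of weight at least \<open>c\<close>, those that are images under \<open>f\<close> correspond to the elements of weight at least
  \<open>c + 2\<close>.
\<close>

lemma string_basis_card: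
  assumes B: "string_basis f G V U B w" and c: "0 \<le> c"
  shows "card {b \<in> B. c \<le> w b} = card {b \<in> B. c \<le> w b \<and> b \<notin> f ` {b \<in> B. 2 \<le> w b}} + card {b \<in> B. c + 2 \<le> w b}"
proof -
  have fin: "finite B" and fB: "\<And>b. b \<in> B \<Longrightarrow> 2 \<le> w b \<Longrightarrow> f b \<in> B \<and> w (f b) = w b - 2"
    and inj: "inj_on f {b \<in> B. 2 \<le> w b}" using B by (auto simp: string_basis_def)
  have im: "f ` {b \<in> B. c + 2 \<le> w b} = {b \<in> B. c \<le> w b \<and> b \<in> f ` {b \<in> B. 2 \<le> w b}}"
  proof (intro equalityI subsetI)
    fix y assume "y \<in> f ` {b \<in> B. c + 2 \<le> w b}"
    then obtain b where b: "b \<in> B" "c + 2 \<le> w b" "y = f b" by blast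
    then show "y \<in> {b \<in> B. c \<le> w b \<and> b \<in> f ` {b \<in> B. 2 \<le> w b}}" using fB[of b] c by auto
  next
    fix y assume "y \<in> {b \<in> B. c \<le> w b \<and> b \<in> f ` {b \<in> B. 2 \<le> w b}}"
    then obtain b where b: "b \<in> B" "2 \<le> w b" "y = f b" "c \<le> w y" by blast
    then show "y \<in> f ` {b \<in> B. c + 2 \<le> w b}" using fB[of b] by auto
  qed
  have "inj_on f {b \<in> B. c + 2 \<le> w b}" by (rule inj_on_subset[OF inj]) (use c in auto)
  then have 1: "card {b \<in> B. c + 2 \<le> w b} = card {b \<in> B. c \<le> w b \<and> b \<in> f ` {b \<in> B. 2 \<le> w b}}"
    by (simp only: im[symmetric] card_image)
  have "{b \<in> B. c \<le> w b} = {b \<in> B. c \<le> w b \<and> b \<notin> f ` {b \<in> B. 2 \<le> w b}} \<union> {b \<in> B. c \<le> w b \<and> b \<in> f ` {b \<in> B. 2 \<le> w b}}"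
    by blast
  then show ?thesis
    unfolding 1 using fin
      card_Un_disjoint[of "{b \<in> B. c \<le> w b \<and> b \<notin> f ` {b \<in> B. 2 \<le> w b}}" "{b \<in> B. c \<le> w b \<and> b \<in> f ` {b \<in> B. 2 \<le> w b}}"]
    by (simp add: disjoint_iff)
qed

lemma weighted_basis_eigen_coeff:
  assumes U: "subspace U" and h: "endo h" "h ` U \<subseteq> U" and B: "finite B" "indep_mod U B id"
    and w: "\<And>b. b \<in> B \<Longrightarrow> h b - w b *s b \<in> U" and v: "h v - l *s v \<in> U" "v \<in> span (B \<union> U)"
  shows "v \<in> span ({b \<in> B. w b = l} \<union> U)"
proof -
  obtain c u where cu: "u \<in> U" "v = (\<Sum>b\<in>B. c b *s b) + u"
    using span_Un_finiteE[OF v(2) U B(1)] by metis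
  have "(\<Sum>b\<in>B. (c b * (w b - l)) *s id b) \<in> U"
  proof -
    have "(\<Sum>b\<in>B. (c b * (w b - l)) *s id b)
      = (h v - l *s v) - (h u - l *s u) - (\<Sum>b\<in>B. c b *s (h b - w b *s b))"
      unfolding cu(2)
      by (simp add: module_hom.add[OF h(1)] module_hom.sum[OF h(1)] module_hom.scale[OF h(1)]
        scale_right_distrib scale_right_diff_distrib right_diff_distrib scale_left_diff_distrib
        sum_subtractf scale_sum_right mult.commute)
    moreover have "h u - l *s u \<in> U" using cu h U by (auto intro: subspace_diff subspace_scale)
    moreover have "(\<Sum>b\<in>B. c b *s (h b - w b *s b)) \<in> U" using w U by (auto intro: subspace_sum subspace_scale)
    ultimately show ?thesis using v(1) U by (simp add: subspace_diff)
  qed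
  then have c0: "c b = 0" if "b \<in> B" "w b \<noteq> l" for b
    using B(2)[unfolded indep_mod_def, rule_format, of "\<lambda>b. c b * (w b - l)" b] that by auto
  have "(\<Sum>b\<in>B. c b *s b) \<in> span ({b \<in> B. w b = l} \<union> U)"
  proof (rule span_sum)
    fix b assume "b \<in> B"
    then show "c b *s b \<in> span ({b \<in> B. w b = l} \<union> U)"
      using c0 by (cases "w b = l") (auto intro: span_scale span_base simp: span_zero)
  qed
  then show ?thesis using cu by (auto intro: span_add span_base)
qed

text \<open>
  Both sides count an eigenvalue with its multiplicity as eigenvalue of \<open>h\<close> on \<open>V / U\<close>.
\<close>

lemma weighted_basis_count:
  assumes U: "subspace U" and h: "endo h" "h ` U \<subseteq> U"
    and B: "finite B" "indep_mod U B id" "B \<subseteq> V" "V \<subseteq> span (B \<union> U)" "\<And>b. b \<in> B \<Longrightarrow> h b - w b *s b \<in> U"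
    and B': "finite B'" "indep_mod U B' id" "B' \<subseteq> V" "V \<subseteq> span (B' \<union> U)" "\<And>b. b \<in> B' \<Longrightarrow> h b - w' b *s b \<in> U"
  shows "card {b \<in> B. P (w b)} = card {b \<in> B'. P (w' b)}"
proof -
  have sub: "indep_mod U A id" if "indep_mod U B id" "A \<subseteq> B" "finite B" for A B
    unfolding indep_mod_def
  proof (intro allI impI ballI)
    fix c b assume s: "(\<Sum>i\<in>A. c i *s id i) \<in> U" "b \<in> A"
    have "(\<Sum>i\<in>B. (if i \<in> A then c i else 0) *s id i) = (\<Sum>i\<in>A. (if i \<in> A then c i else 0) *s id i)"
      using that by (intro sum.mono_neutral_right) auto
    then have "(\<Sum>i\<in>B. (if i \<in> A then c i else 0) *s id i) \<in> U" using s by (simp cong: sum.cong)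
    then show "c b = 0"
      using that(1)[unfolded indep_mod_def, rule_format, of "\<lambda>i. if i \<in> A then c i else 0" b] s(2) that(2) by auto
  qed
  have span: "{b \<in> B1. P (w1 b)} \<subseteq> span ({b \<in> B2. P (w2 b)} \<union> U)"
    if "finite B2" "indep_mod U B2 id" "B1 \<subseteq> V" "V \<subseteq> span (B2 \<union> U)"
      "\<And>b. b \<in> B2 \<Longrightarrow> h b - w2 b *s b \<in> U" "\<And>b. b \<in> B1 \<Longrightarrow> h b - w1 b *s b \<in> U" for B1 B2 w1 w2
  proof
    fix b assume b: "b \<in> {b \<in> B1. P (w1 b)}"
    have "b \<in> span ({b' \<in> B2. w2 b' = w1 b} \<union> U)"
      by (rule weighted_basis_eigen_coeff[OF U h that(1,2,5)]) (use that b in auto)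
    moreover have "span ({b' \<in> B2. w2 b' = w1 b} \<union> U) \<subseteq> span ({b \<in> B2. P (w2 b)} \<union> U)"
      using b by (intro span_mono) auto
    ultimately show "b \<in> span ({b \<in> B2. P (w2 b)} \<union> U)" by blast
  qed
  show ?thesis
  proof (rule indep_mod_same_card[OF _ _ U])
    show "indep_mod U {b \<in> B. P (w b)} id" by (rule sub[OF B(2) _ B(1)]) auto
    show "indep_mod U {b \<in> B'. P (w' b)} id" by (rule sub[OF B'(2) _ B'(1)]) auto
    show "{b \<in> B. P (w b)} \<subseteq> span ({b \<in> B'. P (w' b)} \<union> U)" by (rule span[OF B'(1,2) B(3) B'(4,5) B(5)])
    show "{b \<in> B'. P (w' b)} \<subseteq> span ({b \<in> B. P (w b)} \<union> U)" by (rule span[OF B(1,2) B'(3) B(4,5) B'(5)])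
  qed (use B(1) B'(1) in auto)
qed

end

text \<open>
  Apply \<open>f\<close> to \<open>v\<close> as long as the result is nonzero. The final vector is a lowest weight vector. If it had weight 0, it would be
  killed by \<open>e\<close> also, but it is the image under \<open>f\<close> of a vector of weight 2, on which \<open>e \<circ> f\<close> is injective.
\<close>

lemma (in sl2_module_mod) negative_weight_exists:
  assumes v: "v \<in> wt l" "v \<notin> U" and l: "Re l > 0"
  shows "\<exists>u l'. u \<in> wt l' \<and> u \<notin> U \<and> Re l' < 0"
proof -
  interpret s: sl2_module_mod "(*s)" V U f e "\<lambda>v. - h v" by (rule swapped)
  have vs: "v \<in> s.wt (- l)" using v swapped_wt by simp
  obtain j where j: "(f ^^ j) v \<notin> U" "(f ^^ Suc j) v \<in> U" using s.e_pow_last[OF vs v(2)] .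
  define u where "u = (f ^^ j) v"
  have fwt: "(f ^^ i) v \<in> wt (l - 2 * of_nat i)" for i
    using s.e_pow_wt[OF vs, of i] swapped_wt by (simp add: algebra_simps)
  have u: "u \<in> wt (l - 2 * of_nat j)" "u \<notin> U" "f u \<in> U" using fwt j by (auto simp: u_def)
  obtain k :: nat where k: "l - 2 * of_nat j = - of_nat k" using lowest_weight[OF u(1,2) eU[OF u(3)]] by blast
  show ?thesis
  proof (cases k)
    case (Suc k')
    then show ?thesis using u k by (intro exI[of _ u] exI[of _ "l - 2 * of_nat j"]) auto
  next
    case 0
    then have u0: "u \<in> wt 0" using u k by simp
    have "j \<noteq> 0"
    proof
      assume "j = 0"
      then show False using k 0 l by simp
    qed
    then obtain i where i: "j = Suc i" by (cases j) auto
    define v1 where "v1 = (f ^^ i) v"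
    have uv: "u = f v1" by (simp add: u_def v1_def i)
    have "l - 2 * of_nat i = 2" using k 0 i by (simp add: algebra_simps)
    then have v1: "v1 \<in> wt 2" using fwt[of i] by (simp add: v1_def)
    have "f (e u) = e (f u) - (e (f u) - f (e u) - h u) - h u" by simp
    also have "\<dots> \<in> U" using u0 by (intro subspace_diff U eU u(3) ef wt_V[OF u0]) (simp add: wt_def)
    finally have "e u \<in> U" using f_inj_mod[OF e_wt[OF u0]] by simp
    then have "v1 \<in> U" using ef_inj_mod[OF v1] uv by simp
    then show ?thesis using u(2) uv fU by blast
  qed
qed

section \<open>Complete intersections with an action of sl2\<close>

(* the order 1 in Ord n 1 and in single i 1 has to keep its shape *)
declare One_nat_def [simp del]

lemma single_one_eq_iff: "Poly_Mapping.single i (1::nat) = Poly_Mapping.single j 1 \<longleftrightarrow> i = j"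
proof
  assume "Poly_Mapping.single i (1::nat) = Poly_Mapping.single j 1"
  from arg_cong[OF this, of Poly_Mapping.keys] show "i = j" by simp
qed simp

text \<open>
  A linear operator on all polynomials that induces a derivation of the quotient of \<open>Ord N 0\<close> by \<open>I\<close>.
\<close>

definition derivation_mod :: "nat \<Rightarrow> mpoly set \<Rightarrow> (mpoly \<Rightarrow> mpoly) \<Rightarrow> bool"
  where "derivation_mod N I D \<longleftrightarrow> mp.endo D \<and> (\<forall>p\<in>Ord N 0. D p \<in> Ord N 0) \<and> (\<forall>p\<in>I. D p \<in> I) \<and>
    (\<forall>p\<in>Ord N 0. \<forall>q\<in>Ord N 0. D (p * q) - (D p * q + p * D q) \<in> I)"

lemma derivation_mod_power:
  assumes I: "is_pideal N I" and D: "derivation_mod N I D" and a: "a \<in> Ord N 0"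
  shows "D (a ^ Suc k) - of_nat (Suc k) * (a ^ k * D a) \<in> I"
proof (induction k)
  case 0
  then show ?case using I by (simp add: is_pideal_def mp.subspace_0)
next
  case (Suc k)
  have ak: "a ^ Suc k \<in> Ord N 0" using Ord_power[OF a, of "Suc k"] by simp
  have 1: "D (a * a ^ Suc k) - (D a * a ^ Suc k + a * D (a ^ Suc k)) \<in> I"
    using D a ak by (simp only: derivation_mod_def)
  have 2: "a * (D (a ^ Suc k) - of_nat (Suc k) * (a ^ k * D a)) \<in> I"
    using I a Suc by (simp only: is_pideal_def)
  have *: "x - (1 + m) * (a * y) = (x - (a * y + a * z)) + a * (z - m * y)" for x y z m :: mpoly
    by (simp add: algebra_simps)
  have 3: "D a * a ^ Suc k = a * (a ^ k * D a)" "a ^ Suc k * D a = a * (a ^ k * D a)" by (simp_all add: mult_ac)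
  have "(D (a * a ^ Suc k) - (D a * a ^ Suc k + a * D (a ^ Suc k)))
      + a * (D (a ^ Suc k) - of_nat (Suc k) * (a ^ k * D a)) \<in> I"
    by (rule mp.subspace_add[OF _ 1 2]) (use I in \<open>simp add: is_pideal_def\<close>)
  then show ?case
    unfolding of_nat_Suc[of "Suc k"] power_Suc[of a "Suc k"] 3
      *[of "D (a * a ^ Suc k)" "of_nat (Suc k)" "a ^ k * D a" "D (a ^ Suc k)"] .
qed

lemma of_nat_mult_psc: "of_nat n * p = psc (of_nat n) p"
  by (simp only: psc_def single_of_nat)

lemma const_plus_Ord1:
  assumes "p \<in> Ord n 0"
  shows "p - psc (Poly_Mapping.lookup p 0) 1 \<in> Ord n 1"
  unfolding Ord_def
proof (intro CollectI ballI)
  fix m assume m: "m \<in> Poly_Mapping.keys (p - psc (Poly_Mapping.lookup p 0) 1)"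
  have l: "Poly_Mapping.lookup (p - psc (Poly_Mapping.lookup p 0) 1) m = (if m = 0 then 0 else Poly_Mapping.lookup p m)"
    by (simp add: lookup_minus psc_1 lookup_single)
  then have "m \<noteq> 0" "m \<in> Poly_Mapping.keys p" using m by (auto simp: in_keys_iff split: if_splits)
  then show "Poly_Mapping.keys m \<subseteq> {..<n} \<and> 1 \<le> mdeg m"
    using assms deg_eq_0[of m] by (auto simp: Ord_def)
qed

text \<open>
  A derivation of a local ring with nilpotent maximal ideal preserves this ideal. If \<open>D a\<close> had a nonzero constant term, it would be a unit.
  But \<open>D (a ^ (j + 1)) = (j + 1) * a ^ j * D a\<close>, so the vanishing of \<open>a ^ (j + 1)\<close> would imply that of
  \<open>a ^ j\<close>.
\<close>

lemma derivation_mod_Ord1: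
  assumes I: "is_pideal N I" "I \<subseteq> Ord N 1" and M: "Ord N M \<subseteq> I"
    and D: "derivation_mod N I D" and a: "a \<in> Ord N 1"
  shows "D a \<in> Ord N 1"
proof -
  have sI: "mp.subspace I" and mI: "\<And>p q. p \<in> Ord N 0 \<Longrightarrow> q \<in> I \<Longrightarrow> p * q \<in> I" using I(1) by (auto simp: is_pideal_def)
  have a0: "a \<in> Ord N 0" using a Ord_antimono[of 0 1 N] by auto
  have Da: "D a \<in> Ord N 0" using D a0 by (simp add: derivation_mod_def)
  define c where "c = Poly_Mapping.lookup (D a) 0"
  define q where "q = D a - psc c 1"
  have q: "q \<in> Ord N 1" unfolding q_def c_def by (rule const_plus_Ord1[OF Da])
  show ?thesis
  proof (cases "c = 0")
    case True
    then show ?thesis using q by (simp add: q_def)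
  next
    case False
    have "a ^ M \<in> I" using Ord_power[OF a, of M] M by auto
    then have ex: "\<exists>k. a ^ k \<in> I" by blast
    define k where "k = (LEAST k. a ^ k \<in> I)"
    have k: "a ^ k \<in> I" unfolding k_def by (rule LeastI_ex[OF ex])
    have "1 \<notin> I" using I(2) mono_Ord[of 0 N 1] by (auto simp: mono_0)
    then obtain j where j: "k = Suc j" using k by (cases k) auto
    have nj: "a ^ j \<notin> I" using not_less_Least[of j "\<lambda>k. a ^ k \<in> I"] j k_def by auto
    have aj: "a ^ j \<in> Ord N 0" using Ord_power[OF a0, of j] by simp
    have "D (a ^ Suc j) \<in> I" using D k j by (simp add: derivation_mod_def)
    then have "D (a ^ Suc j) - (D (a ^ Suc j) - of_nat (Suc j) * (a ^ j * D a)) \<in> I"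
      using derivation_mod_power[OF I(1) D a0, of j] sI by (blast intro: mp.subspace_diff)
    then have "psc (of_nat (Suc j)) (a ^ j * D a) \<in> I" by (simp add: of_nat_mult_psc[symmetric] del: of_nat_Suc)
    then have ajD: "a ^ j * D a \<in> I" using mp.subspace_scale_iff[OF sI] by (metis of_nat_neq_0)
    define r where "r = - psc (inverse c) q"
    have r: "r \<in> Ord N 1" using q subspace_Ord by (auto simp: r_def mp.subspace_neg mp.subspace_scale)
    have "D a = psc c (1 - r)" using False by (simp add: r_def q_def mp.scale_right_diff_distrib)
    then have "psc c (a ^ j * (1 - r)) \<in> I" using ajD by (simp add: psc_mult_right)
    then have 1: "a ^ j * (1 - r) \<in> I" using mp.subspace_scale_iff[OF sI False] by blast
    \<comment> \<open>Inverting \<open>1 - r\<close> by the geometric series, which ends because \<open>r\<close> is nilpotent modulo \<open>I\<close>.\<close>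
    have "a ^ j - a ^ j * r ^ i \<in> I" for i
    proof (induction i)
      case 0
      then show ?case using sI by (simp add: mp.subspace_0)
    next
      case (Suc i)
      have "r ^ i \<in> Ord N 0" using Ord_power[OF r, of i] Ord_antimono[of 0 "1 * i" N] by blast
      then have "r ^ i * (a ^ j * (1 - r)) \<in> I" using 1 mI by blast
      then have "(a ^ j - a ^ j * r ^ i) + r ^ i * (a ^ j * (1 - r)) \<in> I" using Suc sI by (blast intro: mp.subspace_add)
      then show ?case by (simp add: algebra_simps)
    qed
    then have "a ^ j - a ^ j * r ^ M \<in> I" .
    moreover have "a ^ j * r ^ M \<in> I" using mI[OF aj] Ord_power[OF r, of M] M by auto
    ultimately have "(a ^ j - a ^ j * r ^ M) + a ^ j * r ^ M \<in> I" using sI by (blast intro: mp.subspace_add)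
    then show ?thesis using nj by simp
  qed
qed

text \<open>
  Monomials of degree \<open>k + 1\<close> or more are products of a variable and a monomial of degree at least \<open>k\<close>.
\<close>

lemma Ord2_in_subspace:
  assumes W: "mp.subspace W" and prod: "\<And>a b. a \<in> Ord n 1 \<Longrightarrow> b \<in> Ord n k \<Longrightarrow> a * b \<in> W" and p: "p \<in> Ord n (Suc k)"
  shows "p \<in> W"
proof (rule Ord_in_subspace[OF p W])
  fix m :: "nat \<Rightarrow>\<^sub>0 nat" assume m: "Poly_Mapping.keys m \<subseteq> {..<n}" "Suc k \<le> mdeg m"
  then have "m \<noteq> 0" by auto
  then obtain i where i: "i \<in> Poly_Mapping.keys m" by (metis equals0I keys_eq_empty)
  note * = monomial_remove_var[OF i]
  have "pvar i \<in> Ord n 1" using i m pvar_Ord by auto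
  moreover have "pmono (m - Poly_Mapping.single i 1) \<in> Ord n k" using * m by (auto simp: mono_Ord)
  ultimately have "pvar i * pmono (m - Poly_Mapping.single i 1) \<in> W" by (rule prod)
  then show "pmono m \<in> W" by (subst *(1)) (simp only: mono_add)
qed

text \<open>
  The quotient of the polynomial ring in \<open>N\<close> variables by \<open>I0\<close> is a zero-dimensional complete intersection, with
  derivations \<open>e\<close>, \<open>f\<close>, \<open>h\<close> that satisfy the relations of \<open>sl\<^sub>2\<close>. The presentation need not be minimal: \<open>I0\<close> may
  contain polynomials with linear terms. That \<open>I0\<close> has \<open>N\<close> generators is required only up to \<open>max_times N I0\<close>,
  which permits to truncate power series.
\<close>

locale ci_sl2 =
  fixes N :: nat and I0 :: "mpoly set" and M :: nat and Gs :: "mpoly set" and e f h :: "mpoly \<Rightarrow> mpoly"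
  assumes I0: "is_pideal N I0" "I0 \<subseteq> Ord N 1" and M: "Ord N M \<subseteq> I0"
    and gens: "finite Gs" "card Gs \<le> N" "I0 \<subseteq> mp.span (Gs \<union> max_times N I0)"
    and e: "derivation_mod N I0 e" and f: "derivation_mod N I0 f" and h: "derivation_mod N I0 h"
    and ef: "\<And>p. e (f p) - f (e p) = h p" and he: "\<And>p. h (e p) - e (h p) = psc 2 (e p)"
    and hf: "\<And>p. h (f p) - f (h p) = - psc 2 (f p)"
begin

lemma sI0: "mp.subspace I0" and I0_mult: "p \<in> Ord N 0 \<Longrightarrow> q \<in> I0 \<Longrightarrow> p * q \<in> I0" and I0_Ord: "I0 \<subseteq> Ord N 0"
  using I0(1) by (auto simp: is_pideal_def)

text \<open>
  The preimage of the square of the maximal ideal.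
\<close>

definition U1 :: "mpoly set"
  where "U1 = mp.span (Ord N 2 \<union> I0)"

lemma sU1: "mp.subspace U1"
  unfolding U1_def by (rule mp.subspace_span)

lemma I0_U1: "I0 \<subseteq> U1" and Ord2_U1: "Ord N 2 \<subseteq> U1"
  unfolding U1_def by (auto intro: mp.span_base)

lemma U1_Ord1: "U1 \<subseteq> Ord N 1"
  unfolding U1_def using I0(2) Ord_antimono[of 1 2 N] by (intro mp.span_minimal subspace_Ord) auto

lemma derivation_mod_U1:
  assumes D: "derivation_mod N I0 D" and p: "p \<in> U1"
  shows "D p \<in> U1"
proof -
  have E: "mp.endo D" using D by (simp add: derivation_mod_def)
  have 1: "D q \<in> U1" if q: "q \<in> Ord N 2" for q
  proof -
    have "q \<in> {q. D q \<in> U1}"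
    proof (rule Ord2_in_subspace[where k = 1])
      show "mp.subspace {q. D q \<in> U1}"
        using sU1 by (intro mp.subspaceI) (auto simp: module_hom.add[OF E] module_hom.scale[OF E] module_hom.zero[OF E]
          mp.subspace_0 mp.subspace_add mp.subspace_scale)
      show "q \<in> Ord N (Suc 1)" using q by (simp add: numeral_2_eq_2)
      fix a b assume ab: "a \<in> Ord N 1" "b \<in> Ord N 1"
      have D1: "D a \<in> Ord N 1" "D b \<in> Ord N 1" using derivation_mod_Ord1[OF I0 M D] ab by auto
      have "D (a * b) - (D a * b + a * D b) \<in> I0"
        using D ab Ord_antimono[of 0 1 N] unfolding derivation_mod_def by blast
      moreover have "D a * b + a * D b \<in> Ord N 2"
        using D1 ab by (intro mp.subspace_add[OF subspace_Ord]) (auto intro: Ord_mult'[of _ N 1 _ 1])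
      ultimately have "(D (a * b) - (D a * b + a * D b)) + (D a * b + a * D b) \<in> U1"
        using I0_U1 Ord2_U1 sU1 by (blast intro: mp.subspace_add)
      then show "a * b \<in> {q. D q \<in> U1}" by simp
    qed
    then show ?thesis by simp
  qed
  show ?thesis
    by (rule mp.endo_image_span[OF E p[unfolded U1_def] _ sU1])
      (use 1 D I0_U1 in \<open>auto simp: derivation_mod_def\<close>)
qed

lemma fin_dim_Ord0: "mp.fin_dim_mod (Ord N 0) I0"
  unfolding mp.fin_dim_mod_def
proof (intro exI conjI)
  show "finite (pmono ` low_monomials N M)" using finite_low_monomials by simp
  have "mp.span (pmono ` low_monomials N M \<union> Ord N M) \<subseteq> mp.span (pmono ` low_monomials N M \<union> I0)"
    using M by (intro mp.span_mono) auto
  then show "Ord N 0 \<subseteq> mp.span (pmono ` low_monomials N M \<union> I0)" using Ord_low_decompose by blast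
qed

lemma sl2_mod_Ord1:
  assumes U: "mp.subspace U" "I0 \<subseteq> U" "U \<subseteq> Ord N 1"
    and st: "\<And>v. v \<in> U \<Longrightarrow> e v \<in> U" "\<And>v. v \<in> U \<Longrightarrow> f v \<in> U" "\<And>v. v \<in> U \<Longrightarrow> h v \<in> U"
  shows "sl2_module_mod psc (Ord N 1) U e f h"
proof -
  have fd: "mp.fin_dim_mod (Ord N 1) U"
    by (rule mp.fin_dim_mod_mono[OF fin_dim_Ord0 _ U(2)]) (rule Ord_antimono, simp)
  have "0 \<in> U" using U(1) by (rule mp.subspace_0)
  then show ?thesis
    by (intro sl2_module_mod.intro sl2_module_mod_axioms.intro mp.complex_vector_space_axioms subspace_Ord U st fd)
      (use e f h derivation_mod_Ord1[OF I0 M] ef he hf in \<open>auto simp: derivation_mod_def\<close>)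
qed

sublocale M0: sl2_module_mod psc "Ord N 1" I0 e f h
  by (rule sl2_mod_Ord1[OF sI0 order_refl I0(2)]) (use e f h in \<open>auto simp: derivation_mod_def\<close>)

sublocale M1: sl2_module_mod psc "Ord N 1" U1 e f h
  by (rule sl2_mod_Ord1[OF sU1 I0_U1 U1_Ord1]) (use derivation_mod_U1 e f h in auto)

lemma weight_subset: "M0.wt l \<subseteq> M1.wt l"
  using I0_U1 by (auto simp: M0.wt_def M1.wt_def)

lemma Ord1_string_basis:
  "\<exists>B w. mp.string_basis f (\<lambda>d. M0.wt (of_int d)) (Ord N 1) U1 B w"
proof (rule mp.string_basis_exists[OF sU1 M0.subspace_wt])
  show "M0.wt (of_int d) \<subseteq> Ord N 1" for d using M0.wt_V by blast
  show "mp.fin_dim_mod (Ord N 1) U1" by (rule M1.fin_dim)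
  show "mp.endo f" by (rule M0.f)
  show "f v \<in> M0.wt (of_int (d - 2))" if "v \<in> M0.wt (of_int d)" for d v
    using M0.f_wt[OF that] by simp
  show "v \<in> U1" if "2 \<le> d" "v \<in> M0.wt (of_int d)" "f v \<in> U1" for d v
    using M1.f_inj_mod[of v "of_int d"] that weight_subset by auto
  have "M0.wt l \<subseteq> mp.span (U1 \<union> (\<Union>d. M0.wt (of_int d)))" for l
  proof
    fix v assume v: "v \<in> M0.wt l"
    show "v \<in> mp.span (U1 \<union> (\<Union>d. M0.wt (of_int d)))"
    proof (cases "v \<in> I0")
      case True
      then show ?thesis using I0_U1 by (auto intro: mp.span_base)
    next
      case False
      then obtain d where "l = of_int d" using M0.weight_int[OF v] by (auto elim: Ints_cases)
      then show ?thesis using v by (auto intro: mp.span_base)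
    qed
  qed
  then have "M0.wts_sum \<subseteq> mp.span (U1 \<union> (\<Union>d. M0.wt (of_int d)))"
    unfolding M0.wts_sum_def by (intro mp.span_minimal mp.subspace_span) auto
  then show "Ord N 1 \<subseteq> mp.span (U1 \<union> (\<Union>d. M0.wt (of_int d)))" by (simp add: M0.wts_sum_eq)
  show "\<forall>d\<in>D. x d \<in> U1" if "finite D" "\<And>d. d \<in> D \<Longrightarrow> x d \<in> M0.wt (of_int d)" "(\<Sum>d\<in>D. x d) \<in> U1" for D x
    by (rule mp.eigenvectors_mod_independent_family[OF M0.h sU1 _ that(1) _ _ that(3), where l = of_int])
      (use that(2) weight_subset M1.hU in \<open>auto simp: inj_on_def M1.wt_def\<close>)
qed

end

text \<open>
  A minimal presentation of the same ring. The variables \<open>x\<^sub>i\<close> are sent by the substitution \<open>S\<close> to a basis \<open>\<theta>\<close> of the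
  maximal ideal modulo its square that consists of eigenvectors of \<open>h\<close> and is adapted to \<open>f\<close>.
\<close>

locale ci_presentation = ci_sl2 +
  fixes n :: nat and B :: "mpoly set" and w :: "mpoly \<Rightarrow> int" and \<theta> :: "nat \<Rightarrow> mpoly"
  assumes B: "mp.string_basis f (\<lambda>d. M0.wt (of_int d)) (Ord N 1) U1 B w"
    and \<theta>: "bij_betw \<theta> {..<n} B"
begin

abbreviation S :: "mpoly \<Rightarrow> mpoly"
  where "S \<equiv> subst_poly \<theta>"

lemmas S_lin = module_hom.add[OF endo_subst] module_hom.diff[OF endo_subst] module_hom.scale[OF endo_subst]
  module_hom.zero[OF endo_subst] module_hom.sum[OF endo_subst] module_hom.neg[OF endo_subst]

definition I :: "mpoly set"
  where "I = {p \<in> Ord n 0. S p \<in> I0}"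

lemma B_fin: "finite B" and B_Ord: "B \<subseteq> Ord N 1" and B_ind: "mp.indep_mod U1 B id"
  and B_span: "Ord N 1 \<subseteq> mp.span (B \<union> U1)" and B_wt: "\<And>b. b \<in> B \<Longrightarrow> b \<in> M0.wt (of_int (w b))"
  and B_f: "\<And>b. b \<in> B \<Longrightarrow> 2 \<le> w b \<Longrightarrow> f b \<in> B \<and> w (f b) = w b - 2"
  using B by (auto simp: mp.string_basis_def)

lemma \<theta>_B: "i < n \<Longrightarrow> \<theta> i \<in> B"
  using \<theta> by (auto simp: bij_betw_def)

lemma \<theta>_Ord: "i < n \<Longrightarrow> \<theta> i \<in> Ord N 1"
  using \<theta>_B B_Ord by blast

lemma card_B: "card B = n"
  using bij_betw_same_card[OF \<theta>] by simp

lemma S_Ord: "p \<in> Ord n k \<Longrightarrow> S p \<in> Ord N k"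
  by (rule subst_Ord[OF \<theta>_Ord])

lemma I_pideal: "is_pideal n I"
  unfolding is_pideal_def
proof (intro conjI ballI)
  show "mp.subspace I"
    using sI0 subspace_Ord by (intro mp.subspaceI)
      (auto simp: I_def S_lin mp.subspace_0 mp.subspace_add mp.subspace_scale)
  show "I \<subseteq> Ord n 0" by (auto simp: I_def)
  fix a j assume "a \<in> Ord n 0" "j \<in> I"
  then show "a * j \<in> I" using I0_mult[OF S_Ord] Ord_mult'[of a n 0 j 0 0] by (auto simp: I_def subst_mult)
qed

lemma Ord_M_I: "Ord n M \<subseteq> I"
  using S_Ord M Ord_antimono[of 0 M n] by (auto simp: I_def)

text \<open>
  The set \<open>R\<close> of elements in the image modulo \<open>I0\<close> is closed under products and contains generators modulo order 2. Hence it
  contains everything modulo any higher order.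
\<close>

lemma S_surj:
  assumes "a \<in> Ord N 1"
  shows "\<exists>p\<in>Ord n 1. a - S p \<in> I0"
proof -
  define R where "R = {u. \<exists>p\<in>Ord n 1. u - S p \<in> I0}"
  have sR: "mp.subspace R"
  proof (rule mp.subspaceI)
    show "0 \<in> R" using sI0 subspace_Ord mp.subspace_0
      by (auto simp: R_def S_lin intro!: bexI[of _ 0])
  next
    fix u v assume "u \<in> R" "v \<in> R"
    then obtain p q where pq: "p \<in> Ord n 1" "u - S p \<in> I0" "q \<in> Ord n 1" "v - S q \<in> I0" by (auto simp: R_def)
    have "(u + v) - S (p + q) \<in> I0" using mp.subspace_add[OF sI0 pq(2,4)] by (simp add: S_lin algebra_simps)
    then show "u + v \<in> R" using pq mp.subspace_add[OF subspace_Ord] by (auto simp: R_def)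
  next
    fix c u assume "u \<in> R"
    then obtain p where p: "p \<in> Ord n 1" "u - S p \<in> I0" by (auto simp: R_def)
    have "psc c u - S (psc c p) \<in> I0" using mp.subspace_scale[OF sI0 p(2), of c] by (simp add: S_lin mp.scale_right_diff_distrib)
    then show "psc c u \<in> R" using p mp.subspace_scale[OF subspace_Ord] by (auto simp: R_def)
  qed
  have SR: "S p \<in> R" if "p \<in> Ord n 1" for p using that sI0 mp.subspace_0 by (auto simp: R_def intro!: bexI[of _ p])
  have IR: "I0 \<subseteq> R" using subspace_Ord mp.subspace_0 by (auto simp: R_def S_lin intro!: bexI[of _ 0])
  have R_Ord: "u \<in> Ord N 1" if u: "u \<in> R" for u
  proof -
    obtain p where p: "p \<in> Ord n 1" "u - S p \<in> I0" using u unfolding R_def by blast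
    then have "(u - S p) + S p \<in> Ord N 1" using I0(2) S_Ord by (blast intro: mp.subspace_add[OF subspace_Ord])
    then show ?thesis by simp
  qed
  have RR: "u * v \<in> R" if uv: "u \<in> R" "v \<in> R" for u v
  proof -
    obtain p q where pq: "p \<in> Ord n 1" "u - S p \<in> I0" "q \<in> Ord n 1" "v - S q \<in> I0" using uv by (auto simp: R_def)
    have 01: "Ord N 1 \<subseteq> Ord N 0" by (rule Ord_antimono) simp
    have "v * (u - S p) + S p * (v - S q) \<in> I0"
      using R_Ord uv S_Ord[OF pq(1)] 01 pq by (intro mp.subspace_add[OF sI0] I0_mult) auto
    then have "u * v - S (p * q) \<in> I0" by (simp add: subst_mult algebra_simps)
    moreover have "p * q \<in> Ord n 1" using pq by (intro Ord_mult'[of _ n 1 _ 1]) auto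
    ultimately show ?thesis by (auto simp: R_def)
  qed
  have base: "Ord N 1 \<subseteq> mp.span (R \<union> Ord N 2)"
  proof -
    have "U1 \<subseteq> mp.span (R \<union> Ord N 2)"
      unfolding U1_def using IR by (intro mp.span_minimal mp.subspace_span) (auto intro: mp.span_base)
    moreover have "B \<subseteq> R"
    proof
      fix b assume "b \<in> B"
      then obtain i where i: "i < n" "\<theta> i = b" using \<theta> by (auto simp: bij_betw_def)
      then show "b \<in> R" using SR[OF pvar_Ord[OF i(1)]] by (simp only: subst_pvar)
    qed
    ultimately have "mp.span (B \<union> U1) \<subseteq> mp.span (R \<union> Ord N 2)"
      by (intro mp.span_minimal mp.subspace_span) (auto intro: mp.span_base)
    then show ?thesis using B_span by blast
  qed
  have spR: "mp.span R = R" using sR by (simp add: mp.span_eq_iff)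
  have step: "Ord N (Suc j) \<subseteq> mp.span (R \<union> Ord N (Suc (Suc j)))" for j
  proof (induction j)
    case 0
    then show ?case using base by (simp add: numeral_2_eq_2 One_nat_def)
  next
    case (Suc j)
    let ?W = "mp.span (R \<union> Ord N (Suc (Suc (Suc j))))"
    show ?case
    proof
      fix q assume "q \<in> Ord N (Suc (Suc j))"
      then show "q \<in> ?W"
      proof (rule Ord2_in_subspace[OF mp.subspace_span, rotated])
        fix a b assume ab: "a \<in> Ord N 1" "b \<in> Ord N (Suc j)"
        obtain r o1 where a: "r \<in> R" "o1 \<in> Ord N 2" "a = r + o1"
          using mp.span_Un_subspaceE[OF subsetD[OF base ab(1)] subspace_Ord] unfolding spR by blast
        obtain r' o2 where b: "r' \<in> R" "o2 \<in> Ord N (Suc (Suc j))" "b = r' + o2"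
          using mp.span_Un_subspaceE[OF subsetD[OF Suc.IH ab(2)] subspace_Ord] unfolding spR by blast
        have "a * b = r * r' + (r * o2 + o1 * b)" by (simp add: a b algebra_simps)
        moreover have "r * o2 + o1 * b \<in> Ord N (Suc (Suc (Suc j)))"
          using R_Ord[OF a(1)] a b ab by (intro mp.subspace_add[OF subspace_Ord]) (auto intro: Ord_mult')
        ultimately show "a * b \<in> ?W" using RR[OF a(1) b(1)] by (auto intro: mp.span_add mp.span_base)
      qed
    qed
  qed
  have "Ord N 1 \<subseteq> mp.span (R \<union> Ord N (Suc j))" for j
  proof (induction j)
    case 0
    then show ?case by (auto simp: One_nat_def intro: mp.span_base)
  next
    case (Suc j)
    have "mp.span (R \<union> Ord N (Suc j)) \<subseteq> mp.span (R \<union> Ord N (Suc (Suc j)))"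
      using step[of j] by (intro mp.span_minimal mp.subspace_span) (auto intro: mp.span_base)
    then show ?case using Suc by blast
  qed
  then have "Ord N 1 \<subseteq> mp.span (R \<union> Ord N (Suc M))" .
  also have "\<dots> \<subseteq> R" using Ord_antimono[of M "Suc M" N] M IR sR by (intro mp.span_minimal) auto
  finally show ?thesis using assms by (auto simp: R_def)
qed

lemma linear_part_decompose:
  assumes p: "p \<in> Ord n 1"
  shows "p - (\<Sum>i<n. psc (Poly_Mapping.lookup p (Poly_Mapping.single i 1)) (pvar i)) \<in> Ord n 2"
  unfolding Ord_def
proof (intro CollectI ballI)
  let ?q = "p - (\<Sum>i<n. psc (Poly_Mapping.lookup p (Poly_Mapping.single i 1)) (pvar i))"
  fix m assume m: "m \<in> Poly_Mapping.keys ?q"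
  have "?q \<in> Ord n 1" using p pvar_Ord
    by (intro mp.subspace_diff[OF subspace_Ord] mp.subspace_sum[OF subspace_Ord] mp.subspace_scale[OF subspace_Ord]) auto
  then have k: "Poly_Mapping.keys m \<subseteq> {..<n}" "1 \<le> mdeg m" using m unfolding Ord_def by blast+
  have "mdeg m \<noteq> 1"
  proof
    assume d: "mdeg m = 1"
    then have "m \<noteq> 0" by auto
    then obtain j where j: "j \<in> Poly_Mapping.keys m" by (metis equals0I keys_eq_empty)
    have "m - Poly_Mapping.single j 1 = 0" using monomial_remove_var(2)[OF j] d by (simp add: deg_eq_0)
    then have mj: "m = Poly_Mapping.single j 1" using monomial_remove_var(1)[OF j] by simp
    have "Poly_Mapping.lookup (\<Sum>i<n. psc (Poly_Mapping.lookup p (Poly_Mapping.single i 1)) (pvar i)) m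
      = (\<Sum>i<n. if i = j then Poly_Mapping.lookup p m else 0)"
      unfolding lookup_sum lookup_psc lookup_mono mj by (rule sum.cong) (auto simp: single_one_eq_iff)
    also have "\<dots> = Poly_Mapping.lookup p m" using j k by auto
    finally show False using m by (simp add: in_keys_iff lookup_minus)
  qed
  then show "Poly_Mapping.keys m \<subseteq> {..<n} \<and> 2 \<le> mdeg m" using k by auto
qed

text \<open>
  Minimality: the linear part of a relation would be a linear dependency among the \<open>\<theta>\<^sub>i\<close> modulo \<open>U1\<close>.
\<close>

lemma I_Ord2: "I \<subseteq> Ord n 2"
proof
  fix p assume "p \<in> I"
  then have p: "p \<in> Ord n 0" "S p \<in> I0" by (auto simp: I_def)
  define c where "c = Poly_Mapping.lookup p 0"
  define q where "q = p - psc c 1"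
  have q: "q \<in> Ord n 1" unfolding q_def c_def by (rule const_plus_Ord1[OF p(1)])
  have "S p - S q \<in> Ord N 1" using p(2) I0(2) S_Ord[OF q] by (blast intro: mp.subspace_diff[OF subspace_Ord])
  then have "psc c 1 \<in> Ord N 1" by (simp add: q_def S_lin subst_1)
  then have c: "c = 0" using mp.subspace_scale_iff[OF subspace_Ord] mono_Ord[of 0 N 1] by (auto simp: mono_0)
  then have p1: "p \<in> Ord n 1" using q by (simp add: q_def)
  define l where "l i = Poly_Mapping.lookup p (Poly_Mapping.single i 1)" for i
  have 2: "p - (\<Sum>i<n. psc (l i) (pvar i)) \<in> Ord n 2" unfolding l_def by (rule linear_part_decompose[OF p1])
  have "S p - S (p - (\<Sum>i<n. psc (l i) (pvar i))) \<in> U1"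
    using p(2) I0_U1 S_Ord[OF 2] Ord2_U1 by (blast intro: mp.subspace_diff[OF sU1])
  then have s: "(\<Sum>i<n. psc (l i) (\<theta> i)) \<in> U1" by (simp add: S_lin subst_pvar)
  define g where "g = the_inv_into {..<n} \<theta>"
  have g: "g (\<theta> i) = i" if "i < n" for i
    using that \<theta> by (auto simp: g_def bij_betw_def the_inv_into_f_f)
  have "(\<Sum>b\<in>B. psc (l (g b)) (id b)) = (\<Sum>i<n. psc (l (g (\<theta> i))) (\<theta> i))"
    by (subst sum.reindex_bij_betw[OF \<theta>, symmetric]) simp
  also have "\<dots> = (\<Sum>i<n. psc (l i) (\<theta> i))" using g by (intro sum.cong) auto
  finally have "(\<Sum>b\<in>B. psc (l (g b)) (id b)) \<in> U1" using s by simp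
  then have "\<forall>b\<in>B. l (g b) = 0"
    using B_ind[unfolded mp.indep_mod_def, rule_format, of "\<lambda>b. l (g b)"] by blast
  then have "l i = 0" if "i < n" for i using \<theta>_B[OF that] g[OF that] by metis
  then show "p \<in> Ord n 2" using 2 by simp
qed

lemma max_times_span_mono:
  assumes "p \<in> mp.span {a * b | a b. a \<in> Ord N 1 \<and> b \<in> I0}" "mp.endo T" "mp.subspace W"
    "\<And>a b. a \<in> Ord N 1 \<Longrightarrow> b \<in> I0 \<Longrightarrow> T (a * b) \<in> W"
  shows "T p \<in> W"
  by (rule mp.endo_image_span[OF assms(2,1) _ assms(3)]) (use assms(4) in auto)

text \<open>
  The number of generators of the ideal minus the number of variables does not depend on the presentation. Besides the
  images of \<open>BW\<close>, which have order at least 2, the ideal \<open>I0\<close> contains a set \<open>PB\<close> of at least \<open>N - n\<close> elements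
  with independent linear parts, since these complement the \<open>\<theta>\<^sub>i\<close>. Together they are independent modulo
  \<open>max_times N I0\<close>, so that there are at most \<open>N\<close>. The independence of the images is shown by means of a
  substitution \<open>S'\<close> in the opposite direction.
\<close>

lemma card_indep_relations:
  assumes BW: "finite BW" "BW \<subseteq> I" "mp.indep_mod (max_times n I) BW id"
  shows "card BW \<le> n"
proof -
  have "\<forall>i<N. \<exists>p\<in>Ord n 1. pvar i - S p \<in> I0" using S_surj pvar_Ord by blast
  then obtain \<xi> where \<xi>: "\<And>i. i < N \<Longrightarrow> \<xi> i \<in> Ord n 1 \<and> pvar i - S (\<xi> i) \<in> I0" by metis
  define S' where "S' = subst_poly \<xi>"
  have S'_endo: "mp.endo S'" unfolding S'_def by (rule endo_subst)
  note S'_lin = module_hom.add[OF S'_endo] module_hom.diff[OF S'_endo] module_hom.scale[OF S'_endo]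
    module_hom.zero[OF S'_endo] module_hom.sum[OF S'_endo]
  have S'_mult: "S' (p * q) = S' p * S' q" for p q by (simp add: S'_def subst_mult)
  have S'_Ord: "S' p \<in> Ord n k" if "p \<in> Ord N k" for p k
    unfolding S'_def using \<xi> that by (intro subst_Ord) auto
  have SS': "a - S (S' a) \<in> I0" if "a \<in> Ord N 0" for a
    using that
  proof (induction a rule: Ord_induct_var)
    case (const c)
    then show ?case using sI0 by (simp add: S'_lin S_lin S'_def subst_1 mp.subspace_0)
  next
    case (add p q)
    then show ?case using mp.subspace_add[OF sI0, of "p - S (S' p)" "q - S (S' q)"]
      by (simp add: S'_lin S_lin algebra_simps)
  next
    case (mult i p)
    have "p * (pvar i - S (\<xi> i)) + S (\<xi> i) * (p - S (S' p)) \<in> I0"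
      using mult \<xi>[OF mult(1)] S_Ord[of "\<xi> i" 1] Ord_antimono[of 0 1 N]
      by (intro mp.subspace_add[OF sI0] I0_mult) auto
    moreover have "S (S' (pvar i * p)) = S (\<xi> i) * S (S' p)" by (simp only: S'_mult subst_mult S'_def subst_pvar)
    ultimately show ?case by (simp add: algebra_simps)
  qed
  have S'I: "S' a \<in> I" if "a \<in> I0" for a
  proof -
    have a0: "a \<in> Ord N 0" using that I0_Ord by blast
    have "a - (a - S (S' a)) \<in> I0" using that SS'[OF a0] by (rule mp.subspace_diff[OF sI0])
    then show ?thesis using S'_Ord[OF a0] by (simp add: I_def)
  qed
  have smI: "mp.subspace (max_times n I)" unfolding max_times_def by (rule mp.subspace_span)
  have mI_base: "a * b \<in> max_times n I" if "a \<in> Ord n 1" "b \<in> I" for a b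
    unfolding max_times_def using that by (blast intro: mp.span_base)
  have S'mI: "S' a \<in> max_times n I" if "a \<in> max_times N I0" for a
    by (rule max_times_span_mono[OF that[unfolded max_times_def] S'_endo smI])
      (auto simp: S'_mult intro!: mI_base S'_Ord S'I)
  have S'S: "S' (S p) - p \<in> I" if "p \<in> Ord n 0" for p
  proof -
    have "- (S p - S (S' (S p))) \<in> I0" using SS'[OF S_Ord[OF that]] by (rule mp.subspace_neg[OF sI0])
    moreover have "S' (S p) - p \<in> Ord n 0" using S'_Ord[OF S_Ord[OF that]] that by (rule mp.subspace_diff[OF subspace_Ord])
    ultimately show ?thesis by (simp add: I_def S_lin)
  qed
  \<comment> \<open>For order at least 2, the difference of \<open>S' \<circ> S\<close> and the identity is not only in \<open>I\<close> but in its product with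
    the maximal ideal.\<close>
  have S'S2: "S' (S p) - p \<in> max_times n I" if p: "p \<in> Ord n 2" for p
  proof -
    have "p \<in> {p. S' (S p) - p \<in> max_times n I}"
    proof (rule Ord2_in_subspace[where k = 1])
      show "mp.subspace {p. S' (S p) - p \<in> max_times n I}"
      proof (rule mp.subspaceI)
        fix u v assume "u \<in> {p. S' (S p) - p \<in> max_times n I}" "v \<in> {p. S' (S p) - p \<in> max_times n I}"
        then have "(S' (S u) - u) + (S' (S v) - v) \<in> max_times n I" by (auto intro: mp.subspace_add[OF smI])
        then show "u + v \<in> {p. S' (S p) - p \<in> max_times n I}" by (simp add: S'_lin S_lin algebra_simps)
      next
        fix c u assume "u \<in> {p. S' (S p) - p \<in> max_times n I}"
        then have "psc c (S' (S u) - u) \<in> max_times n I" by (auto intro: mp.subspace_scale[OF smI])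
        then show "psc c u \<in> {p. S' (S p) - p \<in> max_times n I}" by (simp add: S'_lin S_lin mp.scale_right_diff_distrib)
      qed (use smI in \<open>simp add: S'_lin S_lin mp.subspace_0\<close>)
      show "p \<in> Ord n (Suc 1)" using p by (simp add: numeral_2_eq_2)
      fix a b assume ab: "a \<in> Ord n 1" "b \<in> Ord n 1"
      have 01: "Ord n 1 \<subseteq> Ord n 0" by (rule Ord_antimono) simp
      have "S' (S b) * (S' (S a) - a) + a * (S' (S b) - b) \<in> max_times n I"
        using ab 01 S'_Ord[OF S_Ord[OF ab(2)]] by (intro mp.subspace_add[OF smI] mI_base S'S) auto
      then show "a * b \<in> {p. S' (S p) - p \<in> max_times n I}" by (simp add: S'_mult subst_mult algebra_simps)
    qed
    then show ?thesis by simp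
  qed
  have sO2: "mp.subspace (Ord N 2)" by (rule subspace_Ord)
  have B2: "mp.indep_mod (Ord N 2) B id" using B_ind Ord2_U1 unfolding mp.indep_mod_def by blast
  have fd2: "mp.fin_dim_mod (B \<union> I0) (Ord N 2)"
    unfolding mp.fin_dim_mod_def
  proof (intro exI conjI)
    show "finite (pmono ` low_monomials N 2)" using finite_low_monomials by simp
    show "B \<union> I0 \<subseteq> mp.span (pmono ` low_monomials N 2 \<union> Ord N 2)"
      using Ord_low_decompose[of N 2] B_Ord I0_Ord Ord_antimono[of 0 1 N] by blast
  qed
  obtain B' where B': "B \<subseteq> B'" "B' \<subseteq> B \<union> I0" "finite B'" "mp.indep_mod (Ord N 2) B' id" "B \<union> I0 \<subseteq> mp.span (B' \<union> Ord N 2)"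
    using mp.indep_mod_extend[OF fd2 sO2 _ B_fin B2] by blast
  have "Ord N 1 \<subseteq> mp.span (B' \<union> Ord N 2)"
  proof -
    have "Ord N 2 \<subseteq> mp.span (B' \<union> Ord N 2)" by (auto intro: mp.span_base)
    then have "U1 \<subseteq> mp.span (B' \<union> Ord N 2)" unfolding U1_def using B'(5) by (intro mp.span_minimal mp.subspace_span) auto
    then have "mp.span (B \<union> U1) \<subseteq> mp.span (B' \<union> Ord N 2)" using B'(5) by (intro mp.span_minimal mp.subspace_span) auto
    then show ?thesis using B_span by blast
  qed
  moreover have "mp.indep_mod (Ord N 2) {..<N} pvar"
    unfolding mp.indep_mod_def
  proof (intro allI impI ballI)
    fix c i assume s: "(\<Sum>i<N. psc (c i) (pvar i)) \<in> Ord N 2" and i: "i \<in> {..<N}"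
    have "Poly_Mapping.lookup (\<Sum>i<N. psc (c i) (pvar i)) (Poly_Mapping.single i 1) = (\<Sum>j<N. if j = i then c i else 0)"
      unfolding lookup_sum lookup_psc lookup_mono by (rule sum.cong) (auto simp: single_one_eq_iff)
    also have "\<dots> = c i" using i by simp
    finally have l: "Poly_Mapping.lookup (\<Sum>i<N. psc (c i) (pvar i)) (Poly_Mapping.single i 1) = c i" .
    show "c i = 0"
    proof (rule ccontr)
      assume "c i \<noteq> 0"
      then have "Poly_Mapping.single i 1 \<in> Poly_Mapping.keys (\<Sum>i<N. psc (c i) (pvar i))" using l by (simp add: in_keys_iff)
      then have "2 \<le> mdeg (Poly_Mapping.single i 1)" using s unfolding Ord_def by blast
      then show False by simp
    qed
  qed
  ultimately have N_le: "N \<le> card B'"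
    using mp.indep_mod_card_le[OF _ B'(3) sO2, of "{..<N}" pvar] pvar_Ord by auto
  define PB where "PB = B' - B"
  have PB: "finite PB" "PB \<subseteq> I0" using B' by (auto simp: PB_def)
  have cardB': "card B' = card PB + n"
    unfolding PB_def using B'(1,3) B_fin card_B by (metis card_Diff_subset card_mono le_add_diff_inverse2)
  have SO2: "S b \<in> Ord N 2" if "b \<in> BW" for b using that BW(2) I_Ord2 S_Ord by blast
  have mI0_O2: "max_times N I0 \<subseteq> Ord N 2"
    unfolding max_times_def using I0(2) by (intro mp.span_minimal subspace_Ord) (auto intro: Ord_mult'[of _ N 1 _ 1])
  have smI0: "mp.subspace (max_times N I0)" unfolding max_times_def by (rule mp.subspace_span)
  have "mp.indep_mod (max_times N I0) (BW <+> PB) (case_sum S id)"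
    unfolding mp.indep_mod_def
  proof (intro allI impI)
    fix c assume "(\<Sum>i\<in>BW <+> PB. psc (c i) (case_sum S id i)) \<in> max_times N I0"
    then have s: "(\<Sum>b\<in>BW. psc (c (Inl b)) (S b)) + (\<Sum>p\<in>PB. psc (c (Inr p)) p) \<in> max_times N I0"
      using BW(1) PB(1) by (simp add: sum.Plus)
    have "(\<Sum>b\<in>BW. psc (c (Inl b)) (S b)) \<in> Ord N 2"
      using SO2 by (intro mp.subspace_sum[OF sO2] mp.subspace_scale[OF sO2])
    then have "((\<Sum>b\<in>BW. psc (c (Inl b)) (S b)) + (\<Sum>p\<in>PB. psc (c (Inr p)) p)) - (\<Sum>b\<in>BW. psc (c (Inl b)) (S b)) \<in> Ord N 2"
      using s mI0_O2 by (blast intro: mp.subspace_diff[OF sO2])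
    then have 1: "(\<Sum>p\<in>PB. psc (c (Inr p)) p) \<in> Ord N 2" by simp
    have "(\<Sum>b\<in>B'. psc (if b \<in> PB then c (Inr b) else 0) (id b)) = (\<Sum>p\<in>PB. psc (if p \<in> PB then c (Inr p) else 0) (id p))"
      using B'(3) by (intro sum.mono_neutral_right) (auto simp: PB_def)
    also have "\<dots> = (\<Sum>p\<in>PB. psc (c (Inr p)) p)" by (rule sum.cong) auto
    finally have "(\<Sum>b\<in>B'. psc (if b \<in> PB then c (Inr b) else 0) (id b)) \<in> Ord N 2" using 1 by simp
    then have "\<forall>b\<in>B'. (if b \<in> PB then c (Inr b) else 0) = 0"
      using B'(4)[unfolded mp.indep_mod_def, rule_format, of "\<lambda>b. if b \<in> PB then c (Inr b) else 0"] by blast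
    then have d0: "\<forall>p\<in>PB. c (Inr p) = 0" by (auto simp: PB_def split: if_splits)
    then have "(\<Sum>p\<in>PB. psc (c (Inr p)) p) = 0" by (intro sum.neutral) auto
    then have "S (\<Sum>b\<in>BW. psc (c (Inl b)) b) \<in> max_times N I0" using s by (simp add: S_lin)
    then have 2: "S' (S (\<Sum>b\<in>BW. psc (c (Inl b)) b)) \<in> max_times n I" by (rule S'mI)
    have "(\<Sum>b\<in>BW. psc (c (Inl b)) b) \<in> Ord n 2"
      using BW(2) I_Ord2 by (intro mp.subspace_sum[OF subspace_Ord] mp.subspace_scale[OF subspace_Ord]) auto
    then have "S' (S (\<Sum>b\<in>BW. psc (c (Inl b)) b)) - (S' (S (\<Sum>b\<in>BW. psc (c (Inl b)) b)) - (\<Sum>b\<in>BW. psc (c (Inl b)) b)) \<in> max_times n I"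
      using 2 S'S2 by (blast intro: mp.subspace_diff[OF smI])
    then have "(\<Sum>b\<in>BW. psc (c (Inl b)) (id b)) \<in> max_times n I" by simp
    then have "\<forall>b\<in>BW. c (Inl b) = 0"
      using BW(3)[unfolded mp.indep_mod_def, rule_format, of "\<lambda>b. c (Inl b)"] by blast
    then show "\<forall>i\<in>BW <+> PB. c i = 0" using d0 by auto
  qed
  moreover have "case_sum S id i \<in> mp.span (Gs \<union> max_times N I0)" if "i \<in> BW <+> PB" for i
    using that BW(2) PB(2) gens(3) by (auto simp: I_def)
  ultimately have "card (BW <+> PB) \<le> card Gs"
    using BW(1) PB(1) by (intro mp.indep_mod_card_le[OF _ gens(1) smI0]) auto
  then show ?thesis using gens(2) N_le cardB' BW(1) PB(1) by (simp add: card_Plus)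
qed

end

section \<open>Homogeneous lifts of derivations\<close>

context ci_presentation
begin

definition lam :: "nat \<Rightarrow> int"
  where "lam i = w (\<theta> i)"

definition wtm :: "(nat \<Rightarrow>\<^sub>0 nat) \<Rightarrow> int"
  where "wtm m = (\<Sum>i<n. int (Poly_Mapping.lookup m i) * lam i)"

text \<open>
  This derivation multiplies monomials by their weights \<open>wtm\<close>; it lifts \<open>h\<close>.
\<close>

definition H :: "mpoly \<Rightarrow> mpoly"
  where "H = pderivation n (\<lambda>i. psc (of_int (lam i)) (pvar i))"

lemma derH: "derivation H"
  unfolding H_def by (rule derivation_pderivation)

lemma H_mono: "H (pmono m) = psc (of_int (wtm m)) (pmono m)"
proof -
  have "psc (of_nat (Poly_Mapping.lookup m i)) (pmono (m - Poly_Mapping.single i 1) * psc (of_int (lam i)) (pvar i))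
    = psc (of_int (int (Poly_Mapping.lookup m i) * lam i)) (pmono m)" for i
  proof (cases "i \<in> Poly_Mapping.keys m")
    case True
    have "pmono (m - Poly_Mapping.single i 1) * pvar i = pmono m"
      by (subst (2) monomial_remove_var(1)[OF True]) (simp add: mono_add mult.commute)
    then show ?thesis by (simp add: psc_mult_right)
  qed (simp add: in_keys_iff)
  then show ?thesis
    by (simp add: H_def pderivation_def lin_ext_mono wtm_def mp.scale_sum_left)
qed

lemma lookup_H: "Poly_Mapping.lookup (H p) m = of_int (wtm m) * Poly_Mapping.lookup p m"
proof -
  have Hp: "H p = (\<Sum>k\<in>Poly_Mapping.keys p. psc (Poly_Mapping.lookup p k) (H (pmono k)))"
    by (subst mpoly_sum_mono)
      (simp add: module_hom.sum[OF derivation_endo[OF derH]] derivation_scale[OF derH])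
  have "Poly_Mapping.lookup (H p) m = (\<Sum>k\<in>Poly_Mapping.keys p. if k = m then of_int (wtm m) * Poly_Mapping.lookup p m else 0)"
    unfolding Hp lookup_sum H_mono lookup_psc lookup_mono by (rule sum.cong) auto
  then show ?thesis by (simp add: in_keys_iff)
qed

definition hom :: "int \<Rightarrow> mpoly set"
  where "hom d = {p. H p = psc (of_int d) p}"

lemma hom_iff: "p \<in> hom d \<longleftrightarrow> (\<forall>m\<in>Poly_Mapping.keys p. wtm m = d)"
proof -
  have "p \<in> hom d \<longleftrightarrow> (\<forall>m. of_int (wtm m) * Poly_Mapping.lookup p m = of_int d * Poly_Mapping.lookup p m)"
    by (simp add: hom_def poly_mapping_eq_iff fun_eq_iff lookup_H lookup_psc)
  then show ?thesis by (auto simp: in_keys_iff)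
qed

lemma subspace_hom: "mp.subspace (hom d)"
  by (rule mp.subspaceI)
    (auto simp: hom_def derivation_add[OF derH] derivation_scale[OF derH] mp.scale_right_distrib mult.commute
      module_hom.zero[OF derivation_endo[OF derH]])

lemma pvar_hom: "i < n \<Longrightarrow> pvar i \<in> hom (lam i)"
  by (simp add: hom_def H_def pderivation_pvar)

definition comp :: "int \<Rightarrow> mpoly \<Rightarrow> mpoly"
  where "comp d = lin_ext (\<lambda>m. if wtm m = d then pmono m else 0)"

lemma lookup_comp: "Poly_Mapping.lookup (comp d p) m = (if wtm m = d then Poly_Mapping.lookup p m else 0)"
proof -
  have "Poly_Mapping.lookup (comp d p) m
    = (\<Sum>k\<in>Poly_Mapping.keys p. if k = m then (if wtm m = d then Poly_Mapping.lookup p m else 0) else 0)"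
    unfolding comp_def lin_ext_def lookup_sum lookup_psc by (rule sum.cong) (auto simp: lookup_mono)
  then show ?thesis by (simp add: in_keys_iff)
qed

lemma comp_hom: "comp d p \<in> hom d"
  unfolding hom_iff by (auto simp: in_keys_iff lookup_comp split: if_splits)

lemma comp_Ord: "p \<in> Ord n k \<Longrightarrow> comp d p \<in> Ord n k"
  unfolding Ord_def by (auto simp: in_keys_iff lookup_comp split: if_splits)

lemma comp_sum:
  assumes "finite D" "wtm ` Poly_Mapping.keys p \<subseteq> D"
  shows "(\<Sum>d\<in>D. comp d p) = p"
proof (rule poly_mapping_eqI)
  fix m
  have "Poly_Mapping.lookup (\<Sum>d\<in>D. comp d p) m = (\<Sum>d\<in>D. if d = wtm m then Poly_Mapping.lookup p m else 0)"
    unfolding lookup_sum lookup_comp by (rule sum.cong) auto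
  then show "Poly_Mapping.lookup (\<Sum>d\<in>D. comp d p) m = Poly_Mapping.lookup p m"
    using assms by (cases "m \<in> Poly_Mapping.keys p") (auto simp: in_keys_iff)
qed

text \<open>
  Both \<open>S \<circ> D\<close> and \<open>d \<circ> S\<close> are derivations along \<open>S\<close>, so it suffices to compare them on variables.
\<close>

lemma lift_derivation:
  assumes D: "derivation D" and d: "derivation_mod N I0 d"
    and Dn: "\<And>i. i < n \<Longrightarrow> D (pvar i) \<in> Ord n 0"
    and x: "\<And>i. i < n \<Longrightarrow> S (D (pvar i)) - d (\<theta> i) \<in> I0" and p: "p \<in> Ord n 0"
  shows "S (D p) - d (S p) \<in> I0"
  using p
proof (induction p rule: Ord_induct_var)
  case (const c)
  have d1: "d (1 * 1) - (d 1 * 1 + 1 * d 1) \<in> I0" using d one_Ord unfolding derivation_mod_def by blast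
  have E: "mp.endo d" using d by (simp add: derivation_mod_def)
  have "psc c (d (1 * 1) - (d 1 * 1 + 1 * d 1)) \<in> I0" using d1 by (rule mp.subspace_scale[OF sI0])
  then show ?case
    by (simp add: derivation_1[OF D] S_lin subst_1 module_hom.scale[OF E] module_hom.zero[OF endo_subst])
next
  case (add p q)
  have E: "mp.endo d" using d by (simp add: derivation_mod_def)
  have "(S (D p) - d (S p)) + (S (D q) - d (S q)) \<in> I0" using add by (intro mp.subspace_add[OF sI0])
  then show ?case by (simp add: derivation_add[OF D] S_lin module_hom.add[OF E] algebra_simps)
next
  case (mult i p)
  have 0: "\<theta> i \<in> Ord N 0" using \<theta>_Ord[OF mult(1)] Ord_antimono[of 0 1 N] by auto
  have 1: "d (\<theta> i * S p) - (d (\<theta> i) * S p + \<theta> i * d (S p)) \<in> I0"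
    using d 0 S_Ord[OF mult(2)] unfolding derivation_mod_def by blast
  have 2: "S p * (S (D (pvar i)) - d (\<theta> i)) + \<theta> i * (S (D p) - d (S p)) \<in> I0"
    using mult x 0 S_Ord by (intro mp.subspace_add[OF sI0] I0_mult) auto
  have "(S p * (S (D (pvar i)) - d (\<theta> i)) + \<theta> i * (S (D p) - d (S p)))
      - (d (\<theta> i * S p) - (d (\<theta> i) * S p + \<theta> i * d (S p))) \<in> I0"
    by (rule mp.subspace_diff[OF sI0 2 1])
  moreover have "S (D (pvar i * p)) - d (S (pvar i * p))
    = (S p * (S (D (pvar i)) - d (\<theta> i)) + \<theta> i * (S (D p) - d (S p)))
      - (d (\<theta> i * S p) - (d (\<theta> i) * S p + \<theta> i * d (S p)))"
    by (simp add: derivation_mult[OF D] S_lin subst_mult subst_pvar algebra_simps)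
  ultimately show ?case by simp
qed

lemma \<theta>_eigen: "i < n \<Longrightarrow> h (\<theta> i) - psc (of_int (lam i)) (\<theta> i) \<in> I0"
  using B_wt[OF \<theta>_B] by (simp add: M0.wt_def lam_def)

lemma S_H:
  assumes "p \<in> Ord n 0"
  shows "S (H p) - h (S p) \<in> I0"
proof (rule lift_derivation[OF derH h _ _ assms])
  fix i assume i: "i < n"
  have Hi: "H (pvar i) = psc (of_int (lam i)) (pvar i)" using i by (simp add: H_def pderivation_pvar)
  have "pvar i \<in> Ord n 0" using pvar_Ord[OF i] Ord_antimono[of 0 1 n] by auto
  then show "H (pvar i) \<in> Ord n 0" unfolding Hi by (rule mp.subspace_scale[OF subspace_Ord])
  have "S (H (pvar i)) - h (\<theta> i) = - (h (\<theta> i) - psc (of_int (lam i)) (\<theta> i))"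
    by (simp add: Hi S_lin subst_pvar)
  then show "S (H (pvar i)) - h (\<theta> i) \<in> I0" using mp.subspace_neg[OF sI0 \<theta>_eigen[OF i]] by simp
qed

lemma S_hom_eigen:
  assumes "p \<in> Ord n 0" "p \<in> hom d"
  shows "h (S p) - psc (of_int d) (S p) \<in> I0"
proof -
  have "- (S (H p) - h (S p)) \<in> I0" using S_H[OF assms(1)] by (rule mp.subspace_neg[OF sI0])
  then show ?thesis using assms(2) by (simp add: hom_def S_lin)
qed

text \<open>
  The homogeneous components of \<open>p\<close> are mapped by \<open>S\<close> to eigenvectors of \<open>h\<close> with distinct eigenvalues and sum 0.
\<close>

lemma I_homogeneous:
  assumes p: "p \<in> I"
  shows "comp d p \<in> I"
proof -
  have p0: "p \<in> Ord n 0" "S p \<in> I0" using p by (auto simp: I_def)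
  define D where "D = insert d (wtm ` Poly_Mapping.keys p)"
  have "finite D" by (simp add: D_def)
  have "\<forall>k\<in>D. S (comp k p) \<in> I0"
  proof (rule mp.eigenvectors_mod_independent_family[OF M0.h sI0 _ \<open>finite D\<close>, where l = of_int])
    show "h (S (comp k p)) - psc (of_int k) (S (comp k p)) \<in> I0" for k
      using S_hom_eigen[OF comp_Ord[OF p0(1)] comp_hom] .
    have "(\<Sum>k\<in>D. comp k p) = p" by (rule comp_sum[OF \<open>finite D\<close>]) (auto simp: D_def)
    then show "(\<Sum>k\<in>D. S (comp k p)) \<in> I0" using p0(2) by (simp add: S_lin flip: S_lin(5))
  qed (use M0.hU in \<open>auto simp: inj_on_def\<close>)
  then show ?thesis using comp_Ord[OF p0(1)] by (auto simp: I_def D_def)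
qed

lemma homogeneous_lift:
  assumes u: "u \<in> Ord N 1" "h u - psc (of_int d) u \<in> I0"
  shows "\<exists>p\<in>Ord n 1. p \<in> hom d \<and> S p - u \<in> I0"
proof -
  obtain p where p: "p \<in> Ord n 1" "u - S p \<in> I0" using S_surj[OF u(1)] by blast
  have p0: "p \<in> Ord n 0" using p(1) Ord_antimono[of 0 1 n] by auto
  define D where "D = insert d (wtm ` Poly_Mapping.keys p)"
  have fD: "finite D" by (simp add: D_def)
  have "\<forall>k\<in>D. S (comp k p) - (if k = d then u else 0) \<in> I0"
  proof (rule mp.eigenvectors_mod_independent_family[OF M0.h sI0 _ fD, where l = of_int])
    fix k
    have "h (S (comp k p)) - psc (of_int k) (S (comp k p)) \<in> I0"
      using S_hom_eigen[OF comp_Ord[OF p0] comp_hom] .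
    moreover have "(if k = d then h u - psc (of_int k) u else 0) \<in> I0" using u(2) mp.subspace_0[OF sI0] by auto
    ultimately have "(h (S (comp k p)) - psc (of_int k) (S (comp k p))) - (if k = d then h u - psc (of_int k) u else 0) \<in> I0"
      by (rule mp.subspace_diff[OF sI0])
    then show "h (S (comp k p) - (if k = d then u else 0)) - psc (of_int k) (S (comp k p) - (if k = d then u else 0)) \<in> I0"
      by (auto simp: M0.h_lin module_hom.zero[OF M0.h] mp.scale_right_diff_distrib algebra_simps)
  next
    have "(\<Sum>k\<in>D. comp k p) = p" by (rule comp_sum[OF fD]) (auto simp: D_def)
    then have "(\<Sum>k\<in>D. S (comp k p)) = S p" by (simp flip: S_lin(5))
    moreover have "(\<Sum>k\<in>D. if k = d then u else 0) = u" using fD by (simp add: D_def)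
    moreover have "S p - u \<in> I0" using mp.subspace_neg[OF sI0 p(2)] by simp
    ultimately show "(\<Sum>k\<in>D. S (comp k p) - (if k = d then u else 0)) \<in> I0" by (simp add: sum_subtractf)
  qed (use M0.hU in \<open>auto simp: inj_on_def\<close>)
  then have "S (comp d p) - (if d = d then u else 0) \<in> I0" unfolding D_def by blast
  then have "S (comp d p) - u \<in> I0" by simp
  then show ?thesis using comp_Ord[OF p(1)] comp_hom by blast
qed

text \<open>
  If \<open>d (\<theta> i)\<close> is one of the \<open>\<theta>\<close> of the correct weight, the lift is taken to be the corresponding variable. This preserves
  the strings of variables exactly, and not only modulo higher order.
\<close>

lemma graded_lift_exists:
  assumes d: "derivation_mod N I0 d" and c: "\<And>v l. v \<in> M0.wt l \<Longrightarrow> d v \<in> M0.wt (l + of_int c)"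
  shows "\<exists>a. \<forall>i\<in>{..<n}. a i \<in> Ord n 1 \<and> a i \<in> hom (lam i + c) \<and> S (a i) - d (\<theta> i) \<in> I0 \<and>
     (\<forall>j<n. \<theta> j = d (\<theta> i) \<and> lam j = lam i + c \<longrightarrow> (\<exists>k<n. a i = pvar k \<and> \<theta> k = d (\<theta> i)))"
proof -
  have "\<exists>a. a \<in> Ord n 1 \<and> a \<in> hom (lam i + c) \<and> S a - d (\<theta> i) \<in> I0 \<and>
     (\<forall>j<n. \<theta> j = d (\<theta> i) \<and> lam j = lam i + c \<longrightarrow> (\<exists>k<n. a = pvar k \<and> \<theta> k = d (\<theta> i)))" if i: "i < n" for i
  proof (cases "\<exists>j<n. \<theta> j = d (\<theta> i) \<and> lam j = lam i + c")
    case True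
    then obtain j where j: "j < n" "\<theta> j = d (\<theta> i)" "lam j = lam i + c" by blast
    then show ?thesis using pvar_Ord[OF j(1)] pvar_hom[OF j(1)] mp.subspace_0[OF sI0]
      by (intro exI[of _ "pvar j"]) (auto simp: subst_pvar)
  next
    case False
    have "d (\<theta> i) \<in> M0.wt (of_int (lam i + c))"
      using c[OF B_wt[OF \<theta>_B[OF i]]] by (simp add: lam_def)
    then have "d (\<theta> i) \<in> Ord N 1" "h (d (\<theta> i)) - psc (of_int (lam i + c)) (d (\<theta> i)) \<in> I0"
      by (auto simp: M0.wt_def)
    then obtain a where "a \<in> Ord n 1" "a \<in> hom (lam i + c)" "S a - d (\<theta> i) \<in> I0"
      using homogeneous_lift by blast
    then show ?thesis using False by blast
  qed
  then have "\<forall>i\<in>{..<n}. \<exists>a. a \<in> Ord n 1 \<and> a \<in> hom (lam i + c) \<and> S a - d (\<theta> i) \<in> I0 \<and>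
     (\<forall>j<n. \<theta> j = d (\<theta> i) \<and> lam j = lam i + c \<longrightarrow> (\<exists>k<n. a = pvar k \<and> \<theta> k = d (\<theta> i)))" by simp
  then show ?thesis by (rule bchoice)
qed

lemma graded_derivation:
  assumes D: "derivation D" and Dn: "\<And>i. i < n \<Longrightarrow> D (pvar i) \<in> hom (lam i + c)" and p: "p \<in> Ord n 0"
  shows "H (D p) - D (H p) = psc (of_int c) (D p)"
proof -
  define \<delta> where "\<delta> p = H (D p) - D (H p) - psc (of_int c) (D p)" for p
  have "derivation \<delta>"
    unfolding derivation_def
  proof (intro conjI allI)
    show "mp.endo \<delta>"
      by (rule mp.endoI) (simp_all add: \<delta>_def derivation_add[OF D] derivation_add[OF derH] derivation_scale[OF D]
        derivation_scale[OF derH] mp.scale_right_distrib mp.scale_right_diff_distrib mult.commute)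
    show "\<delta> (p * q) = \<delta> p * q + p * \<delta> q" for p q
      by (simp add: \<delta>_def derivation_add[OF D] derivation_add[OF derH] derivation_mult[OF D] derivation_mult[OF derH]
        mp.scale_right_distrib algebra_simps psc_mult_left psc_mult_right)
  qed
  moreover have "is_pideal n {0}"
    by (auto simp: is_pideal_def mp.subspace_0[OF subspace_Ord] mp.subspace_def)
  moreover have "\<delta> (pvar i) \<in> {0}" if i: "i < n" for i
  proof -
    have "H (D (pvar i)) = psc (of_int (lam i + c)) (D (pvar i))" using Dn[OF i] by (simp add: hom_def)
    moreover have "H (pvar i) = psc (of_int (lam i)) (pvar i)" using pvar_hom[OF i] by (simp add: hom_def)
    ultimately show ?thesis by (simp add: \<delta>_def derivation_scale[OF D] mp.scale_left_distrib)
  qed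
  ultimately have "\<delta> p \<in> {0}" using p by (rule derivation_into_ideal)
  then show ?thesis by (simp add: \<delta>_def)
qed

lemma Ord_pideal: "is_pideal n (Ord n k)"
  using Ord_antimono[of 0 k n] by (auto simp: is_pideal_def subspace_Ord intro: Ord_mult')

lemma lift_stable:
  assumes D: "derivation D" and d: "derivation_mod N I0 d"
    and x: "\<And>i. i < n \<Longrightarrow> D (pvar i) \<in> Ord n 1" "\<And>i. i < n \<Longrightarrow> S (D (pvar i)) - d (\<theta> i) \<in> I0"
  shows "p \<in> Ord n 0 \<Longrightarrow> D p \<in> Ord n 1" "p \<in> Ord n 0 \<Longrightarrow> S (D p) - d (S p) \<in> I0" "p \<in> I \<Longrightarrow> D p \<in> I"
    "p \<in> max_times n I \<Longrightarrow> D p \<in> max_times n I"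
proof -
  show 1: "D p \<in> Ord n 1" if "p \<in> Ord n 0" for p
    using derivation_into_ideal[OF D Ord_pideal x(1) that] .
  have 01: "Ord n 1 \<subseteq> Ord n 0" by (rule Ord_antimono) simp
  show 2: "S (D p) - d (S p) \<in> I0" if "p \<in> Ord n 0" for p
    using lift_derivation[OF D d _ x(2) that] x(1) 01 by blast
  show 3: "D p \<in> I" if "p \<in> I" for p
  proof -
    have p: "p \<in> Ord n 0" "S p \<in> I0" using that by (auto simp: I_def)
    have "d (S p) \<in> I0" using d p(2) by (simp add: derivation_mod_def)
    then have "(S (D p) - d (S p)) + d (S p) \<in> I0" using 2[OF p(1)] by (intro mp.subspace_add[OF sI0])
    then show ?thesis using 1[OF p(1)] 01 by (auto simp: I_def)
  qed
  show "D p \<in> max_times n I" if "p \<in> max_times n I"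
  proof (rule mp.endo_image_span[OF derivation_endo[OF D] that[unfolded max_times_def]], safe)
    show s: "mp.subspace (max_times n I)" unfolding max_times_def by (rule mp.subspace_span)
    fix a b assume ab: "a \<in> Ord n 1" "b \<in> I"
    have m: "a * b \<in> max_times n I" if "a \<in> Ord n 1" "b \<in> I" for a b
      unfolding max_times_def using that by (blast intro: mp.span_base)
    show "D (a * b) \<in> max_times n I"
      unfolding derivation_mult[OF D] using 1 3 01 ab by (intro mp.subspace_add[OF s] m) auto
  qed
qed

text \<open>
  By the product rule. The error in a relation of \<open>sl\<^sub>2\<close> between lifts is a derivation into \<open>I\<close>; on \<open>I\<close> itself, which has order at
  least 2, the error is therefore in \<open>max_times n I\<close>.
\<close>

lemma derivation_into_max_times:
  assumes D: "derivation D" and DI: "\<And>p. p \<in> Ord n 0 \<Longrightarrow> D p \<in> I" and p: "p \<in> Ord n 2"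
  shows "D p \<in> max_times n I"
proof -
  have s: "mp.subspace (max_times n I)" unfolding max_times_def by (rule mp.subspace_span)
  have m: "a * b \<in> max_times n I" if "a \<in> Ord n 1" "b \<in> I" for a b
    unfolding max_times_def using that by (blast intro: mp.span_base)
  have "p \<in> {p. D p \<in> max_times n I}"
  proof (rule Ord2_in_subspace[where k = 1])
    show "mp.subspace {p. D p \<in> max_times n I}"
      using s by (intro mp.subspaceI) (auto simp: derivation_add[OF D] derivation_scale[OF D]
        module_hom.zero[OF derivation_endo[OF D]] mp.subspace_0 mp.subspace_add mp.subspace_scale)
    show "p \<in> Ord n (Suc 1)" using p by (simp add: numeral_2_eq_2 One_nat_def)
    fix a b assume ab: "a \<in> Ord n 1" "b \<in> Ord n 1"
    have 01: "Ord n 1 \<subseteq> Ord n 0" by (rule Ord_antimono) simp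
    have "b * D a + a * D b \<in> max_times n I" using ab DI 01 by (intro mp.subspace_add[OF s] m) auto
    then show "a * b \<in> {p. D p \<in> max_times n I}" by (simp add: derivation_mult[OF D] mult.commute)
  qed
  then show ?thesis by simp
qed

lemma derivation_commutator:
  assumes "derivation D1" "derivation D2" "derivation D3"
  shows "derivation (\<lambda>p. D1 (D2 p) - D2 (D1 p) - psc c (D3 p))"
  unfolding derivation_def
proof (intro conjI allI)
  note lin = derivation_add[OF assms(1)] derivation_add[OF assms(2)] derivation_add[OF assms(3)]
    derivation_scale[OF assms(1)] derivation_scale[OF assms(2)] derivation_scale[OF assms(3)]
    derivation_mult[OF assms(1)] derivation_mult[OF assms(2)] derivation_mult[OF assms(3)]
  show "mp.endo (\<lambda>p. D1 (D2 p) - D2 (D1 p) - psc c (D3 p))"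
    by (rule mp.endoI) (simp_all add: lin mp.scale_right_distrib mp.scale_right_diff_distrib mult.commute)
  show "D1 (D2 (p * q)) - D2 (D1 (p * q)) - psc c (D3 (p * q)) =
    (D1 (D2 p) - D2 (D1 p) - psc c (D3 p)) * q + p * (D1 (D2 q) - D2 (D1 q) - psc c (D3 q))" for p q
    by (simp add: lin mp.scale_right_distrib algebra_simps psc_mult_left psc_mult_right)
qed

lemma relation_lift:
  assumes D: "\<And>p. p \<in> Ord n 0 \<Longrightarrow> D1 p \<in> Ord n 0 \<and> D2 p \<in> Ord n 0 \<and> D3 p \<in> Ord n 0"
    and d: "derivation_mod N I0 d1" "derivation_mod N I0 d2"
    and S: "\<And>p. p \<in> Ord n 0 \<Longrightarrow> S (D1 p) - d1 (S p) \<in> I0" "\<And>p. p \<in> Ord n 0 \<Longrightarrow> S (D2 p) - d2 (S p) \<in> I0"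
      "\<And>p. p \<in> Ord n 0 \<Longrightarrow> S (D3 p) - d3 (S p) \<in> I0"
    and rel: "\<And>p. d1 (d2 p) - d2 (d1 p) = psc c (d3 p)" and p: "p \<in> Ord n 0"
  shows "D1 (D2 p) - D2 (D1 p) - psc c (D3 p) \<in> I"
proof -
  have E: "mp.endo d1" "mp.endo d2" using d by (auto simp: derivation_mod_def)
  have st: "d1 q \<in> I0" "d2 q \<in> I0" if "q \<in> I0" for q using d that by (auto simp: derivation_mod_def)
  have "(S (D1 (D2 p)) - d1 (S (D2 p))) + d1 (S (D2 p) - d2 (S p)) - (S (D2 (D1 p)) - d2 (S (D1 p)))
      - d2 (S (D1 p) - d1 (S p)) - psc c (S (D3 p) - d3 (S p)) \<in> I0"
    using D[OF p] p by (intro mp.subspace_diff[OF sI0] mp.subspace_add[OF sI0] mp.subspace_scale[OF sI0] st S) auto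
  also have "(S (D1 (D2 p)) - d1 (S (D2 p))) + d1 (S (D2 p) - d2 (S p)) - (S (D2 (D1 p)) - d2 (S (D1 p)))
      - d2 (S (D1 p) - d1 (S p)) - psc c (S (D3 p) - d3 (S p)) = S (D1 (D2 p) - D2 (D1 p) - psc c (D3 p))"
  proof -
    have r: "d1 (d2 (S p)) = d2 (d1 (S p)) + psc c (d3 (S p))" using rel[of "S p"] by (simp add: diff_eq_eq add.commute)
    show ?thesis
      by (simp add: S_lin module_hom.diff[OF E(1)] module_hom.diff[OF E(2)] r mp.scale_right_diff_distrib)
  qed
  finally have "S (D1 (D2 p) - D2 (D1 p) - psc c (D3 p)) \<in> I0" .
  moreover have "D1 (D2 p) - D2 (D1 p) - psc c (D3 p) \<in> Ord n 0"
    using D p by (intro mp.subspace_diff[OF subspace_Ord] mp.subspace_scale[OF subspace_Ord]) auto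
  ultimately show ?thesis by (simp add: I_def)
qed

end

section \<open>The inequality between weights\<close>

lemma (in complex_vector_space) indep_mod_not_mem:
  assumes "finite B" "indep_mod U B id" "b \<in> B"
  shows "b \<notin> U"
proof
  assume b: "b \<in> U"
  have "(\<Sum>k\<in>B. (if k = b then 1 else 0) *s id k) = (\<Sum>k\<in>{b}. (if k = b then 1 else 0) *s id k)"
    using assms by (intro sum.mono_neutral_right) auto
  then have "(\<Sum>k\<in>B. (if k = b then 1 else 0) *s id k) \<in> U" using b by simp
  then show False
    using assms(2)[unfolded indep_mod_def, rule_format, of "\<lambda>k. if k = b then 1 else 0" b] assms(3) by auto
qed

lemma exists_weight_bound:
  assumes "finite A"
  shows "\<exists>K::nat. \<forall>b\<in>A. w b < int K"
proof (intro exI ballI)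
  fix b assume "b \<in> A"
  then have "nat (w b) \<le> (\<Sum>b\<in>A. nat (w b))" using assms by (intro member_le_sum) auto
  then show "w b < int (Suc (\<Sum>b\<in>A. nat (w b)))" by linarith
qed

context ci_presentation
begin

lemma s_mI: "mp.subspace (max_times n I)"
  unfolding max_times_def by (rule mp.subspace_span)

lemma fin_dim_relations: "mp.fin_dim_mod I (max_times n I)"
  unfolding mp.fin_dim_mod_def
proof (intro exI conjI)
  show "finite (pmono ` low_monomials n (Suc M))" using finite_low_monomials by simp
  have "Ord n (Suc M) \<subseteq> max_times n I"
  proof
    fix p assume "p \<in> Ord n (Suc M)"
    then show "p \<in> max_times n I"
      by (rule Ord2_in_subspace[OF s_mI, rotated])
        (use Ord_M_I in \<open>auto simp: max_times_def intro!: mp.span_base\<close>)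
  qed
  then have "mp.span (pmono ` low_monomials n (Suc M) \<union> Ord n (Suc M))
      \<subseteq> mp.span (pmono ` low_monomials n (Suc M) \<union> max_times n I)"
    by (intro mp.span_mono) auto
  then show "I \<subseteq> mp.span (pmono ` low_monomials n (Suc M) \<union> max_times n I)"
    using Ord_low_decompose[of n "Suc M"] I_pideal by (auto simp: is_pideal_def)
qed

text \<open>
  The relations with \<open>H\<close> hold exactly on \<open>Ord n 0\<close>, because \<open>E\<close> and \<open>F\<close> are homogeneous. The relation \<open>[E, F] = H\<close>
  holds modulo \<open>I\<close> on \<open>Ord n 0\<close>, hence modulo \<open>max_times n I\<close> on \<open>I\<close>.
\<close>

lemma relations_sl2:
  obtains E F where "derivation E" "derivation F" "sl2_module_mod psc I (max_times n I) E F H"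
    "\<And>i. i < n \<Longrightarrow> F (pvar i) \<in> Ord n 1" "\<And>i. i < n \<Longrightarrow> F (pvar i) \<in> hom (lam i - 2)"
    "\<And>i. i < n \<Longrightarrow> 2 \<le> lam i \<Longrightarrow> \<exists>k<n. F (pvar i) = pvar k \<and> \<theta> k = f (\<theta> i)"
proof -
  have "\<exists>a. \<forall>i\<in>{..<n}. a i \<in> Ord n 1 \<and> a i \<in> hom (lam i + 2) \<and> S (a i) - e (\<theta> i) \<in> I0 \<and>
     (\<forall>j<n. \<theta> j = e (\<theta> i) \<and> lam j = lam i + 2 \<longrightarrow> (\<exists>k<n. a i = pvar k \<and> \<theta> k = e (\<theta> i)))"
    by (rule graded_lift_exists[OF e]) (use M0.e_wt in simp)
  then obtain aE where aE: "\<And>i. i < n \<Longrightarrow> aE i \<in> Ord n 1" "\<And>i. i < n \<Longrightarrow> aE i \<in> hom (lam i + 2)"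
    "\<And>i. i < n \<Longrightarrow> S (aE i) - e (\<theta> i) \<in> I0" by blast
  have "\<exists>a. \<forall>i\<in>{..<n}. a i \<in> Ord n 1 \<and> a i \<in> hom (lam i + (- 2)) \<and> S (a i) - f (\<theta> i) \<in> I0 \<and>
     (\<forall>j<n. \<theta> j = f (\<theta> i) \<and> lam j = lam i + (- 2) \<longrightarrow> (\<exists>k<n. a i = pvar k \<and> \<theta> k = f (\<theta> i)))"
    by (rule graded_lift_exists[OF f]) (use M0.f_wt in simp)
  then obtain aF where aF: "\<And>i. i < n \<Longrightarrow> aF i \<in> Ord n 1" "\<And>i. i < n \<Longrightarrow> aF i \<in> hom (lam i + (- 2))"
    "\<And>i. i < n \<Longrightarrow> S (aF i) - f (\<theta> i) \<in> I0"
    "\<And>i j. i < n \<Longrightarrow> j < n \<Longrightarrow> \<theta> j = f (\<theta> i) \<and> lam j = lam i + (- 2) \<Longrightarrow> (\<exists>k<n. aF i = pvar k \<and> \<theta> k = f (\<theta> i))"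
    by blast
  define E where "E = pderivation n aE"
  define F where "F = pderivation n aF"
  have derE: "derivation E" and derF: "derivation F" unfolding E_def F_def by (rule derivation_pderivation)+
  have Ex: "E (pvar i) = aE i" and Fx: "F (pvar i) = aF i" and Hx: "H (pvar i) = psc (of_int (lam i)) (pvar i)"
    if "i < n" for i using that pvar_hom[of i] by (auto simp: E_def F_def pderivation_pvar hom_def)
  have E1: "\<And>i. i < n \<Longrightarrow> E (pvar i) \<in> Ord n 1" "\<And>i. i < n \<Longrightarrow> S (E (pvar i)) - e (\<theta> i) \<in> I0" using aE Ex by auto
  have F1: "\<And>i. i < n \<Longrightarrow> F (pvar i) \<in> Ord n 1" "\<And>i. i < n \<Longrightarrow> S (F (pvar i)) - f (\<theta> i) \<in> I0" using aF Fx by auto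
  have H1: "\<And>i. i < n \<Longrightarrow> H (pvar i) \<in> Ord n 1"
    using Hx pvar_Ord by (auto intro: mp.subspace_scale[OF subspace_Ord])
  have H2: "\<And>i. i < n \<Longrightarrow> S (H (pvar i)) - h (\<theta> i) \<in> I0"
  proof -
    fix i assume i: "i < n"
    have "S (H (pvar i)) - h (\<theta> i) = - (h (\<theta> i) - psc (of_int (lam i)) (\<theta> i))" using i by (simp add: Hx S_lin subst_pvar)
    then show "S (H (pvar i)) - h (\<theta> i) \<in> I0" using mp.subspace_neg[OF sI0 \<theta>_eigen[OF i]] by simp
  qed
  note Est = lift_stable[OF derE e E1] and Fst = lift_stable[OF derF f F1] and Hst = lift_stable[OF derH h H1 H2]
  have 01: "Ord n 1 \<subseteq> Ord n 0" by (rule Ord_antimono) simp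
  have I0n: "p \<in> I \<Longrightarrow> p \<in> Ord n 0" for p by (simp add: I_def)
  have rel: "E (F p) - F (E p) - psc 1 (H p) \<in> I" if "p \<in> Ord n 0" for p
    by (rule relation_lift[where ?d1.0 = e and ?d2.0 = f and ?d3.0 = h])
      (use that e f Est(1,2) Fst(1,2) Hst(1,2) 01 ef in auto)
  have "E (F p) - F (E p) - psc 1 (H p) \<in> max_times n I" if "p \<in> I" for p
    using derivation_into_max_times[OF derivation_commutator[OF derE derF derH] rel] that I_Ord2 by blast
  then have efU: "E (F p) - F (E p) - H p \<in> max_times n I" if "p \<in> I" for p using that by simp
  have heU: "H (E p) - E (H p) - psc 2 (E p) \<in> max_times n I" if "p \<in> I" for p
    using graded_derivation[OF derE _ I0n[OF that], of 2] aE(2) Ex mp.subspace_0[OF s_mI] by simp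
  have hfU: "H (F p) - F (H p) + psc 2 (F p) \<in> max_times n I" if "p \<in> I" for p
    using graded_derivation[OF derF _ I0n[OF that], of "- 2"] aF(2) Fx mp.subspace_0[OF s_mI] by simp
  have "sl2_module_mod psc I (max_times n I) E F H"
    by (intro sl2_module_mod.intro sl2_module_mod_axioms.intro mp.complex_vector_space_axioms s_mI
        fin_dim_relations efU heU hfU derivation_endo derE derF derH max_times_subset[OF I_pideal])
      (use I_pideal Est Fst Hst in \<open>auto simp: is_pideal_def\<close>)
  moreover have "\<exists>k<n. F (pvar i) = pvar k \<and> \<theta> k = f (\<theta> i)" if i: "i < n" "2 \<le> lam i" for i
  proof -
    have "f (\<theta> i) \<in> B" "w (f (\<theta> i)) = lam i - 2" using B_f[OF \<theta>_B[OF i(1)]] i(2) by (auto simp: lam_def)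
    then obtain j where "j < n" "\<theta> j = f (\<theta> i)" "lam j = lam i - 2"
      using \<theta> by (auto simp: bij_betw_def lam_def)
    then show ?thesis using aF(4)[OF i(1), of j] Fx[OF i(1)] by simp
  qed
  ultimately show ?thesis using that derE derF F1(1) aF(2) Fx by simp
qed

text \<open>
  For \<open>c \<ge> 0\<close>, the ideal \<open>J\<close> generated by \<open>Z\<close> below contains \<open>I\<close> modulo \<open>max_times n I\<close>, hence contains, up to terms of any given
  order, all polynomials of order at least \<open>M\<close>. So \<open>Z\<close> has at least \<open>n\<close> elements, which is the inequality \<open>key\<close>. Its sum
  over all \<open>c\<close> telescopes to the first claim. In the case of equality there are \<open>n\<close> basic relations, none of them of
  negative weight. A representation without negative weights has no positive ones, so
  by \<open>key\<close> the numbers \<open>nB 1 \<le> nB 3 \<le> \<dots>\<close> increase, but they are finally zero.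
\<close>

theorem weight_inequality:
  "card {b \<in> B. 1 \<le> w b} \<le> card {b \<in> B. w b \<le> - 1}"
  "card {b \<in> B. 1 \<le> w b} = card {b \<in> B. w b \<le> - 1} \<Longrightarrow> card {b \<in> B. 1 \<le> w b} = 0"
proof -
  obtain E F where EF: "derivation E" "derivation F" "sl2_module_mod psc I (max_times n I) E F H"
    and Fx: "\<And>i. i < n \<Longrightarrow> F (pvar i) \<in> Ord n 1" "\<And>i. i < n \<Longrightarrow> F (pvar i) \<in> hom (lam i - 2)"
      "\<And>i. i < n \<Longrightarrow> 2 \<le> lam i \<Longrightarrow> \<exists>k<n. F (pvar i) = pvar k \<and> \<theta> k = f (\<theta> i)"
    using relations_sl2 by blast
  interpret W: sl2_module_mod psc I "max_times n I" E F H by (rule EF(3))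
  let ?U = "max_times n I"
  have hom_wt: "I \<inter> hom d \<subseteq> W.wt (of_int d)" for d
    using mp.subspace_0[OF s_mI] by (auto simp: W.wt_def hom_def)
  have I0n: "I \<subseteq> Ord n 0" using I_pideal by (simp add: is_pideal_def)
  have sI: "mp.subspace I" by (rule W.V)
  have "\<exists>BW w'. mp.string_basis F (\<lambda>d. I \<inter> hom d) I ?U BW w'"
  proof (rule mp.string_basis_exists[OF s_mI])
    show "mp.subspace (I \<inter> hom d)" for d using sI subspace_hom by (rule mp.subspace_inter)
    show "F v \<in> I \<inter> hom (d - 2)" if v: "v \<in> I \<inter> hom d" for d v
    proof -
      have v0: "v \<in> Ord n 0" using v I0n by blast
      have "H (F v) - F (H v) = psc (of_int (- 2)) (F v)"
        by (rule graded_derivation[OF EF(2) _ v0]) (use Fx(2) in simp)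
      then have "F v \<in> hom (d - 2)"
        using v by (simp add: hom_def derivation_scale[OF EF(2)] mp.scale_left_diff_distrib diff_eq_eq)
      then show ?thesis using W.fV v by simp
    qed
    show "v \<in> ?U" if "2 \<le> d" "v \<in> I \<inter> hom d" "F v \<in> ?U" for d v
      using W.f_inj_mod[of v "of_int d"] that hom_wt by auto
    show "I \<subseteq> mp.span (?U \<union> (\<Union>d. I \<inter> hom d))"
    proof
      fix p assume p: "p \<in> I"
      have "(\<Sum>d\<in>wtm ` Poly_Mapping.keys p. comp d p) \<in> mp.span (?U \<union> (\<Union>d. I \<inter> hom d))"
        using I_homogeneous[OF p] comp_hom by (intro mp.span_sum mp.span_base) blast
      then show "p \<in> mp.span (?U \<union> (\<Union>d. I \<inter> hom d))" by (simp add: comp_sum)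
    qed
    show "\<forall>d\<in>D. x d \<in> ?U" if "finite D" "\<And>d. d \<in> D \<Longrightarrow> x d \<in> I \<inter> hom d" "(\<Sum>d\<in>D. x d) \<in> ?U" for D x
      by (rule mp.eigenvectors_mod_independent_family[OF W.h s_mI _ that(1) _ _ that(3), where l = of_int])
        (use that(2) hom_wt W.hU in \<open>auto simp: inj_on_def W.wt_def\<close>)
  qed (use fin_dim_relations W.f in auto)
  then obtain BW w' where BW: "mp.string_basis F (\<lambda>d. I \<inter> hom d) I ?U BW w'" by blast
  have BW': "finite BW" "BW \<subseteq> I" "mp.indep_mod ?U BW id" "I \<subseteq> mp.span (BW \<union> ?U)" "\<And>b. b \<in> BW \<Longrightarrow> b \<in> hom (w' b)"
    using BW by (auto simp: mp.string_basis_def)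
  have card_BW: "card BW \<le> n" by (rule card_indep_relations[OF BW'(1-3)])
  define nB where "nB c = card {b \<in> B. c \<le> w b}" for c
  define nW where "nW c = card {b \<in> BW. c \<le> w' b}" for c
  have key: "nB c + nW (2 * c + 2) \<le> nW (2 * c) + nB (c + 2)" if c: "0 \<le> c" for c
  proof -
    define bad where "bad = {i \<in> {..<n}. lam i < c \<or> \<theta> i \<in> f ` {b \<in> B. 2 \<le> w b}}"
    define surv where "surv = {b \<in> BW. 2 * c \<le> w' b \<and> b \<notin> F ` {b \<in> BW. 2 \<le> w' b}}"
    define Z where "Z = pvar ` bad \<union> surv"
    have Z: "finite Z" "Z \<subseteq> Ord n 1"
      using BW'(1,2) I_Ord2 Ord_antimono[of 1 2 n] pvar_Ord by (auto simp: Z_def bad_def surv_def)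
    have Z0: "Z \<subseteq> Ord n 0" using Z Ord_antimono[of 0 1 n] by auto
    define J where "J = gen_ideal n Z"
    have J: "is_pideal n J" unfolding J_def by (rule is_pideal_gen[OF Z0])
    have sJ: "mp.subspace J" using J by (simp add: is_pideal_def)
    have ZJ: "Z \<subseteq> J" using gen_ideal_base by (auto simp: J_def)
    have bad_mono: "pmono m \<in> J" if m: "Poly_Mapping.keys m \<subseteq> {..<n}" "i \<in> Poly_Mapping.keys m" "lam i < c" for m i
    proof -
      have "pvar i \<in> J" using m ZJ by (auto simp: Z_def bad_def)
      moreover have "pmono (m - Poly_Mapping.single i 1) \<in> Ord n 0"
        using monomial_remove_var(3)[OF m(2)] m(1) by (auto simp: mono_Ord)
      ultimately have "pmono (m - Poly_Mapping.single i 1) * pvar i \<in> J" using J by (simp add: is_pideal_def)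
      then show ?thesis by (subst monomial_remove_var(1)[OF m(2)]) (simp add: mono_add mult.commute)
    qed
    \<comment> \<open>On variables of weight at least 2 the value of \<open>F\<close> is again a variable, contained in \<open>bad\<close>. On the other
      ones it has negative weight, so each of its monomials contains a variable of negative weight.\<close>
    have FJ: "F p \<in> J" if "p \<in> Ord n 0" for p
    proof (rule derivation_into_ideal[OF EF(2) J _ that])
      fix i assume i: "i < n"
      show "F (pvar i) \<in> J"
      proof (cases "2 \<le> lam i")
        case True
        then obtain k where k: "k < n" "F (pvar i) = pvar k" "\<theta> k = f (\<theta> i)" using Fx(3)[OF i] by blast
        have "\<theta> k \<in> f ` {b \<in> B. 2 \<le> w b}" using k(3) True \<theta>_B[OF i] by (auto simp: lam_def)
        then show ?thesis using k ZJ by (auto simp: Z_def bad_def)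
      next
        case False
        show ?thesis
        proof (rule mpoly_in_subspace[OF sJ])
          fix m assume m: "m \<in> Poly_Mapping.keys (F (pvar i))"
          have "wtm m < 0" using m Fx(2)[OF i] False by (auto simp: hom_iff)
          have "\<exists>j\<in>Poly_Mapping.keys m. lam j < 0"
          proof (rule ccontr)
            assume "\<not> (\<exists>j\<in>Poly_Mapping.keys m. lam j < 0)"
            then have "0 \<le> int (Poly_Mapping.lookup m j) * lam j" for j
              by (cases "j \<in> Poly_Mapping.keys m") (auto simp: in_keys_iff not_less)
            then have "0 \<le> wtm m" unfolding wtm_def by (intro sum_nonneg) auto
            then show False using \<open>wtm m < 0\<close> by simp
          qed
          moreover have "Poly_Mapping.keys m \<subseteq> {..<n}" using m Fx(1)[OF i] by (auto simp: Ord_def)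
          ultimately show "pmono m \<in> J" using bad_mono c by force
        qed
      qed
    qed
    have BWJ: "BW \<subseteq> J"
    proof
      fix b assume b: "b \<in> BW"
      show "b \<in> J"
      proof (cases "2 * c \<le> w' b")
        case True
        show ?thesis
        proof (cases "b \<in> F ` {b \<in> BW. 2 \<le> w' b}")
          case True
          then show ?thesis using FJ BW'(2) I0n by blast
        next
          case False
          then show ?thesis using ZJ b True by (auto simp: Z_def surv_def)
        qed
      next
        case False
        show ?thesis
        proof (rule mpoly_in_subspace[OF sJ])
          fix m assume m: "m \<in> Poly_Mapping.keys b"
          have k: "Poly_Mapping.keys m \<subseteq> {..<n}" "2 \<le> mdeg m" using m b BW'(2) I_Ord2 by (auto simp: Ord_def)
          have wm: "wtm m = w' b" using m BW'(5)[OF b] by (simp add: hom_iff)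
          \<comment> \<open>Two or more variables of weight at least \<open>c\<close> would have a product of weight at least \<open>2 * c\<close>.\<close>
          have "\<exists>j\<in>Poly_Mapping.keys m. lam j < c"
          proof (rule ccontr)
            assume "\<not> (\<exists>j\<in>Poly_Mapping.keys m. lam j < c)"
            then have "int (Poly_Mapping.lookup m j) * c \<le> int (Poly_Mapping.lookup m j) * lam j" for j
              by (cases "j \<in> Poly_Mapping.keys m") (force intro: mult_left_mono simp: not_less, simp add: in_keys_iff)
            then have "(\<Sum>j<n. int (Poly_Mapping.lookup m j) * c) \<le> wtm m" unfolding wtm_def by (intro sum_mono) auto
            moreover have "(\<Sum>j<n. int (Poly_Mapping.lookup m j) * c) = int (mdeg m) * c"
              using deg_superset[OF _ k(1)] by (simp add: sum_distrib_right)
            moreover have "2 * c \<le> int (mdeg m) * c" using k(2) c by (intro mult_right_mono) auto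
            ultimately show False using False wm by simp
          qed
          then show "pmono m \<in> J" using bad_mono k(1) by blast
        qed
      qed
    qed
    \<comment> \<open>Nakayama: iterate \<open>I \<subseteq> J + (x) I\<close>.\<close>
    have IJ: "I \<subseteq> mp.span (J \<union> Ord n k)" for k
    proof (induction k)
      case 0
      then show ?case using I0n by (auto intro: mp.span_base)
    next
      case (Suc k)
      let ?S = "mp.span (J \<union> Ord n (Suc k))"
      have "?U \<subseteq> ?S"
        unfolding max_times_def
      proof (intro mp.span_minimal mp.subspace_span subsetI)
        fix x assume "x \<in> {a * b |a b. a \<in> Ord n 1 \<and> b \<in> I}"
        then obtain a b where ab: "x = a * b" "a \<in> Ord n 1" "b \<in> I" by blast
        then obtain j q where b: "j \<in> mp.span J" "q \<in> Ord n k" "b = j + q"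
          using mp.span_Un_subspaceE[OF subsetD[OF Suc.IH ab(3)] subspace_Ord] by blast
        have "j \<in> J" using b(1) sJ by (simp add: mp.span_eq_iff[THEN iffD2])
        moreover have "a \<in> Ord n 0" using ab Ord_antimono[of 0 1 n] by auto
        ultimately have "a * j \<in> J" using J by (simp add: is_pideal_def)
        moreover have "a * q \<in> Ord n (Suc k)" using ab b by (intro Ord_mult'[of _ n 1 _ k]) auto
        ultimately show "x \<in> ?S" unfolding ab(1) b(3) distrib_left by (auto intro: mp.span_add mp.span_base)
      qed
      moreover have "BW \<subseteq> ?S" using BWJ by (auto intro: mp.span_base)
      ultimately have "mp.span (BW \<union> ?U) \<subseteq> ?S" by (intro mp.span_minimal mp.subspace_span) auto
      then show ?case using BW'(4) by blast
    qed
    have "n \<le> card Z"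
      by (rule num_generators_ge_num_vars[OF Z, of M]) (use Ord_M_I IJ in \<open>auto simp: J_def\<close>)
    also have "\<dots> \<le> card bad + card surv"
    proof -
      have "card (pvar ` bad) \<le> card bad" by (rule card_image_le) (simp add: bad_def)
      then show ?thesis unfolding Z_def using card_Un_le[of "pvar ` bad" surv] by linarith
    qed
    finally have 1: "n \<le> card bad + card surv" .
    have badn: "bad \<subseteq> {..<n}" by (auto simp: bad_def)
    have "\<theta> ` ({..<n} - bad) = {b \<in> B. c \<le> w b \<and> b \<notin> f ` {b \<in> B. 2 \<le> w b}}"
      using \<theta> by (auto simp: bad_def lam_def bij_betw_def not_less)
    moreover have "inj_on \<theta> ({..<n} - bad)" using \<theta> by (auto simp: bij_betw_def intro: inj_on_subset)
    ultimately have "card ({..<n} - bad) = card {b \<in> B. c \<le> w b \<and> b \<notin> f ` {b \<in> B. 2 \<le> w b}}"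
      using card_image by fastforce
    moreover have "card ({..<n} - bad) = n - card bad" using badn by (simp add: card_Diff_subset finite_subset)
    moreover have "nB c = card {b \<in> B. c \<le> w b \<and> b \<notin> f ` {b \<in> B. 2 \<le> w b}} + nB (c + 2)"
      unfolding nB_def by (rule mp.string_basis_card[OF B c])
    moreover have "nW (2 * c) = card surv + nW (2 * c + 2)"
      unfolding nW_def surv_def by (rule mp.string_basis_card[OF BW]) (use c in simp)
    ultimately show ?thesis using 1 by linarith
  qed
  have tel: "nB 0 + nB 1 + nW (2 * int K) \<le> nW 0 + nB (int K) + nB (int K + 1)" for K
  proof (induction K)
    case (Suc K)
    have "2 * int (Suc K) = 2 * int K + 2" "int (Suc K) + 1 = int K + 2" "int (Suc K) = int K + 1" by simp_all
    then show ?case using Suc key[of "int K"] by (simp only:) linarith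
  qed simp
  obtain K where K: "\<forall>b\<in>B. w b < int K" using exists_weight_bound[OF B_fin] by blast
  have nB_large: "nB c = 0" if "int K \<le> c" for c
    using K that by (auto simp: nB_def card_eq_0_iff)
  have le: "nB 0 + nB 1 \<le> nW 0" using tel[of K] nB_large by simp
  have nW0: "nW 0 \<le> card BW" unfolding nW_def by (rule card_mono[OF BW'(1)]) auto
  have split: "nB 0 + card {b \<in> B. w b \<le> - 1} = n"
  proof -
    have "{b \<in> B. 0 \<le> w b} \<inter> {b \<in> B. w b \<le> - 1} = {}" "{b \<in> B. 0 \<le> w b} \<union> {b \<in> B. w b \<le> - 1} = B" by auto
    then show ?thesis
      using card_Un_disjoint[of "{b \<in> B. 0 \<le> w b}" "{b \<in> B. w b \<le> - 1}"] B_fin card_B by (simp add: nB_def)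
  qed
  have nB1: "nB 1 = card {b \<in> B. 1 \<le> w b}" by (simp add: nB_def)
  show "card {b \<in> B. 1 \<le> w b} \<le> card {b \<in> B. w b \<le> - 1}" using le nW0 card_BW split nB1 by linarith
  assume eq: "card {b \<in> B. 1 \<le> w b} = card {b \<in> B. w b \<le> - 1}"
  have "nW 0 = card BW" using eq le nW0 card_BW split nB1 by linarith
  then have "{b \<in> BW. 0 \<le> w' b} = BW" using BW'(1) unfolding nW_def by (intro card_subset_eq) auto
  then have nonneg: "0 \<le> w' b" if "b \<in> BW" for b using that by blast
  have zero: "w' b \<le> 0" if b: "b \<in> BW" for b
  proof (rule ccontr)
    assume "\<not> w' b \<le> 0"
    then have pos: "0 < Re (of_int (w' b))" by simp
    have "b \<in> W.wt (of_int (w' b))" using hom_wt BW'(2,5) b by blast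
    moreover have "b \<notin> ?U" using mp.indep_mod_not_mem BW'(1,3) b by blast
    ultimately obtain u l' where u: "u \<in> W.wt l'" "u \<notin> ?U" "Re l' < 0"
      using W.negative_weight_exists pos by blast
    have "u \<in> mp.span ({b \<in> BW. of_int (w' b) = l'} \<union> ?U)"
    proof (rule mp.weighted_basis_eigen_coeff[OF s_mI W.h _ BW'(1,3)])
      show "H b - psc (of_int (w' b)) b \<in> ?U" if "b \<in> BW" for b
        using BW'(5)[OF that] mp.subspace_0[OF s_mI] by (simp add: hom_def)
      show "H ` ?U \<subseteq> ?U" using W.hU by blast
      show "H u - psc l' u \<in> ?U" using u(1) by (simp add: W.wt_def)
      show "u \<in> mp.span (BW \<union> ?U)" using W.wt_V[OF u(1)] BW'(4) by blast
    qed
    moreover have "{b \<in> BW. of_int (w' b) = l'} = {}" using nonneg u(3) by fastforce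
    ultimately have "u \<in> mp.span ?U" by (metis Un_empty_left)
    moreover have "mp.span ?U = ?U" using s_mI by (simp add: mp.span_eq_iff)
    ultimately show False using u(2) by simp
  qed
  have nW_pos: "nW c = 0" if "1 \<le> c" for c
  proof -
    have "{b \<in> BW. c \<le> w' b} = {}" using zero that by force
    then show ?thesis by (simp only: nW_def card.empty)
  qed
  have mono: "nB c \<le> nB (c + 2)" if "1 \<le> c" for c
    using key[of c] nW_pos[of "2 * c"] that by simp
  have "nB 1 \<le> nB (1 + 2 * int k)" for k
  proof (induction k)
    case (Suc k)
    then show ?case using mono[of "1 + 2 * int k"] by (simp add: add.commute add.left_commute)
  qed simp
  from this[of K] have "nB 1 = 0" using nB_large[of "1 + 2 * int K"] by simp
  then show "card {b \<in> B. 1 \<le> w b} = 0" using nB1 by simp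
qed

lemma h_zero_if_weights_zero:
  assumes "\<And>b. b \<in> B \<Longrightarrow> w b = 0" and a: "a \<in> Ord N 0"
  shows "h a \<in> I0"
proof -
  have "lam i = 0" if "i < n" for i using assms(1) \<theta>_B[OF that] by (simp add: lam_def)
  then have "wtm m = 0" for m by (simp add: wtm_def)
  then have H0: "H p = 0" for p by (intro poly_mapping_eqI) (simp add: lookup_H)
  have hS: "h (S p) \<in> I0" if "p \<in> Ord n 0" for p
    using mp.subspace_neg[OF sI0 S_H[OF that]] by (simp add: H0 S_lin)
  define a1 where "a1 = a - psc (Poly_Mapping.lookup a 0) 1"
  have "a1 \<in> Ord N 1" unfolding a1_def by (rule const_plus_Ord1[OF a])
  then obtain p where p: "p \<in> Ord n 1" "a1 - S p \<in> I0" using S_surj by blast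
  have p0: "p \<in> Ord n 0" using p(1) Ord_antimono[of 0 1 n] by auto
  have "h (a1 - S p) + h (S p) + psc (Poly_Mapping.lookup a 0) (h (S 1)) \<in> I0"
    by (intro mp.subspace_add[OF sI0] mp.subspace_scale[OF sI0] hS p0 one_Ord M0.hU p(2))
  moreover have "h (a1 - S p) + h (S p) + psc (Poly_Mapping.lookup a 0) (h (S 1)) = h a"
    by (simp add: M0.h_lin subst_1 a1_def)
  ultimately show ?thesis by simp
qed

end

context ci_sl2
begin

lemma presentation_exists:
  obtains n B w \<theta> where "ci_presentation N I0 M Gs e f h n B w \<theta>"
proof -
  obtain B w where B: "mp.string_basis f (\<lambda>d. M0.wt (of_int d)) (Ord N 1) U1 B w"
    using Ord1_string_basis by blast
  then have "finite B" by (simp add: mp.string_basis_def)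
  then obtain \<theta> where "bij_betw \<theta> {0..<card B} B" using ex_bij_betw_nat_finite by blast
  then have "ci_presentation N I0 M Gs e f h (card B) B w \<theta>"
    using B ci_sl2_axioms by (intro ci_presentation.intro ci_presentation_axioms.intro) (auto simp: atLeast0LessThan)
  then show ?thesis by (rule that)
qed

lemma derivation_mod_neg: "derivation_mod N I0 D \<Longrightarrow> derivation_mod N I0 (\<lambda>p. - D p)"
proof -
  assume D: "derivation_mod N I0 D"
  then have E: "mp.endo D" by (simp add: derivation_mod_def)
  have "- D (p * q) - (- D p * q + p * - D q) \<in> I0" if "p \<in> Ord N 0" "q \<in> Ord N 0" for p q
  proof -
    have "D (p * q) - (D p * q + p * D q) \<in> I0" using D that unfolding derivation_mod_def by blast
    then have "- (D (p * q) - (D p * q + p * D q)) \<in> I0" by (rule mp.subspace_neg[OF sI0])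
    then show ?thesis by (simp add: algebra_simps)
  qed
  moreover have "mp.endo (\<lambda>p. - D p)"
    by (rule mp.endoI) (simp_all add: module_hom.add[OF E] module_hom.scale[OF E])
  ultimately show ?thesis using D mp.subspace_neg[OF sI0] mp.subspace_neg[OF subspace_Ord]
    by (simp add: derivation_mod_def)
qed

lemma swapped_ci: "ci_sl2 N I0 M Gs f e (\<lambda>p. - h p)"
proof
  show "f (e p) - e (f p) = - h p" for p using ef[of p] by (simp add: algebra_simps)
  show "- h (f p) - f (- h p) = psc 2 (f p)" for p using hf[of p] by (simp add: M0.f_lin algebra_simps)
  show "- h (e p) - e (- h p) = - psc 2 (e p)" for p using he[of p] by (simp add: M0.e_lin algebra_simps)
qed (use I0 M gens e f derivation_mod_neg[OF h] in auto)

text \<open>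
  Compare a minimal presentation adapted to \<open>f\<close> with one adapted to \<open>e\<close>, which has the negative weights. The two instances of
  \<open>weight_inequality\<close> show that there are as many positive as negative weights, and then that all weights are zero.
\<close>

theorem sl2_acts_trivially:
  assumes p: "p \<in> Ord N 0"
  shows "e p \<in> I0"
proof -
  obtain n B w \<theta> where P: "ci_presentation N I0 M Gs e f h n B w \<theta>" by (rule presentation_exists)
  interpret P: ci_presentation N I0 M Gs e f h n B w \<theta> by (rule P)
  interpret s: ci_sl2 N I0 M Gs f e "\<lambda>p. - h p" by (rule swapped_ci)
  obtain n' B' w' \<theta>' where P': "ci_presentation N I0 M Gs f e (\<lambda>p. - h p) n' B' w' \<theta>'" by (rule s.presentation_exists)
  interpret P': ci_presentation N I0 M Gs f e "\<lambda>p. - h p" n' B' w' \<theta>' by (rule P')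
  have eig: "h b - psc (of_int (w b)) b \<in> U1" if "b \<in> B" for b
    using P.B_wt[OF that] I0_U1 by (auto simp: M0.wt_def)
  have eig': "h b - psc (of_int (- w' b)) b \<in> U1" if "b \<in> B'" for b
  proof -
    have "b \<in> M0.wt (- of_int (w' b))" using P'.B_wt[OF that] by (simp add: M0.swapped_wt)
    then show ?thesis using I0_U1 by (auto simp: M0.wt_def)
  qed
  have count: "card {b \<in> B. Q (w b)} = card {b \<in> B'. Q (- w' b)}" for Q
  proof -
    have "card {b \<in> B. \<exists>d. complex_of_int (w b) = of_int d \<and> Q d} = card {b \<in> B'. \<exists>d. complex_of_int (- w' b) = of_int d \<and> Q d}"
    proof (rule mp.weighted_basis_count[where w = "\<lambda>b. of_int (w b)" and w' = "\<lambda>b. of_int (- w' b)"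
          and P = "\<lambda>l. \<exists>d. l = of_int d \<and> Q d" and h = h and U = U1 and V = "Ord N 1"])
      show "h ` U1 \<subseteq> U1" using M1.hU by blast
      show "finite B" "mp.indep_mod U1 B id" "B \<subseteq> Ord N 1" "Ord N 1 \<subseteq> mp.span (B \<union> U1)"
        by (rule P.B_fin P.B_ind P.B_Ord P.B_span)+
      show "finite B'" "mp.indep_mod U1 B' id" "B' \<subseteq> Ord N 1" "Ord N 1 \<subseteq> mp.span (B' \<union> U1)"
        by (rule P'.B_fin P'.B_ind P'.B_Ord P'.B_span)+
    qed (rule sU1 M0.h eig eig'; assumption)+
    moreover have "(\<exists>d. complex_of_int k = of_int d \<and> Q d) = Q k" for k by (simp only: of_int_eq_iff) blast
    ultimately show ?thesis by (simp only:)
  qed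
  have 1: "card {b \<in> B. w b \<le> - 1} = card {b \<in> B'. 1 \<le> w' b}"
    using count[of "\<lambda>d. d \<le> - 1"] by simp
  have 2: "card {b \<in> B. 1 \<le> w b} = card {b \<in> B'. w' b \<le> - 1}"
    using count[of "\<lambda>d. 1 \<le> d"] by (simp add: le_minus_iff[of 1])
  have eq: "card {b \<in> B. 1 \<le> w b} = card {b \<in> B. w b \<le> - 1}"
    using P.weight_inequality(1) P'.weight_inequality(1) 1 2 by linarith
  then have "card {b \<in> B. 1 \<le> w b} = 0" by (rule P.weight_inequality(2))
  then have "card {b \<in> B. 1 \<le> w b} = 0" "card {b \<in> B. w b \<le> - 1} = 0" using eq by simp_all
  moreover have "finite {b \<in> B. 1 \<le> w b}" "finite {b \<in> B. w b \<le> - 1}" using P.B_fin by simp_all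
  ultimately have "{b \<in> B. 1 \<le> w b} = {}" "{b \<in> B. w b \<le> - 1} = {}" by (simp_all only: card_0_eq)
  then have w0: "w b = 0" if "b \<in> B" for b using that by force
  have hI: "h q \<in> I0" if "q \<in> Ord N 0" for q using P.h_zero_if_weights_zero[OF w0 that] .
  have "e p \<in> Ord N 0" using e p by (simp add: derivation_mod_def)
  then have "h (e p) - e (h p) \<in> I0" using hI p e by (intro mp.subspace_diff[OF sI0]) (auto simp: derivation_mod_def)
  then have "psc 2 (e p) \<in> I0" by (simp add: he)
  then show ?thesis using mp.subspace_scale_iff[OF sI0, of 2] by simp
qed

end

section \<open>Prime ideals and formal power series\<close>

text \<open>
  An ideal that is maximal among those that contain \<open>J\<close> but no power of \<open>s\<close> is prime. For \<open>s = 1\<close> this gives prime ideals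
  above a proper ideal.
\<close>

lemma (in cring) prime_avoiding_powers:
  assumes J: "ideal J R" and s: "s \<in> carrier R" and nJ: "\<And>k::nat. s [^] k \<notin> J"
  shows "\<exists>P. primeideal P R \<and> J \<subseteq> P \<and> s \<notin> P"
proof -
  define A where "A = {K. ideal K R \<and> J \<subseteq> K \<and> (\<forall>k::nat. s [^] k \<notin> K)}"
  have "\<exists>P\<in>A. \<forall>K\<in>A. P \<subseteq> K \<longrightarrow> K = P"
  proof (rule subset_Zorn_nonempty)
    show "A \<noteq> {}" using J nJ by (auto simp: A_def)
    fix C assume C: "C \<noteq> {}" "subset.chain A C"
    then have CA: "\<And>K. K \<in> C \<Longrightarrow> ideal K R \<and> J \<subseteq> K \<and> (\<forall>k::nat. s [^] k \<notin> K)"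
      by (auto simp: subset.chain_def A_def)
    have big: "\<exists>K\<in>C. x \<in> K \<and> y \<in> K" if xy: "x \<in> \<Union>C" "y \<in> \<Union>C" for x y
    proof -
      obtain K L where "K \<in> C" "x \<in> K" "L \<in> C" "y \<in> L" using xy by blast
      moreover then have "K \<subseteq> L \<or> L \<subseteq> K" using C(2) by (auto simp: subset.chain_def)
      ultimately show ?thesis by blast
    qed
    have id: "ideal K R" if "K \<in> C" for K using CA that by blast
    have "ideal (\<Union>C) R"
    proof (rule idealI[OF ring_axioms])
      show "subgroup (\<Union>C) (add_monoid R)"
      proof (rule group.subgroupI[OF a_group])
        show "\<Union>C \<subseteq> carrier (add_monoid R)"
        proof
          fix x assume "x \<in> \<Union>C"
          then obtain K where K: "K \<in> C" "x \<in> K" by blast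
          show "x \<in> carrier (add_monoid R)" using ideal.Icarr[OF id[OF K(1)] K(2)] by simp
        qed
        obtain K where K: "K \<in> C" using C by blast
        have "\<zero> \<in> K" by (rule additive_subgroup.zero_closed[OF ideal.axioms(1)[OF id[OF K]]])
        then show "\<Union>C \<noteq> {}" using K by blast
      next
        fix a assume "a \<in> \<Union>C"
        then obtain K where K: "K \<in> C" "a \<in> K" by blast
        have "\<ominus> a \<in> K" by (rule additive_subgroup.a_inv_closed[OF ideal.axioms(1)[OF id[OF K(1)]] K(2)])
        then show "inv\<^bsub>add_monoid R\<^esub> a \<in> \<Union>C" using K by (auto simp: a_inv_def)
      next
        fix a b assume "a \<in> \<Union>C" "b \<in> \<Union>C"
        then obtain K where K: "K \<in> C" "a \<in> K" "b \<in> K" using big by blast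
        have "a \<oplus> b \<in> K" by (rule additive_subgroup.a_closed[OF ideal.axioms(1)[OF id[OF K(1)]] K(2,3)])
        then show "a \<otimes>\<^bsub>add_monoid R\<^esub> b \<in> \<Union>C" using K by auto
      qed
      fix a x assume "a \<in> \<Union>C" and x: "x \<in> carrier R"
      then obtain K where K: "K \<in> C" "a \<in> K" by blast
      have "x \<otimes> a \<in> K" by (rule ideal.I_l_closed[OF id[OF K(1)] K(2) x])
      then show "x \<otimes> a \<in> \<Union>C" using K by blast
      have "a \<otimes> x \<in> K" by (rule ideal.I_r_closed[OF id[OF K(1)] K(2) x])
      then show "a \<otimes> x \<in> \<Union>C" using K by blast
    qed
    then show "\<Union>C \<in> A" using CA C(1) by (auto simp: A_def)
  qed
  then obtain P where P: "P \<in> A" and max: "\<And>K. K \<in> A \<Longrightarrow> P \<subseteq> K \<Longrightarrow> K = P" by blast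
  have iP: "ideal P R" and JP: "J \<subseteq> P" and nP: "\<And>k::nat. s [^] k \<notin> P" using P by (auto simp: A_def)
  interpret P: ideal P R by (rule iP)
  have pow: "\<exists>(k::nat) p r. p \<in> P \<and> r \<in> carrier R \<and> s [^] k = p \<oplus> r \<otimes> a" if a: "a \<in> carrier R" "a \<notin> P" for a
  proof -
    let ?K = "set_add R P (PIdl a)"
    have iK: "ideal ?K R" by (rule add_ideals[OF iP cgenideal_ideal[OF a(1)]])
    have mem: "x \<in> ?K \<longleftrightarrow> (\<exists>p\<in>P. \<exists>r\<in>carrier R. x = p \<oplus> r \<otimes> a)" for x
      by (auto simp: set_add_def' cgenideal_def)
    have "P \<subseteq> ?K"
    proof
      fix p assume p: "p \<in> P"
      then have "p = p \<oplus> \<zero> \<otimes> a" using a by simp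
      then show "p \<in> ?K" using p mem by blast
    qed
    moreover have "a \<in> ?K"
    proof -
      have "a = \<zero> \<oplus> \<one> \<otimes> a" using a by simp
      then show ?thesis using mem P.zero_closed by blast
    qed
    ultimately have "?K \<notin> A" using max[of ?K] a by blast
    then have "\<exists>k::nat. s [^] k \<in> ?K" using iK JP \<open>P \<subseteq> ?K\<close> by (auto simp: A_def)
    then show ?thesis using mem by blast
  qed
  have "primeideal P R"
  proof (rule primeidealI[OF iP is_cring])
    show "carrier R \<noteq> P" using nP[of 0] by auto
    fix a b assume ab: "a \<in> carrier R" "b \<in> carrier R" "a \<otimes> b \<in> P"
    show "a \<in> P \<or> b \<in> P"
    proof (rule ccontr)
      assume "\<not> (a \<in> P \<or> b \<in> P)"
      then obtain k l :: nat and p r q t where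
        k: "p \<in> P" "r \<in> carrier R" "s [^] k = p \<oplus> r \<otimes> a" and
        l: "q \<in> P" "t \<in> carrier R" "s [^] l = q \<oplus> t \<otimes> b"
        using pow[OF ab(1)] pow[OF ab(2)] by blast
      have c: "p \<in> carrier R" "q \<in> carrier R" using k l P.a_subset by auto
      have "s [^] (k + l) = (p \<oplus> r \<otimes> a) \<otimes> (q \<oplus> t \<otimes> b)"
        using s k l by (simp flip: nat_pow_mult)
      also have "\<dots> = p \<otimes> (q \<oplus> t \<otimes> b) \<oplus> ((r \<otimes> a) \<otimes> q \<oplus> (r \<otimes> t) \<otimes> (a \<otimes> b))"
        using c k l ab by algebra
      also have "\<dots> \<in> P"
      proof (intro P.a_closed)
        show "p \<otimes> (q \<oplus> t \<otimes> b) \<in> P" by (rule P.I_r_closed) (use c k l ab in auto)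
        show "(r \<otimes> a) \<otimes> q \<in> P" by (rule P.I_l_closed) (use c k l ab in auto)
        show "(r \<otimes> t) \<otimes> (a \<otimes> b) \<in> P" by (rule P.I_l_closed) (use c k l ab in auto)
      qed
      finally show False using nP by blast
    qed
  qed
  moreover have "s \<notin> P" using nP[of 1] s by simp
  ultimately show ?thesis using JP by blast
qed

lemma krull_dim_zero_primes:
  assumes "krull_dim R = 0" "primeideal P R" "primeideal P' R" "P \<subseteq> P'"
  shows "P = P'"
proof (rule ccontr)
  assume "P \<noteq> P'"
  then have "\<exists>Q. (\<forall>i\<le>1. primeideal (Q i) R) \<and> (\<forall>i<1::nat. Q i \<subset> Q (Suc i))"
    using assms by (intro exI[of _ "\<lambda>i::nat. if i = 0 then P else P'"]) auto
  then have "enat 1 \<le> krull_dim R" unfolding krull_dim_def by (intro Sup_upper) blast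
  then show False using assms(1) by (simp add: zero_enat_def)
qed

abbreviation PS :: "nat \<Rightarrow> (complex, mpower_series) module"
  where "PS \<equiv> power_series_algebra"

definition add_pairs :: "(nat \<Rightarrow>\<^sub>0 nat) \<Rightarrow> ((nat \<Rightarrow>\<^sub>0 nat) \<times> (nat \<Rightarrow>\<^sub>0 nat)) set"
  where "add_pairs m = {(a, b). a + b = m}"

lemma PS_simps:
  "f \<in> carrier (PS n) \<longleftrightarrow> (\<forall>m. f m \<noteq> 0 \<longrightarrow> Poly_Mapping.keys m \<subseteq> {..<n})"
  "f \<otimes>\<^bsub>PS n\<^esub> g = (\<lambda>m. \<Sum>(a, b)\<in>add_pairs m. f a * g b)"
  "\<one>\<^bsub>PS n\<^esub> = (\<lambda>m. if m = 0 then 1 else 0)"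
  "\<zero>\<^bsub>PS n\<^esub> = (\<lambda>m. 0)"
  "f \<oplus>\<^bsub>PS n\<^esub> g = (\<lambda>m. f m + g m)"
  "c \<odot>\<^bsub>PS n\<^esub> f = (\<lambda>m. c * f m)"
  by (auto simp: power_series_algebra_def add_pairs_def)

lemma finite_add_pairs: "finite (add_pairs m)"
proof -
  obtain N where N: "Poly_Mapping.keys m \<subseteq> {..<N}"
    using finite_nat_set_iff_bounded[of "Poly_Mapping.keys m"] finite_keys[of m] by blast
  have "add_pairs m \<subseteq> low_monomials N (Suc (mdeg m)) \<times> low_monomials N (Suc (mdeg m))"
  proof
    fix x assume "x \<in> add_pairs m"
    then obtain a b where x: "x = (a, b)" "a + b = m" by (auto simp: add_pairs_def)
    then show "x \<in> low_monomials N (Suc (mdeg m)) \<times> low_monomials N (Suc (mdeg m))"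
      using N by (auto simp: low_monomials_def keys_plus_nat deg_add)
  qed
  then show ?thesis by (rule finite_subset) (intro finite_cartesian_product finite_low_monomials)
qed

lemma add_pairs_keys: "(a, b) \<in> add_pairs m \<Longrightarrow>
    Poly_Mapping.keys m = Poly_Mapping.keys a \<union> Poly_Mapping.keys b \<and> mdeg m = mdeg a + mdeg b"
  by (auto simp: add_pairs_def keys_plus_nat deg_add)

lemma lookup_mult_pairs:
  "Poly_Mapping.lookup (p * q) m = (\<Sum>(a, b)\<in>add_pairs m. Poly_Mapping.lookup p a * Poly_Mapping.lookup (q :: mpoly) b)"
proof -
  have "Poly_Mapping.lookup (p * q) m = prod_fun (Poly_Mapping.lookup p) (Poly_Mapping.lookup q) m"
    by (simp add: times_poly_mapping.rep_eq)
  also have "\<dots> = (\<Sum>(a, b). Poly_Mapping.lookup p a * Poly_Mapping.lookup q b when m = a + b)"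
    by (rule prod_fun_unfold_prod) simp_all
  also have "\<dots> = (\<Sum>(a, b)\<in>add_pairs m. Poly_Mapping.lookup p a * Poly_Mapping.lookup q b when m = a + b)"
    by (rule Sum_any.expand_superset[OF finite_add_pairs]) (auto simp: add_pairs_def)
  also have "\<dots> = (\<Sum>(a, b)\<in>add_pairs m. Poly_Mapping.lookup p a * Poly_Mapping.lookup q b)"
    by (rule sum.cong) (auto simp: add_pairs_def)
  finally show ?thesis .
qed

lemma PS_mult_commute: "f \<otimes>\<^bsub>PS n\<^esub> g = g \<otimes>\<^bsub>PS n\<^esub> f"
proof
  fix m
  have "(\<Sum>(a, b)\<in>add_pairs m. f a * g b) = (\<Sum>(a, b)\<in>add_pairs m. g a * f b)"
    by (rule sum.reindex_bij_witness[of _ prod.swap prod.swap]) (auto simp: add_pairs_def add.commute mult.commute)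
  then show "(f \<otimes>\<^bsub>PS n\<^esub> g) m = (g \<otimes>\<^bsub>PS n\<^esub> f) m" by (simp add: PS_simps)
qed

lemma PS_mult_closed:
  assumes "f \<in> carrier (PS n)" "g \<in> carrier (PS n)"
  shows "f \<otimes>\<^bsub>PS n\<^esub> g \<in> carrier (PS n)"
  unfolding PS_simps(1)
proof (intro allI impI)
  fix m assume "(f \<otimes>\<^bsub>PS n\<^esub> g) m \<noteq> 0"
  then have "(\<Sum>(a, b)\<in>add_pairs m. f a * g b) \<noteq> 0" by (simp add: PS_simps)
  then obtain x where x: "x \<in> add_pairs m" "(case x of (a, b) \<Rightarrow> f a * g b) \<noteq> 0" by (rule sum.not_neutral_contains_not_neutral)
  obtain a b where ab: "x = (a, b)" by (cases x)
  have "f a \<noteq> 0" "g b \<noteq> 0" using x ab by auto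
  then have "Poly_Mapping.keys a \<subseteq> {..<n}" "Poly_Mapping.keys b \<subseteq> {..<n}"
    using assms unfolding PS_simps(1) by blast+
  then show "Poly_Mapping.keys m \<subseteq> {..<n}" using add_pairs_keys x ab by blast
qed

text \<open>
  Solves \<open>f * g = 1\<close> for the coefficients of \<open>g\<close> by recursion on the degree.
\<close>

function series_inverse :: "mpower_series \<Rightarrow> mpower_series" where
  "series_inverse f m = ((if m = 0 then 1 else 0)
     - (\<Sum>x\<in>{x \<in> add_pairs m. fst x \<noteq> 0}. f (fst x) * series_inverse f (snd x))) / f 0"
  by pat_completeness auto
termination
proof (relation "measure (\<lambda>(f, m). mdeg m)")
  fix f m x assume "x \<in> {x \<in> add_pairs m. fst x \<noteq> 0}"
  then have "(fst x, snd x) \<in> add_pairs m" "fst x \<noteq> 0" by auto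
  then show "((f, snd x), f, m) \<in> measure (\<lambda>(f, m). mdeg m)"
    using add_pairs_keys[of "fst x" "snd x" m] deg_eq_0[of "fst x"] by simp
qed simp

declare series_inverse.simps [simp del]

lemma series_inverse_closed:
  assumes f: "f \<in> carrier (PS n)"
  shows "series_inverse f \<in> carrier (PS n)"
proof -
  have "series_inverse f m \<noteq> 0 \<longrightarrow> Poly_Mapping.keys m \<subseteq> {..<n}" for m
  proof (induction "mdeg m" arbitrary: m rule: less_induct)
    case less
    show ?case
    proof (intro impI)
      assume nz: "series_inverse f m \<noteq> 0"
      show "Poly_Mapping.keys m \<subseteq> {..<n}"
      proof (cases "m = 0")
        case False
        then have "(\<Sum>x\<in>{x \<in> add_pairs m. fst x \<noteq> 0}. f (fst x) * series_inverse f (snd x)) \<noteq> 0"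
          using nz series_inverse.simps[of f m] by auto
        then obtain x where x: "x \<in> {x \<in> add_pairs m. fst x \<noteq> 0}" "f (fst x) * series_inverse f (snd x) \<noteq> 0"
          by (rule sum.not_neutral_contains_not_neutral)
        then have p: "(fst x, snd x) \<in> add_pairs m" "fst x \<noteq> 0" by auto
        have "mdeg (snd x) < mdeg m" using add_pairs_keys[OF p(1)] deg_eq_0[of "fst x"] p(2) by simp
        then have "Poly_Mapping.keys (snd x) \<subseteq> {..<n}" using less x(2) by simp
        moreover have "Poly_Mapping.keys (fst x) \<subseteq> {..<n}" using f x(2) unfolding PS_simps(1) by auto
        ultimately show ?thesis using add_pairs_keys[OF p(1)] by simp
      qed simp
    qed
  qed
  then show ?thesis by (simp add: PS_simps)
qed

lemma series_inverse:
  assumes "f 0 \<noteq> 0"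
  shows "f \<otimes>\<^bsub>PS n\<^esub> series_inverse f = \<one>\<^bsub>PS n\<^esub>"
proof
  fix m
  let ?A = "{x \<in> add_pairs m. fst x \<noteq> 0}"
  have "(\<Sum>x\<in>add_pairs m. f (fst x) * series_inverse f (snd x))
    = f 0 * series_inverse f m + (\<Sum>x\<in>?A. f (fst x) * series_inverse f (snd x))"
  proof -
    have "add_pairs m - {(0, m)} = ?A" by (auto simp: add_pairs_def)
    moreover have "(0, m) \<in> add_pairs m" by (simp add: add_pairs_def)
    ultimately have "(\<Sum>x\<in>add_pairs m. f (fst x) * series_inverse f (snd x))
        = f (fst (0, m)) * series_inverse f (snd (0, m)) + (\<Sum>x\<in>?A. f (fst x) * series_inverse f (snd x))"
      using sum.remove[OF finite_add_pairs, of "(0, m)" m "\<lambda>x. f (fst x) * series_inverse f (snd x)"] by simp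
    then show ?thesis by simp
  qed
  also have "f 0 * series_inverse f m = (if m = 0 then 1 else 0) - (\<Sum>x\<in>?A. f (fst x) * series_inverse f (snd x))"
    using assms by (subst series_inverse.simps) simp
  finally show "(f \<otimes>\<^bsub>PS n\<^esub> series_inverse f) m = \<one>\<^bsub>PS n\<^esub> m"
    by (simp add: PS_simps case_prod_beta)
qed

text \<open>
  Terms with other variables are dropped, so that all values are power series in \<open>n\<close> variables.
\<close>

definition poly_series :: "nat \<Rightarrow> mpoly \<Rightarrow> mpower_series"
  where "poly_series n p = (\<lambda>m. if Poly_Mapping.keys m \<subseteq> {..<n} then Poly_Mapping.lookup p m else 0)"

lemma poly_series_closed: "poly_series n p \<in> carrier (PS n)"
  by (auto simp: PS_simps poly_series_def)

lemma poly_series_add: "poly_series n (p + q) = poly_series n p \<oplus>\<^bsub>PS n\<^esub> poly_series n q"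
  by (auto simp: PS_simps poly_series_def lookup_add)

lemma poly_series_scale: "poly_series n (psc c p) = c \<odot>\<^bsub>PS n\<^esub> poly_series n p"
  by (auto simp: PS_simps poly_series_def lookup_psc)

lemma poly_series_mult: "poly_series n (p * q) = poly_series n p \<otimes>\<^bsub>PS n\<^esub> poly_series n q"
proof
  fix m
  show "poly_series n (p * q) m = (poly_series n p \<otimes>\<^bsub>PS n\<^esub> poly_series n q) m"
  proof (cases "Poly_Mapping.keys m \<subseteq> {..<n}")
    case True
    then show ?thesis using add_pairs_keys
      by (auto simp: PS_simps poly_series_def lookup_mult_pairs intro!: sum.cong)
  next
    case False
    have "(poly_series n p \<otimes>\<^bsub>PS n\<^esub> poly_series n q) m = 0"
      using PS_mult_closed[OF poly_series_closed poly_series_closed] False unfolding PS_simps(1) by blast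
    then show ?thesis using False by (simp add: poly_series_def)
  qed
qed

lemma poly_series_1: "poly_series n 1 = \<one>\<^bsub>PS n\<^esub>"
  by (auto simp: PS_simps poly_series_def lookup_one when_def)

text \<open>
  The sum of the terms of degree at most \<open>M\<close>. The bound is attained on purpose: the remainder of order \<open>M + 1\<close> lies in the
  product of the maximal ideal with an ideal that contains all terms of order \<open>M\<close>.
\<close>

definition trunc :: "nat \<Rightarrow> nat \<Rightarrow> mpower_series \<Rightarrow> mpoly"
  where "trunc n M f = (\<Sum>m\<in>low_monomials n (Suc M). psc (f m) (pmono m))"

lemma lookup_trunc: "Poly_Mapping.lookup (trunc n M f) m = (if m \<in> low_monomials n (Suc M) then f m else 0)"
proof -
  have "Poly_Mapping.lookup (trunc n M f) m = (\<Sum>k\<in>low_monomials n (Suc M). if k = m then f m else 0)"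
    unfolding trunc_def lookup_sum lookup_psc lookup_mono by (rule sum.cong) auto
  then show ?thesis using finite_low_monomials by simp
qed

lemma trunc_Ord: "trunc n M f \<in> Ord n 0"
  unfolding Ord_def
proof (intro CollectI ballI)
  fix m assume "m \<in> Poly_Mapping.keys (trunc n M f)"
  then have "m \<in> low_monomials n (Suc M)" by (simp add: in_keys_iff lookup_trunc split: if_splits)
  then show "Poly_Mapping.keys m \<subseteq> {..<n} \<and> 0 \<le> mdeg m" by (simp add: low_monomials_def)
qed

lemma trunc_add: "trunc n M (f \<oplus>\<^bsub>PS n\<^esub> g) = trunc n M f + trunc n M g"
  by (simp add: trunc_def PS_simps mp.scale_left_distrib sum.distrib)

lemma trunc_mult: "trunc n M (f \<otimes>\<^bsub>PS n\<^esub> g) - trunc n M f * trunc n M g \<in> Ord n (Suc M)"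
proof -
  have low: "(a, b) \<in> add_pairs m \<Longrightarrow> m \<in> low_monomials n (Suc M) \<Longrightarrow> a \<in> low_monomials n (Suc M) \<and> b \<in> low_monomials n (Suc M)" for a b m
    using add_pairs_keys[of a b m] by (auto simp: low_monomials_def)
  have eq: "Poly_Mapping.lookup (trunc n M (f \<otimes>\<^bsub>PS n\<^esub> g)) m = Poly_Mapping.lookup (trunc n M f * trunc n M g) m"
    if "m \<in> low_monomials n (Suc M)" for m
    using that low by (auto simp: lookup_trunc lookup_mult_pairs PS_simps intro!: sum.cong)
  have 0: "trunc n M (f \<otimes>\<^bsub>PS n\<^esub> g) - trunc n M f * trunc n M g \<in> Ord n 0"
    using trunc_Ord by (intro mp.subspace_diff[OF subspace_Ord] Ord_mult'[of _ n 0 _ 0 0]) auto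
  show ?thesis
    unfolding Ord_def
  proof (intro CollectI ballI)
    fix m assume m: "m \<in> Poly_Mapping.keys (trunc n M (f \<otimes>\<^bsub>PS n\<^esub> g) - trunc n M f * trunc n M g)"
    then have "Poly_Mapping.keys m \<subseteq> {..<n}" using 0 unfolding Ord_def by blast
    moreover have "m \<notin> low_monomials n (Suc M)" using m eq[of m] by (auto simp: in_keys_iff lookup_minus)
    ultimately show "Poly_Mapping.keys m \<subseteq> {..<n} \<and> Suc M \<le> mdeg m" by (simp add: low_monomials_def not_less)
  qed
qed

lemma poly_trunc_diff: "p \<in> Ord n 0 \<Longrightarrow> p - trunc n M (poly_series n p) \<in> Ord n (Suc M)"
proof -
  assume p: "p \<in> Ord n 0"
  show ?thesis
    unfolding Ord_def
  proof (intro CollectI ballI)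
    fix m assume m: "m \<in> Poly_Mapping.keys (p - trunc n M (poly_series n p))"
    have "p - trunc n M (poly_series n p) \<in> Ord n 0" by (rule mp.subspace_diff[OF subspace_Ord p trunc_Ord])
    then have k: "Poly_Mapping.keys m \<subseteq> {..<n}" using m unfolding Ord_def by blast
    then have "m \<notin> low_monomials n (Suc M)" using m by (auto simp: in_keys_iff lookup_minus lookup_trunc poly_series_def)
    then show "Poly_Mapping.keys m \<subseteq> {..<n} \<and> Suc M \<le> mdeg m" using k by (simp add: low_monomials_def not_less)
  qed
qed

section \<open>Presentation by polynomials\<close>

text \<open>
  The map \<open>\<pi>\<close> is the composition of the quotient map with the inverse of the isomorphism between \<open>S\<close> and the
  quotient.
\<close>

locale series_quotient = S: cring S
  for S :: "(complex, 'a, 'm) module_scheme" (structure) +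
  fixes n :: nat and I :: "mpower_series set" and g :: "nat \<Rightarrow> mpower_series"
    and \<pi> :: "mpower_series \<Rightarrow> 'a"
  assumes alg: "algebra complex_field S" and I: "ideal I (PS n)" and proper: "\<one>\<^bsub>PS n\<^esub> \<notin> I"
    and gens: "g ` {..<n} \<subseteq> carrier (PS n)" "I = Idl\<^bsub>PS n\<^esub> (g ` {..<n})"
    and dim0: "krull_dim S = 0"
    and pi_closed: "f \<in> carrier (PS n) \<Longrightarrow> \<pi> f \<in> carrier S"
    and pi_add: "f \<in> carrier (PS n) \<Longrightarrow> f' \<in> carrier (PS n) \<Longrightarrow> \<pi> (f \<oplus>\<^bsub>PS n\<^esub> f') = \<pi> f \<oplus> \<pi> f'"
    and pi_mult: "f \<in> carrier (PS n) \<Longrightarrow> f' \<in> carrier (PS n) \<Longrightarrow> \<pi> (f \<otimes>\<^bsub>PS n\<^esub> f') = \<pi> f \<otimes> \<pi> f'"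
    and pi_one: "\<pi> \<one>\<^bsub>PS n\<^esub> = \<one>"
    and pi_smult: "f \<in> carrier (PS n) \<Longrightarrow> \<pi> (c \<odot>\<^bsub>PS n\<^esub> f) = c \<odot> \<pi> f"
    and pi_surj: "s \<in> carrier S \<Longrightarrow> \<exists>f\<in>carrier (PS n). \<pi> f = s"
    and pi_ker: "f \<in> carrier (PS n) \<Longrightarrow> \<pi> f = \<zero> \<longleftrightarrow> f \<in> I"

lemma ex_series_quotient:
  assumes "zero_dim_complete_intersection S"
  shows "\<exists>n I g \<pi>. series_quotient S n I g \<pi>"
proof -
  obtain n I g h where alg: "algebra complex_field S" and dim: "krull_dim S = 0"
    and I: "ideal I (PS n)" and proper: "I \<noteq> carrier (PS n)"
    and g: "g ` {..<n} \<subseteq> carrier (PS n)" "I = Idl\<^bsub>PS n\<^esub> (g ` {..<n})"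
    and h: "h \<in> algebra_iso complex_field S (quotient_algebra (PS n) I)"
    using assms unfolding zero_dim_complete_intersection_def by blast
  interpret Sc: cring S using alg by (simp add: algebra_def)
  interpret A: algebra complex_field S by (rule alg)
  interpret I: ideal I "PS n" by (rule I)
  let ?Q = "quotient_algebra (PS n) I"
  note Qs = quotient_algebra_def
  have hr: "h \<in> ring_iso S ?Q" using h by (simp add: algebra_iso_def)
  have hsm: "h (c \<odot>\<^bsub>S\<^esub> x) = c \<odot>\<^bsub>?Q\<^esub> h x" if "x \<in> carrier S" for c x
    using h that by (simp add: algebra_iso_def ring_of_type_algebra_def)
  have hhom: "h \<in> ring_hom S ?Q" and hb: "bij_betw h (carrier S) (carrier ?Q)"
    using hr by (auto simp: ring_iso_def)
  let ?c = "\<lambda>f. I +>\<^bsub>PS n\<^esub> f"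
  have rh: "?c \<in> ring_hom (PS n) (PS n Quot I)" by (rule I.rcos_ring_hom)
  define \<pi> where "\<pi> f = inv_into (carrier S) h (?c f)" for f
  have cc: "?c f \<in> carrier ?Q" if "f \<in> carrier (PS n)" for f
    using ring_hom_closed[OF rh that] by (simp add: Qs)
  have im: "h ` carrier S = carrier ?Q" using hb by (simp add: bij_betw_def)
  have pc: "\<pi> f \<in> carrier S" if "f \<in> carrier (PS n)" for f
    unfolding \<pi>_def by (rule inv_into_into) (simp only: im cc[OF that])
  have hp: "h (\<pi> f) = ?c f" if "f \<in> carrier (PS n)" for f
    unfolding \<pi>_def by (rule f_inv_into_f) (simp only: im cc[OF that])
  have eqI: "a = b" if "a \<in> carrier S" "b \<in> carrier S" "h a = h b" for a b
    using hb that by (meson bij_betw_imp_inj_on inj_onD)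
  have inj0: "h \<zero>\<^bsub>S\<^esub> = I"
  proof -
    interpret Qt: ring "PS n Quot I" by (rule I.quotient_is_ring)
    have "h (\<zero>\<^bsub>S\<^esub> \<oplus>\<^bsub>S\<^esub> \<zero>\<^bsub>S\<^esub>) = h \<zero>\<^bsub>S\<^esub> \<oplus>\<^bsub>?Q\<^esub> h \<zero>\<^bsub>S\<^esub>"
      by (rule ring_hom_add[OF hhom]) simp_all
    then have "h \<zero>\<^bsub>S\<^esub> \<oplus>\<^bsub>PS n Quot I\<^esub> h \<zero>\<^bsub>S\<^esub> = h \<zero>\<^bsub>S\<^esub>" by (simp add: Qs)
    moreover have "h \<zero>\<^bsub>S\<^esub> \<in> carrier (PS n Quot I)" using ring_hom_closed[OF hhom Sc.zero_closed] by (simp add: Qs)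
    ultimately have "h \<zero>\<^bsub>S\<^esub> = \<zero>\<^bsub>PS n Quot I\<^esub>" using Qt.add.l_cancel_one by blast
    then show ?thesis by (simp add: Qs FactRing_def)
  qed
  have "series_quotient S n I g \<pi>"
  proof (intro series_quotient.intro series_quotient_axioms.intro)
    show "cring S" by (rule Sc.is_cring)
    show "algebra complex_field S" by (rule alg)
    show "ideal I (PS n)" by (rule I)
    show "g ` {..<n} \<subseteq> carrier (PS n)" "I = Idl\<^bsub>PS n\<^esub> (g ` {..<n})" by (fact g)+
    show "krull_dim S = 0" by (rule dim)
    show "\<one>\<^bsub>PS n\<^esub> \<notin> I" using I.one_imp_carrier proper by blast
    fix f assume f: "f \<in> carrier (PS n)"
    show "\<pi> f \<in> carrier S" by (rule pc[OF f])
    show "\<pi> f = \<zero>\<^bsub>S\<^esub> \<longleftrightarrow> f \<in> I"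
    proof
      assume "\<pi> f = \<zero>\<^bsub>S\<^esub>"
      then have "?c f = I" using hp[OF f] inj0 by simp
      then show "f \<in> I" using I.rcos_const_imp_mem[OF f] by simp
    next
      assume "f \<in> I"
      then have "?c f = I" by (rule I.a_rcos_const)
      then show "\<pi> f = \<zero>\<^bsub>S\<^esub>" using hp[OF f] inj0 pc[OF f] by (intro eqI) auto
    qed
    fix c
    show "\<pi> (c \<odot>\<^bsub>PS n\<^esub> f) = c \<odot>\<^bsub>S\<^esub> \<pi> f"
    proof (rule eqI)
      have cf: "c \<odot>\<^bsub>PS n\<^esub> x \<in> carrier (PS n)" if "x \<in> carrier (PS n)" for x
        using that by (auto simp: PS_simps)
      show "\<pi> (c \<odot>\<^bsub>PS n\<^esub> f) \<in> carrier S" by (rule pc[OF cf[OF f]])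
      show "c \<odot>\<^bsub>S\<^esub> \<pi> f \<in> carrier S" using pc[OF f] by (intro A.smult_closed) (auto simp: ring_of_type_algebra_def)
      have cm: "c \<odot>\<^bsub>PS n\<^esub> x = (c \<odot>\<^bsub>PS n\<^esub> \<one>\<^bsub>PS n\<^esub>) \<otimes>\<^bsub>PS n\<^esub> x" for x
      proof
        fix m
        have "(\<Sum>(a, b)\<in>add_pairs m. (c * (if a = 0 then 1 else 0)) * x b) = (\<Sum>p\<in>add_pairs m. if p = (0, m) then c * x m else 0)"
          by (rule sum.cong) (auto simp: add_pairs_def split: if_splits)
        also have "\<dots> = c * x m" using finite_add_pairs by (auto simp: add_pairs_def)
        finally show "(c \<odot>\<^bsub>PS n\<^esub> x) m = ((c \<odot>\<^bsub>PS n\<^esub> \<one>\<^bsub>PS n\<^esub>) \<otimes>\<^bsub>PS n\<^esub> x) m" by (simp add: PS_simps)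
      qed
      have c1: "c \<odot>\<^bsub>PS n\<^esub> \<one>\<^bsub>PS n\<^esub> \<in> carrier (PS n)" by (rule cf[OF I.one_closed])
      have coset: "?c (c \<odot>\<^bsub>PS n\<^esub> x) = ?c (c \<odot>\<^bsub>PS n\<^esub> f)" if x: "x \<in> ?c f" for x
      proof -
        obtain i where i: "i \<in> I" "x = i \<oplus>\<^bsub>PS n\<^esub> f" using x by (auto simp: a_r_coset_def')
        have xc: "x \<in> carrier (PS n)" using i f I.Icarr by simp
        have "?c x = ?c f" by (rule I.a_repr_independence'[symmetric]) (use x f in auto)
        then have "?c (c \<odot>\<^bsub>PS n\<^esub> \<one>\<^bsub>PS n\<^esub>) \<otimes>\<^bsub>PS n Quot I\<^esub> ?c x = ?c (c \<odot>\<^bsub>PS n\<^esub> \<one>\<^bsub>PS n\<^esub>) \<otimes>\<^bsub>PS n Quot I\<^esub> ?c f" by simp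
        then show ?thesis using ring_hom_mult[OF rh c1 xc] ring_hom_mult[OF rh c1 f] cm[of x] cm[of f] by simp
      qed
      have "f \<in> ?c f" by (rule I.a_rcos_self[OF f])
      then have "(\<Union>x\<in>?c f. ?c (c \<odot>\<^bsub>PS n\<^esub> x)) = ?c (c \<odot>\<^bsub>PS n\<^esub> f)" using coset by blast
      then show "h (\<pi> (c \<odot>\<^bsub>PS n\<^esub> f)) = h (c \<odot>\<^bsub>S\<^esub> \<pi> f)"
        using hsm[OF pc[OF f]] hp[OF f] hp[OF cf[OF f]] by (simp add: Qs)
    qed
    fix f' assume f': "f' \<in> carrier (PS n)"
    show "\<pi> (f \<oplus>\<^bsub>PS n\<^esub> f') = \<pi> f \<oplus>\<^bsub>S\<^esub> \<pi> f'"
      using f f' pc hp ring_hom_add[OF hhom pc[OF f] pc[OF f']] ring_hom_add[OF rh f f']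
      by (intro eqI) (auto simp: Qs)
    show "\<pi> (f \<otimes>\<^bsub>PS n\<^esub> f') = \<pi> f \<otimes>\<^bsub>S\<^esub> \<pi> f'"
      using f f' pc hp ring_hom_mult[OF hhom pc[OF f] pc[OF f']] ring_hom_mult[OF rh f f']
      by (intro eqI) (auto simp: Qs)
  next
    show "\<pi> \<one>\<^bsub>PS n\<^esub> = \<one>\<^bsub>S\<^esub>"
      using pc hp ring_hom_one[OF hhom] ring_hom_one[OF rh]
      by (intro eqI) (auto simp: Qs)
    fix s assume s: "s \<in> carrier S"
    then have "h s \<in> carrier (PS n Quot I)" using ring_hom_closed[OF hhom s] by (simp add: Qs)
    then obtain f where f: "f \<in> carrier (PS n)" "h s = ?c f" by (auto simp: FactRing_def A_RCOSETS_def')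
    then have "\<pi> f = s" using s pc hp by (intro eqI) auto
    then show "\<exists>f\<in>carrier (PS n). \<pi> f = s" using f by blast
  qed
  then show ?thesis by blast
qed

lemma lookup_poly_series_mono_mult:
  assumes "i < n"
  shows "(poly_series n (pmono (Poly_Mapping.single i K)) \<otimes>\<^bsub>PS n\<^esub> f) m
    = (if K \<le> Poly_Mapping.lookup m i then f (m - Poly_Mapping.single i K) else 0)"
proof -
  let ?a = "Poly_Mapping.single i K"
  have k: "Poly_Mapping.keys ?a \<subseteq> {..<n}" using assms by simp
  have "(poly_series n (pmono ?a) \<otimes>\<^bsub>PS n\<^esub> f) m = (\<Sum>x\<in>add_pairs m. if x = (?a, m - ?a) then f (m - ?a) else 0)"
    unfolding PS_simps poly_series_def
    by (rule sum.cong) (use k in \<open>auto simp: lookup_mono add_pairs_def split: if_splits\<close>)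
  also have "\<dots> = (if (?a, m - ?a) \<in> add_pairs m then f (m - ?a) else 0)"
    using finite_add_pairs by simp
  also have "(?a, m - ?a) \<in> add_pairs m \<longleftrightarrow> K \<le> Poly_Mapping.lookup m i"
  proof
    assume "(?a, m - ?a) \<in> add_pairs m"
    then have "Poly_Mapping.lookup (?a + (m - ?a)) i = Poly_Mapping.lookup m i" by (simp add: add_pairs_def)
    then show "K \<le> Poly_Mapping.lookup m i" by (simp add: lookup_add)
  next
    assume "K \<le> Poly_Mapping.lookup m i"
    then have "?a + (m - ?a) = m"
      by (intro poly_mapping_eqI) (auto simp: lookup_add lookup_minus lookup_single when_def)
    then show "(?a, m - ?a) \<in> add_pairs m" by (simp add: add_pairs_def)
  qed
  finally show ?thesis .
qed

lemma PS_mult_at_0: "(f \<otimes>\<^bsub>PS n\<^esub> g) 0 = f 0 * g 0"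
proof -
  have "add_pairs 0 = {(0, 0)}"
  proof
    show "add_pairs 0 \<subseteq> {(0, 0)}"
    proof
      fix x assume "x \<in> add_pairs 0"
      then have "mdeg (fst x) = 0 \<and> mdeg (snd x) = 0" using add_pairs_keys[of "fst x" "snd x" 0] by simp
      then show "x \<in> {(0, 0)}" by (cases x) (simp add: deg_eq_0)
    qed
  qed (simp add: add_pairs_def)
  then show ?thesis by (simp add: PS_simps)
qed

context series_quotient
begin

sublocale I: ideal I "PS n" by (rule I)

lemma relation_constant_term:
  assumes "f \<in> I"
  shows "f 0 = 0"
proof (rule ccontr)
  assume nz: "f 0 \<noteq> 0"
  have "f \<otimes>\<^bsub>PS n\<^esub> series_inverse f \<in> I"
    by (rule I.I_r_closed[OF assms series_inverse_closed[OF I.Icarr[OF assms]]])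
  then show False using series_inverse[of f n] nz proper by simp
qed

lemma pi_pow:
  assumes "f \<in> carrier (PS n)"
  shows "\<pi> (f [^]\<^bsub>PS n\<^esub> (k::nat)) = \<pi> f [^] k"
proof (induction k)
  case (Suc k)
  then show ?case using assms I.nat_pow_closed by (simp add: pi_mult)
qed (simp add: pi_one)

text \<open>
  Otherwise some prime ideal \<open>P\<close> avoids the class \<open>s\<close> of the variable. The ideal generated by \<open>P\<close> and \<open>s\<close> is proper: power
  series with constant term 1 are units, and so \<open>1 - r * s\<close> is a unit and not in \<open>P\<close>. A prime ideal above it contains \<open>P\<close> strictly,
  which contradicts Krull dimension 0.
\<close>

lemma variable_nilpotent:
  assumes i: "i < n"
  shows "\<exists>k::nat. poly_series n (pvar i) [^]\<^bsub>PS n\<^esub> k \<in> I"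
proof (rule ccontr)
  assume no: "\<not> ?thesis"
  let ?x = "poly_series n (pvar i)"
  define s where "s = \<pi> ?x"
  have s: "s \<in> carrier S" unfolding s_def by (rule pi_closed[OF poly_series_closed])
  have "s [^] k \<notin> {\<zero>}" for k :: nat
    using no pi_ker[OF I.nat_pow_closed[OF poly_series_closed], of "pvar i" k] pi_pow[OF poly_series_closed, of "pvar i" k]
    by (auto simp: s_def)
  then obtain P where P: "primeideal P S" "s \<notin> P"
    using S.prime_avoiding_powers[OF S.zeroideal s] by blast
  interpret P: primeideal P S by (rule P(1))
  define K where "K = set_add S P (PIdl s)"
  have iK: "ideal K S" unfolding K_def by (rule S.add_ideals[OF P.is_ideal S.cgenideal_ideal[OF s]])
  have mem: "x \<in> K \<longleftrightarrow> (\<exists>p\<in>P. \<exists>r\<in>carrier S. x = p \<oplus> r \<otimes> s)" for x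
    unfolding K_def by (auto simp: set_add_def' cgenideal_def)
  have "\<one> \<notin> K"
  proof
    assume "\<one> \<in> K"
    then obtain p r where p: "p \<in> P" "r \<in> carrier S" "\<one> = p \<oplus> r \<otimes> s" using mem by blast
    obtain u where u: "u \<in> carrier (PS n)" "\<pi> u = \<ominus> r" using pi_surj[of "\<ominus> r"] p by blast
    define w where "w = \<one>\<^bsub>PS n\<^esub> \<oplus>\<^bsub>PS n\<^esub> u \<otimes>\<^bsub>PS n\<^esub> ?x"
    have wc: "w \<in> carrier (PS n)" unfolding w_def using u poly_series_closed by simp
    have pc: "p \<in> carrier S" by (rule P.Icarr[OF p(1)])
    have "\<pi> w = \<one> \<oplus> (\<ominus> r) \<otimes> s"
      unfolding w_def using u poly_series_closed by (simp add: pi_add pi_mult pi_one s_def)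
    also have "\<dots> = (p \<oplus> r \<otimes> s) \<oplus> (\<ominus> r) \<otimes> s" using p(3) by simp
    also have "\<dots> = p" using pc p(2) s by algebra
    finally have "\<pi> w = p" .
    moreover have "w 0 = 1"
      unfolding w_def PS_simps(5) PS_mult_at_0 using deg_eq_0[of "Poly_Mapping.single i 1"]
      by (auto simp: PS_simps poly_series_def lookup_mono)
    then have "w \<otimes>\<^bsub>PS n\<^esub> series_inverse w = \<one>\<^bsub>PS n\<^esub>" by (intro series_inverse) simp
    then have "\<pi> w \<otimes> \<pi> (series_inverse w) = \<one>"
      using pi_mult[OF wc series_inverse_closed[OF wc]] pi_one by simp
    ultimately have "\<one> \<in> P" using P.I_r_closed[OF p(1) pi_closed[OF series_inverse_closed[OF wc]]] by simp
    then show False using P.one_imp_carrier P.I_notcarr by blast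
  qed
  then have "\<one> [^] k \<notin> K" for k :: nat by simp
  then obtain P' where P': "primeideal P' S" "K \<subseteq> P'"
    using S.prime_avoiding_powers[OF iK S.one_closed] by blast
  have "P \<subseteq> K"
  proof
    fix p assume p: "p \<in> P"
    then have "p = p \<oplus> \<zero> \<otimes> s" using s P.Icarr by simp
    then show "p \<in> K" using p mem by blast
  qed
  then have "P = P'" using krull_dim_zero_primes[OF dim0 P(1) P'(1)] P'(2) by blast
  moreover have "s = \<zero> \<oplus> \<one> \<otimes> s" using s by simp
  then have "s \<in> K" using mem P.zero_closed by blast
  ultimately show False using P P' by blast
qed

lemma variable_power:
  "poly_series n (pvar i) [^]\<^bsub>PS n\<^esub> (k::nat) = poly_series n (pmono (Poly_Mapping.single i k))"
proof (induction k)
  case (Suc k)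
  have "Poly_Mapping.single i (Suc k) = Poly_Mapping.single i k + Poly_Mapping.single i 1"
    by (simp only: Suc_eq_plus1 single_add)
  then show ?case using Suc by (simp add: mono_add poly_series_mult)
qed (simp add: mono_0 poly_series_1)

lemma ex_common_exponent: "\<exists>K. \<forall>i<n. poly_series n (pmono (Poly_Mapping.single i K)) \<in> I"
proof -
  obtain k :: "nat \<Rightarrow> nat" where k: "\<And>i. i < n \<Longrightarrow> poly_series n (pmono (Poly_Mapping.single i (k i))) \<in> I"
    using variable_nilpotent unfolding variable_power by metis
  have "poly_series n (pmono (Poly_Mapping.single i (\<Sum>j<n. k j))) \<in> I" if i: "i < n" for i
  proof -
    have "(\<Sum>j<n. k j) = k i + ((\<Sum>j<n. k j) - k i)" using i member_le_sum[of i "{..<n}" k] by simp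
    then have "pmono (Poly_Mapping.single i (\<Sum>j<n. k j))
        = pmono (Poly_Mapping.single i (k i)) * pmono (Poly_Mapping.single i ((\<Sum>j<n. k j) - k i))"
      by (metis mono_add single_add)
    then show ?thesis using I.I_r_closed[OF k[OF i] poly_series_closed] by (simp add: poly_series_mult)
  qed
  then show ?thesis by blast
qed

text \<open>
  Split off, one variable after the other, the terms that are divisible by \<open>x\<^sub>j ^ K\<close>.
\<close>

lemma high_power_series_in_I:
  assumes K: "\<And>i. i < n \<Longrightarrow> poly_series n (pmono (Poly_Mapping.single i K)) \<in> I"
    and j: "j \<le> n" and f: "f \<in> carrier (PS n)"
    and supp: "\<And>m. f m \<noteq> 0 \<Longrightarrow> \<exists>i<j. K \<le> Poly_Mapping.lookup m i"
  shows "f \<in> I"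
  using j f supp
proof (induction j arbitrary: f)
  case 0
  then have "f = \<zero>\<^bsub>PS n\<^esub>" by (auto simp: PS_simps)
  then show ?case using I.zero_closed by simp
next
  case (Suc j)
  have jn: "j < n" using Suc.prems by simp
  define u where "u m = (if Poly_Mapping.keys m \<subseteq> {..<n} then f (m + Poly_Mapping.single j K) else 0)" for m
  define r where "r m = (if K \<le> Poly_Mapping.lookup m j then 0 else f m)" for m
  have uc: "u \<in> carrier (PS n)" by (auto simp: PS_simps u_def)
  have "r \<in> I"
  proof (rule Suc.IH)
    show "j \<le> n" "r \<in> carrier (PS n)" using Suc.prems by (auto simp: PS_simps r_def split: if_splits)
    fix m assume m: "r m \<noteq> 0"
    then have nz: "f m \<noteq> 0" and nj: "\<not> K \<le> Poly_Mapping.lookup m j" by (auto simp: r_def split: if_splits)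
    show "\<exists>i<j. K \<le> Poly_Mapping.lookup m i" using Suc.prems(3)[OF nz] nj by (metis less_Suc_eq)
  qed
  moreover have "poly_series n (pmono (Poly_Mapping.single j K)) \<otimes>\<^bsub>PS n\<^esub> u \<in> I"
    by (rule I.I_r_closed[OF K[OF jn] uc])
  moreover have "f = (poly_series n (pmono (Poly_Mapping.single j K)) \<otimes>\<^bsub>PS n\<^esub> u) \<oplus>\<^bsub>PS n\<^esub> r"
  proof
    fix m
    have "f m = u (m - Poly_Mapping.single j K)" if le: "K \<le> Poly_Mapping.lookup m j"
    proof -
      have e: "m - Poly_Mapping.single j K + Poly_Mapping.single j K = m"
        by (rule poly_mapping_eqI) (use le in \<open>auto simp: lookup_add lookup_minus lookup_single when_def\<close>)
      have "Poly_Mapping.keys (m - Poly_Mapping.single j K) \<subseteq> Poly_Mapping.keys m"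
        by (auto simp: in_keys_iff lookup_minus)
      then have "f m \<noteq> 0 \<Longrightarrow> Poly_Mapping.keys (m - Poly_Mapping.single j K) \<subseteq> {..<n}"
        using Suc.prems(2) unfolding PS_simps(1) by blast
      then show ?thesis using e by (auto simp: u_def)
    qed
    then show "f m = ((poly_series n (pmono (Poly_Mapping.single j K)) \<otimes>\<^bsub>PS n\<^esub> u) \<oplus>\<^bsub>PS n\<^esub> r) m"
      unfolding PS_simps(5) lookup_poly_series_mono_mult[OF jn] by (simp add: r_def)
  qed
  ultimately show ?case using I.a_closed by simp
qed

lemma ex_order_in_I: "\<exists>M. \<forall>f\<in>carrier (PS n). (\<forall>m. f m \<noteq> 0 \<longrightarrow> M \<le> mdeg m) \<longrightarrow> f \<in> I"
proof -
  obtain K where K: "\<And>i. i < n \<Longrightarrow> poly_series n (pmono (Poly_Mapping.single i K)) \<in> I"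
    using ex_common_exponent by blast
  have "f \<in> I" if f: "f \<in> carrier (PS n)" and o: "\<And>m. f m \<noteq> 0 \<Longrightarrow> n * K + 1 \<le> mdeg m" for f
  proof (rule high_power_series_in_I[OF K order.refl f])
    fix m assume m: "f m \<noteq> 0"
    have "mdeg m = (\<Sum>i<n. Poly_Mapping.lookup m i)"
      by (rule deg_superset) (use f m in \<open>auto simp: PS_simps\<close>)
    moreover have "(\<Sum>i<n. Poly_Mapping.lookup m i) \<le> n * K" if "\<And>i. i < n \<Longrightarrow> Poly_Mapping.lookup m i \<le> K"
      using sum_bounded_above[of "{..<n}" "Poly_Mapping.lookup m" K] that by simp
    ultimately have "\<not> (\<forall>i<n. Poly_Mapping.lookup m i \<le> K)" using o[OF m] by fastforce
    then show "\<exists>i<n. K \<le> Poly_Mapping.lookup m i" by (metis linear)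
  qed
  then show ?thesis by blast
qed

text \<open>
  The ideal of those polynomials that vanish in \<open>S\<close>.
\<close>

definition I0 :: "mpoly set"
  where "I0 = {p \<in> Ord n 0. poly_series n p \<in> I}"

text \<open>
  All power series of order at least \<open>M\<close> belong to \<open>I\<close>.
\<close>

definition M :: nat
  where "M = (SOME M. \<forall>f\<in>carrier (PS n). (\<forall>m. f m \<noteq> 0 \<longrightarrow> M \<le> mdeg m) \<longrightarrow> f \<in> I)"

definition Gs :: "mpoly set"
  where "Gs = (\<lambda>j. trunc n M (g j)) ` {..<n}"

lemma order_in_I: "f \<in> carrier (PS n) \<Longrightarrow> (\<And>m. f m \<noteq> 0 \<Longrightarrow> M \<le> mdeg m) \<Longrightarrow> f \<in> I"
  using someI_ex[OF ex_order_in_I] unfolding M_def by blast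

lemma I0_pideal: "is_pideal n I0"
  unfolding is_pideal_def
proof (intro conjI ballI mp.subspaceI)
  have "poly_series n 0 = \<zero>\<^bsub>PS n\<^esub>" by (rule ext) (simp add: poly_series_def PS_simps)
  then show "0 \<in> I0"
    using additive_subgroup.zero_closed[OF I.additive_subgroup_axioms] mp.subspace_0[OF subspace_Ord]
    by (simp add: I0_def)
  fix p q assume "p \<in> I0" "q \<in> I0"
  then show "p + q \<in> I0"
    using I.a_closed mp.subspace_add[OF subspace_Ord] by (simp add: I0_def poly_series_add)
next
  have smult: "poly_series n (a * p) \<in> I" if "p \<in> I0" for a p
    using I.I_l_closed[OF _ poly_series_closed] that by (simp add: I0_def poly_series_mult)
  fix c p assume p: "p \<in> I0"
  have "psc c p = psc c 1 * p" by (simp add: psc_mult_left)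
  then have "poly_series n (psc c p) \<in> I" using smult[OF p] by metis
  then show "psc c p \<in> I0" using p mp.subspace_scale[OF subspace_Ord] by (simp add: I0_def)
next
  show "I0 \<subseteq> Ord n 0" by (auto simp: I0_def)
  fix a p assume "a \<in> Ord n 0" "p \<in> I0"
  then show "a * p \<in> I0"
    using I.I_l_closed[OF _ poly_series_closed] Ord_mult'[of a n 0 p 0 0] by (simp add: I0_def poly_series_mult)
qed

lemma I0_Ord1: "I0 \<subseteq> Ord n 1"
proof
  fix p assume p: "p \<in> I0"
  then have "poly_series n p 0 = 0" using relation_constant_term by (simp add: I0_def)
  then have "Poly_Mapping.lookup p 0 = 0" by (simp add: poly_series_def)
  then have "m \<noteq> 0" if "m \<in> Poly_Mapping.keys p" for m using that by (auto simp: in_keys_iff)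
  moreover have "Poly_Mapping.keys m \<subseteq> {..<n}" if "m \<in> Poly_Mapping.keys p" for m using p that by (auto simp: I0_def Ord_def)
  ultimately show "p \<in> Ord n 1" using deg_eq_0 by (fastforce simp: Ord_def)
qed

lemma Ord_M_I0: "Ord n M \<subseteq> I0"
proof
  fix p assume p: "p \<in> Ord n M"
  have "poly_series n p \<in> I"
    by (rule order_in_I[OF poly_series_closed])
      (use p in \<open>auto simp: Ord_def poly_series_def in_keys_iff split: if_splits\<close>)
  then show "p \<in> I0" using p Ord_antimono[of 0 M n] by (auto simp: I0_def)
qed

lemma minus_trunc_in_I:
  assumes f: "f \<in> carrier (PS n)"
  shows "\<exists>r\<in>I. f = poly_series n (trunc n M f) \<oplus>\<^bsub>PS n\<^esub> r"
proof
  let ?r = "\<lambda>m. f m - poly_series n (trunc n M f) m"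
  show "f = poly_series n (trunc n M f) \<oplus>\<^bsub>PS n\<^esub> ?r" by (simp add: PS_simps)
  have z: "Poly_Mapping.keys m \<subseteq> {..<n} \<and> M \<le> mdeg m" if "?r m \<noteq> 0" for m
    using that f by (auto simp: poly_series_def lookup_trunc low_monomials_def PS_simps split: if_splits)
  show "?r \<in> I"
    by (rule order_in_I) (use z in \<open>auto simp: PS_simps\<close>)
qed

lemma pi_trunc: "f \<in> carrier (PS n) \<Longrightarrow> \<pi> (poly_series n (trunc n M f)) = \<pi> f"
proof -
  assume f: "f \<in> carrier (PS n)"
  obtain r where r: "r \<in> I" "f = poly_series n (trunc n M f) \<oplus>\<^bsub>PS n\<^esub> r" using minus_trunc_in_I[OF f] by blast
  have "\<pi> f = \<pi> (poly_series n (trunc n M f)) \<oplus> \<pi> r"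
    using pi_add[OF poly_series_closed I.Icarr[OF r(1)]] r(2) by metis
  moreover have "\<pi> r = \<zero>" using pi_ker[OF I.Icarr[OF r(1)]] r(1) by simp
  ultimately show ?thesis using pi_closed[OF poly_series_closed] by simp
qed

lemma trunc_in_I0: "f \<in> I \<Longrightarrow> trunc n M f \<in> I0"
proof -
  assume f: "f \<in> I"
  have "\<pi> (poly_series n (trunc n M f)) = \<zero>" using pi_trunc[OF I.Icarr[OF f]] pi_ker[OF I.Icarr[OF f]] f by simp
  then show ?thesis using pi_ker[OF poly_series_closed] trunc_Ord by (simp add: I0_def)
qed

lemma Gs_I0: "Gs \<subseteq> I0"
proof -
  have "g j \<in> I" if "j < n" for j using I.genideal_self[OF gens(1)] gens(2) that by blast
  then show ?thesis unfolding Gs_def using trunc_in_I0 by blast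
qed

text \<open>
  The power series whose truncation lies in the right hand side form an ideal, and it contains the generators of \<open>I\<close>. Here terms of
  order \<open>M + 1\<close> may be neglected, since they belong to \<open>max_times n I0\<close>.
\<close>

lemma I0_generated: "I0 \<subseteq> mp.span (Gs \<union> max_times n I0)"
proof -
  define Xs where "Xs = mp.span (Gs \<union> max_times n I0)"
  have sX: "mp.subspace Xs" unfolding Xs_def by (rule mp.subspace_span)
  have mX: "max_times n I0 \<subseteq> Xs" and gX: "Gs \<subseteq> Xs" unfolding Xs_def using mp.span_superset by blast+
  have high: "p \<in> Xs" if "p \<in> Ord n (Suc M)" for p
  proof -
    have "p \<in> max_times n I0"
    proof (rule Ord2_in_subspace[OF _ _ that])
      show "mp.subspace (max_times n I0)" unfolding max_times_def by (rule mp.subspace_span)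
      fix a b assume "a \<in> Ord n 1" "b \<in> Ord n M"
      then show "a * b \<in> max_times n I0" unfolding max_times_def using Ord_M_I0 by (intro mp.span_base) blast
    qed
    then show ?thesis using mX by blast
  qed
  have mult: "a * z \<in> Xs" if a: "a \<in> Ord n 0" and z: "z \<in> Xs" for a z
  proof -
    have "Xs \<subseteq> {z. a * z \<in> Xs}"
      unfolding Xs_def
    proof (rule mp.span_minimal)
      show "mp.subspace {z. a * z \<in> mp.span (Gs \<union> max_times n I0)}"
        by (rule mp.subspaceI) (simp_all add: mp.span_zero distrib_left mp.span_add psc_mult_right mp.span_scale)
      show "Gs \<union> max_times n I0 \<subseteq> {z. a * z \<in> mp.span (Gs \<union> max_times n I0)}"
        unfolding Xs_def[symmetric]
      proof
        fix z assume "z \<in> Gs \<union> max_times n I0"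
        then show "z \<in> {z. a * z \<in> Xs}"
        proof
          assume zg: "z \<in> Gs"
          obtain c b where cb: "b \<in> Ord n 1" "a = psc c 1 + b"
            using const_plus_Ord1[OF a] by (metis add.commute diff_add_cancel)
          have "b * z \<in> max_times n I0"
            unfolding max_times_def using cb zg Gs_I0 by (intro mp.span_base) blast
          moreover have "a * z = psc c z + b * z" using cb by (simp add: distrib_right psc_mult_left)
          moreover have "psc c z \<in> Xs" using mp.subspace_scale[OF sX] gX zg by blast
          ultimately have "a * z \<in> Xs" using mp.subspace_add[OF sX] mX by auto
          then show ?thesis by simp
        next
          assume "z \<in> max_times n I0"
          then have "a * z \<in> max_times n I0" using is_pideal_max_times[OF I0_pideal] a by (auto simp: is_pideal_def)
          then show ?thesis using mX by blast
        qed
      qed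
    qed
    then show ?thesis using z by blast
  qed
  define T where "T = {f \<in> carrier (PS n). trunc n M f \<in> Xs}"
  have t0: "trunc n M \<zero>\<^bsub>PS n\<^esub> = 0" by (rule poly_mapping_eqI) (simp add: lookup_trunc PS_simps)
  have tmult: "trunc n M (x \<otimes>\<^bsub>PS n\<^esub> f) \<in> Xs" if "trunc n M f \<in> Xs" for x f
  proof -
    have "trunc n M x * trunc n M f \<in> Xs" by (rule mult[OF trunc_Ord that])
    then have "trunc n M x * trunc n M f + (trunc n M (x \<otimes>\<^bsub>PS n\<^esub> f) - trunc n M x * trunc n M f) \<in> Xs"
      using high[OF trunc_mult] mp.subspace_add[OF sX] by blast
    then show ?thesis by simp
  qed
  have "ideal T (PS n)"
  proof (rule idealI[OF I.ring_axioms])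
    show "subgroup T (add_monoid (PS n))"
    proof (rule group.subgroupI[OF I.a_group])
      show "T \<subseteq> carrier (add_monoid (PS n))" by (auto simp: T_def)
      have "\<zero>\<^bsub>PS n\<^esub> \<in> T" using t0 mp.subspace_0[OF sX] by (simp add: T_def)
      then show "T \<noteq> {}" by blast
    next
      fix a assume a: "a \<in> T"
      then have ac: "a \<in> carrier (PS n)" by (simp add: T_def)
      have "a \<oplus>\<^bsub>PS n\<^esub> (\<ominus>\<^bsub>PS n\<^esub> a) = \<zero>\<^bsub>PS n\<^esub>" by (rule I.r_neg[OF ac])
      then have "trunc n M a + trunc n M (\<ominus>\<^bsub>PS n\<^esub> a) = 0" using t0 trunc_add by metis
      then have "trunc n M (\<ominus>\<^bsub>PS n\<^esub> a) = - trunc n M a" by (simp add: add_eq_0_iff)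
      then have "\<ominus>\<^bsub>PS n\<^esub> a \<in> T" using a ac mp.subspace_neg[OF sX] by (simp add: T_def)
      then show "inv\<^bsub>add_monoid (PS n)\<^esub> a \<in> T" by (simp add: a_inv_def)
    next
      fix a b assume "a \<in> T" "b \<in> T"
      then have "a \<oplus>\<^bsub>PS n\<^esub> b \<in> T" using mp.subspace_add[OF sX] by (simp add: T_def trunc_add)
      then show "a \<otimes>\<^bsub>add_monoid (PS n)\<^esub> b \<in> T" by simp
    qed
    fix a x assume a: "a \<in> T" and x: "x \<in> carrier (PS n)"
    show xa: "x \<otimes>\<^bsub>PS n\<^esub> a \<in> T" using a x tmult by (simp add: T_def)
    then show "a \<otimes>\<^bsub>PS n\<^esub> x \<in> T" by (simp only: PS_mult_commute)
  qed
  moreover have "g ` {..<n} \<subseteq> T" using gens(1) gX by (auto simp: T_def Gs_def)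
  ultimately have IT: "I \<subseteq> T" unfolding gens(2) by (rule I.genideal_minimal)
  show ?thesis
  proof
    fix p assume p: "p \<in> I0"
    then have "trunc n M (poly_series n p) \<in> Xs" using IT by (auto simp: I0_def T_def)
    moreover have "p - trunc n M (poly_series n p) \<in> Xs"
      using p by (intro high poly_trunc_diff) (simp add: I0_def)
    ultimately have "trunc n M (poly_series n p) + (p - trunc n M (poly_series n p)) \<in> Xs"
      using mp.subspace_add[OF sX] by blast
    then show "p \<in> mp.span (Gs \<union> max_times n I0)" by (simp add: Xs_def)
  qed
qed

lemma Gs_card: "finite Gs" "card Gs \<le> n"
  unfolding Gs_def using card_image_le[of "{..<n}" "\<lambda>j. trunc n M (g j)"] by auto

end

section \<open>The Lie algebra of derivations\<close>

lemma Der_simps: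
  "carrier (Der R S) = derivations R S"
  "\<zero>\<^bsub>Der R S\<^esub> = (\<lambda>x \<in> carrier S. \<zero>\<^bsub>S\<^esub>)"
  "D \<oplus>\<^bsub>Der R S\<^esub> E = (\<lambda>x \<in> carrier S. D x \<oplus>\<^bsub>S\<^esub> E x)"
  "c \<odot>\<^bsub>Der R S\<^esub> D = (\<lambda>x \<in> carrier S. c \<odot>\<^bsub>S\<^esub> D x)"
  "\<lbrace>D, E\<rbrace>\<^bsub>Der R S\<^esub> = (\<lambda>x \<in> carrier S. D (E x) \<ominus>\<^bsub>S\<^esub> E (D x))"
  by (simp_all add: Der_def)

lemma derivationsD:
  assumes "D \<in> derivations R S"
  shows "x \<in> carrier S \<Longrightarrow> D x \<in> carrier S"
    and "x \<in> carrier S \<Longrightarrow> y \<in> carrier S \<Longrightarrow> D (x \<oplus>\<^bsub>S\<^esub> y) = D x \<oplus>\<^bsub>S\<^esub> D y"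
    and "c \<in> carrier R \<Longrightarrow> x \<in> carrier S \<Longrightarrow> D (c \<odot>\<^bsub>S\<^esub> x) = c \<odot>\<^bsub>S\<^esub> D x"
    and "x \<in> carrier S \<Longrightarrow> y \<in> carrier S \<Longrightarrow> D (x \<otimes>\<^bsub>S\<^esub> y) = D x \<otimes>\<^bsub>S\<^esub> y \<oplus>\<^bsub>S\<^esub> x \<otimes>\<^bsub>S\<^esub> D y"
    and "D \<in> extensional (carrier S)"
  using assms by (auto simp: derivations_def PiE_def)

lemma derivationsI:
  assumes "D \<in> extensional (carrier S)"
    and "\<And>x. x \<in> carrier S \<Longrightarrow> D x \<in> carrier S"
    and "\<And>x y. x \<in> carrier S \<Longrightarrow> y \<in> carrier S \<Longrightarrow> D (x \<oplus>\<^bsub>S\<^esub> y) = D x \<oplus>\<^bsub>S\<^esub> D y"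
    and "\<And>c x. c \<in> carrier R \<Longrightarrow> x \<in> carrier S \<Longrightarrow> D (c \<odot>\<^bsub>S\<^esub> x) = c \<odot>\<^bsub>S\<^esub> D x"
    and "\<And>x y. x \<in> carrier S \<Longrightarrow> y \<in> carrier S \<Longrightarrow> D (x \<otimes>\<^bsub>S\<^esub> y) = D x \<otimes>\<^bsub>S\<^esub> y \<oplus>\<^bsub>S\<^esub> x \<otimes>\<^bsub>S\<^esub> D y"
  shows "D \<in> derivations R S"
  using assms by (auto simp: derivations_def PiE_def)

context
  fixes R :: "('a, 'r) ring_scheme" and S :: "('a, 'b, 'm) module_scheme" (structure)
  assumes alg: "algebra R S"
begin

interpretation S: cring S using alg by (simp add: algebra_def)
interpretation A: algebra R S by (rule alg)

lemma smult_commute: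
  "a \<in> carrier R \<Longrightarrow> b \<in> carrier R \<Longrightarrow> x \<in> carrier S \<Longrightarrow> a \<odot> (b \<odot> x) = b \<odot> (a \<odot> x)"
  by (metis A.smult_assoc1 A.R.m_comm)

lemma smult_mult_right:
  "a \<in> carrier R \<Longrightarrow> x \<in> carrier S \<Longrightarrow> y \<in> carrier S \<Longrightarrow> x \<otimes> (a \<odot> y) = a \<odot> (x \<otimes> y)"
  by (metis A.smult_assoc2 A.smult_closed S.m_comm)

lemma smult_diff:
  "a \<in> carrier R \<Longrightarrow> x \<in> carrier S \<Longrightarrow> y \<in> carrier S \<Longrightarrow> a \<odot> (x \<ominus> y) = a \<odot> x \<ominus> a \<odot> y"
  by (simp add: a_minus_def A.smult_r_distr A.smult_r_minus)

lemma derivations_diff: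
  assumes D: "D \<in> derivations R S" and xy: "x \<in> carrier S" "y \<in> carrier S"
  shows "D (x \<ominus> y) = D x \<ominus> D y"
proof -
  note d = derivationsD[OF D]
  have c: "x \<ominus> y \<in> carrier S" using xy by simp
  have "x = (x \<ominus> y) \<oplus> y" using xy by algebra
  then have "D x = D (x \<ominus> y) \<oplus> D y" using d(2)[OF c xy(2)] by simp
  then show ?thesis using d(1)[OF c] d(1)[OF xy(1)] d(1)[OF xy(2)] by algebra
qed

lemma zero_derivation: "(\<lambda>x\<in>carrier S. \<zero>) \<in> derivations R S"
  by (rule derivationsI) (auto simp: A.smult_r_null)

lemma add_derivation:
  assumes D: "D \<in> derivations R S" and E: "E \<in> derivations R S"
  shows "(\<lambda>x\<in>carrier S. D x \<oplus> E x) \<in> derivations R S"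
proof (rule derivationsI)
  note d = derivationsD[OF D] and e = derivationsD[OF E]
  show "(\<lambda>x\<in>carrier S. D x \<oplus> E x) \<in> extensional (carrier S)" by simp
  fix x assume x: "x \<in> carrier S"
  note dx = d(1)[OF x] e(1)[OF x] x
  show "(\<lambda>x\<in>carrier S. D x \<oplus> E x) x \<in> carrier S" using dx by simp
  { fix c assume "c \<in> carrier R"
    then show "(\<lambda>x\<in>carrier S. D x \<oplus> E x) (c \<odot> x) = c \<odot> (\<lambda>x\<in>carrier S. D x \<oplus> E x) x"
      using dx d(3) e(3) by (simp add: A.smult_r_distr) }
  fix y assume y: "y \<in> carrier S"
  note dy = d(1)[OF y] e(1)[OF y] y
  have "D (x \<oplus> y) \<oplus> E (x \<oplus> y) = (D x \<oplus> E x) \<oplus> (D y \<oplus> E y)"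
    unfolding d(2)[OF x y] e(2)[OF x y] using dx dy by algebra
  then show "(\<lambda>x\<in>carrier S. D x \<oplus> E x) (x \<oplus> y) = (\<lambda>x\<in>carrier S. D x \<oplus> E x) x \<oplus> (\<lambda>x\<in>carrier S. D x \<oplus> E x) y"
    using x y by simp
  have "D (x \<otimes> y) \<oplus> E (x \<otimes> y) = (D x \<oplus> E x) \<otimes> y \<oplus> x \<otimes> (D y \<oplus> E y)"
    unfolding d(4)[OF x y] e(4)[OF x y] using dx dy by algebra
  then show "(\<lambda>x\<in>carrier S. D x \<oplus> E x) (x \<otimes> y) = (\<lambda>x\<in>carrier S. D x \<oplus> E x) x \<otimes> y \<oplus> x \<otimes> (\<lambda>x\<in>carrier S. D x \<oplus> E x) y"
    using x y by simp
qed

lemma smult_derivation: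
  assumes D: "D \<in> derivations R S" and a: "a \<in> carrier R"
  shows "(\<lambda>x\<in>carrier S. a \<odot> D x) \<in> derivations R S"
proof (rule derivationsI)
  note d = derivationsD[OF D]
  show "(\<lambda>x\<in>carrier S. a \<odot> D x) \<in> extensional (carrier S)" by simp
  fix x assume x: "x \<in> carrier S"
  note dx = d(1)[OF x] x
  show "(\<lambda>x\<in>carrier S. a \<odot> D x) x \<in> carrier S" using dx a by simp
  { fix c assume "c \<in> carrier R"
    then show "(\<lambda>x\<in>carrier S. a \<odot> D x) (c \<odot> x) = c \<odot> (\<lambda>x\<in>carrier S. a \<odot> D x) x"
      using dx d(3) a smult_commute[of a c "D x"] by simp }
  fix y assume y: "y \<in> carrier S"
  note dy = d(1)[OF y] y
  show "(\<lambda>x\<in>carrier S. a \<odot> D x) (x \<oplus> y) = (\<lambda>x\<in>carrier S. a \<odot> D x) x \<oplus> (\<lambda>x\<in>carrier S. a \<odot> D x) y"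
    using dx dy a d(2)[OF x y] by (simp add: A.smult_r_distr)
  show "(\<lambda>x\<in>carrier S. a \<odot> D x) (x \<otimes> y) = (\<lambda>x\<in>carrier S. a \<odot> D x) x \<otimes> y \<oplus> x \<otimes> (\<lambda>x\<in>carrier S. a \<odot> D x) y"
    using dx dy a d(4)[OF x y] by (simp add: A.smult_r_distr A.smult_assoc2 smult_mult_right)
qed

lemma bracket_derivation:
  assumes D: "D \<in> derivations R S" and E: "E \<in> derivations R S"
  shows "(\<lambda>x\<in>carrier S. D (E x) \<ominus> E (D x)) \<in> derivations R S"
proof (rule derivationsI)
  note d = derivationsD[OF D] and e = derivationsD[OF E]
  show "(\<lambda>x\<in>carrier S. D (E x) \<ominus> E (D x)) \<in> extensional (carrier S)" by simp
  fix x assume x: "x \<in> carrier S"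
  note x1 = d(1)[OF x] e(1)[OF x]
  note x2 = d(1)[OF x1(2)] e(1)[OF x1(1)]
  show "(\<lambda>x\<in>carrier S. D (E x) \<ominus> E (D x)) x \<in> carrier S" using x x2 by simp
  { fix c assume "c \<in> carrier R"
    then show "(\<lambda>x\<in>carrier S. D (E x) \<ominus> E (D x)) (c \<odot> x) = c \<odot> (\<lambda>x\<in>carrier S. D (E x) \<ominus> E (D x)) x"
      using x x1 x2 d(3) e(3) by (simp add: smult_diff) }
  fix y assume y: "y \<in> carrier S"
  note y1 = d(1)[OF y] e(1)[OF y]
  note y2 = d(1)[OF y1(2)] e(1)[OF y1(1)]
  have "D (E (x \<oplus> y)) \<ominus> E (D (x \<oplus> y)) = (D (E x) \<ominus> E (D x)) \<oplus> (D (E y) \<ominus> E (D y))"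
    unfolding d(2)[OF x y] e(2)[OF x y] d(2)[OF x1(2) y1(2)] e(2)[OF x1(1) y1(1)] using x2 y2 by algebra
  then show "(\<lambda>x\<in>carrier S. D (E x) \<ominus> E (D x)) (x \<oplus> y)
      = (\<lambda>x\<in>carrier S. D (E x) \<ominus> E (D x)) x \<oplus> (\<lambda>x\<in>carrier S. D (E x) \<ominus> E (D x)) y"
    using x y by simp
  have m: "E x \<otimes> y \<in> carrier S" "x \<otimes> E y \<in> carrier S" "D x \<otimes> y \<in> carrier S" "x \<otimes> D y \<in> carrier S"
    using x y x1 y1 by simp_all
  have "D (E (x \<otimes> y)) \<ominus> E (D (x \<otimes> y)) = (D (E x) \<ominus> E (D x)) \<otimes> y \<oplus> x \<otimes> (D (E y) \<ominus> E (D y))"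
    unfolding d(4)[OF x y] e(4)[OF x y] d(2)[OF m(1,2)] e(2)[OF m(3,4)] d(4)[OF x1(2) y] d(4)[OF x y1(2)]
      e(4)[OF x1(1) y] e(4)[OF x y1(1)]
    using x y x1 y1 x2 y2 by algebra
  then show "(\<lambda>x\<in>carrier S. D (E x) \<ominus> E (D x)) (x \<otimes> y)
      = (\<lambda>x\<in>carrier S. D (E x) \<ominus> E (D x)) x \<otimes> y \<oplus> x \<otimes> (\<lambda>x\<in>carrier S. D (E x) \<ominus> E (D x)) y"
    using x y by simp
qed

lemma neg_derivation:
  assumes D: "D \<in> derivations R S"
  shows "(\<lambda>x\<in>carrier S. \<ominus> D x) \<in> derivations R S"
proof -
  have "(\<ominus>\<^bsub>R\<^esub> \<one>\<^bsub>R\<^esub>) \<odot> D x = \<ominus> D x" if "x \<in> carrier S" for x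
    using derivationsD(1)[OF D that] by (simp add: A.smult_l_minus)
  then have "(\<lambda>x\<in>carrier S. \<ominus> D x) = (\<lambda>x\<in>carrier S. (\<ominus>\<^bsub>R\<^esub> \<one>\<^bsub>R\<^esub>) \<odot> D x)" by (auto simp: restrict_def)
  then show ?thesis using smult_derivation[OF D, of "\<ominus>\<^bsub>R\<^esub> \<one>\<^bsub>R\<^esub>"] by simp
qed

lemma Der_abelian_group: "abelian_group (Der R S)"
proof (rule abelian_groupI, unfold Der_simps)
  fix D E F assume D: "D \<in> derivations R S" and E: "E \<in> derivations R S" and F: "F \<in> derivations R S"
  note d = derivationsD[OF D] and e = derivationsD[OF E] and f = derivationsD[OF F]
  show "(\<lambda>x\<in>carrier S. (\<lambda>x\<in>carrier S. D x \<oplus> E x) x \<oplus> F x)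
      = (\<lambda>x\<in>carrier S. D x \<oplus> (\<lambda>x\<in>carrier S. E x \<oplus> F x) x)"
    using d(1) e(1) f(1) by (auto simp: restrict_def S.a_assoc)
  show "(\<lambda>x\<in>carrier S. D x \<oplus> E x) = (\<lambda>x\<in>carrier S. E x \<oplus> D x)"
    using d(1) e(1) by (auto simp: restrict_def S.a_comm)
  show "(\<lambda>x\<in>carrier S. (\<lambda>x\<in>carrier S. \<zero>) x \<oplus> D x) = D"
    by (rule extensionalityI[OF _ d(5)]) (use d(1) in auto)
  show "\<exists>y\<in>derivations R S. (\<lambda>x\<in>carrier S. y x \<oplus> D x) = (\<lambda>x\<in>carrier S. \<zero>)"
    using neg_derivation[OF D] d(1) by (intro bexI[of _ "\<lambda>x\<in>carrier S. \<ominus> D x"]) (auto simp: restrict_def S.l_neg)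
  show "(\<lambda>x\<in>carrier S. D x \<oplus> E x) \<in> derivations R S" by (rule add_derivation[OF D E])
qed (rule zero_derivation)

lemma Der_module: "module R (Der R S)"
proof (rule moduleI[OF A.R.is_cring Der_abelian_group], unfold Der_simps)
  fix a b D E assume a: "a \<in> carrier R" and b: "b \<in> carrier R"
    and D: "D \<in> derivations R S" and E: "E \<in> derivations R S"
  note d = derivationsD[OF D] and e = derivationsD[OF E]
  show "(\<lambda>x\<in>carrier S. a \<odot> D x) \<in> derivations R S" by (rule smult_derivation[OF D a])
  show "(\<lambda>x\<in>carrier S. (a \<oplus>\<^bsub>R\<^esub> b) \<odot> D x)
      = (\<lambda>x\<in>carrier S. (\<lambda>x\<in>carrier S. a \<odot> D x) x \<oplus> (\<lambda>x\<in>carrier S. b \<odot> D x) x)"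
    using a b d(1) by (auto simp: restrict_def A.smult_l_distr)
  show "(\<lambda>x\<in>carrier S. a \<odot> (\<lambda>x\<in>carrier S. D x \<oplus> E x) x)
      = (\<lambda>x\<in>carrier S. (\<lambda>x\<in>carrier S. a \<odot> D x) x \<oplus> (\<lambda>x\<in>carrier S. a \<odot> E x) x)"
    using a d(1) e(1) by (auto simp: restrict_def A.smult_r_distr)
  show "(\<lambda>x\<in>carrier S. (a \<otimes>\<^bsub>R\<^esub> b) \<odot> D x) = (\<lambda>x\<in>carrier S. a \<odot> (\<lambda>x\<in>carrier S. b \<odot> D x) x)"
    using a b d(1) by (auto simp: restrict_def A.smult_assoc1)
next
  fix D assume "D \<in> derivations R S"
  note d = derivationsD[OF this]
  show "(\<lambda>x\<in>carrier S. \<one>\<^bsub>R\<^esub> \<odot> D x) = D"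
    by (rule extensionalityI[OF _ d(5)]) (use d(1) in auto)
qed

lemma Der_lie_algebra:
  assumes "field R"
  shows "lie_algebra R (Der R S)"
proof (intro lie_algebra.intro lie_algebra_axioms.intro Der_module assms, unfold Der_simps)
  fix D E F assume D: "D \<in> derivations R S" and E: "E \<in> derivations R S" and F: "F \<in> derivations R S"
  note d = derivationsD(1)[OF D] and e = derivationsD(1)[OF E] and f = derivationsD(1)[OF F]
  note ad = derivationsD(2)[OF D] and ae = derivationsD(2)[OF E] and af = derivationsD(2)[OF F]
  show "(\<lambda>x\<in>carrier S. D (E x) \<ominus> E (D x)) \<in> derivations R S" by (rule bracket_derivation[OF D E])
  have "(D (F x) \<oplus> E (F x)) \<ominus> F (D x \<oplus> E x) = (D (F x) \<ominus> F (D x)) \<oplus> (E (F x) \<ominus> F (E x))"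
    if x: "x \<in> carrier S" for x
    unfolding af[OF d[OF x] e[OF x]]
    using d[OF f[OF x]] e[OF f[OF x]] f[OF d[OF x]] f[OF e[OF x]] by algebra
  then show "(\<lambda>x\<in>carrier S. (\<lambda>x\<in>carrier S. D x \<oplus> E x) (F x) \<ominus> F ((\<lambda>x\<in>carrier S. D x \<oplus> E x) x))
      = (\<lambda>x\<in>carrier S. (\<lambda>x\<in>carrier S. D (F x) \<ominus> F (D x)) x \<oplus> (\<lambda>x\<in>carrier S. E (F x) \<ominus> F (E x)) x)"
    using d e f by (auto simp: restrict_def)
  have "D (E x \<oplus> F x) \<ominus> (E (D x) \<oplus> F (D x)) = (D (E x) \<ominus> E (D x)) \<oplus> (D (F x) \<ominus> F (D x))"
    if x: "x \<in> carrier S" for x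
    unfolding ad[OF e[OF x] f[OF x]]
    using d[OF f[OF x]] d[OF e[OF x]] f[OF d[OF x]] e[OF d[OF x]] by algebra
  then show "(\<lambda>x\<in>carrier S. D ((\<lambda>x\<in>carrier S. E x \<oplus> F x) x) \<ominus> (\<lambda>x\<in>carrier S. E x \<oplus> F x) (D x))
      = (\<lambda>x\<in>carrier S. (\<lambda>x\<in>carrier S. D (E x) \<ominus> E (D x)) x \<oplus> (\<lambda>x\<in>carrier S. D (F x) \<ominus> F (D x)) x)"
    using d e f by (auto simp: restrict_def)
  show "(\<lambda>x\<in>carrier S. D (D x) \<ominus> D (D x)) = (\<lambda>x\<in>carrier S. \<zero>)"
    using d by (auto simp: restrict_def a_minus_def S.r_neg)
  let ?br = "\<lambda>D E. \<lambda>x\<in>carrier S. D (E x) \<ominus> E (D x)"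
  have br: "?br D (?br E F) x = (D (E (F x)) \<ominus> D (F (E x))) \<ominus> (E (F (D x)) \<ominus> F (E (D x)))"
    if "D \<in> derivations R S" "E \<in> derivations R S" "F \<in> derivations R S" "x \<in> carrier S" for D E F x
    using that derivationsD(1)[of _ R S] by (simp add: derivations_diff)
  have "(?br D (?br E F) x \<oplus> ?br E (?br F D) x) \<oplus> ?br F (?br D E) x = \<zero>" if x: "x \<in> carrier S" for x
    unfolding br[OF D E F x] br[OF E F D x] br[OF F D E x]
    using d[OF e[OF f[OF x]]] d[OF f[OF e[OF x]]] e[OF d[OF f[OF x]]] e[OF f[OF d[OF x]]]
      f[OF e[OF d[OF x]]] f[OF d[OF e[OF x]]] by algebra
  then show "(\<lambda>x\<in>carrier S. (\<lambda>x\<in>carrier S. ?br D (?br E F) x \<oplus> ?br E (?br F D) x) x \<oplus> ?br F (?br D E) x) = (\<lambda>x\<in>carrier S. \<zero>)"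
    by (auto simp: restrict_def cong: if_cong)
  fix a assume a: "a \<in> carrier R"
  show "(\<lambda>x\<in>carrier S. (\<lambda>x\<in>carrier S. a \<odot> D x) (E x) \<ominus> E ((\<lambda>x\<in>carrier S. a \<odot> D x) x))
      = (\<lambda>x\<in>carrier S. a \<odot> ?br D E x)"
    using a d e derivationsD(3)[OF E a] by (auto simp: restrict_def smult_diff)
  show "(\<lambda>x\<in>carrier S. D ((\<lambda>x\<in>carrier S. a \<odot> E x) x) \<ominus> (\<lambda>x\<in>carrier S. a \<odot> E x) (D x))
      = (\<lambda>x\<in>carrier S. a \<odot> ?br D E x)"
    using a d e derivationsD(3)[OF D a] by (auto simp: restrict_def smult_diff)
qed

end

section \<open>Solvability\<close>

text \<open>
  The results on Lie algebras concern brackets on a whole type; linear operators on polynomials form such a type.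
\<close>

typedef pendo = "{T :: mpoly \<Rightarrow> mpoly. mp.endo T}" morphisms act pendo_of
  by (rule exI[of _ "\<lambda>_. 0"]) (auto intro: mp.endoI)

lemma act_endo: "mp.endo (act x)"
  using act[of x] by simp

lemma act_pendo_of: "mp.endo T \<Longrightarrow> act (pendo_of T) = T"
  by (simp add: pendo_of_inverse)

lemma pendo_eqI: "(\<And>p. act x p = act y p) \<Longrightarrow> x = y"
  by (metis act_inject ext)

lemmas act_linear = module_hom.add[OF act_endo] module_hom.scale[OF act_endo] module_hom.diff[OF act_endo]
  module_hom.neg[OF act_endo] module_hom.zero[OF act_endo]

instantiation pendo :: ab_group_add
begin

definition "0 = pendo_of (\<lambda>_. 0)"
definition "x + y = pendo_of (\<lambda>p. act x p + act y p)"
definition "- x = pendo_of (\<lambda>p. - act x p)"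
definition "x - y = pendo_of (\<lambda>p. act x p - act y p)"

lemma act_group:
  "act 0 p = 0" "act (x + y) p = act x p + act y p" "act (- x) p = - act x p" "act (x - y) p = act x p - act y p"
proof -
  show "act 0 p = 0"
    unfolding zero_pendo_def by (subst act_pendo_of) (auto intro!: mp.endoI)
  show "act (x + y) p = act x p + act y p"
    unfolding plus_pendo_def
    by (subst act_pendo_of) (auto intro!: mp.endoI simp: act_linear mp.scale_right_distrib)
  show "act (- x) p = - act x p"
    unfolding uminus_pendo_def
    by (subst act_pendo_of) (auto intro!: mp.endoI simp: act_linear)
  show "act (x - y) p = act x p - act y p"
    unfolding minus_pendo_def
    by (subst act_pendo_of) (auto intro!: mp.endoI simp: act_linear mp.scale_right_diff_distrib)
qed

instance
  by standard (rule pendo_eqI, simp add: act_group)+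

end

definition pendo_scale :: "complex \<Rightarrow> pendo \<Rightarrow> pendo"
  where "pendo_scale c x = pendo_of (\<lambda>p. psc c (act x p))"

definition commutator :: "pendo \<Rightarrow> pendo \<Rightarrow> pendo"
  where "commutator x y = pendo_of (\<lambda>p. act x (act y p) - act y (act x p))"

lemma act_scale: "act (pendo_scale c x) p = psc c (act x p)"
  unfolding pendo_scale_def
  by (subst act_pendo_of) (auto intro!: mp.endoI simp: act_linear mp.scale_right_distrib mult.commute)

lemma act_commutator: "act (commutator x y) p = act x (act y p) - act y (act x p)"
  unfolding commutator_def
  by (subst act_pendo_of) (auto intro!: mp.endoI simp: act_linear mp.scale_right_diff_distrib)

global_interpretation pe: complex_vector_space pendo_scale
  by unfold_locales (rule pendo_eqI, simp add: act_group act_scale mp.scale_right_distrib mp.scale_left_distrib)+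

global_interpretation pe: lie_bracket pendo_scale commutator
proof (intro lie_bracket.intro lie_bracket_axioms.intro pe.complex_vector_space_axioms)
  fix x y z :: pendo
  show "pe.endo (\<lambda>x. commutator x y)" "pe.endo (commutator x)"
    by (auto intro!: pe.endoI pendo_eqI simp: act_group act_scale act_commutator act_linear mp.scale_right_diff_distrib)
  show "commutator x x = 0"
    by (rule pendo_eqI) (simp add: act_commutator act_group)
  show "commutator x (commutator y z) = commutator (commutator x y) z + commutator y (commutator x z)"
    by (rule pendo_eqI) (simp add: act_commutator act_group act_linear)
qed

lemma carrier_complex_field: "c \<in> carrier complex_field"
  by (simp add: ring_of_type_algebra_def)

context series_quotient
begin

interpretation A: algebra complex_field S by (rule alg)

lemma smult_closed: "s \<in> carrier S \<Longrightarrow> c \<odot> s \<in> carrier S"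
  by (rule A.smult_closed[OF carrier_complex_field])

definition ev :: "mpoly \<Rightarrow> 'a"
  where "ev p = \<pi> (poly_series n p)"

lemma ev_closed: "ev p \<in> carrier S"
  unfolding ev_def by (rule pi_closed[OF poly_series_closed])

lemma ev_add: "ev (p + q) = ev p \<oplus> ev q"
  unfolding ev_def poly_series_add by (rule pi_add[OF poly_series_closed poly_series_closed])

lemma ev_mult: "ev (p * q) = ev p \<otimes> ev q"
  unfolding ev_def poly_series_mult by (rule pi_mult[OF poly_series_closed poly_series_closed])

lemma ev_scale: "ev (psc c p) = c \<odot> ev p"
  unfolding ev_def poly_series_scale by (rule pi_smult[OF poly_series_closed])

lemma ev_diff: "ev (p - q) = ev p \<ominus> ev q"
proof -
  have "ev p = ev (p - q) \<oplus> ev q" using ev_add[of "p - q" q] by simp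
  then show ?thesis using ev_closed[of p] ev_closed[of q] ev_closed[of "p - q"] by algebra
qed

lemma ev_zero_iff: "p \<in> Ord n 0 \<Longrightarrow> ev p = \<zero> \<longleftrightarrow> p \<in> I0"
  unfolding ev_def I0_def using pi_ker[OF poly_series_closed] by simp

lemma ev_eq_iff:
  assumes "p \<in> Ord n 0" "q \<in> Ord n 0"
  shows "ev p = ev q \<longleftrightarrow> p - q \<in> I0"
proof -
  have "p - q \<in> Ord n 0" using assms by (rule mp.subspace_diff[OF subspace_Ord])
  then have "ev (p - q) = \<zero> \<longleftrightarrow> p - q \<in> I0" by (rule ev_zero_iff)
  then show ?thesis using ev_closed[of p] ev_closed[of q] by (simp add: S.r_right_minus_eq ev_diff)
qed

lemma ev_surj: "s \<in> carrier S \<Longrightarrow> \<exists>p\<in>Ord n 0. ev p = s"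
  unfolding ev_def using pi_surj pi_trunc trunc_Ord by metis

text \<open>
  A linear projection along \<open>I0\<close>, obtained from a basis of \<open>I0\<close> that is extended to a basis of all polynomials in \<open>n\<close> variables.
\<close>

lemma ex_normal_form:
  "\<exists>\<rho>. mp.endo \<rho> \<and> (\<forall>p\<in>Ord n 0. \<rho> p \<in> Ord n 0 \<and> p - \<rho> p \<in> I0) \<and> (\<forall>p\<in>I0. \<rho> p = 0)"
proof -
  interpret P: vector_space_pair psc psc by unfold_locales
  have sI: "mp.subspace I0" and IO: "I0 \<subseteq> Ord n 0" using I0_pideal by (auto simp: is_pideal_def)
  obtain Bi where Bi: "Bi \<subseteq> I0" "mp.independent Bi" "I0 \<subseteq> mp.span Bi" by (rule mp.basis_exists)
  obtain B where B: "Bi \<subseteq> B" "B \<subseteq> Ord n 0" "mp.independent B" "Ord n 0 \<subseteq> mp.span B"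
    using mp.maximal_independent_subset_extend[of Bi "Ord n 0"] Bi IO by blast
  obtain \<rho> where "Vector_Spaces.linear psc psc \<rho>" and r: "\<forall>b\<in>B. \<rho> b = (if b \<in> Bi then 0 else b)"
    using P.linear_independent_extend[OF B(3), of "\<lambda>b. if b \<in> Bi then 0 else b"] by blast
  then have E: "mp.endo \<rho>" by (simp add: Vector_Spaces.linear_def)
  note lin = module_hom.add[OF E] module_hom.scale[OF E] module_hom.zero[OF E]
  have "mp.span B \<subseteq> {p. \<rho> p \<in> Ord n 0 \<and> p - \<rho> p \<in> I0}"
  proof (rule mp.span_minimal)
    show "B \<subseteq> {p. \<rho> p \<in> Ord n 0 \<and> p - \<rho> p \<in> I0}"
      using r B(2) Bi(1) mp.subspace_0[OF subspace_Ord] mp.subspace_0[OF sI] by auto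
    show "mp.subspace {p. \<rho> p \<in> Ord n 0 \<and> p - \<rho> p \<in> I0}"
    proof (rule mp.subspaceI)
      show "0 \<in> {p. \<rho> p \<in> Ord n 0 \<and> p - \<rho> p \<in> I0}"
        using mp.subspace_0[OF subspace_Ord] mp.subspace_0[OF sI] by (simp add: lin)
      fix p q assume "p \<in> {p. \<rho> p \<in> Ord n 0 \<and> p - \<rho> p \<in> I0}" "q \<in> {p. \<rho> p \<in> Ord n 0 \<and> p - \<rho> p \<in> I0}"
      then have "(p - \<rho> p) + (q - \<rho> q) \<in> I0" "\<rho> p + \<rho> q \<in> Ord n 0"
        using mp.subspace_add[OF subspace_Ord] mp.subspace_add[OF sI] by auto
      then show "p + q \<in> {p. \<rho> p \<in> Ord n 0 \<and> p - \<rho> p \<in> I0}" by (simp add: lin algebra_simps)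
    next
      fix c p assume "p \<in> {p. \<rho> p \<in> Ord n 0 \<and> p - \<rho> p \<in> I0}"
      then have "psc c (p - \<rho> p) \<in> I0" "psc c (\<rho> p) \<in> Ord n 0"
        using mp.subspace_scale[OF subspace_Ord] mp.subspace_scale[OF sI] by auto
      then show "psc c p \<in> {p. \<rho> p \<in> Ord n 0 \<and> p - \<rho> p \<in> I0}" by (simp add: lin mp.scale_right_diff_distrib)
    qed
  qed
  moreover have "mp.span Bi \<subseteq> {p. \<rho> p = 0}"
  proof (rule mp.span_minimal)
    show "Bi \<subseteq> {p. \<rho> p = 0}" using r B(1) by auto
    show "mp.subspace {p. \<rho> p = 0}" by (rule mp.subspaceI) (simp_all add: lin)
  qed
  ultimately show ?thesis using E B(4) Bi(3) by blast
qed

definition nf :: "mpoly \<Rightarrow> mpoly"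
  where "nf = (SOME \<rho>. mp.endo \<rho> \<and> (\<forall>p\<in>Ord n 0. \<rho> p \<in> Ord n 0 \<and> p - \<rho> p \<in> I0) \<and> (\<forall>p\<in>I0. \<rho> p = 0))"

lemma nf_endo: "mp.endo nf" and nf_Ord: "p \<in> Ord n 0 \<Longrightarrow> nf p \<in> Ord n 0"
  and nf_diff: "p \<in> Ord n 0 \<Longrightarrow> p - nf p \<in> I0" and nf_I0: "p \<in> I0 \<Longrightarrow> nf p = 0"
  using someI_ex[OF ex_normal_form] unfolding nf_def by blast+

text \<open>
  A linear section of \<open>ev\<close>; by \<open>sec_ev\<close> it does not depend on the choice of \<open>p\<close>.
\<close>

definition sec :: "'a \<Rightarrow> mpoly"
  where "sec s = nf (SOME p. p \<in> Ord n 0 \<and> ev p = s)"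

lemma sec_ev: "p \<in> Ord n 0 \<Longrightarrow> sec (ev p) = nf p"
proof -
  assume p: "p \<in> Ord n 0"
  define q where "q = (SOME q. q \<in> Ord n 0 \<and> ev q = ev p)"
  have q: "q \<in> Ord n 0 \<and> ev q = ev p" unfolding q_def by (rule someI[of _ p]) (use p in simp)
  then have "nf (q - p) = 0" using ev_eq_iff[of q p] p nf_I0 by simp
  then show ?thesis unfolding sec_def q_def[symmetric] by (simp add: module_hom.diff[OF nf_endo])
qed

lemma sec_Ord: "s \<in> carrier S \<Longrightarrow> sec s \<in> Ord n 0"
  using ev_surj[of s] sec_ev nf_Ord by metis

lemma ev_sec: "s \<in> carrier S \<Longrightarrow> ev (sec s) = s"
proof -
  assume "s \<in> carrier S"
  then obtain p where p: "p \<in> Ord n 0" "ev p = s" using ev_surj by blast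
  then show ?thesis using sec_ev[OF p(1)] ev_eq_iff[OF p(1) nf_Ord[OF p(1)]] nf_diff[OF p(1)] by simp
qed

lemma sec_add: "s \<in> carrier S \<Longrightarrow> t \<in> carrier S \<Longrightarrow> sec (s \<oplus> t) = sec s + sec t"
proof -
  assume "s \<in> carrier S" "t \<in> carrier S"
  then obtain p q where pq: "p \<in> Ord n 0" "ev p = s" "q \<in> Ord n 0" "ev q = t" using ev_surj by metis
  have "sec (ev (p + q)) = nf (p + q)" using pq by (intro sec_ev mp.subspace_add[OF subspace_Ord])
  then show ?thesis using pq sec_ev by (auto simp: ev_add module_hom.add[OF nf_endo])
qed

lemma sec_scale: "s \<in> carrier S \<Longrightarrow> sec (c \<odot> s) = psc c (sec s)"
proof -
  assume "s \<in> carrier S"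
  then obtain p where p: "p \<in> Ord n 0" "ev p = s" using ev_surj by blast
  have "sec (ev (psc c p)) = nf (psc c p)" using p by (intro sec_ev mp.subspace_scale[OF subspace_Ord])
  then show ?thesis using p sec_ev by (auto simp: ev_scale module_hom.scale[OF nf_endo])
qed

lemma sec_diff: "s \<in> carrier S \<Longrightarrow> t \<in> carrier S \<Longrightarrow> sec (s \<ominus> t) = sec s - sec t"
proof -
  assume st: "s \<in> carrier S" "t \<in> carrier S"
  have "s = (s \<ominus> t) \<oplus> t" using st by algebra
  then have "sec s = sec (s \<ominus> t) + sec t" using sec_add[of "s \<ominus> t" t] st by simp
  then show ?thesis by simp
qed

lemma sec_zero: "sec \<zero> = 0"
proof -
  have "0 \<in> I0" using I0_pideal by (auto simp: is_pideal_def intro: mp.subspace_0)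
  then have "ev 0 = \<zero>" using ev_zero_iff[of 0] mp.subspace_0[OF subspace_Ord] by simp
  then show ?thesis using sec_ev[of 0] mp.subspace_0[OF subspace_Ord] module_hom.zero[OF nf_endo] by metis
qed

abbreviation Ders :: "('a \<Rightarrow> 'a) set"
  where "Ders \<equiv> derivations complex_field S"

text \<open>
  Since \<open>ev \<circ> sec\<close> is the identity on \<open>S\<close>, this is compatible with compositions and not only modulo \<open>I0\<close>. Therefore the relations of
  \<open>sl\<^sub>2\<close> among derivations of \<open>S\<close> hold exactly for their lifts.
\<close>

definition lift :: "('a \<Rightarrow> 'a) \<Rightarrow> pendo"
  where "lift d = pendo_of (\<lambda>p. sec (d (ev p)))"

lemma act_lift:
  assumes d: "d \<in> Ders"
  shows "act (lift d) p = sec (d (ev p))"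
proof -
  note D = derivationsD[OF d]
  have "mp.endo (\<lambda>p. sec (d (ev p)))"
    by (rule mp.endoI)
      (simp_all add: ev_add ev_scale ev_closed D(1,2) D(3)[OF carrier_complex_field] sec_add sec_scale)
  then show ?thesis unfolding lift_def by (simp add: act_pendo_of)
qed

lemma lift_derivation_mod:
  assumes d: "d \<in> Ders"
  shows "derivation_mod n I0 (act (lift d))"
  unfolding derivation_mod_def
proof (intro conjI ballI)
  note D = derivationsD[OF d]
  have O: "act (lift d) p \<in> Ord n 0" for p unfolding act_lift[OF d] by (rule sec_Ord[OF D(1)[OF ev_closed]])
  have ev_act: "ev (act (lift d) p) = d (ev p)" for p unfolding act_lift[OF d] by (rule ev_sec[OF D(1)[OF ev_closed]])
  show "mp.endo (act (lift d))" by (rule act_endo)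
  show "act (lift d) p \<in> Ord n 0" for p by (rule O)
  have d0: "d \<zero> = \<zero>"
  proof -
    have "d (\<zero> \<oplus> \<zero>) = d \<zero> \<oplus> d \<zero>" by (rule D(2)) simp_all
    then show ?thesis using D(1)[of \<zero>] by simp
  qed
  fix p assume p: "p \<in> I0"
  then have "ev p = \<zero>" using ev_zero_iff[of p] by (simp add: I0_def)
  then have "act (lift d) p = 0" using d0 sec_zero by (simp add: act_lift[OF d])
  then show "act (lift d) p \<in> I0" using I0_pideal by (auto simp: is_pideal_def intro: mp.subspace_0)
next
  note D = derivationsD[OF d]
  have O: "act (lift d) p \<in> Ord n 0" for p unfolding act_lift[OF d] by (rule sec_Ord[OF D(1)[OF ev_closed]])
  have ev_act: "ev (act (lift d) p) = d (ev p)" for p unfolding act_lift[OF d] by (rule ev_sec[OF D(1)[OF ev_closed]])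
  fix p q assume pq: "p \<in> Ord n 0" "q \<in> Ord n 0"
  have r: "act (lift d) p * q + p * act (lift d) q \<in> Ord n 0"
    using pq O by (intro mp.subspace_add[OF subspace_Ord] Ord_mult'[of _ n 0 _ 0 0]) auto
  have "ev (act (lift d) (p * q)) = ev (act (lift d) p * q + p * act (lift d) q)"
    by (simp add: ev_act ev_add ev_mult D(4)[OF ev_closed ev_closed])
  then show "act (lift d) (p * q) - (act (lift d) p * q + p * act (lift d) q) \<in> I0"
    using ev_eq_iff[OF O r] by simp
qed

lemma lift_zero_iff:
  assumes d: "d \<in> Ders"
  shows "lift d = 0 \<longleftrightarrow> d = \<zero>\<^bsub>Der complex_field S\<^esub>"
proof
  note D = derivationsD[OF d]
  assume 0: "lift d = 0"
  have "d s = \<zero>" if s: "s \<in> carrier S" for s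
  proof -
    have "sec (d (ev (sec s))) = 0" using 0 act_lift[OF d, of "sec s"] by (simp add: act_group)
    then have "ev (sec (d s)) = ev (sec \<zero>)" using ev_sec[OF s] sec_zero by simp
    then show ?thesis using ev_sec[OF D(1)[OF s]] ev_sec[OF S.zero_closed] by simp
  qed
  then show "d = \<zero>\<^bsub>Der complex_field S\<^esub>"
    unfolding Der_simps by (intro extensionalityI[OF D(5)]) auto
next
  assume 0: "d = \<zero>\<^bsub>Der complex_field S\<^esub>"
  show "lift d = 0"
    by (rule pendo_eqI) (use ev_closed in \<open>simp add: act_lift[OF d] act_group, simp add: 0 Der_simps sec_zero\<close>)
qed

lemma lift_add:
  assumes d: "d \<in> Ders" and d': "d' \<in> Ders"
  shows "d \<oplus>\<^bsub>Der complex_field S\<^esub> d' \<in> Ders"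
    and "lift (d \<oplus>\<^bsub>Der complex_field S\<^esub> d') = lift d + lift d'"
proof -
  show c: "d \<oplus>\<^bsub>Der complex_field S\<^esub> d' \<in> Ders" unfolding Der_simps by (rule add_derivation[OF alg d d'])
  show "lift (d \<oplus>\<^bsub>Der complex_field S\<^esub> d') = lift d + lift d'"
    by (rule pendo_eqI)
      (simp add: act_lift[OF c] act_group act_lift[OF d] act_lift[OF d'], simp add: Der_simps ev_closed
        sec_add derivationsD(1)[OF d] derivationsD(1)[OF d'])
qed

lemma lift_scale:
  assumes d: "d \<in> Ders"
  shows "c \<odot>\<^bsub>Der complex_field S\<^esub> d \<in> Ders"
    and "lift (c \<odot>\<^bsub>Der complex_field S\<^esub> d) = pendo_scale c (lift d)"
proof -
  show e: "c \<odot>\<^bsub>Der complex_field S\<^esub> d \<in> Ders"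
    unfolding Der_simps by (rule smult_derivation[OF alg d carrier_complex_field])
  show "lift (c \<odot>\<^bsub>Der complex_field S\<^esub> d) = pendo_scale c (lift d)"
    by (rule pendo_eqI)
      (simp add: act_lift[OF e] act_scale act_lift[OF d], simp add: Der_simps ev_closed
        sec_scale derivationsD(1)[OF d])
qed

lemma lift_bracket:
  assumes d: "d \<in> Ders" and d': "d' \<in> Ders"
  shows "\<lbrace>d, d'\<rbrace>\<^bsub>Der complex_field S\<^esub> \<in> Ders"
    and "lift \<lbrace>d, d'\<rbrace>\<^bsub>Der complex_field S\<^esub> = commutator (lift d) (lift d')"
proof -
  show c: "\<lbrace>d, d'\<rbrace>\<^bsub>Der complex_field S\<^esub> \<in> Ders" unfolding Der_simps by (rule bracket_derivation[OF alg d d'])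
  show "lift \<lbrace>d, d'\<rbrace>\<^bsub>Der complex_field S\<^esub> = commutator (lift d) (lift d')"
    by (rule pendo_eqI)
      (simp add: act_lift[OF c] act_commutator act_lift[OF d] act_lift[OF d'], simp add: Der_simps ev_closed
        sec_diff ev_sec derivationsD(1)[OF d] derivationsD(1)[OF d'])
qed

lemma subalg_lift: "pe.subalg (lift ` Ders)"
  unfolding pe.subalg_def
proof (intro conjI ballI pe.subspaceI)
  have z: "\<zero>\<^bsub>Der complex_field S\<^esub> \<in> Ders" unfolding Der_simps by (rule zero_derivation[OF alg])
  then show "0 \<in> lift ` Ders" using lift_zero_iff by force
  fix x y assume "x \<in> lift ` Ders" "y \<in> lift ` Ders"
  then obtain d d' where d: "d \<in> Ders" "d' \<in> Ders" "x = lift d" "y = lift d'" by blast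
  show "x + y \<in> lift ` Ders" using lift_add[OF d(1,2)] d(3,4) by (metis imageI)
  show "commutator x y \<in> lift ` Ders" using lift_bracket[OF d(1,2)] d(3,4) by (metis imageI)
next
  fix c x assume "x \<in> lift ` Ders"
  then obtain d where d: "d \<in> Ders" "x = lift d" by blast
  show "pendo_scale c x \<in> lift ` Ders" using lift_scale[OF d(1)] d(2) by (metis imageI)
qed

lemma finite_basis_of_normal_forms:
  obtains B where "finite B" "mp.independent B" "B \<subseteq> nf ` Ord n 0" "nf ` Ord n 0 \<subseteq> mp.span B"
proof -
  obtain B where B: "B \<subseteq> nf ` Ord n 0" "mp.independent B" "nf ` Ord n 0 \<subseteq> mp.span B" by (rule mp.basis_exists)
  let ?Y = "(\<lambda>m. nf (pmono m)) ` low_monomials n M"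
  have "nf p \<in> mp.span ?Y" if p: "p \<in> Ord n 0" for p
  proof -
    have "p \<in> {p. nf p \<in> mp.span ?Y}"
    proof (rule Ord_in_subspace[OF p])
      show "mp.subspace {p. nf p \<in> mp.span ?Y}"
        by (rule mp.subspaceI) (simp_all add: module_hom.add[OF nf_endo] module_hom.scale[OF nf_endo]
            module_hom.zero[OF nf_endo] mp.span_zero mp.span_add mp.span_scale)
      fix m :: "nat \<Rightarrow>\<^sub>0 nat" assume m: "Poly_Mapping.keys m \<subseteq> {..<n}"
      show "pmono m \<in> {p. nf p \<in> mp.span ?Y}"
      proof (cases "mdeg m < M")
        case True
        then show ?thesis using m by (auto simp: low_monomials_def intro: mp.span_base)
      next
        case False
        then have "pmono m \<in> I0" using m Ord_M_I0 by (auto simp: mono_Ord not_less)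
        then show ?thesis by (simp add: nf_I0 mp.span_zero)
      qed
    qed
    then show ?thesis by simp
  qed
  then have "B \<subseteq> mp.span ?Y" using B(1) by blast
  then have "finite B" using mp.independent_span_bound[OF _ B(2), of ?Y] finite_low_monomials by blast
  then show thesis using that B by blast
qed

text \<open>
  The matrix units \<open>E b b'\<close> with respect to a finite basis of the normal forms span all lifts.
\<close>

lemma lift_finite_dim: "\<exists>Y. finite Y \<and> lift ` Ders \<subseteq> pe.span Y"
proof -
  obtain B where B: "finite B" "mp.independent B" "B \<subseteq> nf ` Ord n 0" "nf ` Ord n 0 \<subseteq> mp.span B"
    by (rule finite_basis_of_normal_forms)
  define co where "co p b = mp.representation B (sec (ev p)) b" for p b
  have sp: "sec s \<in> mp.span B" if "s \<in> carrier S" for s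
    using ev_surj[OF that] sec_ev B(4) by (metis image_subset_iff)
  define E where "E b b' = pendo_of (\<lambda>p. psc (co p b) b')" for b b'
  have actE: "act (E b b') p = psc (co p b) b'" for b b' p
  proof -
    have "mp.endo (\<lambda>p. psc (co p b) b')"
      by (rule mp.endoI) (simp_all add: co_def ev_add ev_scale ev_closed sec_add sec_scale
          mp.representation_add[OF B(2)] mp.representation_scale[OF B(2)] sp mp.scale_left_distrib)
    then show ?thesis unfolding E_def by (simp add: act_pendo_of)
  qed
  have sumact: "act (sum F J) p = (\<Sum>x\<in>J. act (F x) p)" if "finite J" for F :: "mpoly \<Rightarrow> pendo" and J p
    using that by induction (auto simp: act_group)
  have "lift d \<in> pe.span ((\<lambda>(b, b'). E b b') ` (B \<times> B))" if d: "d \<in> Ders" for d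
  proof -
    note D = derivationsD[OF d]
    have e: "mp.endo (\<lambda>p. sec (d (ev p)))" using act_endo[of "lift d"] unfolding act_lift[OF d] .
    have sumr: "(\<Sum>b\<in>B. psc (mp.representation B v b) b) = v" if "v \<in> mp.span B" for v
      by (rule mp.sum_representation_eq[OF B(2) that B(1)]) simp
    have "lift d = (\<Sum>b\<in>B. \<Sum>b'\<in>B. pendo_scale (mp.representation B (sec (d (ev b))) b') (E b b'))"
    proof (rule pendo_eqI)
      fix p
      have "act (lift d) p = sec (d (ev (sec (ev p))))" by (simp add: act_lift[OF d] ev_sec[OF ev_closed])
      also have "\<dots> = sec (d (ev (\<Sum>b\<in>B. psc (co p b) b)))"
        unfolding co_def sumr[OF sp[OF ev_closed]] ..
      also have "\<dots> = (\<Sum>b\<in>B. psc (co p b) (sec (d (ev b))))"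
        by (simp only: module_hom.sum[OF e] module_hom.scale[OF e])
      also have "\<dots> = (\<Sum>b\<in>B. psc (co p b) (\<Sum>b'\<in>B. psc (mp.representation B (sec (d (ev b))) b') b'))"
        using sumr[OF sp[OF D(1)[OF ev_closed]]] by simp
      also have "\<dots> = act (\<Sum>b\<in>B. \<Sum>b'\<in>B. pendo_scale (mp.representation B (sec (d (ev b))) b') (E b b')) p"
        by (simp add: sumact[OF B(1)] act_scale actE mp.scale_sum_right mult.commute)
      finally show "act (lift d) p
          = act (\<Sum>b\<in>B. \<Sum>b'\<in>B. pendo_scale (mp.representation B (sec (d (ev b))) b') (E b b')) p" .
    qed
    moreover have "pendo_scale c (E b b') \<in> pe.span ((\<lambda>(b, b'). E b b') ` (B \<times> B))" if "b \<in> B" "b' \<in> B" for c b b'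
      using that by (intro pe.span_scale pe.span_base) force
    ultimately show ?thesis by (simp add: pe.span_sum)
  qed
  then show ?thesis using B(1) by (intro exI[of _ "(\<lambda>(b, b'). E b b') ` (B \<times> B)"]) auto
qed

lemma solv_lift: "pe.solv (lift ` Ders)"
proof (rule ccontr)
  assume ns: "\<not> ?thesis"
  obtain Y where Y: "finite Y" "lift ` Ders \<subseteq> pe.span Y" using lift_finite_dim by blast
  obtain x y z where xyz: "x \<in> lift ` Ders" "y \<in> lift ` Ders" "z \<in> lift ` Ders" "x \<noteq> 0"
      "commutator x y = z" "commutator z x = pendo_scale 2 x" "commutator z y = - pendo_scale 2 y"
    by (rule pe.not_solv_contains_sl2[OF subalg_lift Y ns, THEN bexE]) (elim bexE conjE, rule that)
  interpret ci_sl2 n I0 M Gs "act x" "act y" "act z"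
  proof
    show "is_pideal n I0" "I0 \<subseteq> Ord n 1" "Ord n M \<subseteq> I0" "finite Gs" "card Gs \<le> n"
      "I0 \<subseteq> mp.span (Gs \<union> max_times n I0)"
      by (fact I0_pideal I0_Ord1 Ord_M_I0 Gs_card I0_generated)+
    show "derivation_mod n I0 (act x)" "derivation_mod n I0 (act y)" "derivation_mod n I0 (act z)"
      using xyz(1-3) lift_derivation_mod by blast+
    fix p
    show "act x (act y p) - act y (act x p) = act z p" using xyz(5) act_commutator[of x y p] by simp
    show "act z (act x p) - act x (act z p) = psc 2 (act x p)"
      using xyz(6) act_commutator[of z x p] act_scale[of 2 x p] by simp
    show "act z (act y p) - act y (act z p) = - psc 2 (act y p)"
      using xyz(7) act_commutator[of z y p] act_scale[of 2 y p] by (simp add: act_group)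
  qed
  obtain d where d: "d \<in> Ders" "x = lift d" using xyz(1) by blast
  note D = derivationsD[OF d(1)]
  have "x = 0"
  proof (rule pendo_eqI)
    fix p
    have "act x (sec (ev p)) \<in> I0" by (rule sl2_acts_trivially[OF sec_Ord[OF ev_closed]])
    then have "sec (d (ev p)) \<in> I0" using act_lift[OF d(1)] d(2) ev_sec[OF ev_closed] by simp
    then have "d (ev p) = \<zero>"
      using ev_zero_iff[OF sec_Ord[OF D(1)[OF ev_closed]]] ev_sec[OF D(1)[OF ev_closed]] by metis
    then show "act x p = act 0 p" using act_lift[OF d(1)] d(2) sec_zero by (simp add: act_group)
  qed
  then show False using xyz(4) by simp
qed

lemma submodule_Der:
  assumes "pe.subspace W"
  shows "submodule {d \<in> Ders. lift d \<in> W} complex_field (Der complex_field S)"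
proof -
  interpret L: module complex_field "Der complex_field S" by (rule Der_module[OF alg])
  show ?thesis
  proof (rule L.submoduleI)
    show "{d \<in> Ders. lift d \<in> W} \<subseteq> carrier (Der complex_field S)" by (auto simp: Der_simps)
    have z: "\<zero>\<^bsub>Der complex_field S\<^esub> \<in> Ders" using L.M.zero_closed by (simp only: Der_simps(1))
    then have "lift \<zero>\<^bsub>Der complex_field S\<^esub> = 0" using lift_zero_iff by blast
    then show "\<zero>\<^bsub>Der complex_field S\<^esub> \<in> {d \<in> Ders. lift d \<in> W}" using z pe.subspace_0[OF assms] by simp
  next
    fix d assume d: "d \<in> {d \<in> Ders. lift d \<in> W}"
    then have dc: "d \<in> carrier (Der complex_field S)" by (simp add: Der_simps)
    have nd: "\<ominus>\<^bsub>Der complex_field S\<^esub> d \<in> Ders" using L.M.a_inv_closed[OF dc] by (simp only: Der_simps(1))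
    have "lift (d \<oplus>\<^bsub>Der complex_field S\<^esub> (\<ominus>\<^bsub>Der complex_field S\<^esub> d)) = 0"
      using lift_zero_iff L.M.r_neg[OF dc] L.M.zero_closed by (simp only: Der_simps(1))
    then have "lift (\<ominus>\<^bsub>Der complex_field S\<^esub> d) = - lift d"
      using lift_add(2)[of d, OF _ nd] d by (simp add: add_eq_0_iff)
    then show "\<ominus>\<^bsub>Der complex_field S\<^esub> d \<in> {d \<in> Ders. lift d \<in> W}" using nd d pe.subspace_neg[OF assms] by simp
  next
    fix d d' assume "d \<in> {d \<in> Ders. lift d \<in> W}" "d' \<in> {d \<in> Ders. lift d \<in> W}"
    then show "d \<oplus>\<^bsub>Der complex_field S\<^esub> d' \<in> {d \<in> Ders. lift d \<in> W}"
      using lift_add pe.subspace_add[OF assms] by simp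
  next
    fix c d assume "d \<in> {d \<in> Ders. lift d \<in> W}"
    then show "c \<odot>\<^bsub>Der complex_field S\<^esub> d \<in> {d \<in> Ders. lift d \<in> W}"
      using lift_scale pe.subspace_scale[OF assms] by simp
  qed
qed

text \<open>
  The derived series is formed with the smallest submodules that contain the brackets, and the preimage under \<open>lift\<close> of a subspace is a
  submodule.
\<close>

lemma derived_series_lift:
  "derived_series complex_field (Der complex_field S) k \<subseteq> {d \<in> Ders. lift d \<in> (pe.der ^^ k) (lift ` Ders)}"
proof (induction k)
  case 0
  then show ?case by (auto simp: Der_simps)
next
  case (Suc k)
  let ?N = "{d \<in> Ders. lift d \<in> (pe.der ^^ Suc k) (lift ` Ders)}"
  have "submodule ?N complex_field (Der complex_field S)"
    by (rule submodule_Der) (simp add: pe.subspace_der)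
  moreover have "{\<lbrace>x, y\<rbrace>\<^bsub>Der complex_field S\<^esub> | x y. x \<in> derived_series complex_field (Der complex_field S) k
      \<and> y \<in> derived_series complex_field (Der complex_field S) k} \<subseteq> ?N"
  proof clarify
    fix x y assume "x \<in> derived_series complex_field (Der complex_field S) k"
      "y \<in> derived_series complex_field (Der complex_field S) k"
    then have xy: "x \<in> Ders" "y \<in> Ders" "lift x \<in> (pe.der ^^ k) (lift ` Ders)" "lift y \<in> (pe.der ^^ k) (lift ` Ders)"
      using Suc by auto
    show "\<lbrace>x, y\<rbrace>\<^bsub>Der complex_field S\<^esub> \<in> Ders \<and> lift \<lbrace>x, y\<rbrace>\<^bsub>Der complex_field S\<^esub> \<in> (pe.der ^^ Suc k) (lift ` Ders)"
      using lift_bracket[OF xy(1,2)] pe.br_der[OF xy(3,4)] by simp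
  qed
  ultimately show ?case unfolding derived_series.simps module_span_def by blast
qed

theorem Der_solvable: "solvable_lie_algebra complex_field (Der complex_field S)"
proof (intro solvable_lie_algebra.intro solvable_lie_algebra_axioms.intro)
  show "lie_algebra complex_field (Der complex_field S)"
    by (rule Der_lie_algebra[OF alg field_from_type_algebra])
  then interpret L: module complex_field "Der complex_field S" by (simp add: lie_algebra_def)
  obtain k where k: "(pe.der ^^ k) (lift ` Ders) \<subseteq> {0}" using solv_lift unfolding pe.solv_def by blast
  have "derived_series complex_field (Der complex_field S) k \<subseteq> {\<zero>\<^bsub>Der complex_field S\<^esub>}"
    using derived_series_lift[of k] k lift_zero_iff by blast
  moreover have "\<zero>\<^bsub>Der complex_field S\<^esub> \<in> derived_series complex_field (Der complex_field S) k"
  proof (cases k)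
    case (Suc j)
    have "\<zero>\<^bsub>Der complex_field S\<^esub> \<in> N" if "submodule N complex_field (Der complex_field S)" for N
      using subgroup.one_closed[OF submodule.axioms(1)[OF that]] by simp
    then show ?thesis by (auto simp: Suc module_span_def)
  qed (use L.M.zero_closed in simp)
  ultimately show "\<exists>k. derived_series complex_field (Der complex_field S) k = {\<zero>\<^bsub>Der complex_field S\<^esub>}" by blast
qed

end

theorem corollary2:
  fixes S :: "(complex, 'a, 'm) module_scheme"
  assumes "zero_dim_complete_intersection S"
  shows "solvable_lie_algebra complex_field (Der complex_field S)"
proof -
  obtain n I g \<pi> where "series_quotient S n I g \<pi>" using ex_series_quotient[OF assms] by blast
  then show ?thesis by (rule series_quotient.Der_solvable)
qed

end
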